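(* Let $Q$ be a connected acyclic quiver and let $X(Q)$ be its frieze variety. (a) If $Q$ is representation finite, then $\dim X(Q)=0$. (b) If $Q$ is tame, then $\dim X(Q)=1$. (c) If $Q$ is wild, then $\dim X(Q)\ge 2$.
   Context: A quiver is a finite directed graph $Q=(Q_0,Q_1)$ (multiple arrows allowed); it is acyclic if it has no oriented cycles. Let $Q$ be acyclic with $n$ vertices, labelled $1,\dots,n$ so that $i>j$ whenever there is an arrow $i\to j$. Define positive rational numbers $f_i(t)$ ($i\in Q_0$, $t\in\mathbb{Z}_{\ge 0}$) recursively by $f_i(0)=1$ and $$f_i(t+1)=\frac{1+\prod_{j\to i}f_j(t)\ \prod_{j\leftarrow i}f_j(t+1)}{f_i(t)},$$ where the first product runs over all arrows $j\to i$ ending at $i$ and the second over all arrows $i\to j$ starting at $i$, counted with multiplicity. (The $f_i(t)$ are in fact integers.) Put $P_t=(f_1(t),\dots,f_n(t))\in\mathbb{C}^n$. The frieze variety $X(Q)\subset\mathbb{C}^n$ is the Zariski closure of the set $\{P_t : t\in\mathbb{Z}_{\ge0}\}$; another admissible labelling only permutes coordinates. Representation type: $Q$ is representation finite if and only if its underlying graph is a Dynkin diagram of type $\mathbb{A},\mathbb{D}$ or $\mathbb{E}$; it is tame if and only if its underlying graph is an affine Dynkin diagram of type $\widetilde{\mathbb{A}},\widetilde{\mathbb{D}}$ or $\widetilde{\mathbb{E}}$ (type $\widetilde{\mathbb{A}}$ includes the Kronecker quiver with two vertices and two parallel arrows); all other connected acyclic quivers are wild. *)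

theory Defs
  imports
    "HOL-Analysis.Abstract_Topology"
    "HOL-Library.Poly_Mapping"
    "HOL-Library.Extended_Nat"
    "HOL-Library.Multiset"
    "HOL-Library.FuncSet"
    "Graph_Theory.Graph_Theory"
begin

section \<open>Quivers and friezes\<close>

text \<open>
  A quiver is a finite directed multigraph, i.e. an instance of the locale \<^locale>\<open>fin_digraph\<close>;
  an arrow \<open>a\<close> runs from \<open>tail Q a\<close> to \<open>head Q a\<close>.
\<close>

definition acyclic_quiver :: "('a, 'b) pre_digraph \<Rightarrow> bool" where
  "acyclic_quiver Q \<longleftrightarrow> fin_digraph Q \<and> (\<nexists>p. pre_digraph.cycle Q p)"

definition admissible_labelling :: "('a, 'b) pre_digraph \<Rightarrow> ('a \<Rightarrow> nat) \<Rightarrow> bool" where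
  "admissible_labelling Q lab \<longleftrightarrow>
     bij_betw lab (verts Q) {1..card (verts Q)} \<and>
     (\<forall>a\<in>arcs Q. lab (tail Q a) > lab (head Q a))"

text \<open>
  \<open>frieze Q lab t i\<close> is the number \<open>f\<^sub>i(t)\<close>, where \<open>i\<close> is the label of a vertex. The condition
  \<open>lab (head Q a) < i\<close> serves only to make the recursion terminate for arbitrary \<open>lab\<close>; it is
  automatic for an admissible labelling, see \<open>frieze_recurrence\<close> below.
\<close>

fun frieze :: "('a, 'b) pre_digraph \<Rightarrow> ('a \<Rightarrow> nat) \<Rightarrow> nat \<Rightarrow> nat \<Rightarrow> rat" where
  "frieze Q lab 0 i = 1"
| "frieze Q lab (Suc t) i =
     (1 + (\<Prod>a\<in>{a \<in> arcs Q. lab (head Q a) = i}. frieze Q lab t (lab (tail Q a))) *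
          (\<Prod>a\<in>{a \<in> arcs Q. lab (tail Q a) = i \<and> lab (head Q a) < i}.
             frieze Q lab (Suc t) (lab (head Q a)))) / frieze Q lab t i"

declare frieze.simps(2) [simp del]

lemma frieze_recurrence:
  assumes "admissible_labelling Q lab"
  shows "frieze Q lab (Suc t) i =
     (1 + (\<Prod>a\<in>{a \<in> arcs Q. lab (head Q a) = i}. frieze Q lab t (lab (tail Q a))) *
          (\<Prod>a\<in>{a \<in> arcs Q. lab (tail Q a) = i}. frieze Q lab (Suc t) (lab (head Q a)))) /
     frieze Q lab t i"
proof -
  have "{a \<in> arcs Q. lab (tail Q a) = i \<and> lab (head Q a) < i} = {a \<in> arcs Q. lab (tail Q a) = i}"
    using assms by (auto simp: admissible_labelling_def)
  then show ?thesis by (subst frieze.simps(2)) (rule arg_cong, simp)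
qed

lemma frieze_pos: "frieze Q lab t i > 0"
proof (induction Q lab t i rule: frieze.induct)
  case (2 Q lab t i)
  show ?case
    unfolding frieze.simps(2)[of Q lab t i]
    by (intro divide_pos_pos add_pos_nonneg mult_nonneg_nonneg prod_nonneg ballI less_imp_le
        zero_less_one 2)
qed simp

lemma ex_labelling_aux:
  assumes "finite V" "wf R"
  shows "\<exists>lab. bij_betw lab V {1..card V} \<and> (\<forall>(x, y)\<in>R. x \<in> V \<longrightarrow> y \<in> V \<longrightarrow> lab x < (lab y :: nat))"
  using assms(1)
proof (induction "card V" arbitrary: V)
  case 0
  then show ?case by simp (simp add: bij_betw_def)
next
  case (Suc n)
  have wfc: "wf ((R \<inter> V \<times> V)\<inverse>)"
  proof (rule finite_acyclic_wf)
    show "finite ((R \<inter> V \<times> V)\<inverse>)" using Suc.prems by (simp add: finite_subset[of _ "V \<times> V"])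
    have "wf (R \<inter> V \<times> V)" by (rule wf_subset[OF assms(2)]) auto
    then show "acyclic ((R \<inter> V \<times> V)\<inverse>)" by (simp add: wf_acyclic)
  qed
  obtain m where m: "m \<in> V" "\<And>y. (m, y) \<in> R \<Longrightarrow> y \<notin> V"
  proof -
    have "V \<noteq> {}" using Suc.hyps(2) by auto
    then obtain v where "v \<in> V" by auto
    then show ?thesis
    proof (rule wfE_min[OF wfc])
      fix z assume "z \<in> V" "\<And>y. (y, z) \<in> (R \<inter> V \<times> V)\<inverse> \<Longrightarrow> y \<notin> V"
      then show ?thesis using that[of z] by blast
    qed
  qed
  have c: "card (V - {m}) = n" using m Suc.hyps(2) Suc.prems by simp
  obtain lab where lab: "bij_betw lab (V - {m}) {1..n}"
    "\<forall>(x, y)\<in>R. x \<in> V - {m} \<longrightarrow> y \<in> V - {m} \<longrightarrow> lab x < (lab y :: nat)"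
    using Suc.hyps(1)[OF c[symmetric] finite_Diff[OF Suc.prems]] unfolding c by blast
  let ?l = "lab(m := Suc n)"
  have "bij_betw ?l (V - {m}) {1..n}"
    using lab(1) by (rule bij_betw_cong[THEN iffD1, rotated]) auto
  then have "bij_betw ?l (insert m (V - {m})) (insert (Suc n) {1..n})"
    using notIn_Un_bij_betw[of m "V - {m}" ?l "{1..n}"] by simp
  moreover have "insert m (V - {m}) = V" "insert (Suc n) {1..n} = {1..card V}"
    using m Suc.hyps(2) by auto
  ultimately have "bij_betw ?l V {1..card V}" by simp
  moreover have "?l x < ?l y" if "(x, y) \<in> R" "x \<in> V" "y \<in> V" for x y
  proof (cases "y = m")
    case True
    then have "x \<noteq> m" using that m by auto
    then have "lab x \<in> {1..n}" using lab(1) that by (auto simp: bij_betw_def)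
    then show ?thesis using True \<open>x \<noteq> m\<close> by simp
  next
    case False
    then have "x \<noteq> m" using that m by auto
    then show ?thesis using False that lab(2) by auto
  qed
  ultimately show ?case by blast
qed

lemma ex_admissible_labelling:
  assumes "acyclic_quiver Q"
  shows "\<exists>lab. admissible_labelling Q lab"
proof -
  interpret fin_digraph Q using assms by (simp add: acyclic_quiver_def)
  have nc: "\<nexists>p. cycle p" using assms by (simp add: acyclic_quiver_def)
  have "acyclic (arcs_ends Q)"
    unfolding acyclic_def
  proof (intro allI notI)
    fix x assume "(x, x) \<in> (arcs_ends Q)\<^sup>+"
    then obtain p where "awalk x p x" "p \<noteq> []" by (auto simp: reachable1_awalk)
    then have "closed_w p" by (auto simp: closed_w_def)
    then obtain q where "cycle q" using closed_w_imp_cycle by metis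
    then show False using nc by blast
  qed
  moreover have fin: "finite (arcs_ends Q)" by (simp add: arcs_ends_def)
  ultimately have "wf ((arcs_ends Q)\<inverse>)" by (simp add: finite_acyclic_wf)
  from ex_labelling_aux[OF finite_verts this] obtain lab where
    lab: "bij_betw lab (verts Q) {1..card (verts Q)}"
    "\<forall>(x, y)\<in>(arcs_ends Q)\<inverse>. x \<in> verts Q \<longrightarrow> y \<in> verts Q \<longrightarrow> lab x < (lab y :: nat)" by blast
  have "lab (head Q a) < lab (tail Q a)" if "a \<in> arcs Q" for a
  proof -
    have "(tail Q a, head Q a) \<in> arcs_ends Q"
      using that by (force simp: arcs_ends_def arc_to_ends_def)
    then show ?thesis using lab(2) head_in_verts[OF that] tail_in_verts[OF that] by blast
  qed
  then show ?thesis using lab(1) by (auto simp: admissible_labelling_def)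
qed


section \<open>Representation type\<close>

text \<open>
  An undirected multigraph is a set of vertices together with a multiset of edges, an edge being
  the set of its end points (quivers with loops, which are not acyclic, would give singletons).
\<close>

type_synonym 'v multigraph = "'v set \<times> 'v set multiset"

definition underlying_graph :: "('a, 'b) pre_digraph \<Rightarrow> 'a multigraph" where
  "underlying_graph Q = (verts Q, image_mset (\<lambda>a. {tail Q a, head Q a}) (mset_set (arcs Q)))"

definition multigraph_iso :: "'v multigraph \<Rightarrow> 'w multigraph \<Rightarrow> bool" (infix \<open>\<simeq>\<close> 50) where
  "G \<simeq> H \<longleftrightarrow> (\<exists>b. bij_betw b (fst G) (fst H) \<and> image_mset (image b) (snd G) = snd H)"

text \<open>\<open>path_edges m\<close> are the edges of the path with vertices \<open>1, \<dots>, m\<close>.\<close>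

definition path_edges :: "nat \<Rightarrow> nat set multiset" where
  "path_edges m = image_mset (\<lambda>i. {i, i + 1}) (mset_set {1..<m})"

definition dynkin_A :: "nat \<Rightarrow> nat multigraph" where
  "dynkin_A n = ({1..n}, path_edges n)"

definition dynkin_D :: "nat \<Rightarrow> nat multigraph" where
  "dynkin_D n = ({1..n}, path_edges (n - 1) + {#{n - 2, n}#})"

definition dynkin_E :: "nat \<Rightarrow> nat multigraph" where
  "dynkin_E n = ({1..n}, path_edges (n - 1) + {#{3, n}#})"

text \<open>
  The affine diagrams with index \<open>n\<close> have \<open>n + 1\<close> vertices; they are obtained by adding the vertex
  \<open>0\<close>. For \<open>n = 1\<close> the diagram \<open>affine_A n\<close> is the double edge (the Kronecker quiver).
\<close>

definition affine_A :: "nat \<Rightarrow> nat multigraph" where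
  "affine_A n = ({0..n}, path_edges n + {#{0, 1}, {0, n}#})"

definition affine_D :: "nat \<Rightarrow> nat multigraph" where
  "affine_D n = ({0..n}, path_edges (n - 1) + {#{n - 2, n}, {0, 2}#})"

definition affine_E :: "nat \<Rightarrow> nat multigraph" where
  "affine_E n = ({0..n}, path_edges (n - 1) +
     {#{3, n}, {0, if n = 6 then 6 else if n = 7 then 1 else 7}#})"

definition rep_finite :: "('a, 'b) pre_digraph \<Rightarrow> bool" where
  "rep_finite Q \<longleftrightarrow>
     (\<exists>n\<ge>1. underlying_graph Q \<simeq> dynkin_A n) \<or>
     (\<exists>n\<ge>4. underlying_graph Q \<simeq> dynkin_D n) \<or>
     (\<exists>n\<in>{6, 7, 8}. underlying_graph Q \<simeq> dynkin_E n)"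

definition tame :: "('a, 'b) pre_digraph \<Rightarrow> bool" where
  "tame Q \<longleftrightarrow>
     (\<exists>n\<ge>1. underlying_graph Q \<simeq> affine_A n) \<or>
     (\<exists>n\<ge>4. underlying_graph Q \<simeq> affine_D n) \<or>
     (\<exists>n\<in>{6, 7, 8}. underlying_graph Q \<simeq> affine_E n)"

definition wild :: "('a, 'b) pre_digraph \<Rightarrow> bool" where
  "wild Q \<longleftrightarrow> \<not> rep_finite Q \<and> \<not> tame Q"


section \<open>The Zariski topology on affine space\<close>

text \<open>
  Polynomials are finitely supported maps from monomials to coefficients, a monomial being a
  finitely supported map from (indices of) variables to exponents. Affine \<open>n\<close>-space consists of the
  extensional functions on \<open>{1..n}\<close>.
\<close>

type_synonym polynomial = "(nat \<Rightarrow>\<^sub>0 nat) \<Rightarrow>\<^sub>0 complex"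

definition polynomials :: "nat \<Rightarrow> polynomial set" where
  "polynomials n = {p. \<forall>m\<in>Poly_Mapping.keys p. Poly_Mapping.keys m \<subseteq> {1..n}}"

definition eval_monom :: "(nat \<Rightarrow>\<^sub>0 nat) \<Rightarrow> (nat \<Rightarrow> complex) \<Rightarrow> complex" where
  "eval_monom m x = (\<Prod>i\<in>Poly_Mapping.keys m. x i ^ Poly_Mapping.lookup m i)"

definition eval_poly :: "polynomial \<Rightarrow> (nat \<Rightarrow> complex) \<Rightarrow> complex" where
  "eval_poly p x = (\<Sum>m\<in>Poly_Mapping.keys p. Poly_Mapping.lookup p m * eval_monom m x)"

definition affine_space :: "nat \<Rightarrow> (nat \<Rightarrow> complex) set" where
  "affine_space n = {1..n} \<rightarrow>\<^sub>E UNIV"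

definition zero_locus :: "nat \<Rightarrow> polynomial set \<Rightarrow> (nat \<Rightarrow> complex) set" where
  "zero_locus n S = {x \<in> affine_space n. \<forall>p\<in>S. eval_poly p x = 0}"

definition zariski :: "nat \<Rightarrow> (nat \<Rightarrow> complex) topology" where
  "zariski n = topology (\<lambda>U. \<exists>S\<subseteq>polynomials n. U = affine_space n - zero_locus n S)"

lemma eval_monom_superset:
  assumes "finite K" "Poly_Mapping.keys m \<subseteq> K"
  shows "eval_monom m x = (\<Prod>i\<in>K. x i ^ Poly_Mapping.lookup m i)"
  unfolding eval_monom_def using assms
  by (intro prod.mono_neutral_left) (auto simp: in_keys_iff)

lemma eval_monom_add: "eval_monom (m + m') x = eval_monom m x * eval_monom m' x"
proof -
  let ?K = "Poly_Mapping.keys m \<union> Poly_Mapping.keys m'"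
  have "Poly_Mapping.keys (m + m') \<subseteq> ?K" by (rule Poly_Mapping.keys_add)
  then show ?thesis
    by (simp add: eval_monom_superset[of ?K] lookup_add power_add prod.distrib)
qed

lemma eval_poly_superset:
  assumes "finite K" "Poly_Mapping.keys p \<subseteq> K"
  shows "eval_poly p x = (\<Sum>m\<in>K. Poly_Mapping.lookup p m * eval_monom m x)"
  unfolding eval_poly_def using assms
  by (intro sum.mono_neutral_left) (auto simp: in_keys_iff)

lemma eval_poly_0: "eval_poly 0 x = 0"
  by (simp add: eval_poly_def)

lemma eval_poly_add: "eval_poly (p + q) x = eval_poly p x + eval_poly q x"
proof -
  let ?K = "Poly_Mapping.keys p \<union> Poly_Mapping.keys q"
  have "Poly_Mapping.keys (p + q) \<subseteq> ?K" by (rule Poly_Mapping.keys_add)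
  then show ?thesis
    by (simp add: eval_poly_superset[of ?K] lookup_add distrib_right sum.distrib)
qed

lemma eval_poly_sum: "eval_poly (\<Sum>a\<in>A. f a) x = (\<Sum>a\<in>A. eval_poly (f a) x)"
  by (induction A rule: infinite_finite_induct) (auto simp: eval_poly_0 eval_poly_add)

lemma eval_poly_single: "eval_poly (Poly_Mapping.single m c) x = c * eval_monom m x"
  by (simp add: eval_poly_superset[of "{m}"])

lemma poly_eq_sum_single:
  "p = (\<Sum>m\<in>Poly_Mapping.keys p. Poly_Mapping.single m (Poly_Mapping.lookup p m))"
  by (rule poly_mapping_eqI)
    (auto simp: lookup_sum lookup_single when_def in_keys_iff)

lemma eval_poly_mult: "eval_poly (p * q) x = eval_poly p x * eval_poly q x"
proof -
  let ?s = "\<lambda>p m. Poly_Mapping.single m (Poly_Mapping.lookup p m)"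
  have "p * q = (\<Sum>m\<in>Poly_Mapping.keys p. ?s p m) * (\<Sum>m\<in>Poly_Mapping.keys q. ?s q m)"
    using poly_eq_sum_single[of p] poly_eq_sum_single[of q] by simp
  also have "\<dots> = (\<Sum>m\<in>Poly_Mapping.keys p. \<Sum>m'\<in>Poly_Mapping.keys q.
      Poly_Mapping.single (m + m') (Poly_Mapping.lookup p m * Poly_Mapping.lookup q m'))"
    by (simp add: sum_product mult_single)
  finally have "eval_poly (p * q) x = (\<Sum>m\<in>Poly_Mapping.keys p. \<Sum>m'\<in>Poly_Mapping.keys q.
      (Poly_Mapping.lookup p m * Poly_Mapping.lookup q m') * (eval_monom m x * eval_monom m' x))"
    by (simp add: eval_poly_sum eval_poly_single eval_monom_add)
  also have "\<dots> = eval_poly p x * eval_poly q x"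
    unfolding eval_poly_def sum_product by (simp add: algebra_simps)
  finally show ?thesis .
qed

lemma polynomials_mult:
  assumes "p \<in> polynomials n" "q \<in> polynomials n"
  shows "p * q \<in> polynomials n"
  unfolding polynomials_def
proof (intro CollectI ballI)
  fix m assume "m \<in> Poly_Mapping.keys (p * q)"
  then obtain a b where "a \<in> Poly_Mapping.keys p" "b \<in> Poly_Mapping.keys q" "m = a + b"
    using keys_mult[of p q] by auto
  then show "Poly_Mapping.keys m \<subseteq> {1..n}"
    using Poly_Mapping.keys_add[of a b] assms by (fastforce simp: polynomials_def)
qed

lemma istopology_zariski:
  "istopology (\<lambda>U. \<exists>S\<subseteq>polynomials n. U = affine_space n - zero_locus n S)"
  unfolding istopology_def
proof (intro conjI allI impI)
  fix U V
  assume "\<exists>S\<subseteq>polynomials n. U = affine_space n - zero_locus n S"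
    and "\<exists>S\<subseteq>polynomials n. V = affine_space n - zero_locus n S"
  then obtain S T where ST: "S \<subseteq> polynomials n" "T \<subseteq> polynomials n"
    "U = affine_space n - zero_locus n S" "V = affine_space n - zero_locus n T" by blast
  let ?P = "{p * q |p q. p \<in> S \<and> q \<in> T}"
  have "?P \<subseteq> polynomials n" using ST(1,2) polynomials_mult by blast
  moreover have "U \<inter> V = affine_space n - zero_locus n ?P"
    unfolding ST zero_locus_def by (auto simp: eval_poly_mult) (metis eval_poly_mult mult_eq_0_iff)
  ultimately show "\<exists>S\<subseteq>polynomials n. U \<inter> V = affine_space n - zero_locus n S" by blast
next
  fix \<K> :: "(nat \<Rightarrow> complex) set set"
  assume "\<forall>K\<in>\<K>. \<exists>S\<subseteq>polynomials n. K = affine_space n - zero_locus n S"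
  then obtain F where F: "\<And>K. K \<in> \<K> \<Longrightarrow> F K \<subseteq> polynomials n"
    "\<And>K. K \<in> \<K> \<Longrightarrow> K = affine_space n - zero_locus n (F K)" by metis
  have "\<Union>\<K> = (\<Union>K\<in>\<K>. affine_space n - zero_locus n (F K))" using F(2) by auto
  also have "\<dots> = affine_space n - zero_locus n (\<Union>K\<in>\<K>. F K)"
    by (auto simp: zero_locus_def)
  finally show "\<exists>S\<subseteq>polynomials n. \<Union>\<K> = affine_space n - zero_locus n S"
    using F(1) by (intro exI[of _ "\<Union>K\<in>\<K>. F K"]) auto
qed

lemma openin_zariski:
  "openin (zariski n) U \<longleftrightarrow> (\<exists>S\<subseteq>polynomials n. U = affine_space n - zero_locus n S)"
  unfolding zariski_def topology_inverse'[OF istopology_zariski] ..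

lemma topspace_zariski: "topspace (zariski n) = affine_space n"
proof
  show "topspace (zariski n) \<subseteq> affine_space n"
    unfolding topspace_def by (auto simp: openin_zariski)
  have "zero_locus n {1} = {}"
    by (auto simp: zero_locus_def eval_poly_def eval_monom_def)
  moreover have "(1 :: polynomial) \<in> polynomials n" by (simp add: polynomials_def)
  ultimately have "openin (zariski n) (affine_space n)"
    unfolding openin_zariski by (intro exI[of _ "{1}"]) auto
  then show "affine_space n \<subseteq> topspace (zariski n)" by (rule openin_subset)
qed

lemma closedin_zariski:
  "closedin (zariski n) C \<longleftrightarrow> (\<exists>S\<subseteq>polynomials n. C = zero_locus n S)"
proof -
  have sub: "zero_locus n S \<subseteq> affine_space n" for S by (auto simp: zero_locus_def)
  show ?thesis
    unfolding closedin_def topspace_zariski openin_zariski using sub by blast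
qed


section \<open>Dimension\<close>

definition irreducible_closedin :: "'p topology \<Rightarrow> 'p set \<Rightarrow> bool" where
  "irreducible_closedin X Z \<longleftrightarrow> closedin X Z \<and> Z \<noteq> {} \<and>
     (\<forall>A B. closedin X A \<longrightarrow> closedin X B \<longrightarrow> Z = A \<union> B \<longrightarrow> Z = A \<or> Z = B)"

text \<open>
  The (Krull) dimension of a topological space is the supremum of the lengths \<open>k\<close> of strictly
  increasing chains \<open>C 0 \<subset> \<dots> \<subset> C k\<close> of irreducible closed subsets. With this
  convention the empty space gets dimension 0; it plays no role here, as a frieze variety is
  never empty.
\<close>

definition krull_dim :: "'p topology \<Rightarrow> enat" where
  "krull_dim X = Sup {enat k |k. \<exists>C. (\<forall>i\<le>k. irreducible_closedin X (C i)) \<and> (\<forall>i<k. C i \<subset> C (Suc i))}"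


section \<open>Frieze varieties\<close>

definition frieze_point :: "('a, 'b) pre_digraph \<Rightarrow> ('a \<Rightarrow> nat) \<Rightarrow> nat \<Rightarrow> (nat \<Rightarrow> complex)" where
  "frieze_point Q lab t = (\<lambda>i\<in>{1..card (verts Q)}. of_rat (frieze Q lab t i))"

definition frieze_variety :: "('a, 'b) pre_digraph \<Rightarrow> ('a \<Rightarrow> nat) \<Rightarrow> (nat \<Rightarrow> complex) set" where
  "frieze_variety Q lab = zariski (card (verts Q)) closure_of (range (frieze_point Q lab))"

definition frieze_dim :: "('a, 'b) pre_digraph \<Rightarrow> ('a \<Rightarrow> nat) \<Rightarrow> enat" where
  "frieze_dim Q lab = krull_dim (subtopology (zariski (card (verts Q))) (frieze_variety Q lab))"

end

theory Submission
  imports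
    Defs
    "HOL-Analysis.Complex_Transcendental"
    "HOL-Library.Landau_Symbols"
    "HOL-Number_Theory.Cong"
    "HOL-Computational_Algebra.Fundamental_Theorem_Algebra"
begin

text \<open>
  The frieze is read as one sequence: with \<open>n\<close> vertices and labels shifted to \<open>0, \<dots>, n - 1\<close>, the value
  \<open>f\<^sub>i(k)\<close> is \<open>g (i + k * n)\<close>, and the two products of the recursion become one product over the window
  \<open>{t<..<t + n}\<close>. The logarithm \<open>L = ln g\<close> solves the linear recurrence
  \<open>L (t + n) + L t = (\<Sum>s. \<alpha> t s * L s)\<close> up to a forcing term in \<open>(0, 1]\<close>. The linear recurrence is
  the Coxeter transformation of the underlying graph: it preserves integrality in both directions
  and the Tits form. The values of \<open>g\<close> are positive integers (\<open>g_integer\<close>). Which of the three cases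
  occurs is decided by a weight \<open>d\<close> on the vertices, compared with its neighbour sums \<open>A d\<close>.

  Representation finite: a Dynkin diagram has \<open>d > 0\<close> with \<open>A d < 2 d\<close>. The Tits form is then
  positive definite, homogeneous solutions are periodic with vanishing mean, and averaging over a
  period bounds \<open>L\<close> (\<open>positive_definite_bounded\<close>). Bounded integral points are finite in number.

  Tame: an affine diagram has an integral \<open>\<delta> > 0\<close> with \<open>A \<delta> = 2 \<delta>\<close> and with a value \<open>1\<close>. Homogeneous
  solutions are periodic up to multiples of \<open>\<delta>\<close>, so \<open>L\<close> grows linearly in the direction \<open>\<delta>\<close>
  (\<open>linear_growth\<close>) and, by bootstrapping, has an asymptotic expansion of every order (\<open>expansion\<close>). At
  a vertex with \<open>\<delta> = 1\<close> integrality makes the growth rate quadratic over the integers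
  (\<open>leading_term_quadratic\<close>), and integrality then turns the expansions into exact identities: along
  arithmetic progressions every coordinate is a Laurent polynomial in one and the same \<open>\<Lambda>\<^sup>k\<close>
  (\<open>laurent_polynomials\<close>). Any two polynomial functions are therefore algebraically dependent on the
  points, so the dimension is at most one; as \<open>g\<close> is unbounded, it is not zero.

  Wild: every other connected multigraph properly contains an affine diagram
  (\<open>dynkin_or_affine\<close>), and \<open>\<delta>\<close> extended by zero is a \<open>d \<ge> 0\<close> with \<open>A d \<ge> 2 d\<close>, strict somewhere.
  This makes \<open>L\<close> grow so fast that its partial sums are bounded by a multiple of the last term
  (\<open>superharmonic_growth\<close>). If the dimension were at most one, any two coordinates would satisfy a
  polynomial relation, two monomials of which must be comparable in size: this is a bounded linear
  relation, with integer coefficients from a finite set, between the logarithms. Hence the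
  direction of \<open>L\<close> is asymptotically a rational vector taken from a finite set, the Coxeter
  transformation carries each direction to the next, and integrality forces the multiplier of a
  recurring direction to have absolute value one. So \<open>L\<close> grows at most linearly
  (\<open>bounded_relations_contradiction\<close>), which
  contradicts the previous bound.

  Dimension is controlled through prime ideals. The extension theorem gives the zero locus of a
  prime ideal as many points as its ideal allows (\<open>nullstellensatz\<close>), which yields chains of
  irreducible closed sets from independent coordinates (\<open>dim_closure_ge_2\<close>); conversely a chain of
  length two carries two algebraically independent functions (\<open>dim_closure_le_1\<close>).
\<close>

section \<open>Asymptotic expansions in powers of a geometric sequence\<close>

text \<open>
  The polynomial \<open>H\<close> may have terms of degree \<open>N\<close> and higher, which carry no information; it is
  not normalized so that expansions can be added and multiplied without truncation.
\<close>

definition expands :: "real \<Rightarrow> nat \<Rightarrow> (nat \<Rightarrow> real) \<Rightarrow> bool" where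
  "expands w N x \<longleftrightarrow> (\<exists>H. (\<lambda>k. x k - poly H (w ^ k)) \<in> O(\<lambda>k. (w ^ k) ^ N))"

text \<open>
  The increments are summable, so the sequence converges, and the tail of a geometric series is
  of the order of its first term.
\<close>

lemma geometric_increments:
  fixes d :: "nat \<Rightarrow> real"
  assumes q: "0 < q" "q < 1" and d: "(\<lambda>k. d (Suc k) - d k) \<in> O(\<lambda>k. q ^ k)"
  shows "\<exists>c. (\<lambda>k. d k - c) \<in> O(\<lambda>k. q ^ k)"
proof -
  obtain C where C: "C > 0" "eventually (\<lambda>k. norm (d (Suc k) - d k) \<le> C * norm (q ^ k)) sequentially"
    using d by (elim landau_o.bigE)
  obtain k0 where k0: "\<And>k. k \<ge> k0 \<Longrightarrow> \<bar>d (Suc k) - d k\<bar> \<le> C * q ^ k"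
    using C(2) q unfolding eventually_sequentially by (auto simp: power_abs)
  have step: "\<bar>d (k + j) - d k\<bar> \<le> C * q ^ k * (1 - q ^ j) / (1 - q)" if "k \<ge> k0" for k j
  proof (induction j)
    case (Suc j)
    have "\<bar>d (k + Suc j) - d k\<bar> \<le> \<bar>d (k + j) - d k\<bar> + \<bar>d (Suc (k + j)) - d (k + j)\<bar>" by simp
    also have "\<dots> \<le> C * q ^ k * (1 - q ^ j) / (1 - q) + C * q ^ (k + j)"
      using Suc k0[of "k + j"] that by simp
    also have "\<dots> = C * q ^ k * (1 - q ^ Suc j) / (1 - q)"
      using q by (simp add: field_simps power_add)
    finally show ?case .
  qed simp
  have le: "\<bar>d (k + j) - d k\<bar> \<le> C / (1 - q) * q ^ k" if "k \<ge> k0" for k j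
  proof -
    have "C * q ^ k * (1 - q ^ j) \<le> C * q ^ k * 1"
      using q C by (intro mult_left_mono) auto
    then have "C * q ^ k * (1 - q ^ j) / (1 - q) \<le> C * q ^ k * 1 / (1 - q)"
      using q by (intro divide_right_mono) auto
    then show ?thesis using step[OF that, of j] by simp
  qed
  have "summable (\<lambda>k. d (Suc k) - d k)"
  proof (rule summable_comparison_test'[of "\<lambda>k. C * q ^ k" k0])
    show "summable (\<lambda>k. C * q ^ k)" using q by (intro summable_mult summable_geometric) auto
  qed (use k0 in auto)
  then have "(\<lambda>n. \<Sum>k<n. d (Suc k) - d k) \<longlonglongrightarrow> suminf (\<lambda>k. d (Suc k) - d k)"
    by (rule summable_LIMSEQ)
  then have "(\<lambda>n. d n - d 0) \<longlonglongrightarrow> suminf (\<lambda>k. d (Suc k) - d k)" by (simp add: sum_lessThan_telescope)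
  then have "(\<lambda>n. d n - d 0 + d 0) \<longlonglongrightarrow> suminf (\<lambda>k. d (Suc k) - d k) + d 0" by (intro tendsto_intros)
  then obtain c where c: "d \<longlonglongrightarrow> c" by auto
  have "\<bar>d k - c\<bar> \<le> C / (1 - q) * q ^ k" if "k \<ge> k0" for k
  proof -
    have "(\<lambda>j. \<bar>d (j + k) - d k\<bar>) \<longlonglongrightarrow> \<bar>c - d k\<bar>"
      by (intro tendsto_intros LIMSEQ_ignore_initial_segment c)
    then have "\<bar>c - d k\<bar> \<le> C / (1 - q) * q ^ k"
      by (rule LIMSEQ_le_const2) (use le[OF that] in \<open>auto simp: add.commute\<close>)
    then show ?thesis by linarith
  qed
  then have "(\<lambda>k. d k - c) \<in> O(\<lambda>k. q ^ k)"
    using q by (intro bigoI[where c = "C / (1 - q)"])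
      (auto simp: eventually_sequentially power_abs intro!: exI[of _ k0])
  then show ?thesis by blast
qed

text \<open>
  The series converges absolutely at \<open>1 / 2\<close>, and \<open>\<bar>x\<bar> ^ N\<close> factors out of the tail.
\<close>

lemma power_series_remainder:
  fixes a :: "nat \<Rightarrow> real"
  assumes "\<And>x. \<bar>x\<bar> < 1 \<Longrightarrow> (\<lambda>j. a j * x ^ j) sums f x"
  shows "\<exists>C. \<forall>x. \<bar>x\<bar> \<le> 1 / 2 \<longrightarrow> \<bar>f x - (\<Sum>j<N. a j * x ^ j)\<bar> \<le> C * \<bar>x\<bar> ^ N"
proof -
  have s: "summable (\<lambda>j. norm (a j * (1 / 2) ^ j))"
    by (rule powser_insidea[of a "3 / 4"]) (use assms[of "3 / 4"] in \<open>auto simp: sums_iff\<close>)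
  then have "summable (\<lambda>j. norm (a (j + N) * (1 / 2) ^ (j + N)))"
    by (rule summable_ignore_initial_segment)
  then have "summable (\<lambda>j. 2 ^ N * norm (a (j + N) * (1 / 2) ^ (j + N)))" by (rule summable_mult)
  then have s2: "summable (\<lambda>j. \<bar>a (j + N)\<bar> * (1 / 2) ^ j)"
    by (rule summable_cong[THEN iffD1, rotated])
       (auto simp: abs_mult power_add power_divide field_simps)
  have "\<bar>f x - (\<Sum>j<N. a j * x ^ j)\<bar> \<le> suminf (\<lambda>j. \<bar>a (j + N)\<bar> * (1 / 2) ^ j) * \<bar>x\<bar> ^ N"
    if x: "\<bar>x\<bar> \<le> 1 / 2" for x
  proof -
    have sm: "(\<lambda>j. a j * x ^ j) sums f x" using assms[of x] x by simp
    have "(\<lambda>j. a (j + N) * x ^ (j + N)) sums (f x - (\<Sum>j<N. a j * x ^ j))"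
      using sums_split_initial_segment[OF sm, of N] by simp
    then have e: "f x - (\<Sum>j<N. a j * x ^ j) = suminf (\<lambda>j. a (j + N) * x ^ (j + N))" by (simp add: sums_iff)
    have le: "norm (a (j + N) * x ^ (j + N)) \<le> (\<bar>a (j + N)\<bar> * (1 / 2) ^ j) * \<bar>x\<bar> ^ N" for j
    proof -
      have "\<bar>x\<bar> ^ j \<le> (1 / 2) ^ j" using x by (intro power_mono) auto
      then have "\<bar>a (j + N)\<bar> * \<bar>x\<bar> ^ j * \<bar>x\<bar> ^ N \<le> \<bar>a (j + N)\<bar> * (1 / 2) ^ j * \<bar>x\<bar> ^ N"
        by (intro mult_right_mono mult_left_mono) auto
      then show ?thesis by (simp add: abs_mult power_add power_abs mult.assoc)
    qed
    have s3: "summable (\<lambda>j. (\<bar>a (j + N)\<bar> * (1 / 2) ^ j) * \<bar>x\<bar> ^ N)" by (rule summable_mult2[OF s2])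
    have "norm (suminf (\<lambda>j. a (j + N) * x ^ (j + N))) \<le> suminf (\<lambda>j. (\<bar>a (j + N)\<bar> * (1 / 2) ^ j) * \<bar>x\<bar> ^ N)"
      by (rule norm_suminf_le[OF le s3])
    also have "\<dots> = suminf (\<lambda>j. \<bar>a (j + N)\<bar> * (1 / 2) ^ j) * \<bar>x\<bar> ^ N" by (rule suminf_mult2[OF s2, symmetric])
    finally show ?thesis by (simp add: e)
  qed
  then show ?thesis by blast
qed

context
  fixes w :: real
  assumes w: "0 < w" "w < 1"
begin

lemma w_tendsto: "(\<lambda>k. w ^ k) \<longlonglongrightarrow> 0"
  using w by (intro LIMSEQ_realpow_zero) auto

lemma poly_w_tendsto: "(\<lambda>k. poly H (w ^ k)) \<longlonglongrightarrow> poly H 0"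
  by (intro tendsto_intros w_tendsto)

lemma poly_w_bounded: "(\<lambda>k. poly H (w ^ k)) \<in> O(\<lambda>_. 1)"
  using poly_w_tendsto by (intro bigoI_tendsto[where c = "poly H 0"]) auto

lemma bigo_w_mono: "N \<le> N' \<Longrightarrow> (\<lambda>k. (w ^ k) ^ N') \<in> O(\<lambda>k. (w ^ k) ^ N)"
  using w by (intro bigoI[where c = 1] always_eventually)
    (auto intro!: power_decreasing power_le_one simp: power_abs)

lemma bigo_w_bounded: "(\<lambda>k. (w ^ k) ^ N) \<in> O(\<lambda>_. 1)"
  using bigo_w_mono[of 0 N] by simp

lemma expands_bounded:
  assumes "expands w N x" shows "x \<in> O(\<lambda>_. 1)"
proof -
  obtain H where H: "(\<lambda>k. x k - poly H (w ^ k)) \<in> O(\<lambda>k. (w ^ k) ^ N)"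
    using assms by (auto simp: expands_def)
  have "(\<lambda>k. (x k - poly H (w ^ k)) + poly H (w ^ k)) \<in> O(\<lambda>_. 1)"
    by (intro sum_in_bigo poly_w_bounded landau_o.big_trans[OF H bigo_w_bounded])
  then show ?thesis by simp
qed

lemma expands_0: "x \<in> O(\<lambda>_. 1) \<Longrightarrow> expands w 0 x"
  unfolding expands_def by (intro exI[of _ 0]) simp

lemma expands_const: "expands w N (\<lambda>_. c)"
  unfolding expands_def by (intro exI[of _ "[:c:]"]) simp

lemma expands_bigo: "x \<in> O(\<lambda>k. (w ^ k) ^ N) \<Longrightarrow> expands w N x"
  unfolding expands_def by (intro exI[of _ 0]) simp

lemma expands_add:
  assumes "expands w N x" "expands w N y" shows "expands w N (\<lambda>k. x k + y k)"
proof -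
  obtain H G where "(\<lambda>k. x k - poly H (w ^ k)) \<in> O(\<lambda>k. (w ^ k) ^ N)"
    "(\<lambda>k. y k - poly G (w ^ k)) \<in> O(\<lambda>k. (w ^ k) ^ N)"
    using assms by (auto simp: expands_def)
  then have "(\<lambda>k. (x k - poly H (w ^ k)) + (y k - poly G (w ^ k))) \<in> O(\<lambda>k. (w ^ k) ^ N)"
    by (rule sum_in_bigo)
  then show ?thesis
    unfolding expands_def by (intro exI[of _ "H + G"]) (simp add: algebra_simps)
qed

lemma expands_mult:
  assumes x: "expands w N x" and y: "expands w N y" shows "expands w N (\<lambda>k. x k * y k)"
proof -
  obtain H G where H: "(\<lambda>k. x k - poly H (w ^ k)) \<in> O(\<lambda>k. (w ^ k) ^ N)" and
    G: "(\<lambda>k. y k - poly G (w ^ k)) \<in> O(\<lambda>k. (w ^ k) ^ N)"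
    using assms by (auto simp: expands_def)
  have "(\<lambda>k. (x k - poly H (w ^ k)) * poly G (w ^ k)) \<in> O(\<lambda>k. (w ^ k) ^ N * 1)"
    by (rule landau_o.big.mult[OF H poly_w_bounded])
  moreover have "(\<lambda>k. x k * (y k - poly G (w ^ k))) \<in> O(\<lambda>k. 1 * (w ^ k) ^ N)"
    by (rule landau_o.big.mult[OF expands_bounded[OF x] G])
  ultimately have "(\<lambda>k. (x k - poly H (w ^ k)) * poly G (w ^ k) + x k * (y k - poly G (w ^ k)))
      \<in> O(\<lambda>k. (w ^ k) ^ N)" by (intro sum_in_bigo) simp_all
  then show ?thesis
    unfolding expands_def by (intro exI[of _ "H * G"]) (simp add: algebra_simps)
qed

lemma expands_cmult: "expands w N x \<Longrightarrow> expands w N (\<lambda>k. c * x k)"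
  by (rule expands_mult[OF expands_const])

lemma expands_diff: "expands w N x \<Longrightarrow> expands w N y \<Longrightarrow> expands w N (\<lambda>k. x k - y k)"
  using expands_add[OF _ expands_cmult[of N y "-1"], of x] by simp

lemma expands_sum: "(\<And>i. i \<in> I \<Longrightarrow> expands w N (x i)) \<Longrightarrow> expands w N (\<lambda>k. \<Sum>i\<in>I. x i k)"
  by (induction I rule: infinite_finite_induct) (auto simp: expands_const intro: expands_add)

lemma expands_power: "expands w N x \<Longrightarrow> expands w N (\<lambda>k. x k ^ j)"
  by (induction j) (auto simp: expands_const intro: expands_mult)

text \<open>
  Multiplication by \<open>w ^ k\<close> gains one order of precision. This gain is what drives the
  bootstrapping of the expansions of a frieze.
\<close>

lemma expands_times_w:
  assumes "expands w N x" shows "expands w (N + d) (\<lambda>k. (w ^ k) ^ d * x k)"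
proof -
  obtain H where H: "(\<lambda>k. x k - poly H (w ^ k)) \<in> O(\<lambda>k. (w ^ k) ^ N)"
    using assms by (auto simp: expands_def)
  have "(\<lambda>k. (w ^ k) ^ d * (x k - poly H (w ^ k))) \<in> O(\<lambda>k. (w ^ k) ^ d * (w ^ k) ^ N)"
    by (rule landau_o.big.mult[OF landau_o.big_refl H])
  then show ?thesis
    unfolding expands_def
    by (intro exI[of _ "[:0, 1:] ^ d * H"]) (simp add: algebra_simps power_add poly_power)
qed

text \<open>
  Since \<open>r k\<close> is of order \<open>w ^ k\<close>, the Taylor remainder of order \<open>N\<close> is absorbed by the error
  term, and the Taylor polynomial only multiplies and adds expansions.
\<close>

lemma expands_power_series:
  assumes f: "\<And>x. \<bar>x\<bar> < 1 \<Longrightarrow> (\<lambda>j. a j * x ^ j) sums f x"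
    and r: "expands w N r" "r \<in> O(\<lambda>k. w ^ k)"
  shows "expands w N (\<lambda>k. f (r k))"
proof -
  obtain C where C: "\<And>x. \<bar>x\<bar> \<le> 1 / 2 \<Longrightarrow> \<bar>f x - (\<Sum>j<N. a j * x ^ j)\<bar> \<le> C * \<bar>x\<bar> ^ N"
    using power_series_remainder[OF f, where N = N] by blast
  have "r \<longlonglongrightarrow> 0"
  proof -
    have "(\<lambda>k. w ^ k) \<in> o(\<lambda>_. 1)" using w_tendsto by (intro smalloI_tendsto) auto
    then have "r \<in> o(\<lambda>_. 1)" using r(2) by (rule landau_o.big_small_trans[rotated])
    then show ?thesis by (auto dest: smalloD_tendsto)
  qed
  then have "\<forall>\<^sub>F k in sequentially. dist (r k) 0 < 1 / 2"
    by (rule tendstoD) simp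
  then have "\<forall>\<^sub>F k in sequentially. \<bar>r k\<bar> < 1 / 2" by simp
  then have "\<forall>\<^sub>F k in sequentially. norm (f (r k) - (\<Sum>j<N. a j * r k ^ j)) \<le> C * norm (r k ^ N)"
    by eventually_elim (use C in \<open>auto simp: power_abs\<close>)
  then have "(\<lambda>k. f (r k) - (\<Sum>j<N. a j * r k ^ j)) \<in> O(\<lambda>k. r k ^ N)" by (rule bigoI)
  also have "(\<lambda>k. r k ^ N) \<in> O(\<lambda>k. (w ^ k) ^ N)" by (rule landau_o.big_power[OF r(2)])
  finally have "expands w N (\<lambda>k. f (r k) - (\<Sum>j<N. a j * r k ^ j))" by (rule expands_bigo)
  moreover have "expands w N (\<lambda>k. \<Sum>j<N. a j * r k ^ j)"
    by (intro expands_sum expands_cmult expands_power r)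
  ultimately have "expands w N (\<lambda>k. (f (r k) - (\<Sum>j<N. a j * r k ^ j)) + (\<Sum>j<N. a j * r k ^ j))"
    by (rule expands_add)
  then show ?thesis by simp
qed

lemma expands_leading:
  assumes "expands w N x" "N > 0" shows "\<exists>c. (\<lambda>k. x k - c) \<in> O(\<lambda>k. w ^ k)"
proof -
  obtain H where H: "(\<lambda>k. x k - poly H (w ^ k)) \<in> O(\<lambda>k. (w ^ k) ^ N)"
    using assms by (auto simp: expands_def)
  have 1: "(\<lambda>k. x k - poly H (w ^ k)) \<in> O(\<lambda>k. w ^ k)"
    using landau_o.big_trans[OF H bigo_w_mono[of 1 N]] assms(2) by simp
  obtain c H' where H': "H = pCons c H'" by (cases H)
  have "(\<lambda>k. w ^ k * poly H' (w ^ k)) \<in> O(\<lambda>k. w ^ k * 1)"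
    by (rule landau_o.big.mult[OF landau_o.big_refl poly_w_bounded])
  then have "(\<lambda>k. w ^ k * poly H' (w ^ k)) \<in> O(\<lambda>k. w ^ k)" by simp
  with 1 have "(\<lambda>k. (x k - poly H (w ^ k)) + w ^ k * poly H' (w ^ k)) \<in> O(\<lambda>k. w ^ k)"
    by (rule sum_in_bigo)
  also have "(\<lambda>k. (x k - poly H (w ^ k)) + w ^ k * poly H' (w ^ k)) = (\<lambda>k. x k - c)"
    by (simp add: H')
  finally show ?thesis by blast
qed

lemma expands_exp:
  assumes "expands w N x" shows "expands w N (\<lambda>k. exp (x k))"
proof (cases "N = 0")
  case True
  obtain C where "\<forall>\<^sub>F k in sequentially. norm (x k) \<le> C * norm (1::real)"
    using expands_bounded[OF assms] by (elim landau_o.bigE)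
  then have "\<forall>\<^sub>F k in sequentially. norm (exp (x k)) \<le> exp C * norm (1::real)"
    by eventually_elim auto
  then have "(\<lambda>k. exp (x k)) \<in> O(\<lambda>_. 1)" by (rule bigoI)
  then show ?thesis using True by (simp add: expands_0)
next
  case False
  obtain c where c: "(\<lambda>k. x k - c) \<in> O(\<lambda>k. w ^ k)" using expands_leading[OF assms] False by blast
  have "expands w N (\<lambda>k. exp (x k - c))"
  proof (rule expands_power_series[where a = "\<lambda>j. inverse (fact j)" and f = exp and r = "\<lambda>k. x k - c"])
    show "(\<lambda>j. inverse (fact j) * y ^ j) sums exp y" for y :: real
      using exp_converges[of y] by simp
  qed (intro expands_diff assms expands_const, rule c)
  then have "expands w N (\<lambda>k. exp c * exp (x k - c))" by (rule expands_cmult)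
  then show ?thesis by (simp add: exp_diff)
qed

lemma expands_ln_1_plus:
  assumes "expands w N x" "x \<in> O(\<lambda>k. w ^ k)" shows "expands w N (\<lambda>k. ln (1 + x k))"
proof (rule expands_power_series[where a = "\<lambda>j. if j = 0 then 0 else - ((- 1) ^ j) / real j"
      and f = "\<lambda>y. ln (1 + y)", OF _ assms])
  fix y :: real assume y: "\<bar>y\<bar> < 1"
  have "(\<lambda>j. - ((- y) ^ j) / real j) sums ln (1 + y)"
    using ln_series'[OF y] .
  moreover have "- ((- y) ^ j) / real j = (if j = 0 then 0 else - ((- 1) ^ j) / real j) * y ^ j" for j
    by (subst power_minus) auto
  ultimately show "(\<lambda>j. (if j = 0 then 0 else - ((- 1) ^ j) / real j) * y ^ j) sums ln (1 + y)"
    by simp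
qed

text \<open>
  Discrete integration: for \<open>j > 0\<close> the sequence \<open>(w ^ k) ^ j\<close> is the increment of a multiple of
  itself, because \<open>w ^ j \<noteq> 1\<close>. The increments tend to zero, which excludes a constant term,
  whose integral would be linear in \<open>k\<close>. The error is integrated by \<open>geometric_increments\<close>.
\<close>

lemma expands_increments:
  assumes N: "N > 0" and u: "expands w N (\<lambda>k. u (Suc k) - u k)" "(\<lambda>k. u (Suc k) - u k) \<longlonglongrightarrow> 0"
  shows "expands w N u"
proof -
  obtain H where H: "(\<lambda>k. (u (Suc k) - u k) - poly H (w ^ k)) \<in> O(\<lambda>k. (w ^ k) ^ N)"
    using u by (auto simp: expands_def)
  have H0: "poly H 0 = 0"
  proof -
    have "(\<lambda>k. (w ^ k) ^ N) \<in> o(\<lambda>_. 1)"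
      using tendsto_power[OF w_tendsto, of N] N by (intro smalloI_tendsto) (auto simp: power_0_left)
    then have "(\<lambda>k. (u (Suc k) - u k) - poly H (w ^ k)) \<in> o(\<lambda>_. 1)"
      using H by (rule landau_o.big_small_trans[rotated])
    then have "(\<lambda>k. (u (Suc k) - u k) - poly H (w ^ k)) \<longlonglongrightarrow> 0" by (auto dest: smalloD_tendsto)
    then have "(\<lambda>k. (u (Suc k) - u k) - ((u (Suc k) - u k) - poly H (w ^ k))) \<longlonglongrightarrow> 0 - 0"
      by (intro tendsto_diff u)
    then have "(\<lambda>k. poly H (w ^ k)) \<longlonglongrightarrow> 0" by simp
    with poly_w_tendsto show ?thesis by (rule LIMSEQ_unique)
  qed
  define G where "G = (\<Sum>j\<le>degree H. monom (coeff H j / (w ^ j - 1)) j)"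
  have G: "poly G (w * y) - poly G y = poly H y" for y
  proof -
    have "poly G (w * y) - poly G y = (\<Sum>j\<le>degree H. coeff H j * y ^ j)"
      unfolding G_def poly_sum poly_monom sum_subtractf[symmetric]
    proof (intro sum.cong refl)
      fix j
      show "coeff H j / (w ^ j - 1) * (w * y) ^ j - coeff H j / (w ^ j - 1) * y ^ j = coeff H j * y ^ j"
      proof (cases "j = 0")
        case True then show ?thesis using H0 by (simp add: poly_0_coeff_0)
      next
        case False
        then have "w ^ j < 1" using w by (simp add: power_less_one_iff)
        then have "c / (w ^ j - 1) * (w ^ j - 1) = c" for c by simp
        then show ?thesis by (simp only: power_mult_distrib mult.assoc[symmetric] left_diff_distrib[symmetric])
            (metis (no_types, opaque_lifting) mult.commute mult.right_neutral right_diff_distrib)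
      qed
    qed
    then show ?thesis by (simp add: poly_altdef)
  qed
  define d where "d = (\<lambda>k. u k - poly G (w ^ k))"
  have "(\<lambda>k. d (Suc k) - d k) = (\<lambda>k. (u (Suc k) - u k) - poly H (w ^ k))"
    by (rule ext) (simp add: d_def G[symmetric])
  then have "(\<lambda>k. d (Suc k) - d k) \<in> O(\<lambda>k. (w ^ N) ^ k)"
    using H by (simp add: power_mult[symmetric] mult.commute)
  moreover have "0 < w ^ N" "w ^ N < 1" using w N by (auto simp: power_less_one_iff)
  ultimately obtain c where "(\<lambda>k. d k - c) \<in> O(\<lambda>k. (w ^ N) ^ k)"
    using geometric_increments[of "w ^ N" d] by blast
  then show ?thesis
    unfolding expands_def
    by (intro exI[of _ "[:c:] + G"])
       (simp add: d_def algebra_simps power_mult[symmetric])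
qed

end


section \<open>Integer sequences with prescribed asymptotics\<close>

lemma integer_ratio:
  fixes p q A :: int
  assumes "coprime p q" "q > 0" "A \<noteq> 0" "\<And>j. q ^ j dvd p ^ j * A"
  shows "q = 1"
proof (rule ccontr)
  assume "q \<noteq> 1"
  then have q: "q \<ge> 2" using assms by simp
  have "q ^ j dvd A" for j
    using assms(4)[of j] assms(1)
    by (metis coprime_commute coprime_dvd_mult_right_iff coprime_power_left_iff coprime_power_right_iff)
  then have "q ^ nat \<bar>A\<bar> \<le> \<bar>A\<bar>" using assms(3) by (meson dvd_imp_le_int dual_order.trans abs_ge_self)
  moreover have "int (nat \<bar>A\<bar>) < 2 ^ nat \<bar>A\<bar>" by (metis of_nat_less_two_power)
  moreover have "(2::int) ^ nat \<bar>A\<bar> \<le> q ^ nat \<bar>A\<bar>" using q by (intro power_mono) auto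
  ultimately show False by simp
qed

text \<open>
  The operator \<open>(S - \<mu>) (S - \<nu>)\<close>, where \<open>S\<close> is the shift. The roots come in pairs because for
  conjugate \<open>\<mu>\<close> and \<open>\<nu>\<close> only the product of the two factors preserves integrality.
\<close>

definition quad_shift :: "real \<Rightarrow> real \<Rightarrow> (nat \<Rightarrow> real) \<Rightarrow> nat \<Rightarrow> real" where
  "quad_shift \<mu> \<nu> u k = u (k + 2) - (\<mu> + \<nu>) * u (k + 1) + \<mu> * \<nu> * u k"

primrec quad_shifts :: "(real \<times> real) list \<Rightarrow> (nat \<Rightarrow> real) \<Rightarrow> nat \<Rightarrow> real" where
  "quad_shifts [] u = u"
| "quad_shifts (p # ps) u = quad_shifts ps (quad_shift (fst p) (snd p) u)"

lemma quad_shift_bigo: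
  assumes \<theta>: "0 < \<theta>" and u: "u \<in> O(\<lambda>k. \<theta> ^ k)"
  shows "quad_shift \<mu> \<nu> u \<in> O(\<lambda>k. \<theta> ^ k)"
proof -
  have sh: "(\<lambda>k. u (k + j)) \<in> O(\<lambda>k. \<theta> ^ k)" for j
  proof -
    have "(\<lambda>k. u (k + j)) \<in> O(\<lambda>k. \<theta> ^ (k + j))"
      by (rule landau_o.big.compose[OF u]) (rule filterlim_add_const_nat_at_top)
    also have "(\<lambda>k. \<theta> ^ (k + j)) \<in> O(\<lambda>k. \<theta> ^ k)" using \<theta> by (simp add: power_add)
    finally show ?thesis .
  qed
  have "(\<lambda>k. u (k + 2) - (\<mu> + \<nu>) * u (k + 1) + \<mu> * \<nu> * u k) \<in> O(\<lambda>k. \<theta> ^ k)"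
    using sh[of 1] sh[of 2] u by (intro sum_in_bigo) (auto simp: cmult_in_bigo_iff)
  then show ?thesis by (simp add: quad_shift_def[abs_def])
qed

lemma quad_shifts_bigo:
  "0 < \<theta> \<Longrightarrow> u \<in> O(\<lambda>k. \<theta> ^ k) \<Longrightarrow> quad_shifts ps u \<in> O(\<lambda>k. \<theta> ^ k)"
  by (induction ps arbitrary: u) (auto intro: quad_shift_bigo)

lemma quad_shifts_integer:
  assumes "\<And>k. u k \<in> \<int>" "\<And>p. p \<in> set ps \<Longrightarrow> fst p + snd p \<in> \<int> \<and> fst p * snd p \<in> \<int>"
  shows "quad_shifts ps u k \<in> \<int>"
  using assms
proof (induction ps arbitrary: u)
  case (Cons p ps)
  have "quad_shift (fst p) (snd p) u k \<in> \<int>" for k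
  proof -
    have "fst p + snd p \<in> \<int>" "fst p * snd p \<in> \<int>" using Cons.prems(2)[of p] by auto
    then show ?thesis
      unfolding quad_shift_def by (intro Ints_add[of "_ - _"] Ints_diff Ints_mult[of "_ + _"] Ints_mult[of "_ * _"] Cons.prems(1))
  qed
  then show ?case using Cons.IH Cons.prems(2) by simp
qed simp

lemma quad_shifts_add: "quad_shifts ps (\<lambda>k. u k + v k) k = quad_shifts ps u k + quad_shifts ps v k"
proof (induction ps arbitrary: u v)
  case (Cons p ps)
  have "quad_shift (fst p) (snd p) (\<lambda>k. u k + v k) =
      (\<lambda>k. quad_shift (fst p) (snd p) u k + quad_shift (fst p) (snd p) v k)"
    by (rule ext) (simp add: quad_shift_def algebra_simps)
  then show ?case using Cons.IH by simp
qed simp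

lemma quad_shifts_geometric:
  "quad_shifts ps (\<lambda>k. h * x ^ k) k = (\<Prod>p\<leftarrow>ps. (x - fst p) * (x - snd p)) * (h * x ^ k)"
proof (induction ps arbitrary: h)
  case (Cons p ps)
  have "quad_shift (fst p) (snd p) (\<lambda>k. h * x ^ k) = (\<lambda>k. ((x - fst p) * (x - snd p) * h) * x ^ k)"
    by (rule ext) (simp add: quad_shift_def algebra_simps power2_eq_square)
  then show ?case using Cons.IH[of "(x - fst p) * (x - snd p) * h"] by (simp add: algebra_simps)
qed simp

lemma quad_shifts_sum_geometric:
  assumes "finite J" "\<And>j. j \<in> J \<Longrightarrow> \<exists>p\<in>set ps. x j = fst p \<or> x j = snd p"
  shows "quad_shifts ps (\<lambda>k. \<Sum>j\<in>J. h j * x j ^ k) k = 0"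
  using assms
proof (induction J rule: finite_induct)
  case empty
  then show ?case using quad_shifts_geometric[of ps 0 0] by simp
next
  case (insert j J)
  have "(\<Prod>p\<leftarrow>ps. (x j - fst p) * (x j - snd p)) = 0"
    using insert.prems[of j] by (induction ps) auto
  then show ?case using insert by (simp add: quad_shifts_add quad_shifts_geometric)
qed

text \<open>
  The nonzero solutions are multiples of \<open>\<mu> ^ k\<close>, which decay more slowly than \<open>\<theta> ^ k\<close>.
\<close>

lemma first_order_decay:
  assumes \<theta>: "0 < \<theta>" "\<theta> < \<bar>\<mu>\<bar> \<or> \<mu> = 0" and u: "u \<in> O(\<lambda>k. \<theta> ^ k)"
    and rec: "\<forall>\<^sub>F k in sequentially. u (Suc k) = \<mu> * u k"
  shows "\<forall>\<^sub>F k in sequentially. u k = (0::real)"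
proof -
  obtain C where "\<forall>\<^sub>F k in sequentially. norm (u k) \<le> C * norm (\<theta> ^ k)"
    using u by (elim landau_o.bigE)
  with rec obtain k0 where k0: "\<And>k. k \<ge> k0 \<Longrightarrow> u (Suc k) = \<mu> * u k" "\<And>k. k \<ge> k0 \<Longrightarrow> \<bar>u k\<bar> \<le> C * \<theta> ^ k"
    using \<theta> unfolding eventually_sequentially by (simp add: power_abs) (metis nle_le order_trans)
  show ?thesis
  proof (cases "\<mu> = 0")
    case True
    then have "u k = 0" if "k \<ge> Suc k0" for k using k0(1)[of "k - 1"] that by (cases k) auto
    then show ?thesis by (auto simp: eventually_sequentially)
  next
    case False
    have "u k = 0" if k: "k \<ge> k0" for k
    proof (rule ccontr)
      assume nz: "u k \<noteq> 0"
      have e: "u (k + j) = \<mu> ^ j * u k" for j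
        by (induction j) (use k0(1) k in auto)
      have "\<bar>u k\<bar> \<le> C * \<theta> ^ k * (\<theta> / \<bar>\<mu>\<bar>) ^ j" for j
      proof -
        have "\<bar>\<mu>\<bar> ^ j * \<bar>u k\<bar> \<le> C * \<theta> ^ k * \<theta> ^ j"
          using k0(2)[of "k + j"] k unfolding e by (simp add: abs_mult power_abs power_add mult.assoc)
        then show ?thesis using False by (simp add: power_divide field_simps)
      qed
      moreover have "(\<lambda>j. C * \<theta> ^ k * (\<theta> / \<bar>\<mu>\<bar>) ^ j) \<longlonglongrightarrow> C * \<theta> ^ k * 0"
        using \<theta> False by (intro tendsto_intros LIMSEQ_power_zero) auto
      ultimately have "\<bar>u k\<bar> \<le> C * \<theta> ^ k * 0"
        by (intro LIMSEQ_le_const) auto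
      then show False using nz by simp
    qed
    then show ?thesis by (auto simp: eventually_sequentially)
  qed
qed

text \<open>
  The factors are removed one root at a time by \<open>first_order_decay\<close>.
\<close>

lemma quad_shifts_decay:
  assumes "0 < \<theta>" "u \<in> O(\<lambda>k. \<theta> ^ k)"
    and "\<And>p. p \<in> set ps \<Longrightarrow> \<theta> < \<bar>fst p\<bar> \<and> (\<theta> < \<bar>snd p\<bar> \<or> snd p = 0)"
    and "\<forall>\<^sub>F k in sequentially. quad_shifts ps u k = 0"
  shows "\<forall>\<^sub>F k in sequentially. u k = 0"
  using assms
proof (induction ps arbitrary: u)
  case (Cons p ps)
  obtain \<mu> \<nu> where p: "p = (\<mu>, \<nu>)" by (cases p)
  have "\<forall>\<^sub>F k in sequentially. quad_shift \<mu> \<nu> u k = 0"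
    using Cons.IH[of "quad_shift \<mu> \<nu> u"] Cons.prems quad_shift_bigo[of \<theta> u] by (simp add: p)
  then have "\<forall>\<^sub>F k in sequentially. u (Suc (Suc k)) - \<nu> * u (Suc k) = \<mu> * (u (Suc k) - \<nu> * u k)"
    by eventually_elim (simp add: quad_shift_def algebra_simps)
  moreover have "(\<lambda>k. u (Suc k) - \<nu> * u k) \<in> O(\<lambda>k. \<theta> ^ k)"
  proof -
    have "(\<lambda>k. u (Suc k)) \<in> O(\<lambda>k. \<theta> ^ Suc k)"
      by (rule landau_o.big.compose[OF Cons.prems(2) filterlim_Suc])
    also have "(\<lambda>k. \<theta> ^ Suc k) \<in> O(\<lambda>k. \<theta> ^ k)" using Cons.prems(1) by simp
    finally show ?thesis using Cons.prems(2) by (intro sum_in_bigo) (auto simp: cmult_in_bigo_iff)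
  qed
  ultimately have "\<forall>\<^sub>F k in sequentially. u (Suc k) - \<nu> * u k = 0"
    using first_order_decay[of \<theta> \<mu> "\<lambda>k. u (Suc k) - \<nu> * u k"] Cons.prems(1) Cons.prems(3)[of p] by (simp add: p)
  then show ?case
    using first_order_decay[of \<theta> \<nu> u] Cons.prems(1,2) Cons.prems(3)[of p] by (simp add: p)
qed simp

lemma integer_tends_to_zero:
  assumes "\<And>k. u k \<in> \<int>" "u \<longlonglongrightarrow> (0::real)"
  shows "\<forall>\<^sub>F k in sequentially. u k = 0"
proof -
  have "\<forall>\<^sub>F k in sequentially. dist (u k) 0 < 1" using assms(2) by (rule tendstoD) simp
  then show ?thesis
    by eventually_elim (use assms(1) Ints_nonzero_abs_less1 in auto)
qed

text \<open>
  The product of the operators annihilates the sum of exponentials. Applied to \<open>y\<close> it yields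
  integers that tend to zero, hence vanish eventually. So the error eventually solves a linear
  recurrence whose nonzero roots are larger than \<open>\<theta>\<close>, while it decays like \<open>\<theta> ^ k\<close>; by
  \<open>quad_shifts_decay\<close> it vanishes.
\<close>

lemma integer_sum_of_exponentials:
  fixes y :: "nat \<Rightarrow> real"
  assumes y: "\<And>k. y k \<in> \<int>" and \<theta>: "0 < \<theta>" "\<theta> < 1" and J: "finite J"
    and e: "(\<lambda>k. y k - (\<Sum>j\<in>J. h j * x j ^ k)) \<in> O(\<lambda>k. \<theta> ^ k)"
    and x: "\<And>j. j \<in> J \<Longrightarrow> \<exists>p\<in>set ps. x j = fst p \<or> x j = snd p"
    and int: "\<And>p. p \<in> set ps \<Longrightarrow> fst p + snd p \<in> \<int> \<and> fst p * snd p \<in> \<int>"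
    and ps: "\<And>p. p \<in> set ps \<Longrightarrow> \<theta> < \<bar>fst p\<bar> \<and> (\<theta> < \<bar>snd p\<bar> \<or> snd p = 0)"
  shows "\<forall>\<^sub>F k in sequentially. y k = (\<Sum>j\<in>J. h j * x j ^ k)"
proof -
  let ?e = "\<lambda>k. y k - (\<Sum>j\<in>J. h j * x j ^ k)"
  have "quad_shifts ps y k = quad_shifts ps ?e k" for k
    using quad_shifts_add[of ps ?e "\<lambda>k. \<Sum>j\<in>J. h j * x j ^ k" k]
      quad_shifts_sum_geometric[where J = J and ps = ps and x = x and h = h and k = k, OF J x] by simp
  then have int': "quad_shifts ps ?e k \<in> \<int>" for k
    using quad_shifts_integer[where u = y and ps = ps and k = k, OF y int] by simp
  have "quad_shifts ps ?e \<in> O(\<lambda>k. \<theta> ^ k)" by (rule quad_shifts_bigo[OF \<theta>(1) e])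
  moreover have "(\<lambda>k. \<theta> ^ k) \<in> o(\<lambda>_. 1)"
    using LIMSEQ_realpow_zero[of \<theta>] \<theta> by (intro smalloI_tendsto) auto
  ultimately have "quad_shifts ps ?e \<in> o(\<lambda>_. 1)" by (rule landau_o.big_small_trans)
  then have "quad_shifts ps ?e \<longlonglongrightarrow> 0" by (auto dest: smalloD_tendsto)
  then have "\<forall>\<^sub>F k in sequentially. quad_shifts ps ?e k = 0" by (rule integer_tends_to_zero[OF int'])
  then have "\<forall>\<^sub>F k in sequentially. ?e k = 0"
    using quad_shifts_decay[where u = ?e and ps = ps and \<theta> = \<theta>] \<theta>(1) e ps by blast
  then show ?thesis by eventually_elim simp
qed

text \<open>
  The expansion is a sum of exponentials with bases \<open>\<Lambda> ^ (d - 2 * j)\<close>. If \<open>c = 1\<close>, the numbers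
  \<open>\<Lambda> ^ i\<close> and \<open>\<Lambda> ^ (- i)\<close> are the roots of a monic integral quadratic polynomial; all bases down
  to \<open>\<Lambda> ^ (- d)\<close> are covered in this way and the remaining error is of order \<open>\<Lambda> ^ (- d - 2)\<close>. If
  \<open>c = 0\<close>, then \<open>\<Lambda>\<close> is an integer; the bases with nonnegative exponents are integers, each
  paired with the root \<open>0\<close>, and all other terms belong to an error that decays.
\<close>

lemma integer_laurent_expansion:
  fixes \<Lambda> :: real and K c :: int
  assumes \<Lambda>: "\<Lambda> > 1" "\<Lambda>\<^sup>2 - K * \<Lambda> + c = 0" "c \<in> {0, 1}" and y: "\<And>k. y k \<in> \<int>"
    and e: "(\<lambda>k. y k - (\<Lambda> ^ k) ^ d * poly H (1 / (\<Lambda> ^ k)\<^sup>2)) \<in> O(\<lambda>k. (\<Lambda> ^ k) ^ d * (1 / (\<Lambda> ^ k)\<^sup>2) ^ Suc d)"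
  shows "\<exists>P. \<forall>\<^sub>F k in sequentially. y k * (\<Lambda> ^ k) ^ d = poly P (\<Lambda> ^ k)"
proof -
  define x where "x j = \<Lambda> ^ d / \<Lambda> ^ (2 * j)" for j
  have xk: "x j ^ k = (\<Lambda> ^ k) ^ d * (1 / (\<Lambda> ^ k)\<^sup>2) ^ j" for j k
    by (simp add: x_def power_divide power_mult[symmetric] mult.commute mult.left_commute)
  define n where "n = Suc (max d (degree H))"
  have H: "(\<Lambda> ^ k) ^ d * poly H (1 / (\<Lambda> ^ k)\<^sup>2) = (\<Sum>j<n. coeff H j * x j ^ k)" for k
  proof -
    have "poly H (1 / (\<Lambda> ^ k)\<^sup>2) = (\<Sum>j<n. coeff H j * (1 / (\<Lambda> ^ k)\<^sup>2) ^ j)"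
      unfolding poly_altdef by (intro sum.mono_neutral_left) (auto simp: n_def coeff_eq_0 not_le)
    then show ?thesis by (simp add: sum_distrib_left xk algebra_simps)
  qed
  have xO: "(\<lambda>k. x j ^ k) \<in> O(\<lambda>k. x i ^ k)" if "i \<le> j" for i j
  proof -
    have "x j \<le> x i" "0 < x j" using that \<Lambda>(1) by (auto simp: x_def intro!: divide_left_mono power_increasing)
    then have "norm (x j ^ k) \<le> 1 * norm (x i ^ k)" for k by (simp add: power_abs power_mono)
    then show ?thesis by (intro bigoI[where c = 1] always_eventually) auto
  qed
  have split: "(\<lambda>k. y k - (\<Sum>j\<in>{..<m}. coeff H j * x j ^ k)) \<in> O(\<lambda>k. x m ^ k)" if m: "m \<le> Suc d" for m
  proof -
    have mn: "m \<le> n" using m by (auto simp: n_def)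
    have "(\<Sum>j<n. coeff H j * x j ^ k) = (\<Sum>j<m. coeff H j * x j ^ k) + (\<Sum>j=m..<n. coeff H j * x j ^ k)" for k
      using mn
      by (subst sum.union_disjoint[symmetric]) (auto intro!: sum.cong)
    then have eq: "y k - (\<Sum>j\<in>{..<m}. coeff H j * x j ^ k) =
        (y k - (\<Lambda> ^ k) ^ d * poly H (1 / (\<Lambda> ^ k)\<^sup>2)) + (\<Sum>j=m..<n. coeff H j * x j ^ k)" for k
      by (simp add: H)
    have "(\<lambda>k. y k - (\<Lambda> ^ k) ^ d * poly H (1 / (\<Lambda> ^ k)\<^sup>2)) \<in> O(\<lambda>k. x (Suc d) ^ k)"
      using e by (simp only: xk)
    also have "(\<lambda>k. x (Suc d) ^ k) \<in> O(\<lambda>k. x m ^ k)" by (rule xO[OF m])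
    finally have "(\<lambda>k. (y k - (\<Lambda> ^ k) ^ d * poly H (1 / (\<Lambda> ^ k)\<^sup>2)) + (\<Sum>j=m..<n. coeff H j * x j ^ k)) \<in> O(\<lambda>k. x m ^ k)"
      by (rule sum_in_bigo) (intro big_sum_in_bigo, simp add: cmult_in_bigo_iff xO)
    then show ?thesis by (simp only: eq)
  qed
  have pos: "x j > 0" for j using \<Lambda>(1) by (simp add: x_def)
  have "\<exists>m\<le>Suc d. \<forall>\<^sub>F k in sequentially. y k = (\<Sum>j\<in>{..<m}. coeff H j * x j ^ k)"
  proof (cases "c = 1")
    case True
    define ps where "ps = map (\<lambda>i. (\<Lambda> ^ i, (1 / \<Lambda>) ^ i)) [0..<Suc d]"
    have K: "\<Lambda> + 1 / \<Lambda> = K" using \<Lambda> True by (simp add: field_simps power2_eq_square)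
    have sums: "\<Lambda> ^ i + (1 / \<Lambda>) ^ i \<in> \<int>" for i
    proof (induction i rule: induct_nat_012)
      case 1 then show ?case using K by simp
    next
      case (ge2 i)
      have "\<Lambda> ^ Suc (Suc i) + (1 / \<Lambda>) ^ Suc (Suc i) =
          K * (\<Lambda> ^ Suc i + (1 / \<Lambda>) ^ Suc i) - (\<Lambda> ^ i + (1 / \<Lambda>) ^ i)"
      proof -
        define t where "t = 1 / \<Lambda>"
        have t: "\<Lambda> * (t * z) = z" for z using \<Lambda>(1) by (simp add: t_def)
        show ?thesis
          unfolding K[symmetric] t_def[symmetric] by (simp add: algebra_simps t)
      qed
      then show ?case using ge2 by (simp add: Ints_diff Ints_mult)
    qed simp
    have xS: "x (Suc d) = (1 / \<Lambda>) ^ (d + 2)"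
    proof -
      have "2 * Suc d = d + (d + 2)" by simp
      then have "\<Lambda> ^ (2 * Suc d) = \<Lambda> ^ d * \<Lambda> ^ (d + 2)" by (simp only: power_add)
      then show ?thesis using \<Lambda>(1) by (simp only: x_def) (simp add: power_divide)
    qed
    have lt: "x (Suc d) < (1 / \<Lambda>) ^ i" if "i \<le> d" for i
      unfolding xS using \<Lambda>(1) that by (intro power_strict_decreasing) auto
    have "\<forall>\<^sub>F k in sequentially. y k = (\<Sum>j\<in>{..<Suc d}. coeff H j * x j ^ k)"
    proof (rule integer_sum_of_exponentials[OF y pos[of "Suc d"] _ _ split[OF order.refl], of ps])
      show "x (Suc d) < 1" using lt[of 0] by simp
      fix j assume j: "j \<in> {..<Suc d}"
      show "\<exists>p\<in>set ps. x j = fst p \<or> x j = snd p"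
      proof (cases "2 * j \<le> d")
        case True
        then have "x j = \<Lambda> ^ (d - 2 * j)" using \<Lambda>(1) by (simp add: x_def power_diff)
        moreover have "(\<Lambda> ^ (d - 2 * j), (1 / \<Lambda>) ^ (d - 2 * j)) \<in> set ps"
          unfolding ps_def set_map set_upt by (rule imageI) auto
        ultimately show ?thesis by (metis fst_conv)
      next
        case False
        then have "\<Lambda> ^ (2 * j) = \<Lambda> ^ d * \<Lambda> ^ (2 * j - d)" by (simp add: power_add[symmetric])
        then have xj: "x j = (1 / \<Lambda>) ^ (2 * j - d)" using \<Lambda>(1) by (simp add: x_def field_simps)
        have "2 * j - d \<le> d" using j by auto
        then have "(\<Lambda> ^ (2 * j - d), (1 / \<Lambda>) ^ (2 * j - d)) \<in> set ps"
          unfolding ps_def set_map set_upt by (intro imageI) auto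
        then show ?thesis using xj by (metis snd_conv)
      qed
    next
      fix p assume "p \<in> set ps"
      then obtain i where i: "i \<le> d" "p = (\<Lambda> ^ i, (1 / \<Lambda>) ^ i)" by (auto simp: ps_def less_Suc_eq_le simp del: upt_Suc)
      show "fst p + snd p \<in> \<int> \<and> fst p * snd p \<in> \<int>"
        using sums[of i] \<Lambda>(1) by (simp add: i power_mult_distrib[symmetric])
      have "(1 / \<Lambda>) ^ i \<le> 1" using \<Lambda>(1) by (intro power_le_one) auto
      also have "1 \<le> \<Lambda> ^ i" using \<Lambda>(1) by simp
      finally show "x (Suc d) < \<bar>fst p\<bar> \<and> (x (Suc d) < \<bar>snd p\<bar> \<or> snd p = 0)"
        using lt[OF i(1)] \<Lambda>(1) by (simp add: i power_abs)
    qed simp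
    then show ?thesis by blast
  next
    case False
    then have K: "\<Lambda> = K" using \<Lambda> by (auto simp: power2_eq_square)
    define ps where "ps = map (\<lambda>i. (\<Lambda> ^ i, 0::real)) [0..<Suc d]"
    define m where "m = Suc (d div 2)"
    have m: "m \<le> Suc d" by (auto simp: m_def)
    have xm: "x m < 1"
    proof -
      have "d < 2 * m" by (simp add: m_def)
      then have "\<Lambda> ^ d < \<Lambda> ^ (2 * m)" using \<Lambda>(1) by (intro power_strict_increasing)
      then show ?thesis using \<Lambda>(1) by (simp add: x_def field_simps)
    qed
    have "\<forall>\<^sub>F k in sequentially. y k = (\<Sum>j\<in>{..<m}. coeff H j * x j ^ k)"
    proof (rule integer_sum_of_exponentials[OF y pos[of m] xm _ split[OF m], of ps])
      fix j assume j: "j \<in> {..<m}"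
      then have "2 * j \<le> d" by (auto simp: m_def)
      then have "x j = \<Lambda> ^ (d - 2 * j)" using \<Lambda>(1) by (simp add: x_def power_diff)
      moreover have "(\<Lambda> ^ (d - 2 * j), 0) \<in> set ps"
        unfolding ps_def set_map set_upt by (rule imageI) auto
      ultimately show "\<exists>p\<in>set ps. x j = fst p \<or> x j = snd p" by (metis fst_conv)
    next
      fix p assume "p \<in> set ps"
      then obtain i where i: "i \<le> d" "p = (\<Lambda> ^ i, 0)" by (auto simp: ps_def less_Suc_eq_le simp del: upt_Suc)
      show "fst p + snd p \<in> \<int> \<and> fst p * snd p \<in> \<int>" by (simp add: i K)
      have "1 \<le> \<Lambda> ^ i" using \<Lambda>(1) by simp
      then show "x m < \<bar>fst p\<bar> \<and> (x m < \<bar>snd p\<bar> \<or> snd p = 0)"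
        using xm by (simp add: i)
    qed simp
    then show ?thesis using m by blast
  qed
  then obtain m where md: "m \<le> Suc d" and m: "\<forall>\<^sub>F k in sequentially. y k = (\<Sum>j\<in>{..<m}. coeff H j * x j ^ k)" by blast
  have "y k * (\<Lambda> ^ k) ^ d = poly (\<Sum>j<m. monom (coeff H j) (2 * d - 2 * j)) (\<Lambda> ^ k)"
    if "y k = (\<Sum>j\<in>{..<m}. coeff H j * x j ^ k)" for k
  proof -
    have "x j ^ k * (\<Lambda> ^ k) ^ d = (\<Lambda> ^ k) ^ (2 * d - 2 * j)" if "j < m" for j
    proof -
      have "2 * j \<le> 2 * d" using that md by auto
      then show ?thesis
        using \<Lambda>(1) by (simp add: xk power_diff power_mult power_divide) (simp add: power2_eq_square power_mult_distrib)
    qed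
    then show ?thesis
      unfolding that by (simp add: sum_distrib_right poly_sum poly_monom mult.assoc)
  qed
  then show ?thesis
    by (intro exI eventually_mono[OF m])
qed

lemma constant_ratio:
  fixes f g :: "nat \<Rightarrow> int"
  assumes nz: "\<And>k. k \<ge> k0 \<Longrightarrow> f k \<noteq> 0"
    and cross: "\<And>k. k \<ge> k0 \<Longrightarrow> f k * g (Suc k) = f (Suc k) * g k"
    and k: "k \<ge> k0"
  shows "f k * g k0 = f k0 * g k"
  using k
proof (induction k rule: dec_induct)
  case (step k)
  have "f k * (f (Suc k) * g k0) = f (Suc k) * (f k * g k0)" by (simp only: mult.left_commute)
  also have "\<dots> = f k0 * (f (Suc k) * g k)" unfolding step.IH by (simp only: mult.left_commute)
  also have "\<dots> = f k * (f k0 * g (Suc k))"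
    unfolding cross[OF step.hyps(1), symmetric] by (simp only: mult.left_commute)
  finally show ?case using nz[OF step.hyps(1)] by (metis mult_cancel_left)
qed simp

lemma constant_ratio_in_lowest_terms:
  fixes f g :: "nat \<Rightarrow> int"
  assumes pos: "\<And>k. k \<ge> k0 \<Longrightarrow> f k > 0"
    and cross: "\<And>k. k \<ge> k0 \<Longrightarrow> f k * g (Suc k) = f (Suc k) * g k"
  shows "\<exists>p q. coprime p q \<and> q > 0 \<and> (\<forall>k\<ge>k0. q * g k = p * f k)"
proof -
  have f0: "f k0 > 0" by (rule pos) simp
  define d where "d = gcd (g k0) (f k0)"
  have "d \<noteq> 0" using f0 by (simp add: d_def)
  then obtain p q where pq: "g k0 = p * d" "f k0 = q * d" "coprime p q"
    using gcd_coprime_exists[of "g k0" "f k0"] unfolding d_def by blast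
  have d: "d > 0" using \<open>d \<noteq> 0\<close> by (simp add: d_def)
  have "q > 0" using pq(2) f0 d by (simp add: zero_less_mult_iff)
  moreover have "q * g k = p * f k" if k: "k \<ge> k0" for k
  proof -
    have nz: "\<And>k. k \<ge> k0 \<Longrightarrow> f k \<noteq> 0" using pos by fastforce
    have "f k * (p * d) = q * d * g k" using constant_ratio[of k0 f g k] nz cross k unfolding pq by blast
    then have "d * (q * g k) = d * (p * f k)" by (simp only: ac_simps)
    then show ?thesis using d by (simp add: mult.commute)
  qed
  ultimately show ?thesis using pq(3) by blast
qed

text \<open>
  The Hankel determinants \<open>b k = a k * a (k + 2) - (a (k + 1))\<^sup>2\<close> are bounded integers, because
  the terms of order \<open>\<mu> ^ (2 * k)\<close> cancel. By Dodgson condensation,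
  \<open>b k * b (k + 2) - (b (k + 1))\<^sup>2\<close> is \<open>a (k + 2)\<close> times a Hankel determinant of size three; as
  \<open>a (k + 2)\<close> tends to infinity, the latter vanishes. So \<open>b\<close> is a bounded geometric sequence of
  integers: it is zero or its ratio \<open>s\<close> is \<open>1\<close> or \<open>- 1\<close>. In both cases \<open>a\<close> satisfies a
  recurrence of order at most two with rational coefficients, whose common denominator \<open>q\<close> must
  be \<open>1\<close> because powers of it divide a fixed nonzero integer. Hence \<open>\<mu>\<close> is a root of
  \<open>\<mu>\<^sup>2 - p * \<mu> + s\<close>; passing to \<open>\<mu>\<^sup>2\<close> makes the constant term \<open>s\<^sup>2\<close>.
\<close>

lemma leading_term_quadratic:
  fixes a :: "nat \<Rightarrow> int" and \<mu> C :: real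
  assumes \<mu>: "\<mu> > 1" and C: "C > 0" and a: "(\<lambda>k. a k - C * \<mu> ^ k) \<in> O(\<lambda>k. (1 / \<mu>) ^ k)"
  shows "\<exists>(K::int) (c::int). c \<in> {0::int, 1} \<and> (\<mu>\<^sup>2)\<^sup>2 - K * \<mu>\<^sup>2 + c = 0"
proof -
  define e where "e k = a k - C * \<mu> ^ k" for k
  have ae: "real_of_int (a k) = C * \<mu> ^ k + e k" for k by (simp add: e_def)
  obtain B0 where "\<forall>\<^sub>F k in sequentially. norm (e k) \<le> B0 * norm ((1 / \<mu>) ^ k)"
    using a unfolding e_def by (elim landau_o.bigE)
  then obtain k1 where k1: "\<And>k. k \<ge> k1 \<Longrightarrow> \<bar>e k\<bar> \<le> B0 * (1 / \<mu>) ^ k"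
    using \<mu> unfolding eventually_sequentially by (metis abs_of_pos norm_power real_norm_def zero_less_divide_1_iff zero_less_one order_less_trans)
  have "0 \<le> B0 * (1 / \<mu>) ^ k1" using k1[of k1] abs_ge_zero[of "e k1"] by linarith
  moreover have "0 < (1 / \<mu>) ^ k1" using \<mu> by simp
  ultimately have B0: "B0 \<ge> 0" by (metis zero_le_mult_iff not_le)
  define b where "b k = a k * a (k + 2) - (a (k + 1))\<^sup>2" for k
  have cross: "\<bar>\<mu> ^ i * e (i + j)\<bar> \<le> B0" "\<bar>e i\<bar> \<le> B0" if "i \<ge> k1" for i j
  proof -
    have "\<bar>e (i + j)\<bar> \<le> B0 * (1 / \<mu>) ^ (i + j)" using k1[of "i + j"] that by simp
    also have "\<dots> \<le> B0 * (1 / \<mu>) ^ i" using \<mu> B0 by (intro mult_left_mono power_decreasing) auto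
    finally have "\<mu> ^ i * \<bar>e (i + j)\<bar> \<le> \<mu> ^ i * (B0 * (1 / \<mu>) ^ i)" using \<mu> by (intro mult_left_mono) auto
    then show "\<bar>\<mu> ^ i * e (i + j)\<bar> \<le> B0" using \<mu> by (simp add: abs_mult power_divide)
    have "\<bar>e i\<bar> \<le> B0 * (1 / \<mu>) ^ i" using k1 that by simp
    also have "\<dots> \<le> B0 * 1" using \<mu> B0 by (intro mult_left_mono power_le_one) auto
    finally show "\<bar>e i\<bar> \<le> B0" by simp
  qed
  define B where "B = C * B0 + C * \<mu>\<^sup>2 * B0 + 2 * C * \<mu> * B0 + B0 * B0 + B0 * B0"
  have bB: "\<bar>real_of_int (b k)\<bar> \<le> B" if k: "k \<ge> k1" for k
  proof -
    have "real_of_int (b k) = C * (\<mu> ^ k * e (k + 2)) + C * \<mu>\<^sup>2 * (\<mu> ^ k * e (k + 0)) - 2 * C * \<mu> * (\<mu> ^ k * e (k + 1))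
        + e k * e (k + 2) - e (k + 1) * e (k + 1)"
      by (simp add: b_def ae power2_eq_square algebra_simps)
    moreover have "\<bar>C * (\<mu> ^ k * e (k + 2))\<bar> \<le> C * B0"
      using cross(1)[OF k, of 2] C by (simp add: abs_mult)
    moreover have "\<bar>C * \<mu>\<^sup>2 * (\<mu> ^ k * e (k + 0))\<bar> \<le> C * \<mu>\<^sup>2 * B0"
      using cross(1)[OF k, of 0] C \<mu> by (simp add: abs_mult)
    moreover have "\<bar>2 * C * \<mu> * (\<mu> ^ k * e (k + 1))\<bar> \<le> 2 * C * \<mu> * B0"
      using cross(1)[OF k, of 1] C \<mu> by (simp add: abs_mult)
    moreover have "\<bar>e k * e (k + 2)\<bar> \<le> B0 * B0" "\<bar>e (k + 1) * e (k + 1)\<bar> \<le> B0 * B0"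
      using cross(2)[of k] cross(2)[of "k + 1"] cross(2)[of "k + 2"] k B0
      unfolding abs_mult by (intro mult_mono; simp)+
    ultimately show ?thesis unfolding B_def by linarith
  qed
  obtain k0 where k0: "(2 * B * B + 2 + B0) / C < \<mu> ^ k0" using real_arch_pow[OF \<mu>] by blast
  define k2 where "k2 = k0 + k1"
  have k2: "real_of_int (a k) > 2 * B * B + 1" if k: "k \<ge> k2" for k
  proof -
    have "\<mu> ^ k0 \<le> \<mu> ^ k" using k \<mu> by (intro power_increasing) (auto simp: k2_def)
    then have "(2 * B * B + 2 + B0) / C < \<mu> ^ k" using k0 by linarith
    then have "2 * B * B + 2 + B0 < C * \<mu> ^ k" using C by (simp add: field_simps)
    moreover have "\<bar>e k\<bar> \<le> B0" using cross(2) k by (simp add: k2_def)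
    ultimately show ?thesis unfolding ae by linarith
  qed
  have B: "B \<ge> 0" using bB[of k1] abs_ge_zero[of "real_of_int (b k1)"] by linarith
  have apos: "a k > 0" if "k \<ge> k2" for k
  proof -
    have "0 \<le> B * B" using B by simp
    then have "0 < real_of_int (a k)" using k2[OF that] by linarith
    then show ?thesis by simp
  qed
  have bsq: "b k * b (k + 2) = (b (k + 1))\<^sup>2" if k: "k \<ge> k1 + k2" for k
  proof -
    \<comment> \<open>The determinant of the three by three Hankel matrix that starts at
      \<open>a k\<close>.\<close>
    define h where "h = a k * a (k+2) * a (k+4) + 2 * a (k+1) * a (k+2) * a (k+3) - a (k+2) ^ 3
        - a k * (a (k+3))\<^sup>2 - (a (k+1))\<^sup>2 * a (k+4)"
    have ah: "a (k + 2) * h = b k * b (k + 2) - (b (k + 1))\<^sup>2"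
      by (simp add: h_def b_def power2_eq_square power3_eq_cube algebra_simps eval_nat_numeral)
    have "\<bar>real_of_int (a (k + 2) * h)\<bar> \<le> \<bar>real_of_int (b k)\<bar> * \<bar>real_of_int (b (k + 2))\<bar> + \<bar>real_of_int (b (k + 1))\<bar> * \<bar>real_of_int (b (k + 1))\<bar>"
      unfolding ah of_int_diff of_int_mult power2_eq_square abs_mult[symmetric] by (rule abs_triangle_ineq4)
    also have "\<dots> \<le> B * B + B * B"
      using k bB[of k] bB[of "k + 1"] bB[of "k + 2"] by (intro add_mono mult_mono) auto
    also have "\<dots> < real_of_int (a (k + 2))" using k2[of "k + 2"] k by simp
    finally have "\<bar>a (k + 2) * h\<bar> < a (k + 2)" by linarith
    then have "\<bar>h\<bar> < 1" using apos[of "k + 2"] k by (simp add: abs_mult mult_less_cancel_left2)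
    then have "h = 0" by simp
    then show ?thesis using ah by simp
  qed
  have lim_a: "(\<lambda>k. a k / \<mu> ^ k) \<longlonglongrightarrow> C"
  proof -
    have "(\<lambda>k. e k / \<mu> ^ k) \<longlonglongrightarrow> 0"
    proof (rule Lim_null_comparison)
      show "\<forall>\<^sub>F k in sequentially. norm (e k / \<mu> ^ k) \<le> B0 * (1 / \<mu>) ^ k"
        unfolding eventually_sequentially
      proof (intro exI allI impI)
        fix k assume k: "k \<ge> k1"
        then have "\<bar>e k\<bar> / \<mu> ^ k \<le> B0 / \<mu> ^ k" using cross(2)[OF k] \<mu> by (intro divide_right_mono) auto
        then show "norm (e k / \<mu> ^ k) \<le> B0 * (1 / \<mu>) ^ k" using \<mu> by (simp add: power_divide abs_mult)
      qed
      show "(\<lambda>k. B0 * (1 / \<mu>) ^ k) \<longlonglongrightarrow> 0"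
        using \<mu> tendsto_mult_left[OF LIMSEQ_realpow_zero[of "1 / \<mu>"], of B0] by simp
    qed
    then have "(\<lambda>k. C + e k / \<mu> ^ k) \<longlonglongrightarrow> C + 0" by (intro tendsto_intros)
    moreover have "C + e k / \<mu> ^ k = a k / \<mu> ^ k" for k using \<mu> by (simp add: ae add_divide_distrib)
    ultimately show ?thesis by simp
  qed
  \<comment> \<open>It suffices to find a recurrence of order two with rational coefficients.\<close>
  have finish: ?thesis
    if rec: "\<And>k. k \<ge> k3 \<Longrightarrow> q * a (k + 2) = p * a (k + 1) - q * s * a k" and pq: "coprime p q" "q > 0" and k3: "k3 \<ge> k2"
      and s: "s = 0 \<or> s\<^sup>2 = 1 \<and> (\<forall>k\<ge>k3. b k \<noteq> 0 \<and> b (k + 1) = s * b k)" and s0: "s = 0 \<Longrightarrow> (\<forall>k\<ge>k3. q * a (k + 1) = p * a k)"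
    for p q s k3
  proof -
    have q1: "q = 1"
    proof (cases "s = 0")
      case True
      have "q ^ j * a (k3 + j) = p ^ j * a k3" for j
      proof (induction j)
        case (Suc j)
        have "q ^ Suc j * a (k3 + Suc j) = q ^ j * (q * a (k3 + j + 1))" by simp
        also have "\<dots> = p * (q ^ j * a (k3 + j))" using s0[OF True] by simp
        finally show ?case using Suc by simp
      qed simp
      then have "q ^ j dvd p ^ j * a k3" for j by (metis dvd_triv_left)
      then show ?thesis using integer_ratio[of p q "a k3"] pq apos[OF k3] by simp
    next
      case False
      have dvd: "\<forall>k\<ge>k3 + j. q ^ j dvd a k" for j
      proof (induction j)
        case (Suc j)
        show ?case
        proof (intro allI impI)
          fix k assume k: "k \<ge> k3 + Suc j"
          define i where "i = k - 1"
          have i: "k = i + 1" "i \<ge> k3 + j" using k by (auto simp: i_def)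
          obtain u where u: "a i = q ^ j * u" using Suc i by (auto simp: dvd_def)
          have "q ^ j dvd a (i + 1)" "q ^ j dvd a (i + 2)" using Suc i(2) by auto
          then obtain v x where vx: "a (i + 1) = q ^ j * v" "a (i + 2) = q ^ j * x" by (auto simp: dvd_def)
          have "q * a (i + 2) = p * a (i + 1) - q * s * a i" using rec[of i] i(2) by simp
          then have "q * (q ^ j * x) = p * (q ^ j * v) - q * s * (q ^ j * u)" unfolding u vx .
          then have "q ^ j * (p * v) = q ^ j * (q * (x + s * u))" by (simp add: algebra_simps)
          then have "p * v = q * (x + s * u)" using pq by (subst (asm) mult_cancel_left) auto
          then have "q dvd v" using pq(1) by (metis coprime_commute coprime_dvd_mult_right_iff dvd_triv_left)
          then show "q ^ Suc j dvd a k" unfolding i vx power_Suc2 by (intro mult_dvd_mono) auto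
        qed
      qed simp
      have s2: "s\<^sup>2 = 1" and bs: "\<And>k. k \<ge> k3 \<Longrightarrow> b k \<noteq> 0 \<and> b (k + 1) = s * b k" using s False by auto
      have "\<bar>s\<bar> = 1" using s2 by (auto simp: power2_eq_1_iff)
      then have bc: "\<bar>b (k3 + j)\<bar> = \<bar>b k3\<bar>" for j
        by (induction j) (use bs in \<open>auto simp: abs_mult\<close>)
      have "q ^ j dvd b (k3 + j)" for j
        unfolding b_def using dvd[of j] by (intro dvd_diff dvd_mult2) (auto simp: power2_eq_square)
      then have "q ^ j dvd b k3" for j using bc[of j] by (metis dvd_abs_iff)
      \<comment> \<open>All later terms of \<open>a\<close>, hence all \<open>b (k3 + j)\<close>, are divisible by \<open>q ^ j\<close>,
        but \<open>\<bar>b\<bar>\<close> is constant.\<close>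
      then show ?thesis using integer_ratio[of p q "b k3"] pq bs[of k3] by simp
    qed
    have "(\<lambda>k. a (k + 2) / \<mu> ^ (k + 2) * \<mu>\<^sup>2 - p * (a (k + 1) / \<mu> ^ (k + 1)) * \<mu> + s * (a k / \<mu> ^ k))
        \<longlonglongrightarrow> C * \<mu>\<^sup>2 - p * C * \<mu> + s * C"
      by (intro tendsto_intros lim_a LIMSEQ_ignore_initial_segment[OF lim_a])
    moreover have "\<forall>\<^sub>F k in sequentially. a (k + 2) / \<mu> ^ (k + 2) * \<mu>\<^sup>2 - p * (a (k + 1) / \<mu> ^ (k + 1)) * \<mu> + s * (a k / \<mu> ^ k) = 0"
      unfolding eventually_sequentially
    proof (intro exI allI impI)
      fix k assume "k \<ge> k3"
      then have "real_of_int (a (k + 2)) = p * a (k + 1) - s * a k" using rec[of k] q1 by simp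
      then show "a (k + 2) / \<mu> ^ (k + 2) * \<mu>\<^sup>2 - p * (a (k + 1) / \<mu> ^ (k + 1)) * \<mu> + s * (a k / \<mu> ^ k) = 0"
      proof -
        have e: "a (k + 2) / \<mu> ^ (k + 2) * \<mu>\<^sup>2 = a (k + 2) / \<mu> ^ k" "p * (a (k + 1) / \<mu> ^ (k + 1)) * \<mu> = p * a (k + 1) / \<mu> ^ k"
          using \<mu> by (simp_all add: power_add power2_eq_square)
        have "a (k + 2) / \<mu> ^ (k + 2) * \<mu>\<^sup>2 - p * (a (k + 1) / \<mu> ^ (k + 1)) * \<mu> + s * (a k / \<mu> ^ k) =
            (a (k + 2) - p * a (k + 1) + s * a k) / \<mu> ^ k"
          unfolding e by (simp add: add_divide_distrib diff_divide_distrib)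
        then show ?thesis using \<open>real_of_int (a (k + 2)) = p * a (k + 1) - s * a k\<close> by simp
      qed
    qed
    ultimately have "(\<lambda>k. 0) \<longlonglongrightarrow> C * \<mu>\<^sup>2 - p * C * \<mu> + s * C"
      by (rule Lim_transform_eventually)
    then have "C * (\<mu>\<^sup>2 - p * \<mu> + s) = 0" by (simp add: LIMSEQ_const_iff algebra_simps)
    then have q: "\<mu>\<^sup>2 + s = p * \<mu>" using C by simp
    have "(\<mu>\<^sup>2 + s)\<^sup>2 = p\<^sup>2 * \<mu>\<^sup>2" unfolding q by (simp add: power_mult_distrib)
    then have "(\<mu>\<^sup>2)\<^sup>2 - real_of_int (p\<^sup>2 - 2 * s) * \<mu>\<^sup>2 + real_of_int (s\<^sup>2) = 0"
      by (simp add: power2_eq_square algebra_simps)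
    moreover have "s\<^sup>2 \<in> {0, 1}" using s by auto
    ultimately show ?thesis by blast
  qed
  define k4 where "k4 = k1 + k2"
  show ?thesis
  proof (cases "\<exists>k3\<ge>k4. b k3 = 0")
    case True
    then obtain k3 where k3: "k3 \<ge> k4" "b k3 = 0" by blast
    have bj: "b (k3 + j) = 0" for j
    proof (induction j)
      case (Suc j)
      have "k3 + j \<ge> k1 + k2" using k3(1) by (simp add: k4_def)
      from bsq[OF this] have "(b (Suc (k3 + j)))\<^sup>2 = b (k3 + j) * b (k3 + j + 2)" by simp
      then have "(b (Suc (k3 + j)))\<^sup>2 = 0" unfolding Suc by simp
      then show ?case by simp
    qed (simp add: k3)
    have b0: "a k * a (k + 2) = (a (k + 1))\<^sup>2" if "k \<ge> k3" for k
    proof -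
      have "b k = 0" using bj[of "k - k3"] that by simp
      then show ?thesis by (simp add: b_def)
    qed
    have k32: "k3 \<ge> k2" using k3 by (simp add: k4_def)
    have "a k * a (Suc (Suc k)) = a (Suc k) * a (Suc k)" if "k \<ge> k3" for k
      using b0[OF that] by (simp add: power2_eq_square)
    moreover have "a k > 0" if "k \<ge> k3" for k using apos[of k] that k32 by simp
    ultimately have "\<exists>p q. coprime p q \<and> q > 0 \<and> (\<forall>k\<ge>k3. q * a (Suc k) = p * a k)"
      by (intro constant_ratio_in_lowest_terms)
    then obtain p q where pq: "coprime p q" "q > 0" and r0: "\<forall>k\<ge>k3. q * a (Suc k) = p * a k"
      by (elim exE conjE)
    have r: "q * a (k + 1) = p * a k" if "k \<ge> k3" for k using r0 that by simp
    show ?thesis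
    proof (rule finish[of k3 q p 0])
      show "q * a (k + 2) = p * a (k + 1) - q * 0 * a k" if "k3 \<le> k" for k using r[of "k + 1"] that by simp
      show "\<forall>k\<ge>k3. q * a (k + 1) = p * a k" using r by blast
    qed (use pq k32 in simp_all)
  next
    case False
    then have bn: "b k \<noteq> 0" if "k \<ge> k4" for k using that by blast
    have geo: "b k * b (k4 + 1) = b k4 * b (k + 1)" if "k \<ge> k4" for k
    proof -
      have "b k * b (Suc (Suc k)) = b (Suc k) * b (Suc k)" if "k \<ge> k4" for k
      proof -
        have "k \<ge> k1 + k2" using that by (simp add: k4_def)
        from bsq[OF this] show ?thesis by (simp add: power2_eq_square)
      qed
      with constant_ratio[of k4 b "\<lambda>k. b (Suc k)" k] bn \<open>k \<ge> k4\<close> show ?thesis by simp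
    qed
    define r where "r = \<bar>real_of_int (b (k4 + 1))\<bar> / \<bar>real_of_int (b k4)\<bar>"
    have r0: "r > 0" using bn[of k4] bn[of "k4 + 1"] by (simp add: r_def)
    have rj: "\<bar>real_of_int (b (k4 + j))\<bar> = \<bar>real_of_int (b k4)\<bar> * r ^ j" for j
    proof (induction j)
      case (Suc j)
      have "\<bar>real_of_int (b (k4 + j))\<bar> * \<bar>real_of_int (b (k4 + 1))\<bar> = \<bar>real_of_int (b k4)\<bar> * \<bar>real_of_int (b (k4 + j + 1))\<bar>"
        using geo[of "k4 + j"] by (metis abs_mult of_int_mult le_add1)
      then have "\<bar>real_of_int (b (k4 + j + 1))\<bar> = \<bar>real_of_int (b (k4 + j))\<bar> * r"
        using bn[of k4] unfolding r_def by (simp add: field_simps)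
      then show ?case using Suc by simp
    qed simp
    have "\<not> r > 1"
    proof
      assume "r > 1"
      then obtain j where "B < r ^ j" using real_arch_pow by blast
      moreover have "\<bar>real_of_int (b k4)\<bar> \<ge> 1" using bn[of k4] by simp
      then have "1 * r ^ j \<le> \<bar>real_of_int (b k4)\<bar> * r ^ j" using r0 by (intro mult_right_mono) auto
      ultimately show False using bB[of "k4 + j"] rj[of j] by (simp add: k4_def)
    qed
    moreover have "\<not> r < 1"
    proof
      assume "r < 1"
      then have "1 / r > 1" using r0 by simp
      then obtain j where j: "\<bar>real_of_int (b k4)\<bar> < (1 / r) ^ j" using real_arch_pow by blast
      have "\<bar>real_of_int (b (k4 + j))\<bar> \<ge> 1" using bn[of "k4 + j"] by simp
      then show False using j r0 unfolding rj by (simp add: power_divide field_simps)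
    qed
    ultimately have "\<bar>b (k4 + 1)\<bar> = \<bar>b k4\<bar>" using bn[of k4] by (simp add: r_def)
    then obtain s where s: "s = 1 \<or> s = -1" "b (k4 + 1) = s * b k4" by (metis abs_eq_iff mult_1 mult_minus1)
    have bs: "b (k + 1) = s * b k" if "k \<ge> k4" for k
    proof -
      have "b k4 * b (k + 1) = b k4 * (s * b k)" using geo[OF that, unfolded s(2)] by (simp only: ac_simps)
      then show ?thesis using bn[of k4] by simp
    qed
    have k42: "k4 \<ge> k2" by (simp add: k4_def)
    have cross': "a (Suc k) * (a (Suc k + 2) + s * a (Suc k)) = a (Suc (Suc k)) * (a (k + 2) + s * a k)" if "k \<ge> k4" for k
    proof -
      have "a (k + 1) * a (k + 3) - a (k + 2) * a (k + 2) = s * (a k * a (k + 2) - a (k + 1) * a (k + 1))"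
        using bs[OF that] by (simp add: b_def power2_eq_square numeral_3_eq_3)
      then show ?thesis by (simp add: numeral_3_eq_3 algebra_simps)
    qed
    have "a (Suc k) > 0" if "k \<ge> k4" for k using apos[of "Suc k"] that k42 by simp
    from constant_ratio_in_lowest_terms[of k4 "\<lambda>k. a (Suc k)" "\<lambda>k. a (k + 2) + s * a k", OF this cross']
    obtain p q where pq: "coprime p q" "q > 0" "\<forall>k\<ge>k4. q * (a (k + 2) + s * a k) = p * a (Suc k)" by blast
    have rr: "q * a (k + 2) = p * a (k + 1) - q * s * a k" if "k \<ge> k4" for k
    proof -
      have "q * (a (k + 2) + s * a k) = p * a (Suc k)" using pq(3) that by blast
      then show ?thesis by (simp add: algebra_simps)
    qed
    show ?thesis
    proof (rule finish[of k4 q p s])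
      show "s = 0 \<or> s\<^sup>2 = 1 \<and> (\<forall>k\<ge>k4. b k \<noteq> 0 \<and> b (k + 1) = s * b k)" using s bn bs by auto
      show "q * a (k + 2) = p * a (k + 1) - q * s * a k" if "k4 \<le> k" for k by (rule rr[OF that])
    qed (use pq(1,2) k42 s(1) in simp_all)
  qed
qed

section \<open>Linear recurrences on a weighted graph\<close>

text \<open>
  Time \<open>t\<close> stands for the vertex \<open>t mod n\<close> at step \<open>t div n\<close>; the window \<open>{t<..<t + n}\<close> contains
  every other vertex once, the larger ones at the same step and the smaller ones at the next
  step.
\<close>

locale weighted_graph =
  fixes n :: nat and a :: "nat \<Rightarrow> nat \<Rightarrow> nat"
  assumes n_pos: "n > 0" and a_sym: "a i j = a j i" and a_diag: "a i i = 0"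
begin

definition \<alpha> :: "nat \<Rightarrow> nat \<Rightarrow> real" where
  "\<alpha> t s = real (a (t mod n) (s mod n))"

lemma \<alpha>_sym: "\<alpha> t s = \<alpha> s t" and \<alpha>_diag [simp]: "\<alpha> t t = 0" and \<alpha>_nonneg [simp]: "\<alpha> t s \<ge> 0"
  and \<alpha>_shift [simp]: "\<alpha> (t + n) s = \<alpha> t s" "\<alpha> t (s + n) = \<alpha> t s"
  and \<alpha>_shift' [simp]: "\<alpha> (n + t) s = \<alpha> t s" "\<alpha> t (n + s) = \<alpha> t s"
  and \<alpha>_shifts [simp]: "\<alpha> (t + k * n) s = \<alpha> t s" "\<alpha> t (s + k * n) = \<alpha> t s"
  by (auto simp: \<alpha>_def a_sym a_diag)

lemma \<alpha>_small: "i < n \<Longrightarrow> j < n \<Longrightarrow> \<alpha> i j = real (a i j)"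
  by (simp add: \<alpha>_def)

definition forcing :: "(nat \<Rightarrow> real) \<Rightarrow> nat \<Rightarrow> real" where
  "forcing x t = x (t + n) + x t - (\<Sum>s\<in>{t<..<t+n}. \<alpha> t s * x s)"

lemma forcing_add: "forcing (\<lambda>t. x t + y t) t = forcing x t + forcing y t"
  by (simp add: forcing_def sum.distrib algebra_simps)

lemma forcing_cmult: "forcing (\<lambda>t. c * x t) t = c * forcing x t"
  by (simp add: forcing_def sum_distrib_left algebra_simps)

lemma forcing_diff: "forcing (\<lambda>t. x t - y t) t = forcing x t - forcing y t"
  using forcing_add[of x "\<lambda>t. (-1) * y t"] forcing_cmult[of "-1" y] by simp

lemma forcing_0 [simp]: "forcing (\<lambda>t. 0) t = 0"
  by (simp add: forcing_def)

lemma forcing_sum: "forcing (\<lambda>t. \<Sum>i\<in>I. x i t) t = (\<Sum>i\<in>I. forcing (x i) t)"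
  by (induction I rule: infinite_finite_induct) (simp_all add: forcing_add)

lemma forcing_shift: "forcing (\<lambda>t. x (t + k * n)) t = forcing x (t + k * n)"
proof -
  have "(\<Sum>s\<in>{t + k * n<..<t + k * n + n}. h s) = (\<Sum>s\<in>{t<..<t+n}. h (s + k * n))" for h :: "nat \<Rightarrow> real"
    by (rule sum.reindex_bij_witness[of _ "\<lambda>s. s + k * n" "\<lambda>s. s - k * n"]) auto
  from this[of "\<lambda>s. \<alpha> (t + k * n) s * x s"] show ?thesis by (simp add: forcing_def algebra_simps)
qed

lemma window_sum_periodic:
  assumes "\<And>t. h (t + n) = (h t :: real)"
  shows "(\<Sum>s\<in>{t..<t+n}. h s) = (\<Sum>i<n. h i)"
proof (induction t)
  case 0 then show ?case by (simp add: lessThan_atLeast0)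
next
  case (Suc t)
  have "(\<Sum>s\<in>{t..<t+n}. h s) = h t + (\<Sum>s\<in>{Suc t..<t+n}. h s)"
    using n_pos by (simp add: sum.atLeast_Suc_lessThan)
  moreover have "(\<Sum>s\<in>{Suc t..<Suc t+n}. h s) = (\<Sum>s\<in>{Suc t..<t+n}. h s) + h (t + n)"
    using n_pos by simp
  ultimately show ?case using Suc assms by simp
qed

text \<open>
  On a periodic sequence the window sum is the sum over the neighbours.
\<close>

lemma open_window_sum_periodic:
  assumes "\<And>t. x (t + n) = x t"
  shows "(\<Sum>s\<in>{t<..<t+n}. \<alpha> t s * x s) = (\<Sum>j<n. \<alpha> t j * x j)"
proof -
  have "{t..<t+n} = insert t {t<..<t+n}" using n_pos by auto
  then have "(\<Sum>s\<in>{t..<t+n}. \<alpha> t s * x s) = (\<Sum>s\<in>{t<..<t+n}. \<alpha> t s * x s)" by simp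
  then show ?thesis using window_sum_periodic[of "\<lambda>s. \<alpha> t s * x s" t] assms by simp
qed

lemma forcing_periodic:
  assumes "\<And>t. x (t + n) = x t"
  shows "forcing x t = 2 * x t - (\<Sum>j<n. \<alpha> t j * x j)"
  using open_window_sum_periodic[of x t] assms by (simp add: forcing_def)

lemma unique_upto:
  assumes "\<And>t. t < n \<Longrightarrow> x t = y t" "\<And>t. t + n \<le> T \<Longrightarrow> forcing x t = forcing y t" "t \<le> T"
  shows "x t = y t"
  using assms(3)
proof (induction t rule: less_induct)
  case (less t)
  show ?case
  proof (cases "t < n")
    case False
    define r where "r = t - n"
    have t: "t = r + n" using False by (simp add: r_def)
    have "forcing x r = forcing y r" using assms(2)[of r] less.prems t by simp
    moreover have "(\<Sum>s\<in>{r<..<r+n}. \<alpha> r s * x s) = (\<Sum>s\<in>{r<..<r+n}. \<alpha> r s * y s)"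
      using less t by (intro sum.cong) auto
    moreover have "x r = y r" using less t n_pos by simp
    ultimately show ?thesis by (simp add: forcing_def t)
  qed (use assms in auto)
qed

text \<open>
  The recurrence determines the sequence in both directions of time, so a zero window anywhere
  suffices.
\<close>

lemma unique_window:
  assumes "\<And>t. forcing x t = 0" "\<And>i. i < n \<Longrightarrow> x (s + i) = 0"
  shows "x t = 0"
  using assms(2)
proof (induction s)
  case 0
  then show ?case using unique_upto[of x "\<lambda>_. 0" t t] assms(1) by simp
next
  case (Suc s)
  have w: "x r = 0" if "r \<in> {s<..s+n}" for r
  proof -
    have "r - Suc s < n" "Suc s + (r - Suc s) = r" using that n_pos by auto
    then show ?thesis using Suc.prems[of "r - Suc s"] by simp
  qed
  have "forcing x s = 0" by (rule assms(1))
  moreover have "(\<Sum>r\<in>{s<..<s+n}. \<alpha> s r * x r) = 0" by (intro sum.neutral) (auto simp: w)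
  moreover have "x (s + n) = 0" using w n_pos by simp
  ultimately have "x s = 0" by (simp add: forcing_def)
  then have "x (s + i) = 0" if "i < n" for i using w[of "s + i"] that by (cases "i = 0") auto
  then show ?case by (rule Suc.IH)
qed

text \<open>
  The sequence with first window \<open>v\<close> and forcing \<open>\<phi>\<close>.
\<close>

function sol :: "(nat \<Rightarrow> real) \<Rightarrow> (nat \<Rightarrow> real) \<Rightarrow> nat \<Rightarrow> real" where
  "sol v \<phi> t = (if t < n then v t
     else \<phi> (t - n) - sol v \<phi> (t - n) + (\<Sum>s\<in>{t-n<..<t}. \<alpha> (t - n) s * sol v \<phi> s))"
  by auto
termination by (relation "measure (\<lambda>(v, \<phi>, t). t)") (use n_pos in auto)

declare sol.simps [simp del]

lemma sol_window [simp]: "t < n \<Longrightarrow> sol v \<phi> t = v t"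
  by (simp add: sol.simps)

lemma forcing_sol [simp]: "forcing (sol v \<phi>) t = \<phi> t"
  by (simp add: forcing_def sol.simps[of v \<phi> "t + n"])

abbreviation hom_sol :: "(nat \<Rightarrow> real) \<Rightarrow> nat \<Rightarrow> real" where
  "hom_sol v \<equiv> sol v (\<lambda>_. 0)"

abbreviation unit :: "nat \<Rightarrow> nat \<Rightarrow> real" where
  "unit j \<equiv> (\<lambda>i. if i = j then 1 else 0)"

definition impulse :: "nat \<Rightarrow> nat \<Rightarrow> real" where
  "impulse s = sol (\<lambda>_. 0) (unit s)"

lemma duhamel:
  assumes "t \<le> T"
  shows "y t = hom_sol y t + (\<Sum>s<T. forcing y s * impulse s t)"
proof (rule unique_upto[OF _ _ assms])
  fix t assume t: "t + n \<le> T"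
  have "forcing (\<lambda>t. hom_sol y t + (\<Sum>s<T. forcing y s * impulse s t)) t =
      (\<Sum>s<T. forcing y s * unit s t)"
    by (simp only: forcing_add forcing_sum forcing_cmult impulse_def forcing_sol)
  also have "\<dots> = (\<Sum>s<T. if s = t then forcing y s else 0)"
    by (intro sum.cong) auto
  also have "\<dots> = forcing y t" using t n_pos by (subst sum.delta) auto
  finally show "forcing y t = forcing (\<lambda>t. hom_sol y t + (\<Sum>s<T. forcing y s * impulse s t)) t" by simp
qed (simp add: impulse_def)

lemma hom_eq_hom_sol: "(\<And>t. forcing x t = 0) \<Longrightarrow> x t = hom_sol x t"
  by (rule unique_upto[where T = t]) auto

lemma hom_sol_units: "hom_sol v t = (\<Sum>j<n. v j * hom_sol (unit j) t)"
proof (rule unique_upto[where T = t and t = t and x = "hom_sol v" and y = "\<lambda>t. \<Sum>j<n. v j * hom_sol (unit j) t"])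
  fix t assume t: "t < n"
  have "(\<Sum>j<n. v j * hom_sol (unit j) t) = (\<Sum>j<n. if j = t then v j else 0)"
    using t by (intro sum.cong) auto
  then show "hom_sol v t = (\<Sum>j<n. v j * hom_sol (unit j) t)" using t by (simp add: sum.delta)
qed (simp_all add: forcing_sum forcing_cmult)

lemma sol_int:
  assumes "\<And>i. i < n \<Longrightarrow> v i \<in> \<int>" shows "hom_sol v t \<in> \<int>"
proof (induction t rule: less_induct)
  case (less t)
  show ?case
  proof (cases "t < n")
    case False
    have "(\<Sum>s\<in>{t-n<..<t}. \<alpha> (t - n) s * hom_sol v s) \<in> \<int>"
      using less by (intro Ints_sum Ints_mult) (auto simp: \<alpha>_def)
    moreover have "hom_sol v (t - n) \<in> \<int>" using less False n_pos by simp
    ultimately show ?thesis using False by (subst sol.simps) (auto intro!: Ints_diff Ints_add)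
  qed (use assms in simp)
qed

section \<open>The invariant quadratic form\<close>

text \<open>
  The Tits form: \<open>\<alpha>\<close> counts every edge in both directions, whence the division by two.
\<close>

definition quad :: "(nat \<Rightarrow> real) \<Rightarrow> nat set \<Rightarrow> real" where
  "quad x I = (\<Sum>s\<in>I. (x s)\<^sup>2) - (\<Sum>s\<in>I. \<Sum>r\<in>I. \<alpha> s r * x s * x r) / 2"

lemma quad_insert:
  assumes "finite I" "t \<notin> I"
  shows "quad x (insert t I) = quad x I + (x t)\<^sup>2 - x t * (\<Sum>s\<in>I. \<alpha> t s * x s)"
proof -
  have "(\<Sum>s\<in>insert t I. \<Sum>r\<in>insert t I. \<alpha> s r * x s * x r) =
      (\<Sum>r\<in>I. \<alpha> t r * x t * x r) + ((\<Sum>s\<in>I. \<alpha> s t * x s * x t) + (\<Sum>s\<in>I. \<Sum>r\<in>I. \<alpha> s r * x s * x r))"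
    using assms by (simp add: sum.distrib)
  moreover have "(\<Sum>s\<in>I. \<alpha> s t * x s * x t) = x t * (\<Sum>s\<in>I. \<alpha> t s * x s)"
    by (simp add: sum_distrib_left \<alpha>_sym[of _ t] algebra_simps)
  moreover have "(\<Sum>r\<in>I. \<alpha> t r * x t * x r) = x t * (\<Sum>s\<in>I. \<alpha> t s * x s)"
    by (simp add: sum_distrib_left algebra_simps)
  ultimately show ?thesis using assms by (simp add: quad_def field_simps)
qed

text \<open>
  Moving the window replaces \<open>x t\<close> by \<open>x (t + n)\<close>. By \<open>quad_insert\<close> both contribute
  \<open>z\<^sup>2 - z * S\<close> with the same interior sum \<open>S\<close>, and they are exchanged by \<open>z \<mapsto> S - z\<close>: the move
  is a reflection.
\<close>

lemma quad_invariant: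
  assumes "forcing x t = 0"
  shows "quad x {Suc t..<Suc t + n} = quad x {t..<t+n}"
proof -
  let ?I = "{t<..<t+n}" and ?S = "\<Sum>s\<in>{t<..<t+n}. \<alpha> t s * x s"
  have "{t..<t+n} = insert t ?I" "{Suc t..<Suc t + n} = insert (t + n) ?I" using n_pos by auto
  then have "quad x {Suc t..<Suc t + n} - quad x {t..<t+n} = (x (t + n) - x t) * (x (t + n) + x t - ?S)"
    by (simp add: quad_insert algebra_simps power2_eq_square)
  also have "\<dots> = 0" using assms by (simp add: forcing_def)
  finally show ?thesis by simp
qed

lemma quad_hom:
  assumes "\<And>t. forcing x t = 0"
  shows "quad (\<lambda>i. x (i + k * n)) {..<n} = quad x {..<n}"
proof -
  have "quad x {t..<t+n} = quad x {..<n}" for t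
  proof (induction t)
    case (Suc t)
    then show ?case using quad_invariant[of x t] assms by simp
  qed (simp add: lessThan_atLeast0)
  moreover have "(\<Sum>s\<in>{k*n..<k*n+n}. h s) = (\<Sum>i<n. h (i + k * n))" for h :: "nat \<Rightarrow> real"
    by (rule sum.reindex_bij_witness[of _ "\<lambda>s. s + k * n" "\<lambda>s. s - k * n"]) auto
  then have "quad x {k*n..<k*n+n} = quad (\<lambda>i. x (i + k * n)) {..<n}"
    by (simp add: quad_def)
  ultimately show ?thesis by metis
qed

text \<open>
  Completing the squares with respect to a positive weight. The form is positive definite if
  \<open>A d < 2 d\<close> everywhere and positive semidefinite if \<open>A d = 2 d\<close>.
\<close>

lemma quad_sum_of_squares:
  assumes d: "\<And>i. i < n \<Longrightarrow> d i > 0"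
  shows "quad v {..<n} = (\<Sum>i<n. \<Sum>j<n. \<alpha> i j * d i * d j * (v i / d i - v j / d j)\<^sup>2) / 4 +
     (\<Sum>i<n. (2 * d i - (\<Sum>j<n. \<alpha> i j * d j)) * (v i)\<^sup>2 / d i) / 2"
proof -
  let ?A = "\<Sum>i<n. (\<Sum>j<n. \<alpha> i j * d j) * (v i)\<^sup>2 / d i"
  have "(\<Sum>i<n. \<Sum>j<n. \<alpha> i j * d i * d j * (v i / d i - v j / d j)\<^sup>2) =
      (\<Sum>i<n. \<Sum>j<n. \<alpha> i j * d j * (v i)\<^sup>2 / d i + \<alpha> i j * d i * (v j)\<^sup>2 / d j - 2 * (\<alpha> i j * v i * v j))"
  proof (intro sum.cong refl)
    fix i j assume "i \<in> {..<n}" "j \<in> {..<n}"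
    then have "d i > 0" "d j > 0" using d by auto
    then show "\<alpha> i j * d i * d j * (v i / d i - v j / d j)\<^sup>2 =
        \<alpha> i j * d j * (v i)\<^sup>2 / d i + \<alpha> i j * d i * (v j)\<^sup>2 / d j - 2 * (\<alpha> i j * v i * v j)"
      by (simp add: field_simps power2_eq_square)
  qed
  also have "\<dots> = (\<Sum>i<n. \<Sum>j<n. \<alpha> i j * d j * (v i)\<^sup>2 / d i) + (\<Sum>i<n. \<Sum>j<n. \<alpha> i j * d i * (v j)\<^sup>2 / d j)
      - 2 * (\<Sum>i<n. \<Sum>j<n. \<alpha> i j * v i * v j)"
    by (simp add: sum.distrib sum_subtractf sum_distrib_left)
  also have "(\<Sum>i<n. \<Sum>j<n. \<alpha> i j * d j * (v i)\<^sup>2 / d i) = ?A"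
    by (simp add: sum_distrib_right sum_divide_distrib)
  also have "(\<Sum>i<n. \<Sum>j<n. \<alpha> i j * d i * (v j)\<^sup>2 / d j) = ?A"
    by (subst sum.swap) (simp add: sum_distrib_right sum_divide_distrib \<alpha>_sym)
  finally have 1: "(\<Sum>i<n. \<Sum>j<n. \<alpha> i j * d i * d j * (v i / d i - v j / d j)\<^sup>2) =
      2 * ?A - 2 * (\<Sum>i<n. \<Sum>j<n. \<alpha> i j * v i * v j)" by simp
  have "(\<Sum>i<n. (2 * d i - (\<Sum>j<n. \<alpha> i j * d j)) * (v i)\<^sup>2 / d i) = (\<Sum>i<n. 2 * (v i)\<^sup>2 - (\<Sum>j<n. \<alpha> i j * d j) * (v i)\<^sup>2 / d i)"
  proof (intro sum.cong refl)
    fix i assume "i \<in> {..<n}"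
    then have "d i > 0" using d by auto
    then show "(2 * d i - (\<Sum>j<n. \<alpha> i j * d j)) * (v i)\<^sup>2 / d i = 2 * (v i)\<^sup>2 - (\<Sum>j<n. \<alpha> i j * d j) * (v i)\<^sup>2 / d i"
      by (simp add: left_diff_distrib diff_divide_distrib)
  qed
  then have 2: "(\<Sum>i<n. (2 * d i - (\<Sum>j<n. \<alpha> i j * d j)) * (v i)\<^sup>2 / d i) = 2 * (\<Sum>i<n. (v i)\<^sup>2) - ?A"
    by (simp add: sum_subtractf sum_distrib_left)
  show ?thesis unfolding quad_def 1 2 by (simp add: field_simps)
qed

section \<open>Quasi-periodicity of homogeneous solutions\<close>

lemma periodic_multiple:
  assumes "\<And>t. f (t + n) = f t" shows "f (t + k * n) = f t"
proof (induction k)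
  case (Suc k)
  have "t + Suc k * n = (t + k * n) + n" by simp
  then show ?case using assms[of "t + k * n"] Suc by metis
qed simp

text \<open>
  Reduced modulo multiples of \<open>\<delta>\<close>, the windows of \<open>x\<close> are bounded integral vectors, so two of
  them agree; by \<open>unique_window\<close> the agreement persists for all times.
\<close>

lemma integer_hom_quasiperiodic:
  assumes \<delta>: "\<And>t. forcing \<delta> t = 0" "\<And>t. \<delta> (t + n) = \<delta> t" "\<And>i. i < n \<Longrightarrow> \<delta> i \<in> \<int>"
    and x: "\<And>t. forcing x t = 0" "\<And>t. x t \<in> \<int>"
    and B: "\<And>k. \<exists>w\<in>\<int>. \<forall>i<n. \<bar>x (i + k * n) - w * \<delta> i\<bar> \<le> B"
  shows "\<exists>m>0. \<exists>w. \<forall>t. x (t + m * n) = x t + w * \<delta> t"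
proof -
  obtain w where w: "\<And>k. w k \<in> \<int>" "\<And>k i. i < n \<Longrightarrow> \<bar>x (i + k * n) - w k * \<delta> i\<bar> \<le> B"
    using B by metis
  note \<delta>p = periodic_multiple[of \<delta>, OF \<delta>(2)]
  define u where "u k = restrict (\<lambda>i. x (i + k * n) - w k * \<delta> i) {..<n}" for k
  have fin: "finite {y::real. y \<in> \<int> \<and> \<bar>y\<bar> \<le> B}"
  proof (rule finite_subset)
    show "{y::real. y \<in> \<int> \<and> \<bar>y\<bar> \<le> B} \<subseteq> of_int ` {-\<lceil>B\<rceil>..\<lceil>B\<rceil>}"
      by (auto simp: Ints_def image_iff ceiling_le_iff abs_le_iff) linarith+
  qed simp
  have "range u \<subseteq> {..<n} \<rightarrow>\<^sub>E {y. y \<in> \<int> \<and> \<bar>y\<bar> \<le> B}"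
  proof (rule image_subsetI)
    fix k
    show "u k \<in> {..<n} \<rightarrow>\<^sub>E {y. y \<in> \<int> \<and> \<bar>y\<bar> \<le> B}"
      unfolding u_def restrict_PiE_iff using w x(2) \<delta>(3) by (auto intro!: Ints_diff Ints_mult)
  qed
  then have "finite (range u)" using fin by (meson finite_PiE finite_lessThan finite_subset)
  then have "\<not> inj u" using finite_imageD infinite_UNIV_nat by blast
  then obtain k k' where k: "k < k'" "u k = u k'" by (metis injI linorder_neqE_nat)
  define m where "m = k' - k"
  define z where "z t = x (t + m * n) - x t - (w k' - w k) * \<delta> t" for t
  have "forcing z t = 0" for t
    unfolding z_def by (simp add: forcing_diff forcing_cmult \<delta>(1) x(1) forcing_shift)
  moreover have "z (k * n + i) = 0" if i: "i < n" for i
  proof -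
    have "x (i + k * n) - w k * \<delta> i = x (i + k' * n) - w k' * \<delta> i"
      using fun_cong[OF k(2), of i] i by (simp add: u_def)
    moreover have "k * n + i + m * n = i + k' * n" using k(1) by (simp add: m_def algebra_simps)
    ultimately show ?thesis using \<delta>p[of i k] by (simp add: z_def algebra_simps)
  qed
  ultimately have "z t = 0" for t by (rule unique_window)
  then have "x (t + m * n) = x t + (w k' - w k) * \<delta> t" for t using z_def[of t] by simp
  moreover have "m > 0" using k by (simp add: m_def)
  ultimately show ?thesis by blast
qed

text \<open>
  By linearity it is enough to treat the unit vectors, with a common multiple of their periods.
\<close>

lemma hom_quasiperiodic:
  assumes \<delta>: "\<And>t. forcing \<delta> t = 0" "\<And>t. \<delta> (t + n) = \<delta> t" "\<And>i. i < n \<Longrightarrow> \<delta> i \<in> \<int>"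
    and B: "\<And>x. (\<And>t. forcing x t = 0) \<Longrightarrow> (\<And>t. x t \<in> \<int>) \<Longrightarrow>
       \<exists>B. \<forall>k. \<exists>w\<in>\<int>. \<forall>i<n. \<bar>x (i + k * n) - w * \<delta> i\<bar> \<le> B"
  obtains m W where "m > 0" "\<And>v t. hom_sol v (t + m * n) = hom_sol v t + (\<Sum>j<n. W j * v j) * \<delta> t"
proof -
  have "\<exists>m>0. \<exists>w. \<forall>t. hom_sol (unit j) (t + m * n) = hom_sol (unit j) t + w * \<delta> t" for j
  proof -
    have int: "hom_sol (unit j) t \<in> \<int>" for t by (rule sol_int) auto
    obtain B' where "\<forall>k. \<exists>w\<in>\<int>. \<forall>i<n. \<bar>hom_sol (unit j) (i + k * n) - w * \<delta> i\<bar> \<le> B'"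
      using B[of "hom_sol (unit j)"] int by auto
    then show ?thesis using integer_hom_quasiperiodic[OF \<delta>, of "hom_sol (unit j)" B'] int by auto
  qed
  then obtain m w where mw: "\<And>j. m j > 0"
    "\<And>j t. hom_sol (unit j) (t + m j * n) = hom_sol (unit j) t + w j * \<delta> t" by metis
  note \<delta>p = periodic_multiple[of \<delta>, OF \<delta>(2)]
  define M where "M = (\<Prod>j<n. m j)"
  have "\<exists>w'. \<forall>t. hom_sol (unit j) (t + M * n) = hom_sol (unit j) t + w' * \<delta> t" if j: "j < n" for j
  proof -
    have "m j dvd M" using j by (simp add: M_def dvd_prodI)
    then obtain k where k: "M = k * m j" by (auto simp: dvd_def mult.commute)
    have "hom_sol (unit j) (t + k * m j * n) = hom_sol (unit j) t + (real k * w j) * \<delta> t" for t k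
    proof (induction k)
      case (Suc k)
      have "t + Suc k * m j * n = (t + k * m j * n) + m j * n" by (simp add: algebra_simps)
      then show ?case using mw(2)[of j "t + k * m j * n"] Suc \<delta>p[of t "k * m j"] by (simp add: algebra_simps)
    qed simp
    then show ?thesis using k by metis
  qed
  then obtain W where W: "\<And>j t. j < n \<Longrightarrow> hom_sol (unit j) (t + M * n) = hom_sol (unit j) t + W j * \<delta> t" by metis
  show thesis
  proof (rule that[of M W])
    show "M > 0" by (simp add: M_def mw prod_pos)
    fix v t
    have "hom_sol v (t + M * n) = (\<Sum>j<n. v j * hom_sol (unit j) t + W j * v j * \<delta> t)"
      unfolding hom_sol_units[of v "t + M * n"] by (intro sum.cong) (auto simp: W algebra_simps)
    then show "hom_sol v (t + M * n) = hom_sol v t + (\<Sum>j<n. W j * v j) * \<delta> t"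
      by (simp add: hom_sol_units[of v t] sum.distrib sum_distrib_right)
  qed
qed

section \<open>Positive definite case\<close>

lemma positive_definite_bound:
  assumes d: "\<And>i. i < n \<Longrightarrow> d i > 0" "\<And>i. i < n \<Longrightarrow> (\<Sum>j<n. \<alpha> i j * d j) < 2 * d i" and i: "i < n"
  shows "(2 * d i - (\<Sum>j<n. \<alpha> i j * d j)) * (v i)\<^sup>2 / d i \<le> 2 * quad v {..<n}"
proof -
  let ?t = "\<lambda>i. (2 * d i - (\<Sum>j<n. \<alpha> i j * d j)) * (v i)\<^sup>2 / d i"
  have "?t j \<ge> 0" if "j < n" for j
    using d(1)[OF that] d(2)[OF that] by (intro divide_nonneg_pos mult_nonneg_nonneg) auto
  then have "?t i \<le> (\<Sum>i<n. ?t i)" using i by (intro member_le_sum) auto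
  moreover have "(\<Sum>i<n. \<Sum>j<n. \<alpha> i j * d i * d j * (v i / d i - v j / d j)\<^sup>2) \<ge> 0"
    using d(1) by (intro sum_nonneg mult_nonneg_nonneg) (auto intro: less_imp_le)
  ultimately show ?thesis using quad_sum_of_squares[of d v, OF d(1)] by linarith
qed

text \<open>
  Invariance of a positive definite form bounds the integral solutions, so all solutions have a
  common period by \<open>hom_quasiperiodic\<close> with \<open>\<delta> = 0\<close>. The sum over a period does not change from
  one step to the next; the recurrence then says that its values satisfy \<open>A X = 2 X\<close>, so the
  form vanishes on \<open>X\<close>.
\<close>

lemma positive_definite_hom_sum_zero:
  assumes d: "\<And>i. i < n \<Longrightarrow> d i > 0" "\<And>i. i < n \<Longrightarrow> (\<Sum>j<n. \<alpha> i j * d j) < 2 * d i"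
  obtains m where "m > 0" "\<And>v t. (\<Sum>k<m. hom_sol v (t + k * n)) = 0"
proof -
  have "\<exists>B. \<forall>k. \<exists>w\<in>\<int>. \<forall>i<n. \<bar>x (i + k * n) - w * 0\<bar> \<le> B" if x: "\<And>t. forcing x t = 0" for x
  proof -
    define c where "c i = d i / (2 * d i - (\<Sum>j<n. \<alpha> i j * d j)) * (2 * quad x {..<n})" for i
    have "\<bar>x (i + k * n)\<bar> \<le> (\<Sum>i<n. \<bar>c i\<bar> + 1)" if i: "i < n" for i k
    proof -
      have p: "2 * d i - (\<Sum>j<n. \<alpha> i j * d j) > 0" "d i > 0" using d i by auto
      have "(2 * d i - (\<Sum>j<n. \<alpha> i j * d j)) * (x (i + k * n))\<^sup>2 / d i \<le> 2 * quad x {..<n}"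
        using positive_definite_bound[OF d i, of "\<lambda>i. x (i + k * n)"] quad_hom[OF x, of k] by simp
      then have "(x (i + k * n))\<^sup>2 \<le> c i" using p by (simp add: c_def field_simps)
      moreover have "\<bar>x (i + k * n)\<bar> \<le> (x (i + k * n))\<^sup>2 + 1"
      proof (cases "\<bar>x (i + k * n)\<bar> \<le> 1")
        case False
        then have "\<bar>x (i + k * n)\<bar> * 1 \<le> \<bar>x (i + k * n)\<bar> * \<bar>x (i + k * n)\<bar>" by (intro mult_left_mono) auto
        then show ?thesis by (simp add: power2_eq_square)
      qed (simp add: add_increasing)
      ultimately have "\<bar>x (i + k * n)\<bar> \<le> \<bar>c i\<bar> + 1" by linarith
      also have "\<dots> \<le> (\<Sum>i<n. \<bar>c i\<bar> + 1)" using i by (intro member_le_sum) auto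
      finally show ?thesis .
    qed
    then show ?thesis by (intro exI[of _ "\<Sum>i<n. \<bar>c i\<bar> + 1"] allI bexI[of _ 0]) auto
  qed
  note bound = this
  obtain m W where m: "m > 0" "\<And>v t. hom_sol v (t + m * n) = hom_sol v t + (\<Sum>j<n. W j * v j) * 0"
    by (rule hom_quasiperiodic[of "\<lambda>_. 0"]) (use bound in auto)
  have "(\<Sum>k<m. hom_sol v (t + k * n)) = 0" for v t
  proof -
    define X where "X t = (\<Sum>k<m. hom_sol v (t + k * n))" for t
    have X: "forcing X t = 0" for t unfolding X_def by (simp add: forcing_sum forcing_shift)
    have Xp: "X (t + n) = X t" for t
    proof -
      have "X (t + n) = (\<Sum>k<m. hom_sol v (t + Suc k * n))" by (simp add: X_def algebra_simps)
      also have "\<dots> = (\<Sum>k<Suc m. hom_sol v (t + k * n)) - hom_sol v (t + 0 * n)"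
        by (subst sum.lessThan_Suc_shift) simp
      also have "\<dots> = X t" using m(2)[of v t] by (simp add: X_def)
      finally show ?thesis .
    qed
    have "quad X {..<n} = (\<Sum>i<n. X i * (2 * X i - (\<Sum>j<n. \<alpha> i j * X j))) / 2"
      by (simp add: quad_def right_diff_distrib sum_subtractf sum_distrib_left power2_eq_square algebra_simps
          flip: sum_divide_distrib)
    also have "\<dots> = 0" using forcing_periodic[of X] Xp X by simp
    finally have q: "quad X {..<n} = 0" .
    have "X i = 0" if i: "i < n" for i
    proof -
      have "(2 * d i - (\<Sum>j<n. \<alpha> i j * d j)) * (X i)\<^sup>2 / d i \<le> 0"
        using positive_definite_bound[OF d i, of X] q by simp
      moreover have "(2 * d i - (\<Sum>j<n. \<alpha> i j * d j)) / d i > 0" using d i by simp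
      ultimately have "(X i)\<^sup>2 \<le> 0"
        by (metis mult_le_0_iff not_less times_divide_eq_left)
      then show ?thesis by simp
    qed
    then have "X t = 0" using unique_window[of X 0 t] X by simp
    then show ?thesis by (simp add: X_def)
  qed
  then show thesis using that m(1) by blast
qed

end

section \<open>Frieze sequences\<close>

locale frieze_seq = weighted_graph +
  fixes g :: "nat \<Rightarrow> real"
  assumes g_init: "t < n \<Longrightarrow> g t = 1" and g_pos: "g t > 0"
    and g_rec: "g (t + n) * g t = 1 + (\<Prod>s\<in>{t<..<t+n}. g s ^ a (t mod n) (s mod n))"
begin

text \<open>
  The argument behind the Laurent phenomenon. Modulo \<open>N = g (r + n)\<close>, the recurrence at \<open>r\<close> says
  that the product \<open>A\<close> over the window after \<open>r\<close> is \<open>- 1\<close>. Whenever \<open>s\<close> is adjacent to \<open>r + n\<close>,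
  the recurrence at \<open>s\<close> says \<open>g (s + n) * g s = 1\<close>, so the next product \<open>B\<close> satisfies
  \<open>A * B = 1\<close>. Hence \<open>B = - 1\<close>, and \<open>N\<close> divides \<open>1 + B = g (r + 2 * n) * N\<close> in the integers.
\<close>

lemma g_integer_step:
  assumes int: "\<And>s. s < r + 2 * n \<Longrightarrow> g s \<in> \<int>"
  shows "g (r + 2 * n) \<in> \<int>"
proof -
  define G where "G s = \<lfloor>g s\<rfloor>" for s
  have G: "g s = of_int (G s)" if "s < r + 2 * n" for s
    using int[OF that] by (auto simp: G_def elim: Ints_cases)
  define e where "e s = a (r mod n) (s mod n)" for s
  let ?I = "{r<..<r+n}"
  define A where "A = (\<Prod>s\<in>?I. G s ^ e s)"
  define B where "B = (\<Prod>s\<in>?I. G (s + n) ^ e s)"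
  define N where "N = G (r + n)"
  have N: "N * G r = 1 + A"
  proof -
    have "real_of_int (N * G r) = real_of_int (1 + A)"
      using g_rec[of r] n_pos by (simp add: A_def N_def e_def G)
    then show ?thesis by linarith
  qed
  have inv: "[(G (s + n) * G s) ^ e s = 1] (mod N)" if s: "s \<in> ?I" for s
  proof (cases "e s = 0")
    case False
    let ?P = "\<Prod>q\<in>{s<..<s+n}. G q ^ a (s mod n) (q mod n)"
    have "real_of_int (G (s + n) * G s) = real_of_int (1 + ?P)"
      using g_rec[of s] s by (simp add: G)
    then have GG: "G (s + n) * G s = 1 + ?P" by linarith
    have "a (s mod n) ((r + n) mod n) = e s" by (simp add: e_def a_sym)
    then have "N dvd G (r + n) ^ a (s mod n) ((r + n) mod n)"
      using False unfolding N_def by (simp add: dvd_power)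
    also have "\<dots> dvd ?P" using s by (intro dvd_prodI) auto
    finally have "[G (s + n) * G s = 1] (mod N)" by (simp add: GG cong_iff_dvd_diff)
    then have "[(G (s + n) * G s) ^ e s = 1 ^ e s] (mod N)" by (rule cong_pow)
    then show ?thesis by simp
  qed simp
  have "[(\<Prod>s\<in>?I. (G (s + n) * G s) ^ e s) = (\<Prod>s\<in>?I. 1)] (mod N)"
    by (rule cong_prod) (rule inv)
  then have "[B * A = 1] (mod N)"
    by (simp add: A_def B_def power_mult_distrib prod.distrib)
  then obtain u where u: "B * A - 1 = N * u" by (auto simp: cong_iff_dvd_diff dvd_def)
  have A: "A = N * G r - 1" using N by simp
  have "1 + B = N * (B * G r - u)" using u unfolding A by (simp add: algebra_simps)
  then have "real_of_int (1 + B) = real_of_int N * real_of_int (B * G r - u)" by (metis of_int_mult)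
  moreover have "g (r + 2 * n) * real_of_int N = real_of_int (1 + B)"
  proof -
    have "(\<Prod>s\<in>{r+n<..<r+n+n}. g s ^ a ((r + n) mod n) (s mod n)) = (\<Prod>s\<in>?I. g (s + n) ^ e s)"
      by (rule prod.reindex_bij_witness[of _ "\<lambda>s. s + n" "\<lambda>s. s - n"]) (auto simp: e_def mod_if)
    also have "\<dots> = real_of_int B" by (simp add: B_def G)
    finally have "g (r + n + n) * g (r + n) = 1 + real_of_int B" using g_rec[of "r + n"] by simp
    moreover have "r + n + n = r + 2 * n" "g (r + n) = real_of_int N" using n_pos by (simp_all add: N_def G)
    ultimately show ?thesis by simp
  qed
  ultimately have "real_of_int N * g (r + 2 * n) = real_of_int N * real_of_int (B * G r - u)"
    by (simp add: mult.commute)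
  moreover have "real_of_int N \<noteq> 0" using g_pos[of "r + n"] G[of "r + n"] n_pos by (auto simp: N_def)
  ultimately have "g (r + 2 * n) = real_of_int (B * G r - u)" by simp
  then show ?thesis by (metis Ints_of_int)
qed

lemma g_integer: "g t \<in> \<int>"
proof (induction t rule: less_induct)
  case (less t)
  consider "t < n" | "n \<le> t" "t < 2 * n" | "2 * n \<le> t" by linarith
  then show ?case
  proof cases
    case 1 then show ?thesis by (simp add: g_init)
  next
    case 2
    define r where "r = t - n"
    have r: "t = r + n" "r < n" using 2 by (auto simp: r_def)
    have "g t = 1 + (\<Prod>s\<in>{r<..<r+n}. g s ^ a (r mod n) (s mod n))"
      using g_rec[of r] r by (simp add: g_init)
    moreover have "(\<Prod>s\<in>{r<..<r+n}. g s ^ a (r mod n) (s mod n)) \<in> \<int>"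
      using less r by (intro Ints_prod Ints_power) auto
    ultimately show ?thesis by simp
  next
    case 3
    then have "t = (t - 2 * n) + 2 * n" by simp
    then show ?thesis using g_integer_step[of "t - 2 * n"] less by metis
  qed
qed

lemma g_ge_1: "g t \<ge> 1"
proof -
  obtain z where z: "g t = of_int z" using g_integer by (auto elim: Ints_cases)
  then show ?thesis using g_pos[of t] by simp
qed

definition L :: "nat \<Rightarrow> real" where "L t = ln (g t)"

lemma L_nonneg: "L t \<ge> 0" using g_ge_1[of t] by (simp add: L_def)
lemma L_init [simp]: "t < n \<Longrightarrow> L t = 0" by (simp add: L_def g_init)
lemma g_exp: "g t = exp (L t)" using g_pos by (simp add: L_def)

lemma forcing_L: "forcing L t = ln (1 + exp (- (\<Sum>s\<in>{t<..<t+n}. \<alpha> t s * L s)))"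
proof -
  let ?S = "\<Sum>s\<in>{t<..<t+n}. \<alpha> t s * L s"
  have "(\<Prod>s\<in>{t<..<t+n}. g s ^ a (t mod n) (s mod n)) = exp ?S"
    by (simp add: exp_sum \<alpha>_def g_exp exp_of_nat_mult)
  then have "g (t + n) * g t = 1 + exp ?S" using g_rec[of t] by simp
  then have "L (t + n) + L t = ln (1 + exp ?S)"
    using g_pos by (simp add: L_def flip: ln_mult_pos)
  also have "1 + exp ?S = exp ?S * (1 + exp (- ?S))" by (simp add: algebra_simps flip: exp_add)
  also have "ln \<dots> = ?S + ln (1 + exp (- ?S))" by (simp add: ln_mult_pos add_pos_pos)
  finally show ?thesis by (simp add: forcing_def)
qed

lemma forcing_L_pos: "forcing L t > 0"
  unfolding forcing_L by (intro ln_gt_zero) simp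

lemma forcing_L_le_exp: "forcing L t \<le> exp (- (\<Sum>s\<in>{t<..<t+n}. \<alpha> t s * L s))"
  unfolding forcing_L by (rule ln_add_one_self_le_self) simp

lemma window_L_nonneg: "(\<Sum>s\<in>{t<..<t+n}. \<alpha> t s * L s) \<ge> 0"
  by (intro sum_nonneg mult_nonneg_nonneg L_nonneg) auto

lemma forcing_L_le_1: "forcing L t \<le> 1"
  using forcing_L_le_exp[of t] window_L_nonneg[of t] by (meson exp_le_one_iff neg_le_0_iff_le order_trans)

lemma L_pair_ge: "L (t + n) + L t \<ge> ln 2"
proof -
  let ?S = "\<Sum>s\<in>{t<..<t+n}. \<alpha> t s * L s"
  have "2 \<le> exp ?S + exp ?S * exp (- ?S)" using window_L_nonneg[of t] by (simp flip: exp_add)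
  then have "ln 2 \<le> ln (exp ?S * (1 + exp (- ?S)))" by (intro ln_mono) (simp_all add: algebra_simps)
  also have "\<dots> = ?S + ln (1 + exp (- ?S))" by (simp add: ln_mult_pos add_pos_pos)
  also have "\<dots> = L (t + n) + L t" using forcing_L[of t] by (simp add: forcing_def)
  finally show ?thesis .
qed

text \<open>
  The forcing lies between \<open>0\<close> and \<open>1\<close>, so over a fixed time \<open>L\<close> stays at bounded distance from
  the homogeneous solution through any of its windows.
\<close>

lemma L_deviation: "\<bar>L (t + k * n) - hom_sol (\<lambda>t. L (t + k * n)) t\<bar> \<le> (\<Sum>s<t. \<bar>impulse s t\<bar>)"
proof -
  have eq: "L (t + k * n) - hom_sol (\<lambda>t. L (t + k * n)) t = (\<Sum>s<t. forcing L (s + k * n) * impulse s t)"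
    using duhamel[of t t "\<lambda>t. L (t + k * n)"] by (simp add: forcing_shift)
  have le: "\<bar>forcing L (s + k * n) * impulse s t\<bar> \<le> \<bar>impulse s t\<bar>" for s
  proof -
    have "\<bar>forcing L (s + k * n)\<bar> \<le> 1" using forcing_L_pos[of "s + k * n"] forcing_L_le_1[of "s + k * n"] by linarith
    then have "\<bar>forcing L (s + k * n)\<bar> * \<bar>impulse s t\<bar> \<le> 1 * \<bar>impulse s t\<bar>" by (rule mult_right_mono) simp
    then show ?thesis by (simp add: abs_mult)
  qed
  show ?thesis unfolding eq by (rule order_trans[OF sum_abs sum_mono[OF le]])
qed

section \<open>Bounded friezes\<close>

text \<open>
  Summed over \<open>m\<close> steps the homogeneous part cancels, so the sum of the \<open>m\<close> nonnegative values
  is bounded by the effect of the forcing.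
\<close>

lemma positive_definite_bounded:
  assumes d: "\<And>i. i < n \<Longrightarrow> d i > 0" "\<And>i. i < n \<Longrightarrow> (\<Sum>j<n. \<alpha> i j * d j) < 2 * d i"
  shows "\<exists>C. \<forall>t. g t \<le> C"
proof -
  obtain m where m: "m > 0" "\<And>v t. (\<Sum>k<m. hom_sol v (t + k * n)) = 0"
    by (rule positive_definite_hom_sum_zero[of d]) (use d in auto)
  define C where "C i = (\<Sum>k<m. \<Sum>s<i + k * n. \<bar>impulse s (i + k * n)\<bar>)" for i
  have "L t \<le> (\<Sum>i<n. C i)" for t
  proof -
    define i k where "i = t mod n" and "k = t div n"
    have t: "t = i + k * n" and i: "i < n" using n_pos by (auto simp: i_def k_def)
    have "L (i + 0 * n + k * n) \<le> (\<Sum>l<m. L (i + l * n + k * n))"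
      using m(1) by (intro member_le_sum[of 0 "{..<m}" "\<lambda>l. L (i + l * n + k * n)"]) (auto intro: L_nonneg)
    also have "\<dots> = (\<Sum>l<m. L (i + l * n + k * n) - hom_sol (\<lambda>t. L (t + k * n)) (i + l * n))"
      by (simp add: sum_subtractf m(2))
    also have "\<dots> \<le> C i" unfolding C_def
      by (intro sum_mono order_trans[OF abs_ge_self L_deviation])
    also have "\<dots> \<le> (\<Sum>i<n. C i)" using i by (intro member_le_sum) (auto simp: C_def intro!: sum_nonneg)
    finally show ?thesis by (simp add: t)
  qed
  then have "g t \<le> exp (\<Sum>i<n. C i)" for t by (simp add: g_exp)
  then show ?thesis by blast
qed

section \<open>Exponential growth\<close>

definition size_at :: "nat \<Rightarrow> real" where "size_at k = (\<Sum>i<n. L (i + k * n))"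
definition partial :: "nat \<Rightarrow> nat \<Rightarrow> real" where "partial K t = (\<Sum>k<K. L (t + k * n))"

lemma L_le_size: "i < n \<Longrightarrow> L (i + k * n) \<le> size_at k"
  unfolding size_at_def by (rule member_le_sum) (auto intro: L_nonneg)

lemma size_nonneg: "size_at k \<ge> 0"
  unfolding size_at_def by (intro sum_nonneg L_nonneg)

lemma partial_nonneg: "partial K t \<ge> 0"
  unfolding partial_def by (intro sum_nonneg L_nonneg)

lemma partial_shift: "t < n \<Longrightarrow> partial K (t + n) = partial K t + L (t + K * n)"
proof -
  assume t: "t < n"
  have "partial K (t + n) = (\<Sum>k<K. L (t + Suc k * n))" by (simp add: partial_def algebra_simps)
  also have "\<dots> = (\<Sum>k<Suc K. L (t + k * n)) - L (t + 0 * n)"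
    by (subst sum.lessThan_Suc_shift) simp
  finally show ?thesis using t by (simp add: partial_def)
qed

text \<open>
  The inequality \<open>forcing L t \<ge> 0\<close> summed over the times of vertex \<open>i\<close>. A smaller neighbour
  enters one step later, which only enlarges its partial sum, as \<open>L\<close> vanishes at the start.
\<close>

lemma partial_subharmonic:
  assumes i: "i < n"
  shows "(\<Sum>j<n. \<alpha> i j * partial K j) \<le> 2 * partial K i + L (i + K * n)"
proof -
  have "(\<Sum>j<n. \<alpha> i j * partial K j) = (\<Sum>j<n. \<alpha> i j * partial K (j mod n))" by simp
  also have "\<dots> = (\<Sum>s\<in>{i<..<i+n}. \<alpha> i s * partial K (s mod n))"
    by (rule open_window_sum_periodic[symmetric]) simp
  also have "\<dots> \<le> (\<Sum>s\<in>{i<..<i+n}. \<alpha> i s * partial K s)"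
  proof (intro sum_mono mult_left_mono)
    fix s assume s: "s \<in> {i<..<i+n}"
    show "partial K (s mod n) \<le> partial K s"
    proof (cases "s < n")
      case False
      then have s': "s - n < n" "s = (s - n) + n" using s i by auto
      then have "partial K s = partial K (s - n) + L (s - n + K * n)" using partial_shift by metis
      moreover have "s mod n = s - n" using s' False by (simp add: mod_if)
      ultimately show ?thesis using L_nonneg by simp
    qed simp
  qed simp
  also have "\<dots> \<le> partial K (i + n) + partial K i"
  proof -
    have "forcing (partial K) i = (\<Sum>k<K. forcing L (i + k * n))"
      unfolding partial_def[abs_def] by (simp add: forcing_sum forcing_shift)
    also have "\<dots> \<ge> 0" by (intro sum_nonneg less_imp_le forcing_L_pos)
    finally show ?thesis by (simp add: forcing_def)
  qed
  also have "\<dots> = 2 * partial K i + L (i + K * n)" using partial_shift[OF i] by simp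
  finally show ?thesis .
qed

definition adjacency :: "(nat \<times> nat) set" where
  "adjacency = {(i, j). i < n \<and> j < n \<and> a i j > 0}"

text \<open>
  By \<open>partial_subharmonic\<close> a neighbour has at most twice the partial sum, up to a final term.
\<close>

lemma partial_harnack:
  assumes "(i, j) \<in> adjacency\<^sup>*" "i < n"
  shows "j < n \<and> (\<exists>c\<ge>0. \<forall>K. partial K j \<le> c * (partial K i + size_at K))"
  using assms(1)
proof (induction rule: rtrancl_induct)
  case base
  have "partial K i \<le> 1 * (partial K i + size_at K)" for K using size_nonneg[of K] by simp
  then show ?case using assms(2) by (intro conjI exI[of _ 1]) auto
next
  case (step j k)
  then obtain c where c: "c \<ge> 0" "\<And>K. partial K j \<le> c * (partial K i + size_at K)" by blast
  have jk: "j < n" "k < n" "a j k > 0" using step.hyps(2) by (auto simp: adjacency_def)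
  have "partial K k \<le> (2 * c + 1) * (partial K i + size_at K)" for K
  proof -
    have "1 * partial K k \<le> \<alpha> j k * partial K k"
      using jk by (intro mult_right_mono partial_nonneg) (simp add: \<alpha>_small)
    also have "\<dots> \<le> (\<Sum>k<n. \<alpha> j k * partial K k)"
      using jk by (intro member_le_sum) (auto intro!: mult_nonneg_nonneg partial_nonneg)
    also have "\<dots> \<le> 2 * partial K j + L (j + K * n)" by (rule partial_subharmonic[OF jk(1)])
    also have "\<dots> \<le> 2 * (c * (partial K i + size_at K)) + (partial K i + size_at K)"
      using c(2)[of K] L_le_size[OF jk(1), of K] partial_nonneg[of K i] by linarith
    finally show ?thesis by (simp add: algebra_simps)
  qed
  then show ?case using jk c(1) by (intro conjI exI[of _ "2 * c + 1"]) auto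
qed

text \<open>
  Pairing \<open>partial_subharmonic\<close> with \<open>d\<close> and using the symmetry of \<open>A\<close> gives
  \<open>(\<Sum>i. (A d - 2 d) i * partial K i) \<le> (\<Sum>i. d i * L (i + K * n))\<close>. This bounds the partial sums
  at \<open>i0\<close> by the final size, and \<open>partial_harnack\<close> carries the bound to all vertices.
\<close>

lemma superharmonic_growth:
  assumes conn: "\<And>i j. i < n \<Longrightarrow> j < n \<Longrightarrow> (i, j) \<in> adjacency\<^sup>*"
    and d: "\<And>i. i < n \<Longrightarrow> d i \<ge> 0" "\<And>i. i < n \<Longrightarrow> (\<Sum>j<n. \<alpha> i j * d j) \<ge> 2 * d i"
    and i0: "i0 < n" "(\<Sum>j<n. \<alpha> i0 j * d j) > 2 * d i0"
  shows "\<exists>C>0. \<forall>K. (\<Sum>k<K. size_at k) \<le> C * size_at K"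
proof -
  define e where "e i = (\<Sum>j<n. \<alpha> i j * d j) - 2 * d i" for i
  have e: "\<And>i. i < n \<Longrightarrow> e i \<ge> 0" "e i0 > 0" using d(2) i0 by (auto simp: e_def)
  define D where "D = (\<Sum>i<n. d i)"
  have D: "D \<ge> 0" unfolding D_def using d(1) by (intro sum_nonneg) auto
  have S0: "partial K i0 \<le> D / e i0 * size_at K" for K
  proof -
    have "(\<Sum>i<n. d i * (\<Sum>j<n. \<alpha> i j * partial K j)) \<le> (\<Sum>i<n. d i * (2 * partial K i + L (i + K * n)))"
      using d(1) by (intro sum_mono mult_left_mono partial_subharmonic) auto
    moreover have "(\<Sum>i<n. d i * (\<Sum>j<n. \<alpha> i j * partial K j)) = (\<Sum>j<n. (2 * d j + e j) * partial K j)"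
    proof -
      have "(\<Sum>i<n. d i * (\<Sum>j<n. \<alpha> i j * partial K j)) = (\<Sum>j<n. \<Sum>i<n. d i * (\<alpha> i j * partial K j))"
        unfolding sum_distrib_left by (rule sum.swap)
      also have "\<dots> = (\<Sum>j<n. (\<Sum>i<n. \<alpha> j i * d i) * partial K j)"
      proof (intro sum.cong refl)
        fix j
        have eq: "d i * (\<alpha> i j * partial K j) = (\<alpha> j i * d i) * partial K j" for i by (simp add: \<alpha>_sym[of i j])
        then show "(\<Sum>i<n. d i * (\<alpha> i j * partial K j)) = (\<Sum>i<n. \<alpha> j i * d i) * partial K j"
          unfolding sum_distrib_right by (intro sum.cong refl eq)
      qed
      finally show ?thesis by (simp add: e_def)
    qed
    ultimately have "(\<Sum>j<n. e j * partial K j) \<le> (\<Sum>i<n. d i * L (i + K * n))"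
      by (simp add: algebra_simps sum.distrib sum_distrib_left[symmetric])
    also have "\<dots> \<le> (\<Sum>i<n. d i * size_at K)"
      using d(1) by (intro sum_mono mult_left_mono L_le_size) auto
    also have "\<dots> = D * size_at K" by (simp add: D_def sum_distrib_right)
    finally have "(\<Sum>j<n. e j * partial K j) \<le> D * size_at K" .
    moreover have "e i0 * partial K i0 \<le> (\<Sum>j<n. e j * partial K j)"
      using e(1) i0(1) by (intro member_le_sum) (auto intro!: mult_nonneg_nonneg partial_nonneg)
    ultimately show ?thesis using e(2) by (simp add: field_simps)
  qed
  have "\<exists>c\<ge>0. \<forall>K. partial K j \<le> c * (partial K i0 + size_at K)" if "j < n" for j
    using partial_harnack[OF conn[OF i0(1) that] i0(1)] by blast
  then obtain c where c: "\<And>j. j < n \<Longrightarrow> c j \<ge> 0" "\<And>j K. j < n \<Longrightarrow> partial K j \<le> c j * (partial K i0 + size_at K)"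
    by metis
  define C where "C = (\<Sum>j<n. c j * (D / e i0 + 1)) + 1"
  have "(\<Sum>k<K. size_at k) \<le> C * size_at K" for K
  proof -
    have "(\<Sum>k<K. size_at k) = (\<Sum>j<n. partial K j)"
      unfolding size_at_def partial_def by (rule sum.swap)
    also have "\<dots> \<le> (\<Sum>j<n. c j * (D / e i0 + 1) * size_at K)"
    proof (rule sum_mono)
      fix j assume j: "j \<in> {..<n}"
      have "partial K i0 + size_at K \<le> (D / e i0 + 1) * size_at K"
        using S0[of K] by (simp add: algebra_simps)
      then have "c j * (partial K i0 + size_at K) \<le> c j * ((D / e i0 + 1) * size_at K)"
        using c(1) j by (intro mult_left_mono) auto
      then show "partial K j \<le> c j * (D / e i0 + 1) * size_at K" using c(2)[of j K] j by (simp add: mult.assoc)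
    qed
    also have "\<dots> \<le> C * size_at K"
      using size_nonneg[of K] by (simp add: C_def sum_distrib_right[symmetric] distrib_right)
    finally show ?thesis .
  qed
  moreover have "C > 0" unfolding C_def
    using c(1) D e(2) by (intro add_nonneg_pos sum_nonneg mult_nonneg_nonneg) auto
  ultimately show ?thesis by blast
qed

lemma size_pair_ge: "size_at k + size_at (Suc k) \<ge> ln 2"
  using L_pair_ge[of "k * n"] L_le_size[of 0 k] L_le_size[of 0 "Suc k"] n_pos by (simp add: algebra_simps)

text \<open>
  Two consecutive sizes have sum at least \<open>ln 2\<close>, so the partial sums diverge.
\<close>

lemma size_at_top:
  assumes "C > 0" "\<And>K. (\<Sum>k<K. size_at k) \<le> C * size_at K"
  shows "filterlim size_at at_top sequentially"
  unfolding filterlim_at_top eventually_sequentially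
proof (intro allI)
  fix Z
  have sum: "(\<Sum>k<2 * N. size_at k) \<ge> N * ln 2" for N
  proof (induction N)
    case (Suc N)
    have "(\<Sum>k<2 * Suc N. size_at k) = (\<Sum>k<2 * N. size_at k) + (size_at (2 * N) + size_at (Suc (2 * N)))" by simp
    then show ?case using Suc size_pair_ge[of "2 * N"] by (simp add: algebra_simps)
  qed simp
  obtain N :: nat where N: "C * Z < N * ln 2"
  proof -
    have "\<forall>y. \<exists>N::nat. y < real N * ln 2" by (rule reals_Archimedean3) simp
    then show ?thesis using that by blast
  qed
  have "Z \<le> size_at K" if "K \<ge> 2 * N" for K
  proof -
    have "C * Z < (\<Sum>k<2 * N. size_at k)" using N sum[of N] by linarith
    also have "\<dots> \<le> (\<Sum>k<K. size_at k)" using that by (intro sum_mono2) (auto intro: size_nonneg)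
    also have "\<dots> \<le> C * size_at K" by (rule assms)
    finally show ?thesis using assms(1) by simp
  qed
  then show "\<exists>N. \<forall>K\<ge>N. Z \<le> size_at K" by blast
qed

section \<open>Bounded relations force a rational eigenvector\<close>

text \<open>
  After scaling, the solution is integral. Integral windows remain integral both forward and
  backward in time, so a fixed nonzero integer multiplied by \<open>\<mu> ^ l\<close>, and also divided by
  \<open>\<mu> ^ l\<close>, has absolute value at least \<open>1\<close> for all \<open>l\<close>.
\<close>

lemma abs_power_multiplier:
  fixes h :: "nat \<Rightarrow> real"
  assumes h: "\<And>t. forcing h t = 0" "\<And>i. i < n \<Longrightarrow> h i \<in> \<rat>" "i0 < n" "h i0 \<noteq> 0"
    and \<mu>: "\<And>t. h (t + m * n) = \<mu> * h t"
  shows "\<bar>\<mu>\<bar> = 1"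
proof -
  have "\<exists>D>0. \<forall>i\<in>I. real D * h i \<in> \<int>" if "finite I" "I \<subseteq> {..<n}" for I
    using that
  proof (induction I rule: finite_induct)
    case (insert i I)
    then obtain D :: nat where D: "D > 0" "\<forall>i\<in>I. real D * h i \<in> \<int>" by auto
    obtain p q :: int where pq: "q > 0" "h i = p / q"
      using h(2)[of i] insert.prems by (auto elim: Rats_cases')
    have "real (nat q * D) * h j \<in> \<int>" if "j \<in> insert i I" for j
    proof (cases "j = i")
      case True
      then have "real (nat q * D) * h j = of_int (int D * p)" using pq by simp
      then show ?thesis by (metis Ints_of_int)
    next
      case False
      then have "real D * h j \<in> \<int>" using D that by auto
      then have "real (nat q) * (real D * h j) \<in> \<int>" by (rule Ints_mult[rotated]) simp
      moreover have "real (nat q * D) * h j = real (nat q) * (real D * h j)" by simp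
      ultimately show ?thesis by metis
    qed
    then show ?case using D pq by (intro exI[of _ "nat q * D"]) auto
  qed auto
  then obtain D :: nat where D: "D > 0" "\<And>i. i < n \<Longrightarrow> real D * h i \<in> \<int>"
    using order_refl[of "{..<n}"] by (metis finite_lessThan lessThan_iff)
  define x where "x t = real D * h t" for t
  have fx: "forcing x t = 0" for t unfolding x_def by (simp add: forcing_cmult h)
  have xint: "x t \<in> \<int>" for t
  proof -
    have "hom_sol x t \<in> \<int>" by (rule sol_int) (simp add: x_def D)
    then show ?thesis using hom_eq_hom_sol[OF fx] by simp
  qed
  have x0: "x i0 \<noteq> 0" using h D by (simp add: x_def)
  have pow: "x (t + l * m * n) = \<mu> ^ l * x t" for t l
  proof (induction l)
    case (Suc l)
    have "t + Suc l * m * n = (t + l * m * n) + m * n" by (simp add: algebra_simps)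
    then show ?case using \<mu>[of "t + l * m * n"] Suc by (simp add: x_def algebra_simps)
  qed simp
  have \<mu>0: "\<mu> \<noteq> 0"
  proof
    assume "\<mu> = 0"
    then have "h (m * n + i) = 0" for i using \<mu>[of i] by (simp add: add.commute)
    then have "h i0 = 0" by (rule unique_window[OF h(1)])
    then show False using h by simp
  qed
  have up: "\<bar>\<mu>\<bar> ^ l * \<bar>x i0\<bar> \<ge> 1" for l
  proof -
    have "\<mu> ^ l * x i0 \<in> \<int>" using xint[of "i0 + l * m * n"] pow by simp
    moreover have "\<mu> ^ l * x i0 \<noteq> 0" using \<mu>0 x0 by simp
    ultimately have "\<bar>\<mu> ^ l * x i0\<bar> \<ge> 1" using Ints_nonzero_abs_ge1 by blast
    then show ?thesis by (simp add: abs_mult power_abs)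
  qed
  have int_below: "z i \<in> \<int>" if "\<And>t. forcing z t = 0" "\<And>i. i < n \<Longrightarrow> z (s + i) \<in> \<int>" "i < n" for z s i
    using that(2)
  proof (induction s)
    case 0 then show ?case using that by simp
  next
    case (Suc s)
    have w: "z r \<in> \<int>" if "r \<in> {s<..s+n}" for r
    proof -
      have "r - Suc s < n" "Suc s + (r - Suc s) = r" using that n_pos by auto
      then show ?thesis using Suc.prems[of "r - Suc s"] by simp
    qed
    have "z s = (\<Sum>r\<in>{s<..<s+n}. \<alpha> s r * z r) - z (s + n)"
      using that(1)[of s] by (simp add: forcing_def)
    also have "\<dots> \<in> \<int>" using w n_pos by (intro Ints_diff Ints_sum Ints_mult) (auto simp: \<alpha>_def)
    finally have "z (s + i) \<in> \<int>" if "i < n" for i using w[of "s + i"] that by (cases "i = 0") auto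
    then show ?case by (rule Suc.IH)
  qed
  have down: "\<bar>x i0\<bar> \<ge> \<bar>\<mu>\<bar> ^ l" for l
  proof -
    define z where "z t = inverse (\<mu> ^ l) * x t" for t
    have "z i0 \<in> \<int>"
    proof (rule int_below[of z "l * m * n"])
      show "forcing z t = 0" for t unfolding z_def by (simp add: forcing_cmult fx)
      show "z (l * m * n + i) \<in> \<int>" for i
      proof -
        have "inverse (\<mu> ^ l) * \<mu> ^ l = 1" using \<mu>0 by simp
        then have "inverse (\<mu> ^ l) * (\<mu> ^ l * x i) = x i" by (metis mult.assoc mult_1)
        moreover have "x (l * m * n + i) = \<mu> ^ l * x i" using pow[of i l] by (simp add: add.commute)
        ultimately show ?thesis using xint[of i] unfolding z_def by metis
      qed
    qed (rule h)
    moreover have "z i0 \<noteq> 0" using \<mu>0 x0 by (simp add: z_def)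
    ultimately have "\<bar>z i0\<bar> \<ge> 1" using Ints_nonzero_abs_ge1 by blast
    then have "inverse (\<bar>\<mu>\<bar> ^ l) * \<bar>x i0\<bar> \<ge> 1" by (simp add: z_def abs_mult power_abs)
    then show ?thesis using \<mu>0 by (simp add: field_simps)
  qed
  have "\<not> \<bar>\<mu>\<bar> > 1" using down real_arch_pow[of "\<bar>\<mu>\<bar>" "\<bar>x i0\<bar>"] by (meson not_less)
  moreover have "\<not> \<bar>\<mu>\<bar> < 1"
  proof
    assume "\<bar>\<mu>\<bar> < 1"
    then obtain l where "\<bar>\<mu>\<bar> ^ l < 1 / \<bar>x i0\<bar>" using real_arch_pow_inv[of "1 / \<bar>x i0\<bar>" "\<bar>\<mu>\<bar>"] x0 by auto
    then show False using up[of l] x0 by (simp add: field_simps)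
  qed
  ultimately show ?thesis by linarith
qed

text \<open>
  Let \<open>N k\<close> be the largest value of \<open>L\<close> at step \<open>k\<close>. The relations with the vertex where it is
  attained show that the window of \<open>L\<close> is \<open>N k * r k\<close> up to a bounded error, with \<open>r k\<close> from a
  finite set \<open>P\<close> of rational vectors. The linear dynamics sends \<open>r k\<close> to a multiple of
  \<open>r (k + 1)\<close>: the cross products take finitely many values and are small, hence zero. By
  finiteness some direction recurs, and by \<open>abs_power_multiplier\<close> its multiplier is \<open>1\<close> or
  \<open>- 1\<close>. So twice the return time adds only a bounded amount to the size, which is incompatible
  with partial sums that are bounded by a multiple of the size.
\<close>

lemma bounded_relations_contradiction:
  assumes C0: "C0 > 0" "\<And>K. (\<Sum>k<K. size_at k) \<le> C0 * size_at K"
    and R: "\<And>i j. i < n \<Longrightarrow> j < n \<Longrightarrow> finite (R i j) \<and> (0, 0) \<notin> R i j \<and>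
      (\<forall>k. \<exists>(p, q)\<in>R i j. \<bar>real_of_int p * L (i + k * n) + real_of_int q * L (j + k * n)\<bar> \<le> c i j)"
  shows False
proof -
  have top: "filterlim size_at at_top sequentially" by (rule size_at_top[OF C0])
  define c0 where "c0 = (\<Sum>i<n. \<Sum>j<n. \<bar>c i j\<bar>)"
  have c0: "c i j \<le> c0" if "i < n" "j < n" for i j
  proof -
    have "c i j \<le> \<bar>c i j\<bar>" by simp
    also have "\<dots> \<le> (\<Sum>j<n. \<bar>c i j\<bar>)" using that by (intro member_le_sum) auto
    also have "\<dots> \<le> c0" unfolding c0_def
      using that by (intro member_le_sum[of i "{..<n}" "\<lambda>i. \<Sum>j<n. \<bar>c i j\<bar>"]) (auto intro: sum_nonneg)
    finally show ?thesis .
  qed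
  have c0': "c0 \<ge> 0" unfolding c0_def by (intro sum_nonneg) auto
  have "\<exists>i<n. \<forall>j<n. L (j + k * n) \<le> L (i + k * n)" for k
  proof -
    let ?A = "(\<lambda>i. L (i + k * n)) ` {..<n}"
    have "Max ?A \<in> ?A" using n_pos by (intro Max_in) auto
    then obtain i where "i < n" "Max ?A = L (i + k * n)" by auto
    moreover have "L (j + k * n) \<le> Max ?A" if "j < n" for j using that by (intro Max_ge) auto
    ultimately show ?thesis by metis
  qed
  then obtain i0 where i0: "\<And>k. i0 k < n" "\<And>k j. j < n \<Longrightarrow> L (j + k * n) \<le> L (i0 k + k * n)" by metis
  define N where "N k = L (i0 k + k * n)" for k
  have N_size: "size_at k \<le> real n * N k" for k
  proof -
    have "size_at k \<le> (\<Sum>i<n. N k)" unfolding size_at_def N_def by (intro sum_mono i0) auto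
    then show ?thesis by simp
  qed
  have N_large: "\<exists>K. \<forall>k\<ge>K. N k > Z" for Z
  proof -
    obtain K where "\<And>k. k \<ge> K \<Longrightarrow> size_at k \<ge> real n * \<bar>Z\<bar> + 1"
      using top unfolding filterlim_at_top eventually_sequentially by blast
    then have "real n * \<bar>Z\<bar> < real n * N k" if "k \<ge> K" for k using N_size[of k] that by fastforce
    then have "\<bar>Z\<bar> < N k" if "k \<ge> K" for k using n_pos that by (simp add: mult_less_cancel_left)
    then show ?thesis by (metis abs_ge_self le_less_trans)
  qed
  \<comment> \<open>The value \<open>1\<close> is the coordinate at the vertex where the maximum is
    attained.\<close>
  define Q where "Q = insert (1::real) (\<Union>i<n. \<Union>j<n. (\<lambda>(p, q). - real_of_int p / real_of_int q) ` R i j)"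
  have Q: "finite Q" "Q \<subseteq> \<rat>" using R by (auto simp: Q_def)
  define P where "P = ({..<n} \<rightarrow>\<^sub>E Q)"
  have P: "finite P" unfolding P_def using Q by (intro finite_PiE) auto
  obtain k0 where k0: "\<And>k. k \<ge> k0 \<Longrightarrow> N k > c0" using N_large by metis
  have "\<exists>r\<in>P. r (i0 k) = 1 \<and> (\<forall>j<n. \<bar>L (j + k * n) - N k * r j\<bar> \<le> c0)" if k: "k \<ge> k0" for k
  proof -
    have Nk: "N k > c0" by (rule k0[OF k])
    have "\<exists>\<rho>\<in>Q. (j = i0 k \<longrightarrow> \<rho> = 1) \<and> \<bar>L (j + k * n) - N k * \<rho>\<bar> \<le> c0" if j: "j < n" for j
    proof (cases "j = i0 k")
      case True then show ?thesis using c0' by (intro bexI[of _ 1]) (auto simp: N_def Q_def)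
    next
      case False
      obtain p q where pq: "(p, q) \<in> R (i0 k) j" "\<bar>real_of_int p * N k + real_of_int q * L (j + k * n)\<bar> \<le> c (i0 k) j"
        using R[OF i0(1) j, of k] unfolding N_def by blast
      have le: "\<bar>real_of_int p * N k + real_of_int q * L (j + k * n)\<bar> \<le> c0"
        using pq(2) c0[OF i0(1) j] by (rule order_trans)
      have q: "q \<noteq> 0"
      proof
        assume "q = 0"
        then have "p \<noteq> 0" using pq(1) R[OF i0(1) j] by auto
        then have "1 * N k \<le> \<bar>real_of_int p\<bar> * N k" using Nk c0' by (intro mult_right_mono) auto
        moreover have "\<bar>real_of_int p * N k\<bar> \<le> c0" using le \<open>q = 0\<close> by simp
        then have "\<bar>real_of_int p\<bar> * N k \<le> c0" using Nk c0' by (simp only: abs_mult abs_of_pos)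
        ultimately show False using Nk by linarith
      qed
      have "L (j + k * n) - N k * (- real_of_int p / real_of_int q) = (real_of_int p * N k + real_of_int q * L (j + k * n)) / real_of_int q"
        using q by (simp add: field_simps)
      then have "\<bar>L (j + k * n) - N k * (- real_of_int p / real_of_int q)\<bar> \<le> c0 / \<bar>real_of_int q\<bar>"
        using le by (simp add: divide_right_mono)
      also have "\<dots> \<le> c0 / 1" using q c0' by (intro divide_left_mono) auto
      finally have "\<bar>L (j + k * n) - N k * (- real_of_int p / real_of_int q)\<bar> \<le> c0" by simp
      moreover have "- real_of_int p / real_of_int q \<in> Q" unfolding Q_def using pq(1) i0(1)[of k] j by force
      ultimately show ?thesis using False by blast
    qed
    then obtain \<rho> where \<rho>: "\<And>j. j < n \<Longrightarrow> \<rho> j \<in> Q" "\<And>j. j < n \<Longrightarrow> j = i0 k \<Longrightarrow> \<rho> j = 1"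
      "\<And>j. j < n \<Longrightarrow> \<bar>L (j + k * n) - N k * \<rho> j\<bar> \<le> c0" by metis
    show ?thesis
      by (rule bexI[of _ "restrict \<rho> {..<n}"]) (use \<rho> i0(1)[of k] in \<open>auto simp: P_def\<close>)
  qed
  then obtain r where r: "\<And>k. k \<ge> k0 \<Longrightarrow> r k \<in> P" "\<And>k. k \<ge> k0 \<Longrightarrow> r k (i0 k) = 1"
    "\<And>k j. k \<ge> k0 \<Longrightarrow> j < n \<Longrightarrow> \<bar>L (j + k * n) - N k * r k j\<bar> \<le> c0" by metis
  define c2 where "c2 t = c0 * (\<Sum>j<n. \<bar>hom_sol (unit j) t\<bar>) + (\<Sum>s<t. \<bar>impulse s t\<bar>)" for t
  have approx: "\<bar>L (t + k * n) - N k * hom_sol (r k) t\<bar> \<le> c2 t" if k: "k \<ge> k0" for k t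
  proof -
    have "hom_sol (\<lambda>t. L (t + k * n)) t - N k * hom_sol (r k) t = (\<Sum>j<n. (L (j + k * n) - N k * r k j) * hom_sol (unit j) t)"
      unfolding hom_sol_units[of "\<lambda>t. L (t + k * n)"] hom_sol_units[of "r k"]
      by (simp add: sum_distrib_left sum_subtractf[symmetric] algebra_simps)
    then have "\<bar>hom_sol (\<lambda>t. L (t + k * n)) t - N k * hom_sol (r k) t\<bar> \<le> (\<Sum>j<n. \<bar>(L (j + k * n) - N k * r k j) * hom_sol (unit j) t\<bar>)"
      by (simp only: sum_abs)
    also have "\<dots> \<le> (\<Sum>j<n. c0 * \<bar>hom_sol (unit j) t\<bar>)"
      unfolding abs_mult using r(3)[OF k] by (intro sum_mono mult_right_mono) auto
    finally have "\<bar>hom_sol (\<lambda>t. L (t + k * n)) t - N k * hom_sol (r k) t\<bar> \<le> c0 * (\<Sum>j<n. \<bar>hom_sol (unit j) t\<bar>)"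
      by (simp add: sum_distrib_left)
    then show ?thesis using L_deviation[of t k] unfolding c2_def by linarith
  qed
  define \<Phi> where "\<Phi> v j = hom_sol v (j + n)" for v j
  \<comment> \<open>The finitely many values that the cross products of \<open>r (k + 1)\<close> and the image of \<open>r k\<close> can take.\<close>
  define V where "V = (\<lambda>(v, u, i, j). u j * \<Phi> v i - u i * \<Phi> v j) ` (P \<times> P \<times> {..<n} \<times> {..<n})"
  have V: "finite V" unfolding V_def using P by auto
  obtain \<kappa> where \<kappa>: "\<kappa> > 0" "\<And>x. x \<in> V \<Longrightarrow> x \<noteq> 0 \<Longrightarrow> \<bar>x\<bar> \<ge> \<kappa>"
  proof -
    let ?A = "insert 1 (abs ` (V - {0}))"
    have "Min ?A > 0" using V by (subst Min_gr_iff) auto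
    moreover have "\<bar>x\<bar> \<ge> Min ?A" if "x \<in> V" "x \<noteq> 0" for x using V that by (intro Min_le) auto
    ultimately show ?thesis using that by blast
  qed
  define F where "F = (\<Sum>(v, i)\<in>P \<times> {..<n}. \<bar>\<Phi> v i\<bar>)"
  have F: "\<bar>\<Phi> v i\<bar> \<le> F" if "v \<in> P" "i < n" for v i
    unfolding F_def using P that by (intro member_le_sum[of "(v, i)" _ "\<lambda>(v, i). \<bar>\<Phi> v i\<bar>", simplified]) auto
  define c3 where "c3 = (\<Sum>j<n. c0 + c2 (j + n))"
  have c2n: "c2 t \<ge> 0" for t unfolding c2_def using c0' by (intro add_nonneg_nonneg mult_nonneg_nonneg sum_nonneg) auto
  have c3: "c0 + c2 (j + n) \<le> c3" if "j < n" for j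
    unfolding c3_def using that c0' c2n by (intro member_le_sum[of j "{..<n}" "\<lambda>j. c0 + c2 (j + n)"]) auto
  obtain k1' where k1': "\<And>k. k \<ge> k1' \<Longrightarrow> N k > 2 * c3 * F / \<kappa>" using N_large by metis
  define k1 where "k1 = k0 + k1'"
  have cross: "r (Suc k) j * \<Phi> (r k) i = r (Suc k) i * \<Phi> (r k) j" if k: "k \<ge> k1" and ij: "i < n" "j < n" for k i j
  proof (rule ccontr)
    define x where "x = r (Suc k) j * \<Phi> (r k) i - r (Suc k) i * \<Phi> (r k) j"
    assume "r (Suc k) j * \<Phi> (r k) i \<noteq> r (Suc k) i * \<Phi> (r k) j"
    then have "x \<noteq> 0" by (simp add: x_def)
    moreover have rP: "r k \<in> P" "r (Suc k) \<in> P" using k by (auto simp: k1_def intro: r)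
    then have "x \<in> V" unfolding V_def x_def using ij by (intro image_eqI[of _ _ "(r k, r (Suc k), i, j)"]) auto
    ultimately have x: "\<bar>x\<bar> \<ge> \<kappa>" using \<kappa> by blast
    have D: "\<bar>N (Suc k) * r (Suc k) j - N k * \<Phi> (r k) j\<bar> \<le> c3" if "j < n" for j
    proof -
      have "\<bar>L (j + Suc k * n) - N (Suc k) * r (Suc k) j\<bar> \<le> c0" using k that by (intro r) (auto simp: k1_def)
      moreover have "\<bar>L (j + n + k * n) - N k * \<Phi> (r k) j\<bar> \<le> c2 (j + n)" unfolding \<Phi>_def using k by (intro approx) (auto simp: k1_def)
      moreover have e: "j + Suc k * n = j + n + k * n" by simp
      ultimately show ?thesis using c3[OF that] unfolding e by linarith
    qed
    have "N (Suc k) * x = (N (Suc k) * r (Suc k) j - N k * \<Phi> (r k) j) * \<Phi> (r k) i - (N (Suc k) * r (Suc k) i - N k * \<Phi> (r k) i) * \<Phi> (r k) j"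
      by (simp add: x_def algebra_simps)
    then have "\<bar>N (Suc k) * x\<bar> \<le> \<bar>(N (Suc k) * r (Suc k) j - N k * \<Phi> (r k) j) * \<Phi> (r k) i\<bar> + \<bar>(N (Suc k) * r (Suc k) i - N k * \<Phi> (r k) i) * \<Phi> (r k) j\<bar>"
      by (simp only: abs_triangle_ineq4)
    also have "\<dots> \<le> c3 * F + c3 * F"
      unfolding abs_mult using D ij F[OF rP(1)] c3[OF ij(1)] c0' c2n[of "i + n"] by (intro add_mono mult_mono) auto
    finally have "\<bar>N (Suc k) * x\<bar> \<le> c3 * F + c3 * F" .
    moreover have "\<bar>N (Suc k) * x\<bar> = N (Suc k) * \<bar>x\<bar>" using L_nonneg by (simp add: abs_mult N_def)
    ultimately have "N (Suc k) * \<bar>x\<bar> \<le> 2 * c3 * F" by linarith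
    moreover have "N (Suc k) * \<kappa> \<le> N (Suc k) * \<bar>x\<bar>" using x L_nonneg by (intro mult_left_mono) (auto simp: N_def)
    ultimately have "N (Suc k) \<le> 2 * c3 * F / \<kappa>" using \<kappa>(1) by (simp add: field_simps)
    then show False using k1'[of "Suc k"] k by (simp add: k1_def)
  qed
  have step: "\<exists>\<mu>. \<mu> \<noteq> 0 \<and> (\<forall>t. hom_sol (r k) (t + n) = \<mu> * hom_sol (r (Suc k)) t)" if k: "k \<ge> k1" for k
  proof -
    define \<mu> where "\<mu> = \<Phi> (r k) (i0 (Suc k))"
    define z where "z t = hom_sol (r k) (t + n) - \<mu> * hom_sol (r (Suc k)) t" for t
    have "forcing z t = 0" for t
      unfolding z_def using forcing_shift[of "hom_sol (r k)" 1] by (simp add: forcing_diff forcing_cmult)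
    moreover have "z (0 + j) = 0" if "j < n" for j
      using cross[OF k i0(1)[of "Suc k"] that] r(2)[of "Suc k"] k that by (simp add: z_def \<mu>_def k1_def) (simp add: \<Phi>_def mult.commute)
    ultimately have "z t = 0" for t by (rule unique_window)
    then have e: "hom_sol (r k) (t + n) = \<mu> * hom_sol (r (Suc k)) t" for t using z_def[of t] by simp
    have "\<mu> \<noteq> 0"
    proof
      assume "\<mu> = 0"
      then have "hom_sol (r k) (n + i) = 0" for i using e[of i] by (simp add: add.commute)
      then have "hom_sol (r k) (i0 k) = 0" using unique_window[of "hom_sol (r k)" n "i0 k"] by simp
      then show False using r(2)[of k] k i0(1)[of k] by (simp add: k1_def)
    qed
    then show ?thesis using e by blast
  qed
  have steps: "\<exists>\<nu>. \<nu> \<noteq> 0 \<and> (\<forall>t. hom_sol (r (k + l)) t = \<nu> * hom_sol (r k) (t + l * n))" if k: "k \<ge> k1" for k l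
  proof (induction l)
    case 0 then show ?case by (intro exI[of _ 1]) simp
  next
    case (Suc l)
    then obtain \<nu> where \<nu>: "\<nu> \<noteq> 0" "\<And>t. hom_sol (r (k + l)) t = \<nu> * hom_sol (r k) (t + l * n)" by blast
    obtain \<mu> where \<mu>: "\<mu> \<noteq> 0" "\<And>t. hom_sol (r (k + l)) (t + n) = \<mu> * hom_sol (r (Suc (k + l))) t"
      using step[of "k + l"] k by auto
    have "hom_sol (r (k + Suc l)) t = (\<nu> / \<mu>) * hom_sol (r k) (t + Suc l * n)" for t
      using \<mu>(2)[of t] \<mu>(1) \<nu>(2)[of "t + n"] by (simp add: field_simps add.assoc)
    then show ?case using \<mu>(1) \<nu>(1) by (intro exI[of _ "\<nu> / \<mu>"]) auto
  qed
  have "\<not> inj_on r {k1..}"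
  proof
    assume "inj_on r {k1..}"
    moreover have "r ` {k1..} \<subseteq> P" using r(1) by (auto simp: k1_def)
    ultimately have "finite {k1..}" using P by (meson finite_imageD finite_subset)
    then show False using infinite_Ici by blast
  qed
  then obtain k k' where kk: "k \<ge> k1" "k < k'" "r k = r k'" unfolding inj_on_def
    by (metis atLeast_iff linorder_neqE_nat)
  define m where "m = k' - k"
  define h where "h = hom_sol (r k)"
  have m: "m > 0" "k' = k + m" using kk by (auto simp: m_def)
  obtain \<nu> where \<nu>: "\<nu> \<noteq> 0" "\<And>t. h t = \<nu> * h (t + m * n)"
    using steps[OF kk(1), of m] kk(3) m unfolding h_def by metis
  have "\<bar>inverse \<nu>\<bar> = 1"
  proof (rule abs_power_multiplier[of h "i0 k" m])
    show "h i \<in> \<rat>" if "i < n" for i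
      using r(1)[of k] kk(1) that Q(2) by (auto simp: h_def P_def k1_def)
    show "h (i0 k) \<noteq> 0" using r(2)[of k] kk(1) i0(1)[of k] by (simp add: h_def k1_def)
    show "h (t + m * n) = inverse \<nu> * h t" for t using \<nu>(2)[of t] \<nu>(1) by simp
  qed (auto simp: h_def i0)
  then have "\<bar>\<nu>\<bar> = 1" by simp
  then have \<nu>2: "\<nu> * \<nu> = 1" by (metis abs_mult_self_eq mult_1)
  \<comment> \<open>Doubling the return time removes the sign of the multiplier.\<close>
  define m2 where "m2 = 2 * m"
  have h2: "h (t + m2 * n) = h t" for t
  proof -
    have e: "t + m2 * n = (t + m * n) + m * n" by (simp add: m2_def algebra_simps)
    have "h t = \<nu> * (\<nu> * h (t + m * n + m * n))" by (metis \<nu>(2))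
    then show ?thesis unfolding e using \<nu>2 by (metis mult.assoc mult_1)
  qed
  have h2l: "h (t + l * m2 * n) = h t" for t l
  proof (induction l)
    case (Suc l)
    have e: "t + Suc l * m2 * n = (t + l * m2 * n) + m2 * n" by (simp add: algebra_simps)
    show ?case unfolding e using h2[of "t + l * m2 * n"] Suc by simp
  qed simp
  define c4 where "c4 = (\<Sum>i<n. c0 + c2 (i + m2 * n))"
  have grow: "size_at (k + Suc l * m2) \<le> size_at (k + l * m2) + c4" for l
  proof -
    define k2 where "k2 = k + l * m2"
    have k2: "k2 \<ge> k0" using kk(1) by (simp add: k2_def k1_def)
    obtain \<nu>' where \<nu>': "\<And>t. hom_sol (r k2) t = \<nu>' * h (t + l * m2 * n)"
      using steps[OF kk(1), of "l * m2"] unfolding k2_def h_def by blast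
    have per: "hom_sol (r k2) (i + m2 * n) = hom_sol (r k2) i" for i
      unfolding \<nu>' h2l h2 ..
    have "L (i + (k2 + m2) * n) \<le> L (i + k2 * n) + (c0 + c2 (i + m2 * n))" if i: "i < n" for i
    proof -
      have e: "i + (k2 + m2) * n = i + m2 * n + k2 * n" by (simp add: algebra_simps)
      have "\<bar>L (i + m2 * n + k2 * n) - N k2 * r k2 i\<bar> \<le> c2 (i + m2 * n)"
        using approx[OF k2, of "i + m2 * n"] per[of i] i by simp
      moreover have "\<bar>L (i + k2 * n) - N k2 * r k2 i\<bar> \<le> c0" using r(3)[OF k2 i] .
      ultimately show ?thesis unfolding e by linarith
    qed
    then have "size_at (k2 + m2) \<le> size_at k2 + c4"
      unfolding size_at_def c4_def sum.distrib[symmetric] by (intro sum_mono) auto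
    then show ?thesis by (simp add: k2_def algebra_simps)
  qed
  have lin: "size_at (k + l * m2) \<le> size_at k + l * c4" for l
  proof (induction l)
    case (Suc l) then show ?case using grow[of l] by (simp add: algebra_simps)
  qed simp
  define B where "B = C0 * c4 + 1"
  have B: "B \<ge> 1" unfolding B_def c4_def using C0(1) c0' c2n by (simp add: sum_nonneg)
  obtain K where K: "\<And>k. k \<ge> K \<Longrightarrow> size_at k \<ge> B"
    using top unfolding filterlim_at_top eventually_sequentially by blast
  obtain l' :: nat where l': "C0 * size_at k + B * K < l'" using reals_Archimedean2 by blast
  define l where "l = l' + K"
  define T where "T = k + l * m2"
  have Tl: "T \<ge> l" using m by (simp add: T_def m2_def trans_le_add2)
  then have TK: "T \<ge> K" by (simp add: l_def)
  have "B * (real l - real K) \<le> B * (real T - real K)" using Tl B by (intro mult_left_mono) auto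
  also have "\<dots> = (\<Sum>k\<in>{K..<T}. B)" using TK by (simp add: of_nat_diff mult.commute)
  also have "\<dots> \<le> (\<Sum>k\<in>{K..<T}. size_at k)" by (intro sum_mono K) auto
  also have "\<dots> \<le> (\<Sum>k<T. size_at k)" by (intro sum_mono2) (auto intro: size_nonneg)
  also have "\<dots> \<le> C0 * size_at T" by (rule C0(2))
  also have "\<dots> \<le> C0 * (size_at k + l * c4)" unfolding T_def using C0(1) by (intro mult_left_mono lin) auto
  finally have "real l \<le> C0 * size_at k + B * K" by (simp add: B_def algebra_simps)
  then show False using l' by (simp add: l_def)
qed

end

section \<open>Affine diagrams\<close>

lemma sum_lower_triangle:
  fixes f :: "nat \<Rightarrow> nat \<Rightarrow> real"
  assumes "\<And>i j. f i j = f j i" "\<And>i. f i i = 0"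
  shows "(\<Sum>i<n. \<Sum>j<n. f i j) = 2 * (\<Sum>i<n. \<Sum>j<i. f i j)"
proof (induction n)
  case (Suc n)
  have "(\<Sum>i<Suc n. \<Sum>j<Suc n. f i j) = (\<Sum>i<n. \<Sum>j<n. f i j) + (\<Sum>i<n. f i n) + (\<Sum>j<n. f n j)"
    using assms(2)[of n] by (simp add: sum.distrib)
  moreover have "(\<Sum>i<n. f i n) = (\<Sum>j<n. f n j)" by (intro sum.cong refl assms(1))
  ultimately show ?case using Suc by simp
qed simp

locale affine_frieze = frieze_seq +
  fixes \<delta> :: "nat \<Rightarrow> nat" and e :: nat
  assumes conn: "i < n \<Longrightarrow> j < n \<Longrightarrow> (i, j) \<in> adjacency\<^sup>*"
    and \<delta>_pos: "i < n \<Longrightarrow> \<delta> i > 0"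
    and harmonic: "i < n \<Longrightarrow> (\<Sum>j<n. a i j * \<delta> j) = 2 * \<delta> i"
    and e: "e < n" "\<delta> e = 1"
begin

definition dl :: "nat \<Rightarrow> real" where "dl t = real (\<delta> (t mod n))"

lemma dl_shift [simp]: "dl (t + n) = dl t" "dl (n + t) = dl t" "dl (t + k * n) = dl t"
  by (simp_all add: dl_def)

lemma dl_ge_1: "dl t \<ge> 1"
  using \<delta>_pos[of "t mod n"] n_pos by (simp add: dl_def Suc_le_eq)

lemma dl_pos: "dl t > 0" using dl_ge_1[of t] by linarith

lemma dl_e [simp]: "dl e = 1" using e by (simp add: dl_def)

lemma dl_harmonic: "(\<Sum>j<n. \<alpha> i j * dl j) = 2 * dl i"
proof -
  have "(\<Sum>j<n. \<alpha> i j * dl j) = real (\<Sum>j<n. a (i mod n) j * \<delta> j)" by (simp add: \<alpha>_def dl_def)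
  also have "\<dots> = 2 * dl i" using harmonic[of "i mod n"] n_pos by (simp add: dl_def)
  finally show ?thesis .
qed

lemma forcing_dl [simp]: "forcing dl t = 0"
  by (subst forcing_periodic) (simp_all add: dl_harmonic)

text \<open>
  A single term of \<open>quad_sum_of_squares\<close>, in which the second sum vanishes for \<open>d = \<delta>\<close>.
\<close>

lemma edge_bound:
  assumes "(i, j) \<in> adjacency"
  shows "(v i / dl i - v j / dl j)\<^sup>2 \<le> 4 * quad v {..<n}"
proof -
  have ij: "i < n" "j < n" "a i j > 0" using assms by (auto simp: adjacency_def)
  let ?t = "\<lambda>i j. \<alpha> i j * dl i * dl j * (v i / dl i - v j / dl j)\<^sup>2"
  have nn: "?t i j \<ge> 0" for i j using dl_pos by (intro mult_nonneg_nonneg) (auto intro: less_imp_le)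
  have "1 * (v i / dl i - v j / dl j)\<^sup>2 \<le> \<alpha> i j * dl i * dl j * (v i / dl i - v j / dl j)\<^sup>2"
  proof (intro mult_right_mono)
    have "1 * 1 * 1 \<le> \<alpha> i j * dl i * dl j"
      using ij dl_ge_1 dl_pos by (intro mult_mono) (auto simp: \<alpha>_small intro: less_imp_le)
    then show "1 \<le> \<alpha> i j * dl i * dl j" by simp
  qed simp
  also have "\<dots> \<le> (\<Sum>j<n. ?t i j)" using ij nn by (intro member_le_sum) auto
  also have "\<dots> \<le> (\<Sum>i<n. \<Sum>j<n. ?t i j)"
    using ij nn by (intro member_le_sum[of i "{..<n}" "\<lambda>i. \<Sum>j<n. ?t i j"]) (auto intro!: sum_nonneg)
  also have "\<dots> = 4 * quad v {..<n}"
    using quad_sum_of_squares[of dl v] dl_pos dl_harmonic by simp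
  finally show ?thesis by simp
qed

text \<open>
  A vector with \<open>A v = 2 v\<close> is isotropic for the Tits form, so \<open>v / \<delta>\<close> is constant along edges.
\<close>

lemma harmonic_multiple:
  assumes "\<And>i. i < n \<Longrightarrow> (\<Sum>j<n. \<alpha> i j * v j) = 2 * v i" "i < n"
  shows "v i = v e * dl i"
proof -
  have "quad v {..<n} = (\<Sum>i<n. v i * (2 * v i - (\<Sum>j<n. \<alpha> i j * v j))) / 2"
    by (simp add: quad_def right_diff_distrib sum_subtractf sum_distrib_left power2_eq_square algebra_simps
        flip: sum_divide_distrib)
  also have "\<dots> = 0" using assms(1) by simp
  finally have q: "quad v {..<n} = 0" .
  have "v i / dl i = v e / dl e" using conn[OF e(1) assms(2)]
  proof (induction rule: rtrancl_induct)
    case (step j k)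
    have "(v j / dl j - v k / dl k)\<^sup>2 \<le> 0" using edge_bound[OF step.hyps(2), of v] q by simp
    then show ?case using step.IH by simp
  qed simp
  then show ?thesis using dl_pos[of i] by (simp add: field_simps)
qed

text \<open>
  The invariant form bounds the differences of \<open>x / \<delta>\<close> along edges. As \<open>\<delta> e = 1\<close>, the multiple
  \<open>x (e + k * n)\<close> is an integer.
\<close>

lemma hom_close_to_dl:
  assumes x: "\<And>t. forcing x t = 0" "\<And>t. x t \<in> \<int>"
  shows "\<exists>B. \<forall>k. \<exists>w\<in>\<int>. \<forall>i<n. \<bar>x (i + k * n) - w * dl i\<bar> \<le> B"
proof -
  have "\<exists>c\<ge>0. \<forall>k. \<bar>x (i + k * n) / dl i - x (e + k * n)\<bar> \<le> c" if "i < n" for i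
    using conn[OF e(1) that]
  proof (induction rule: rtrancl_induct)
    case base then show ?case by (intro exI[of _ 0]) simp
  next
    case (step j l)
    then obtain c where c: "c \<ge> 0" "\<And>k. \<bar>x (j + k * n) / dl j - x (e + k * n)\<bar> \<le> c" by blast
    have "\<bar>x (l + k * n) / dl l - x (e + k * n)\<bar> \<le> c + (4 * quad x {..<n} + 1)" for k
    proof -
      let ?y = "x (j + k * n) / dl j - x (l + k * n) / dl l"
      have "?y\<^sup>2 \<le> 4 * quad x {..<n}"
        using edge_bound[OF step.hyps(2), of "\<lambda>i. x (i + k * n)"] quad_hom[OF x(1), of k] by simp
      moreover have "\<bar>?y\<bar> \<le> ?y\<^sup>2 + 1"
      proof (cases "\<bar>?y\<bar> \<le> 1")
        case False
        then have "\<bar>?y\<bar> * 1 \<le> \<bar>?y\<bar> * \<bar>?y\<bar>" by (intro mult_left_mono) auto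
        then show ?thesis by (simp add: power2_eq_square)
      qed (simp add: add_increasing)
      ultimately show ?thesis using c(2)[of k] by linarith
    qed
    moreover have "0 \<le> 4 * quad x {..<n}"
      using edge_bound[OF step.hyps(2), of x] zero_le_power2 order_trans by blast
    ultimately show ?case using c(1) by (intro exI[of _ "c + (4 * quad x {..<n} + 1)"]) auto
  qed
  then obtain c where c: "\<And>i. i < n \<Longrightarrow> c i \<ge> 0" "\<And>i k. i < n \<Longrightarrow> \<bar>x (i + k * n) / dl i - x (e + k * n)\<bar> \<le> c i" by metis
  have "\<bar>x (i + k * n) - x (e + k * n) * dl i\<bar> \<le> (\<Sum>i<n. c i * dl i)" if i: "i < n" for i k
  proof -
    have "x (i + k * n) - x (e + k * n) * dl i = (x (i + k * n) / dl i - x (e + k * n)) * dl i"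
      using dl_pos[of i] by (simp add: left_diff_distrib)
    then have "\<bar>x (i + k * n) - x (e + k * n) * dl i\<bar> = \<bar>x (i + k * n) / dl i - x (e + k * n)\<bar> * dl i"
      using dl_pos[of i] by (simp add: abs_mult)
    also have "\<dots> \<le> c i * dl i" using c(2)[OF i] dl_pos[of i] by (intro mult_right_mono) auto
    also have "\<dots> \<le> (\<Sum>i<n. c i * dl i)" using i
      by (intro member_le_sum) (auto intro!: mult_nonneg_nonneg c(1) less_imp_le[OF dl_pos])
    finally show ?thesis .
  qed
  then show ?thesis using x(2) by blast
qed

lemma impulse_zero: "t < s + n \<Longrightarrow> impulse s t = 0"
  unfolding impulse_def by (rule unique_upto[where T = t and y = "\<lambda>_. 0"]) auto

lemma window_propagation:
  assumes i: "i < n"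
  shows "y (i + n) = hom_sol y (i + n) + (\<Sum>s<n. forcing y s * impulse s (i + n))"
proof -
  have "(\<Sum>s<i + n. forcing y s * impulse s (i + n)) = (\<Sum>s<n. forcing y s * impulse s (i + n))"
    using i by (intro sum.mono_neutral_right) (auto simp: impulse_zero)
  then show ?thesis using duhamel[of "i + n" "i + n" y] by simp
qed

text \<open>
  By \<open>window_propagation\<close> an invariant functional of the windows jumps by a linear functional
  \<open>\<beta>\<close> of the forcing. Take for \<open>y\<close> the unit vector at time \<open>n + i\<close>: it vanishes on the windows
  at steps \<open>0\<close> and \<open>2\<close>, so its two jumps cancel, which says \<open>(A \<beta>) i = 2 * \<beta> i\<close>. Hence \<open>\<beta>\<close> is a
  multiple of \<open>\<delta>\<close>.
\<close>

lemma invariant_functional: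
  assumes inv: "\<And>v. (\<Sum>j<n. C j * hom_sol v (j + n)) = (\<Sum>j<n. C j * v j)"
  obtains \<kappa> where "\<And>y k. (\<Sum>j<n. C j * y (j + Suc k * n)) - (\<Sum>j<n. C j * y (j + k * n)) =
      \<kappa> * (\<Sum>s<n. forcing y (s + k * n) * dl s)"
proof -
  define \<beta> where "\<beta> s = (\<Sum>j<n. C j * impulse s (j + n))" for s
  have jump0: "(\<Sum>j<n. C j * y (j + n)) - (\<Sum>j<n. C j * y j) = (\<Sum>s<n. forcing y s * \<beta> s)" for y
  proof -
    have "(\<Sum>j<n. C j * y (j + n)) = (\<Sum>j<n. C j * hom_sol y (j + n) + (\<Sum>s<n. forcing y s * (C j * impulse s (j + n))))"
      by (intro sum.cong refl) (subst window_propagation, simp_all add: sum_distrib_left algebra_simps)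
    also have "\<dots> = (\<Sum>j<n. C j * y j) + (\<Sum>s<n. \<Sum>j<n. forcing y s * (C j * impulse s (j + n)))"
      by (simp only: sum.distrib inv) (subst sum.swap, rule refl)
    finally show ?thesis by (simp add: \<beta>_def sum_distrib_left)
  qed
  have jump: "(\<Sum>j<n. C j * y (j + Suc k * n)) - (\<Sum>j<n. C j * y (j + k * n)) = (\<Sum>s<n. forcing y (s + k * n) * \<beta> s)" for y k
    using jump0[of "\<lambda>t. y (t + k * n)"] by (simp add: forcing_shift add.assoc)
  have "(\<Sum>j<n. \<alpha> i j * \<beta> j) = 2 * \<beta> i" if i: "i < n" for i
  proof -
    define y where "y = unit (n + i)"
    have "(\<Sum>j<n. C j * y (j + Suc 1 * n)) - (\<Sum>j<n. C j * y (j + 0 * n)) = 0" using i by (simp add: y_def)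
    then have "(\<Sum>s<n. forcing y (s + 0 * n) * \<beta> s) + (\<Sum>s<n. forcing y (s + 1 * n) * \<beta> s) = 0"
      unfolding jump[symmetric] by simp
    then have 0: "(\<Sum>s<n. forcing y s * \<beta> s) + (\<Sum>s<n. forcing y (s + n) * \<beta> s) = 0" by simp
    have dsum: "(\<Sum>s\<in>{r<..<r+n}. \<alpha> r s * y s) = (if r < n + i \<and> i < r then \<alpha> r i else 0)" for r
    proof -
      have "(\<Sum>s\<in>{r<..<r+n}. \<alpha> r s * y s) = (\<Sum>s\<in>{r<..<r+n}. if s = n + i then \<alpha> r s else 0)"
        by (intro sum.cong) (auto simp: y_def)
      also have "\<dots> = (if r < n + i \<and> i < r then \<alpha> r i else 0)" by (subst sum.delta) (auto simp: add.commute)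
      finally show ?thesis .
    qed
    have f1: "forcing y s = unit i s - (if i < s then \<alpha> s i else 0)" if "s < n" for s
      using that i unfolding forcing_def dsum by (auto simp: y_def)
    have f2: "forcing y (s + n) = unit i s - (if s < i then \<alpha> s i else 0)" if "s < n" for s
      using that i unfolding forcing_def dsum by (auto simp: y_def)
    have "(\<Sum>s<n. (unit i s - (if i < s then \<alpha> s i else 0)) * \<beta> s) + (\<Sum>s<n. (unit i s - (if s < i then \<alpha> s i else 0)) * \<beta> s) = 0"
      using 0 f1 f2 by simp
    then have "(\<Sum>s<n. (unit i s - (if i < s then \<alpha> s i else 0)) * \<beta> s + (unit i s - (if s < i then \<alpha> s i else 0)) * \<beta> s) = 0"
      by (simp add: sum.distrib)
    also have "(\<Sum>s<n. (unit i s - (if i < s then \<alpha> s i else 0)) * \<beta> s + (unit i s - (if s < i then \<alpha> s i else 0)) * \<beta> s)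
        = (\<Sum>s<n. 2 * (if s = i then \<beta> s else 0) - \<alpha> i s * \<beta> s)"
      by (intro sum.cong refl) (auto simp: \<alpha>_sym[of _ i])
    also have "\<dots> = 2 * \<beta> i - (\<Sum>s<n. \<alpha> i s * \<beta> s)"
      using i by (simp add: sum_subtractf sum_distrib_left[symmetric])
    finally show ?thesis by simp
  qed
  then have "\<beta> s = \<beta> e * dl s" if "s < n" for s using harmonic_multiple[of \<beta> s] that by blast
  then have E: "(\<Sum>s<n. forcing y (s + k * n) * \<beta> s) = \<beta> e * (\<Sum>s<n. forcing y (s + k * n) * dl s)" for y k
    unfolding sum_distrib_left by (intro sum.cong refl) auto
  show thesis by (rule that[of "\<beta> e"]) (simp only: jump E)
qed

text \<open>
  The functional \<open>W\<close> from \<open>hom_quasiperiodic\<close> is invariant, because advancing by \<open>n\<close> and by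
  \<open>m * n\<close> commute. If \<open>\<kappa>\<close> were zero, then \<open>W\<close> would vanish and all homogeneous solutions would
  be periodic, so the sum \<open>C\<close> of the values at \<open>e\<close> over a period would be invariant too. The
  sequence that is zero on the first window and equal to \<open>\<delta>\<close> afterwards refutes this: \<open>C\<close> jumps
  from \<open>0\<close> to \<open>m\<close>, but the jump is a multiple of the pairing of its forcing with \<open>\<delta>\<close>, which is
  the Tits form at \<open>\<delta>\<close>, namely zero.
\<close>

lemma translation:
  obtains m W \<kappa> where "m > 0" "\<kappa> \<noteq> 0"
    "\<And>v t. hom_sol v (t + m * n) = hom_sol v t + (\<Sum>j<n. W j * v j) * dl t"
    "\<And>y k. (\<Sum>j<n. W j * y (j + Suc k * n)) - (\<Sum>j<n. W j * y (j + k * n)) =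
      \<kappa> * (\<Sum>s<n. forcing y (s + k * n) * dl s)"
proof -
  obtain m W where m: "m > 0" "\<And>v t. hom_sol v (t + m * n) = hom_sol v t + (\<Sum>j<n. W j * v j) * dl t"
    by (rule hom_quasiperiodic[of dl]) (use hom_close_to_dl in \<open>auto simp: dl_def\<close>)
  have again: "hom_sol (\<lambda>i. hom_sol v (i + n)) t = hom_sol v (t + n)" for v t
    using hom_eq_hom_sol[of "\<lambda>t. hom_sol v (t + n)" t] forcing_shift[of "hom_sol v" 1] by simp
  have inv: "(\<Sum>j<n. W j * hom_sol v (j + n)) = (\<Sum>j<n. W j * v j)" for v
  proof -
    have "hom_sol v (e + n + m * n) = hom_sol v (e + n) + (\<Sum>j<n. W j * v j) * dl (e + n)" by (rule m(2))
    moreover have "hom_sol v (e + m * n + n) = hom_sol v (e + n) + (\<Sum>j<n. W j * hom_sol v (j + n)) * dl e"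
      using m(2)[of "\<lambda>i. hom_sol v (i + n)" e] unfolding again .
    moreover have "e + n + m * n = e + m * n + n" by simp
    ultimately have "hom_sol v (e + n) + (\<Sum>j<n. W j * v j) * dl (e + n) = hom_sol v (e + n) + (\<Sum>j<n. W j * hom_sol v (j + n)) * dl e"
      by simp
    then show ?thesis by simp
  qed
  obtain \<kappa> where \<kappa>: "\<And>y k. (\<Sum>j<n. W j * y (j + Suc k * n)) - (\<Sum>j<n. W j * y (j + k * n)) =
      \<kappa> * (\<Sum>s<n. forcing y (s + k * n) * dl s)" using invariant_functional[OF inv] by blast
  have "\<kappa> \<noteq> 0"
  proof
    assume "\<kappa> = 0"
    have W0: "(\<Sum>j<n. W j * v j) = 0" for v
      using \<kappa>[of "\<lambda>t. if t < n then 0 else v (t - n)" 0] \<open>\<kappa> = 0\<close> by simp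
    have per: "hom_sol v (t + m * n) = hom_sol v t" for v t using m(2)[of v t] W0[of v] by simp
    define C where "C j = (\<Sum>k<m. hom_sol (unit j) (e + k * n))" for j
    have C: "(\<Sum>j<n. C j * v j) = (\<Sum>k<m. hom_sol v (e + k * n))" for v
      unfolding C_def hom_sol_units[of v] sum_distrib_right by (subst sum.swap) (simp add: mult.commute)
    have invC: "(\<Sum>j<n. C j * hom_sol v (j + n)) = (\<Sum>j<n. C j * v j)" for v
    proof -
      have "(\<Sum>j<n. C j * hom_sol v (j + n)) = (\<Sum>k<m. hom_sol v (e + Suc k * n))"
        unfolding C again by (simp add: algebra_simps)
      also have "\<dots> = (\<Sum>k<Suc m. hom_sol v (e + k * n)) - hom_sol v (e + 0 * n)"
        by (subst sum.lessThan_Suc_shift) simp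
      also have "\<dots> = (\<Sum>j<n. C j * v j)" unfolding C using per[of v e] by simp
      finally show ?thesis .
    qed
    obtain \<kappa>' where \<kappa>': "\<And>y k. (\<Sum>j<n. C j * y (j + Suc k * n)) - (\<Sum>j<n. C j * y (j + k * n)) =
      \<kappa>' * (\<Sum>s<n. forcing y (s + k * n) * dl s)" using invariant_functional[OF invC] by blast
    define y where "y t = (if t < n then 0 else dl t)" for t
    have Cdl: "(\<Sum>j<n. C j * dl j) = m"
    proof -
      have "hom_sol dl t = dl t" for t using hom_eq_hom_sol[of dl t] by simp
      then show ?thesis unfolding C by simp
    qed
    have fy: "forcing y s = dl s - (\<Sum>j<s. \<alpha> s j * dl j)" if s: "s < n" for s
    proof -
      have "(\<Sum>r\<in>{s<..<s+n}. \<alpha> s r * y r) = (\<Sum>r\<in>{n..<s+n}. \<alpha> s r * y r)"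
        using s by (intro sum.mono_neutral_right) (auto simp: y_def)
      also have "\<dots> = (\<Sum>j<s. \<alpha> s j * dl j)"
        by (rule sum.reindex_bij_witness[of _ "\<lambda>j. j + n" "\<lambda>r. r - n"])
          (use s in \<open>auto simp: y_def \<alpha>_def dl_def mod_if\<close>)
      finally show ?thesis using s by (simp add: forcing_def y_def)
    qed
    have "(\<Sum>s<n. forcing y s * dl s) = (\<Sum>s<n. dl s * dl s - (\<Sum>j<s. \<alpha> s j * dl s * dl j))"
      by (intro sum.cong refl) (simp add: fy left_diff_distrib sum_distrib_right sum_distrib_left algebra_simps)
    also have "\<dots> = (\<Sum>s<n. dl s * dl s) - (\<Sum>s<n. \<Sum>j<n. \<alpha> s j * dl s * dl j) / 2"
      using sum_lower_triangle[of "\<lambda>s j. \<alpha> s j * dl s * dl j" n] by (simp add: sum_subtractf \<alpha>_sym ac_simps)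
    also have "(\<Sum>s<n. \<Sum>j<n. \<alpha> s j * dl s * dl j) = (\<Sum>s<n. dl s * (\<Sum>j<n. \<alpha> s j * dl j))"
      by (simp add: sum_distrib_left ac_simps)
    also have "\<dots> = 2 * (\<Sum>s<n. dl s * dl s)" unfolding dl_harmonic by (simp add: sum_distrib_left ac_simps)
    finally have "(\<Sum>s<n. forcing y s * dl s) = 0" by simp
    then have "(\<Sum>j<n. C j * y (j + n)) - (\<Sum>j<n. C j * y j) = 0" using \<kappa>'[of y 0] by simp
    then have "real m = 0" using Cdl by (simp add: y_def)
    then show False using m(1) by simp
  qed
  then show thesis using that m \<kappa> by blast
qed

section \<open>Linear growth\<close>

context
  fixes m :: nat and W :: "nat \<Rightarrow> real" and \<kappa> :: real
  assumes m: "m > 0" and \<kappa>: "\<kappa> \<noteq> 0"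
    and quasi: "\<And>v t. hom_sol v (t + m * n) = hom_sol v t + (\<Sum>j<n. W j * v j) * dl t"
    and jumps: "\<And>y k. (\<Sum>j<n. W j * y (j + Suc k * n)) - (\<Sum>j<n. W j * y (j + k * n)) =
      \<kappa> * (\<Sum>s<n. forcing y (s + k * n) * dl s)"
begin

definition E :: "nat \<Rightarrow> real" where "E k = (\<Sum>s<n. forcing L (s + k * n) * dl s)"
definition U :: "nat \<Rightarrow> real" where "U k = (\<Sum>l<k. E l)"

lemma E_pos: "E k > 0"
  unfolding E_def using n_pos by (intro sum_pos mult_pos_pos forcing_L_pos dl_pos) auto

lemma functional_L: "(\<Sum>j<n. W j * L (j + k * n)) = \<kappa> * U k"
proof (induction k)
  case (Suc k)
  then show ?case using jumps[of L k] by (simp add: U_def E_def algebra_simps)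
qed (simp add: U_def)

definition err :: "nat \<Rightarrow> nat \<Rightarrow> real" where
  "err i k = (\<Sum>s<i + m * n. forcing L (s + k * n) * impulse s (i + m * n))"

lemma increment:
  assumes i: "i < n"
  shows "L (i + (k + m) * n) = L (i + k * n) + \<kappa> * U k * dl i + err i k"
proof -
  let ?y = "\<lambda>t. L (t + k * n)"
  have "L (i + (k + m) * n) = ?y (i + m * n)" by (simp add: algebra_simps)
  also have "\<dots> = hom_sol ?y (i + m * n) + err i k"
    using duhamel[of "i + m * n" "i + m * n" ?y] by (simp add: err_def forcing_shift)
  also have "hom_sol ?y (i + m * n) = L (i + k * n) + (\<Sum>j<n. W j * L (j + k * n)) * dl i"
    using quasi[of ?y i] i by simp
  finally show ?thesis by (simp add: functional_L)
qed

lemma err_bounded: "\<exists>C. \<forall>k. \<forall>i<n. \<bar>err i k\<bar> \<le> C"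
proof -
  define c where "c i = (\<Sum>s<i + m * n. \<bar>impulse s (i + m * n)\<bar>)" for i
  have "\<bar>err i k\<bar> \<le> (\<Sum>i<n. c i)" if i: "i < n" for i k
  proof -
    have "\<bar>err i k\<bar> \<le> (\<Sum>s<i + m * n. \<bar>forcing L (s + k * n) * impulse s (i + m * n)\<bar>)" unfolding err_def by (rule sum_abs)
    also have "\<dots> \<le> (\<Sum>s<i + m * n. 1 * \<bar>impulse s (i + m * n)\<bar>)"
    proof (rule sum_mono)
      fix s
      have "\<bar>forcing L (s + k * n)\<bar> \<le> 1" using forcing_L_pos[of "s + k * n"] forcing_L_le_1[of "s + k * n"] by linarith
      then show "\<bar>forcing L (s + k * n) * impulse s (i + m * n)\<bar> \<le> 1 * \<bar>impulse s (i + m * n)\<bar>"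
        unfolding abs_mult by (rule mult_right_mono) simp
    qed
    also have "\<dots> = c i" by (simp add: c_def)
    also have "\<dots> \<le> (\<Sum>i<n. c i)" using i by (intro member_le_sum) (auto simp: c_def intro!: sum_nonneg)
    finally show ?thesis .
  qed
  then show ?thesis by blast
qed

lemma err_bigo:
  assumes "0 < q" "\<And>t. (\<lambda>k. forcing L (t + k * n)) \<in> O(\<lambda>k. q ^ k)"
  shows "err i \<in> O(\<lambda>k. q ^ k)"
  unfolding err_def[abs_def] by (intro big_sum_in_bigo) (use assms in \<open>auto intro!: landau_o.big.mult_in_1 simp: mult.commute cmult_in_bigo_iff\<close>)

text \<open>
  A steady decline would make \<open>L\<close> negative.
\<close>

lemma no_decline:
  assumes "c > 0" shows "\<not> (\<forall>k\<ge>k0. L (e + (k + m) * n) \<le> L (e + k * n) - c)"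
proof
  assume a: "\<forall>k\<ge>k0. L (e + (k + m) * n) \<le> L (e + k * n) - c"
  have "L (e + (k0 + l * m) * n) \<le> L (e + k0 * n) - l * c" for l
  proof (induction l)
    case (Suc l)
    have "k0 + Suc l * m = (k0 + l * m) + m" by simp
    then show ?case using a[rule_format, of "k0 + l * m"] Suc by (simp add: algebra_simps)
  qed simp
  moreover obtain l :: nat where "L (e + k0 * n) < l * c" using reals_Archimedean3[OF assms] by blast
  ultimately show False using L_nonneg by (meson diff_less_0_iff_less leD le_less_trans)
qed

text \<open>
  Steady growth makes the window sums grow linearly, and the forcing is at most the exponential
  of minus the window sum.
\<close>

lemma growth_imp_decay:
  assumes c: "c > 0" and a: "\<And>k i. k \<ge> k0 \<Longrightarrow> i < n \<Longrightarrow> L (i + (k + m) * n) \<ge> L (i + k * n) + c"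
  obtains q C where "0 < q" "q < 1" "C > 0" "\<And>i k. i < n \<Longrightarrow> forcing L (i + k * n) \<le> C * q ^ k"
proof -
  define b where "b k = c * ((real k - real k0) / m - 1)" for k
  have lower: "L (i + k * n) \<ge> b k" if i: "i < n" for i k
  proof (induction k rule: less_induct)
    case (less k)
    show ?case
    proof (cases "k < k0 + m")
      case True
      then have "(real k - real k0) / m \<le> 1" using m by (simp add: divide_le_eq)
      then have "b k \<le> 0" using c by (simp add: b_def mult_le_0_iff)
      then show ?thesis using L_nonneg[of "i + k * n"] by linarith
    next
      case False
      define l where "l = k - m"
      have l: "k = l + m" "l \<ge> k0" "l < k" using False m by (auto simp: l_def)
      have "b k = b l + c" using m by (simp add: b_def l(1) field_simps)
      then show ?thesis using less[OF l(3)] a[OF l(2) i] by (simp add: l(1))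
    qed
  qed
  define q where "q = exp (- (c / m))"
  define C where "C = exp (c * (real k0 / m + 1))"
  have bq: "exp (- b k) = C * q ^ k" for k
  proof -
    have eq: "- b k = c * (real k0 / m + 1) + real k * (- (c / m))" using m by (simp add: b_def field_simps)
    show ?thesis unfolding eq exp_add C_def q_def by (simp only: exp_of_nat_mult)
  qed
  have "forcing L (i + k * n) \<le> C * q ^ k" if i: "i < n" for i k
  proof -
    have "(\<Sum>j<n. a i j * \<delta> j) \<noteq> 0" using harmonic[OF i] \<delta>_pos[OF i] by simp
    then obtain j where j: "j < n" "a i j > 0" by (metis (no_types, lifting) gr0I lessThan_iff mult_0 sum.neutral)
    have ij: "i \<noteq> j" using j a_diag by (metis less_irrefl)
    define l where "l = (if i < j then k else Suc k)"
    define s where "s = j + l * n"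
    have s: "s \<in> {i + k * n<..<i + k * n + n}" using i j ij by (auto simp: s_def l_def)
    have "b k \<le> b l" using m c by (auto simp: b_def l_def divide_right_mono)
    also have "\<dots> \<le> L s" unfolding s_def by (rule lower[OF j(1)])
    also have "\<dots> \<le> \<alpha> (i + k * n) s * L s"
    proof -
      have "\<alpha> (i + k * n) s \<ge> 1" using i j by (simp add: s_def \<alpha>_small)
      then have "1 * L s \<le> \<alpha> (i + k * n) s * L s" by (intro mult_right_mono L_nonneg)
      then show ?thesis by simp
    qed
    also have "\<dots> \<le> (\<Sum>s\<in>{i + k * n<..<i + k * n + n}. \<alpha> (i + k * n) s * L s)"
      using s by (intro member_le_sum) (auto intro!: mult_nonneg_nonneg L_nonneg)
    finally have "exp (- (\<Sum>s\<in>{i + k * n<..<i + k * n + n}. \<alpha> (i + k * n) s * L s)) \<le> exp (- b k)" by simp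
    then show ?thesis using forcing_L_le_exp[of "i + k * n"] unfolding bq by linarith
  qed
  moreover have "0 < q" "q < 1" "C > 0" using c m by (auto simp: q_def C_def)
  ultimately show thesis using that by blast
qed

lemma decay_imp_E: 
  assumes "0 < q" "q < 1" "C > 0" "\<And>i k. i < n \<Longrightarrow> forcing L (i + k * n) \<le> C * q ^ k"
  shows "E k \<le> C * (\<Sum>s<n. dl s) * q ^ k"
proof -
  have "E k \<le> (\<Sum>s<n. C * q ^ k * dl s)" unfolding E_def
    using assms dl_pos by (intro sum_mono mult_right_mono) (auto intro: less_imp_le)
  then show ?thesis by (simp add: sum_distrib_left algebra_simps)
qed

text \<open>
  If \<open>U\<close> is unbounded, \<open>\<kappa> * U\<close> dominates the increments of \<open>L\<close> over \<open>m\<close> steps. For \<open>\<kappa> < 0\<close> this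
  is a steady decline; for \<open>\<kappa> > 0\<close> it is steady growth, which makes the forcing decay
  geometrically and hence bounds its sum \<open>U\<close>.
\<close>

lemma U_bounded: "\<exists>B. \<forall>k. U k \<le> B"
proof (rule ccontr)
  assume nb: "\<not> (\<exists>B. \<forall>k. U k \<le> B)"
  have mono: "U k \<le> U l" if "k \<le> l" for k l
    unfolding U_def using that by (intro sum_mono2) (auto intro: less_imp_le[OF E_pos])
  have large: "\<exists>k0. \<forall>k\<ge>k0. U k > B" for B using nb mono by (meson not_le order_trans)
  obtain C where C: "\<And>k i. i < n \<Longrightarrow> \<bar>err i k\<bar> \<le> C" using err_bounded by blast
  obtain k0 where k0: "\<And>k. k \<ge> k0 \<Longrightarrow> U k > (\<bar>C\<bar> + 1) / \<bar>\<kappa>\<bar>" using large by blast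
  have big: "\<bar>\<kappa>\<bar> * U k * dl i \<ge> \<bar>C\<bar> + 1" if "k \<ge> k0" for k i
  proof -
    have "\<bar>C\<bar> + 1 \<le> \<bar>\<kappa>\<bar> * U k" using k0[OF that] \<kappa> by (simp add: field_simps)
    also have "\<dots> = \<bar>\<kappa>\<bar> * U k * 1" by simp
    also have "\<dots> \<le> \<bar>\<kappa>\<bar> * U k * dl i"
      using dl_ge_1[of i] calculation by (intro mult_left_mono) auto
    finally show ?thesis .
  qed
  show False
  proof (cases "\<kappa> < 0")
    case True
    have "\<forall>k\<ge>k0. L (e + (k + m) * n) \<le> L (e + k * n) - 1"
    proof (intro allI impI)
      fix k assume "k \<ge> k0"
      then show "L (e + (k + m) * n) \<le> L (e + k * n) - 1"
        using big[of k e] increment[OF e(1), of k] C[OF e(1), of k] True by simp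
    qed
    then show False using no_decline[of 1 k0] by simp
  next
    case False
    have "L (i + (k + m) * n) \<ge> L (i + k * n) + 1" if "k \<ge> k0" "i < n" for k i
      using big[OF that(1), of i] increment[OF that(2), of k] C[OF that(2), of k] False by simp
    note g = this
    obtain q C' where q: "0 < q" "q < 1" "C' > 0" "\<And>i k. i < n \<Longrightarrow> forcing L (i + k * n) \<le> C' * q ^ k"
      by (rule growth_imp_decay[of 1 k0]) (use g in auto)
    have "U k \<le> C' * (\<Sum>s<n. dl s) / (1 - q)" for k
    proof -
      have "U k \<le> (\<Sum>l<k. C' * (\<Sum>s<n. dl s) * q ^ l)" unfolding U_def by (intro sum_mono decay_imp_E[OF q])
      also have "\<dots> = C' * (\<Sum>s<n. dl s) * ((1 - q ^ k) / (1 - q))"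
        using q by (simp add: sum_distrib_left[symmetric] sum_gp_strict)
      also have "\<dots> \<le> C' * (\<Sum>s<n. dl s) * (1 / (1 - q))"
        using q dl_pos by (intro mult_left_mono divide_right_mono mult_nonneg_nonneg sum_nonneg) (auto intro: less_imp_le)
      finally show ?thesis by simp
    qed
    then show False using nb by blast
  qed
qed

text \<open>
  Since \<open>U\<close> increases to a limit, the forcing tends to zero and the increments over \<open>m\<close> steps
  tend to \<open>\<eta> * \<delta>\<close>. Here \<open>\<eta> < 0\<close> is excluded by \<open>no_decline\<close>, and \<open>\<eta> = 0\<close> by \<open>\<kappa> \<noteq> 0\<close> and \<open>U > 0\<close>.
  By \<open>growth_imp_decay\<close> the convergence is geometric, so the deviations from linear growth are
  bounded.
\<close>

lemma linear_growth:
  obtains \<eta> where "\<eta> > 0" "(\<lambda>k. \<kappa> * U k) \<longlonglongrightarrow> \<eta>"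
    "\<And>t. (\<lambda>k. L (t + k * (m * n)) - k * \<eta> * dl t) \<in> O(\<lambda>_. 1)"
proof -
  have "incseq U" unfolding incseq_def U_def by (auto intro!: sum_mono2 less_imp_le[OF E_pos])
  then obtain u where u: "U \<longlonglongrightarrow> u" "\<And>k. U k \<le> u" using U_bounded by (metis incseq_convergent)
  have "u > 0" using u(2)[of 1] E_pos[of 0] by (simp add: U_def)
  define \<eta> where "\<eta> = \<kappa> * u"
  have lim: "(\<lambda>k. \<kappa> * U k) \<longlonglongrightarrow> \<eta>" unfolding \<eta>_def by (intro tendsto_intros u)
  have \<eta>0: "\<eta> \<noteq> 0" using \<open>u > 0\<close> \<kappa> by (simp add: \<eta>_def)
  have E0: "E \<longlonglongrightarrow> 0"
  proof -
    have "(\<lambda>k. U (Suc k) - U k) \<longlonglongrightarrow> u - u" by (intro tendsto_diff u LIMSEQ_Suc)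
    then show ?thesis by (simp add: U_def)
  qed
  have F0: "(\<lambda>k. forcing L (s + k * n)) \<longlonglongrightarrow> 0" for s
  proof -
    have "forcing L (s + k * n) \<le> E (k + s div n)" for k
    proof -
      have "s + k * n = s mod n + (k + s div n) * n" by (simp add: algebra_simps)
      moreover have "forcing L (s mod n + (k + s div n) * n) * 1 \<le> forcing L (s mod n + (k + s div n) * n) * dl (s mod n)"
        by (intro mult_left_mono dl_ge_1 less_imp_le[OF forcing_L_pos])
      moreover have "forcing L (s mod n + (k + s div n) * n) * dl (s mod n) \<le> E (k + s div n)"
        unfolding E_def using n_pos
        by (intro member_le_sum[of "s mod n" "{..<n}" "\<lambda>i. forcing L (i + (k + s div n) * n) * dl i"])
           (auto intro!: mult_nonneg_nonneg less_imp_le[OF forcing_L_pos] less_imp_le[OF dl_pos])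
      ultimately show ?thesis by simp
    qed
    then show ?thesis
      by (intro tendsto_sandwich[OF _ _ tendsto_const LIMSEQ_ignore_initial_segment[OF E0, of "s div n"]])
         (auto intro!: always_eventually less_imp_le[OF forcing_L_pos])
  qed
  have err0: "err i \<longlonglongrightarrow> 0" for i
  proof -
    have "(\<lambda>k. \<Sum>s<i + m * n. forcing L (s + k * n) * impulse s (i + m * n)) \<longlonglongrightarrow> (\<Sum>s<i + m * n. 0 * impulse s (i + m * n))"
      by (intro tendsto_intros F0)
    then show ?thesis by (simp add: err_def[abs_def])
  qed
  have inc: "(\<lambda>k. L (i + (k + m) * n) - L (i + k * n)) \<longlonglongrightarrow> \<eta> * dl i" if "i < n" for i
  proof -
    have "(\<lambda>k. \<kappa> * U k * dl i + err i k) \<longlonglongrightarrow> \<eta> * dl i + 0" by (intro tendsto_intros lim err0)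
    then show ?thesis using increment[OF that] by simp
  qed
  have "\<not> \<eta> < 0"
  proof
    assume neg: "\<eta> < 0"
    have "(\<lambda>k. L (e + (k + m) * n) - L (e + k * n)) \<longlonglongrightarrow> \<eta>" using inc[OF e(1)] by simp
    then have "\<forall>\<^sub>F k in sequentially. L (e + (k + m) * n) - L (e + k * n) < \<eta> / 2"
      using neg by (intro order_tendstoD) auto
    then obtain k0 where "\<And>k. k \<ge> k0 \<Longrightarrow> L (e + (k + m) * n) - L (e + k * n) < \<eta> / 2"
      by (auto simp: eventually_sequentially)
    then have "L (e + (k + m) * n) \<le> L (e + k * n) - (- \<eta> / 2)" if "k \<ge> k0" for k using that by fastforce
    then show False using no_decline[of "- \<eta> / 2" k0] neg by auto
  qed
  then have \<eta>: "\<eta> > 0" using \<eta>0 by simp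
  have "\<forall>\<^sub>F k in sequentially. \<forall>i\<in>{..<n}. L (i + (k + m) * n) - L (i + k * n) > \<eta> / 2"
  proof (intro eventually_ball_finite ballI)
    fix i assume "i \<in> {..<n}"
    then have "(\<lambda>k. L (i + (k + m) * n) - L (i + k * n)) \<longlonglongrightarrow> \<eta> * dl i" by (intro inc) auto
    moreover have "\<eta> / 2 < \<eta> * dl i"
    proof -
      have "\<eta> * 1 \<le> \<eta> * dl i" using \<eta> dl_ge_1 by (intro mult_left_mono) auto
      then show ?thesis using \<eta> by linarith
    qed
    ultimately show "\<forall>\<^sub>F k in sequentially. L (i + (k + m) * n) - L (i + k * n) > \<eta> / 2" by (intro order_tendstoD)
  qed simp
  then obtain k0 where k0: "\<And>k i. k \<ge> k0 \<Longrightarrow> i < n \<Longrightarrow> L (i + (k + m) * n) - L (i + k * n) > \<eta> / 2"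
    by (auto simp: eventually_sequentially)
  have "L (i + (k + m) * n) \<ge> L (i + k * n) + \<eta> / 2" if "k \<ge> k0" "i < n" for k i using k0[OF that] by linarith
  note g = this
  obtain q C where q: "0 < q" "q < 1" "C > 0" "\<And>i k. i < n \<Longrightarrow> forcing L (i + k * n) \<le> C * q ^ k"
    by (rule growth_imp_decay[of "\<eta> / 2" k0]) (use g \<eta> in auto)
  have Fq: "(\<lambda>k. forcing L (t + k * n)) \<in> O(\<lambda>k. q ^ k)" for t
  proof (rule bigoI[of _ C], rule always_eventually, rule allI)
    fix k
    have "t + k * n = t mod n + (k + t div n) * n" by (simp add: algebra_simps)
    then have "forcing L (t + k * n) \<le> C * q ^ (k + t div n)" using q(4)[of "t mod n" "k + t div n"] n_pos by simp
    also have "\<dots> \<le> C * q ^ k" using q by (intro mult_left_mono power_decreasing) auto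
    finally show "norm (forcing L (t + k * n)) \<le> C * norm (q ^ k)" using forcing_L_pos[of "t + k * n"] q by simp
  qed
  have errq: "err i \<in> O(\<lambda>k. q ^ k)" for i by (rule err_bigo[OF q(1) Fq])
  have Uq: "(\<lambda>k. \<kappa> * U k - \<eta>) \<in> O(\<lambda>k. q ^ k)"
  proof -
    have "(\<lambda>k. \<kappa> * U (Suc k) - \<kappa> * U k) \<in> O(\<lambda>k. q ^ k)"
    proof -
      have "(\<lambda>k. \<kappa> * (\<Sum>s<n. forcing L (s + k * n) * dl s)) \<in> O(\<lambda>k. q ^ k)"
        unfolding cmult_in_bigo_iff by (intro disjI2 big_sum_in_bigo) (simp add: mult.commute[of _ "dl _"] cmult_in_bigo_iff Fq)
      then show ?thesis by (simp add: U_def E_def algebra_simps)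
    qed
    then obtain c where c: "(\<lambda>k. \<kappa> * U k - c) \<in> O(\<lambda>k. q ^ k)" using geometric_increments[of q "\<lambda>k. \<kappa> * U k"] q by blast
    have "(\<lambda>k. q ^ k) \<in> o(\<lambda>_. 1)" using q LIMSEQ_realpow_zero[of q] by (intro smalloI_tendsto) auto
    then have "(\<lambda>k. \<kappa> * U k - c) \<in> o(\<lambda>_. 1)" using c by (rule landau_o.big_small_trans[rotated])
    then have "(\<lambda>k. \<kappa> * U k - c) \<longlonglongrightarrow> 0" by (auto dest: smalloD_tendsto)
    then have "(\<lambda>k. \<kappa> * U k) \<longlonglongrightarrow> c" by (simp add: LIM_zero_iff)
    then have "c = \<eta>" using lim LIMSEQ_unique by blast
    then show ?thesis using c by simp
  qed
  have "(\<lambda>k. L (t + k * (m * n)) - k * \<eta> * dl t) \<in> O(\<lambda>_. 1)" for t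
  proof -
    define i k' where "i = t mod n" and "k' = t div n"
    have i: "i < n" "t = i + k' * n" using n_pos by (auto simp: i_def k'_def)
    define d where "d k = L (t + k * (m * n)) - k * \<eta> * dl t" for k :: nat
    have step: "d (Suc k) - d k = (\<kappa> * U (k' + k * m) - \<eta>) * dl i + err i (k' + k * m)" for k
    proof -
      have e1: "t + Suc k * (m * n) = i + ((k' + k * m) + m) * n" and e2: "t + k * (m * n) = i + (k' + k * m) * n"
        by (simp_all add: i(2) algebra_simps)
      have "dl t = dl i" by (simp add: i(2))
      then show ?thesis unfolding d_def e1 e2 increment[OF i(1)] by (simp add: algebra_simps)
    qed
    have sub: "filterlim (\<lambda>k. k' + k * m) at_top sequentially"
      using m by (intro filterlim_at_top_mono[OF filterlim_ident]) (auto intro!: always_eventually simp: trans_le_add2)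
    have qs: "(\<lambda>k. q ^ (k' + k * m)) \<in> O(\<lambda>k. q ^ k)"
      using q m by (intro bigoI[of _ 1] always_eventually) (auto intro!: power_decreasing simp: trans_le_add2)
    have "(\<lambda>k. (\<kappa> * U (k' + k * m) - \<eta>) * dl i) \<in> O(\<lambda>k. q ^ k)"
      using landau_o.big_trans[OF landau_o.big.compose[OF Uq sub] qs] by (simp add: mult.commute[of _ "dl i"] cmult_in_bigo_iff)
    moreover have "(\<lambda>k. err i (k' + k * m)) \<in> O(\<lambda>k. q ^ k)"
      using landau_o.big_trans[OF landau_o.big.compose[OF errq sub] qs] .
    ultimately have "(\<lambda>k. d (Suc k) - d k) \<in> O(\<lambda>k. q ^ k)" unfolding step by (rule sum_in_bigo)
    then obtain c where c: "(\<lambda>k. d k - c) \<in> O(\<lambda>k. q ^ k)" using geometric_increments[of q d] q by blast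
    have "(\<lambda>k. q ^ k) \<in> O(\<lambda>_. 1)" using q by (intro bigoI[of _ 1] always_eventually) (auto intro: power_le_one)
    with c have "(\<lambda>k. d k - c) \<in> O(\<lambda>_. 1)" by (rule landau_o.big_trans)
    then have "(\<lambda>k. (d k - c) + c) \<in> O(\<lambda>_. 1)" by (rule sum_in_bigo(1)) simp
    then show ?thesis by (simp add: d_def)
  qed
  then show thesis using that \<eta> lim by blast
qed

section \<open>Full asymptotic expansions\<close>

context
  fixes \<eta> w :: real and dev :: "nat \<Rightarrow> nat \<Rightarrow> real"
  assumes \<eta>: "\<eta> > 0" and lim: "(\<lambda>k. \<kappa> * U k) \<longlonglongrightarrow> \<eta>"
    and bounded: "\<And>t. dev t \<in> O(\<lambda>_. 1)"
    and dev_def: "\<And>t k. dev t k = L (t + k * (m * n)) - real k * \<eta> * dl t" and w_def: "w = exp (- 2 * \<eta>)"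
begin

lemma w01: "0 < w" "w < 1" using \<eta> by (auto simp: w_def)

lemma L_eq: "L (t + k * (m * n)) = real k * \<eta> * dl t + dev t k"
  by (simp add: dev_def)

text \<open>
  The window sum of \<open>\<delta>\<close> at \<open>t\<close> is \<open>2 * \<delta> t\<close>, which is where \<open>w = exp (- 2 * \<eta>)\<close> comes from. One
  factor \<open>w ^ k\<close> is split off because it is the gain in precision in \<open>expansion_step\<close>.
\<close>

lemma exponential_window:
  "exp (- (\<Sum>s\<in>{t + k * (m * n)<..<t + k * (m * n) + n}. \<alpha> (t + k * (m * n)) s * L s)) =
   w ^ k * ((w ^ k) ^ (\<delta> (t mod n) - 1) * exp (- (\<Sum>s\<in>{t<..<t+n}. \<alpha> t s * dev s k)))"
proof -
  let ?M = "m * n"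
  have sh: "\<alpha> (t + k * ?M) s = \<alpha> t s" "\<alpha> t (s + k * ?M) = \<alpha> t s" for s
    by (simp_all only: mult.assoc[symmetric] \<alpha>_shifts)
  have "(\<Sum>s\<in>{t + k * ?M<..<t + k * ?M + n}. h s) = (\<Sum>s\<in>{t<..<t+n}. h (s + k * ?M))" for h :: "nat \<Rightarrow> real"
    by (rule sum.reindex_bij_witness[of _ "\<lambda>s. s + k * ?M" "\<lambda>s. s - k * ?M"]) auto
  then have "(\<Sum>s\<in>{t + k * ?M<..<t + k * ?M + n}. \<alpha> (t + k * ?M) s * L s) = (\<Sum>s\<in>{t<..<t+n}. \<alpha> t s * (real k * \<eta> * dl s + dev s k))"
    by (simp only: sh L_eq)
  also have "\<dots> = real k * \<eta> * (\<Sum>s\<in>{t<..<t+n}. \<alpha> t s * dl s) + (\<Sum>s\<in>{t<..<t+n}. \<alpha> t s * dev s k)"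
    by (simp add: sum.distrib sum_distrib_left algebra_simps)
  also have "(\<Sum>s\<in>{t<..<t+n}. \<alpha> t s * dl s) = 2 * dl t"
    using forcing_dl[of t] by (simp add: forcing_def)
  finally have eq: "(\<Sum>s\<in>{t + k * ?M<..<t + k * ?M + n}. \<alpha> (t + k * ?M) s * L s) = real k * \<eta> * (2 * dl t) + (\<Sum>s\<in>{t<..<t+n}. \<alpha> t s * dev s k)" .
  have pos: "\<delta> (t mod n) = Suc (\<delta> (t mod n) - 1)" using \<delta>_pos[of "t mod n"] n_pos by simp
  have "exp (- (real k * \<eta> * (2 * dl t))) = exp (real (k * \<delta> (t mod n)) * (- 2 * \<eta>))"
    by (simp add: dl_def)
  also have "\<dots> = w ^ (k * \<delta> (t mod n))" unfolding w_def by (rule exp_of_nat_mult)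
  also have "\<dots> = (w ^ k) ^ Suc (\<delta> (t mod n) - 1)" using pos by (simp add: power_mult)
  finally show ?thesis unfolding eq minus_add_distrib exp_add by (simp add: mult.assoc)
qed

text \<open>
  The forcing is \<open>ln (1 + w ^ k * b)\<close> with \<open>b\<close> known to order \<open>N\<close>, so it is known to order
  \<open>N + 1\<close>. The sequence \<open>\<kappa> * U\<close> is its discrete integral and the deviation \<open>dev\<close> is a discrete
  integral of \<open>\<kappa> * U - \<eta>\<close> and of the forcing.
\<close>

lemma expansion_step:
  assumes N: "\<And>t. expands w N (dev t)"
  shows "expands w (Suc N) (dev t)"
proof -
  define v where "v t k = exp (- (\<Sum>s\<in>{t + k * (m * n)<..<t + k * (m * n) + n}. \<alpha> (t + k * (m * n)) s * L s))" for t k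
  define b where "b t k = (w ^ k) ^ (\<delta> (t mod n) - 1) * exp (- (\<Sum>s\<in>{t<..<t+n}. \<alpha> t s * dev s k))" for t k
  have v: "v t k = w ^ k * b t k" for t k unfolding v_def b_def by (rule exponential_window)
  have b: "expands w N (b t)" for t
  proof -
    have "expands w N (\<lambda>k. exp ((-1) * (\<Sum>s\<in>{t<..<t+n}. \<alpha> t s * dev s k)))"
      by (intro expands_exp expands_cmult expands_sum N w01)
    moreover have "expands w N (\<lambda>k. (w ^ k) ^ d)" for d
      unfolding expands_def by (intro exI[of _ "[:0, 1:] ^ d"]) (simp add: poly_power)
    ultimately show ?thesis unfolding b_def using expands_mult[OF w01] by simp
  qed
  have vO: "v t \<in> O(\<lambda>k. w ^ k)" for t
  proof -
    have "(\<lambda>k. w ^ k * b t k) \<in> O(\<lambda>k. w ^ k * 1)"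
      by (rule landau_o.big.mult[OF landau_o.big_refl expands_bounded[OF w01 b]])
    then show ?thesis by (simp add: v[abs_def])
  qed
  have vE: "expands w (Suc N) (v t)" for t
    using expands_times_w[OF w01 b[of t], of 1] by (simp add: v[abs_def])
  define F where "F t k = forcing L (t + k * (m * n))" for t k
  have F: "F t k = ln (1 + v t k)" for t k by (simp add: F_def v_def forcing_L)
  have FE: "expands w (Suc N) (F t)" for t
    using expands_ln_1_plus[OF w01 vE vO] by (simp add: F[abs_def])
  have w0: "(\<lambda>k. w ^ k) \<in> o(\<lambda>_. 1)" using w_tendsto[OF w01] by (intro smalloI_tendsto) auto
  have F0: "(\<lambda>k. F t k) \<longlonglongrightarrow> 0" for t
  proof -
    have "v t \<in> o(\<lambda>_. 1)" using vO w0 by (rule landau_o.big_small_trans)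
    then have v0: "v t \<longlonglongrightarrow> 0" by (auto dest: smalloD_tendsto)
    have "(\<lambda>k. ln (1 + v t k)) \<longlonglongrightarrow> ln (1 + 0)" by (intro tendsto_intros v0) simp
    then show ?thesis by (simp add: F)
  qed
  define i k' where "i = t mod n" and "k' = t div n"
  have i: "i < n" "t = i + k' * n" using n_pos by (auto simp: i_def k'_def)
  define Uc where "Uc k = \<kappa> * U (k' + k * m)" for k
  have UcS: "Uc (Suc k) - Uc k = (\<Sum>j<m. \<Sum>s<n. (\<kappa> * dl s) * F (s + (k' + j) * n) k)" for k
  proof -
    have e: "(\<Sum>j<a + b. E j) - (\<Sum>j<a. E j) = (\<Sum>j<b. E (a + j))" for a b
      by (induction b) (simp_all)
    have "U (k' + Suc k * m) - U (k' + k * m) = (\<Sum>j<m. E (k' + k * m + j))"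
      unfolding U_def e[symmetric] by (simp add: algebra_simps)
    also have "\<dots> = (\<Sum>j<m. \<Sum>s<n. F (s + (k' + j) * n) k * dl s)"
      unfolding E_def F_def by (simp add: algebra_simps)
    finally show ?thesis by (simp add: Uc_def right_diff_distrib[symmetric] sum_distrib_left algebra_simps)
  qed
  have sub: "filterlim (\<lambda>k. k' + k * m) at_top sequentially"
    using m by (intro filterlim_at_top_mono[OF filterlim_ident]) (auto intro!: always_eventually simp: trans_le_add2)
  have Uclim: "Uc \<longlonglongrightarrow> \<eta>" using filterlim_compose[OF lim sub] by (simp add: Uc_def[abs_def])
  have UcE: "expands w (Suc N) Uc"
  proof (rule expands_increments[OF w01])
    show "expands w (Suc N) (\<lambda>k. Uc (Suc k) - Uc k)" unfolding UcS
      by (intro expands_sum expands_cmult FE w01)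
    have "(\<lambda>k. Uc (Suc k) - Uc k) \<longlonglongrightarrow> \<eta> - \<eta>" by (intro tendsto_diff LIMSEQ_Suc Uclim)
    then show "(\<lambda>k. Uc (Suc k) - Uc k) \<longlonglongrightarrow> 0" by simp
  qed simp
  have inc: "dev t (Suc k) - dev t k = (Uc k - \<eta>) * dl i + (\<Sum>s<i + m * n. F (s + k' * n) k * impulse s (i + m * n))" for k
  proof -
    have e1: "t + Suc k * (m * n) = i + ((k' + k * m) + m) * n" and e2: "t + k * (m * n) = i + (k' + k * m) * n"
      by (simp_all add: i(2) algebra_simps)
    have "dl t = dl i" by (simp add: i(2))
    moreover have "err i (k' + k * m) = (\<Sum>s<i + m * n. F (s + k' * n) k * impulse s (i + m * n))"
      unfolding err_def F_def by (simp add: algebra_simps)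
    ultimately show ?thesis unfolding dev_def e1 e2 increment[OF i(1)] by (simp add: Uc_def algebra_simps)
  qed
  show ?thesis
  proof (rule expands_increments[OF w01])
    have "expands w (Suc N) (\<lambda>k. dl i * (Uc k - \<eta>) + (\<Sum>s<i + m * n. impulse s (i + m * n) * F (s + k' * n) k))"
      by (intro expands_add expands_cmult expands_diff expands_sum expands_const UcE FE w01)
    then show "expands w (Suc N) (\<lambda>k. dev t (Suc k) - dev t k)" unfolding inc by (simp add: mult.commute)
    have "(\<lambda>k. (Uc k - \<eta>) * dl i + (\<Sum>s<i + m * n. F (s + k' * n) k * impulse s (i + m * n))) \<longlonglongrightarrow>
        (\<eta> - \<eta>) * dl i + (\<Sum>s<i + m * n. 0 * impulse s (i + m * n))"
      by (intro tendsto_intros Uclim F0)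
    then show "(\<lambda>k. dev t (Suc k) - dev t k) \<longlonglongrightarrow> 0" unfolding inc by simp
  qed simp
qed

lemma expansion: "expands w N (dev t)"
proof (induction N arbitrary: t)
  case 0 show ?case using bounded by (intro expands_0 w01)
next
  case (Suc N) show ?case by (rule expansion_step[OF Suc])
qed

lemma g_form: "g (t + k * (m * n)) = exp \<eta> ^ (k * \<delta> (t mod n)) * exp (dev t k)"
proof -
  have "g (t + k * (m * n)) = exp (real (k * \<delta> (t mod n)) * \<eta>) * exp (dev t k)"
    unfolding g_exp L_eq exp_add by (simp add: dl_def ac_simps)
  then show ?thesis by (simp only: exp_of_nat_mult)
qed

text \<open>
  At the vertex \<open>e\<close>, where \<open>\<delta>\<close> is \<open>1\<close>, the values of \<open>g\<close> are integers with leading term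
  \<open>C * exp \<eta> ^ k\<close> and relative error of order \<open>exp (- 2 * \<eta>) ^ k\<close>.
\<close>

lemma integral_parameter: "\<exists>(K::int) (c::int). c \<in> {0::int, 1} \<and> ((exp \<eta>)\<^sup>2)\<^sup>2 - K * (exp \<eta>)\<^sup>2 + c = 0"
proof -
  obtain c where c: "(\<lambda>k. dev e k - c) \<in> O(\<lambda>k. w ^ k)"
    using expands_leading[OF w01 expansion[of 1 e]] by auto
  obtain C where C: "(\<lambda>k. exp (dev e k) - C) \<in> O(\<lambda>k. w ^ k)"
    using expands_leading[OF w01 expands_exp[OF w01 expansion[of 1 e]]] by auto
  have w0: "(\<lambda>k. w ^ k) \<in> o(\<lambda>_. 1)" using w_tendsto[OF w01] by (intro smalloI_tendsto) auto
  have "(\<lambda>k. exp (dev e k) - C) \<in> o(\<lambda>_. 1)" using C w0 by (rule landau_o.big_small_trans)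
  then have "(\<lambda>k. (exp (dev e k) - C) / 1) \<longlonglongrightarrow> 0" by (rule smalloD_tendsto)
  then have l1: "(\<lambda>k. exp (dev e k)) \<longlonglongrightarrow> C" by (simp add: LIM_zero_iff)
  have "(\<lambda>k. dev e k - c) \<in> o(\<lambda>_. 1)" using c w0 by (rule landau_o.big_small_trans)
  then have "(\<lambda>k. (dev e k - c) / 1) \<longlonglongrightarrow> 0" by (rule smalloD_tendsto)
  then have "dev e \<longlonglongrightarrow> c" by (simp add: LIM_zero_iff)
  then have "(\<lambda>k. exp (dev e k)) \<longlonglongrightarrow> exp c" by (intro tendsto_intros)
  then have "C = exp c" using l1 LIMSEQ_unique by blast
  then have Cpos: "C > 0" by simp
  define a' where "a' k = \<lfloor>g (e + k * (m * n))\<rfloor>" for k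
  have a': "real_of_int (a' k) = g (e + k * (m * n))" for k
    using g_integer[of "e + k * (m * n)"] by (auto simp: a'_def elim: Ints_cases)
  have wk: "exp \<eta> ^ k * w ^ k = (1 / exp \<eta>) ^ k" for k
  proof -
    have "exp \<eta> * w = 1 / exp \<eta>" by (simp add: w_def exp_minus[symmetric] exp_add[symmetric] divide_inverse)
    then show ?thesis by (metis power_mult_distrib)
  qed
  have "(\<lambda>k. exp \<eta> ^ k * (exp (dev e k) - C)) \<in> O(\<lambda>k. exp \<eta> ^ k * w ^ k)"
    by (rule landau_o.big.mult[OF landau_o.big_refl C])
  moreover have "exp \<eta> ^ k * (exp (dev e k) - C) = real_of_int (a' k) - C * exp \<eta> ^ k" for k
    unfolding a' g_form using e by (simp add: algebra_simps)
  ultimately have main: "(\<lambda>k. real_of_int (a' k) - C * exp \<eta> ^ k) \<in> O(\<lambda>k. (1 / exp \<eta>) ^ k)"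
    by (simp only: wk)
  have "exp \<eta> > 1" using \<eta> by simp
  from leading_term_quadratic[OF this Cpos main] show ?thesis .
qed

text \<open>
  Every second step is taken, so that the base is \<open>(exp \<eta>)\<^sup>2\<close>, for which \<open>integral_parameter\<close>
  provides the quadratic equation.
\<close>

lemma laurent_on_classes:
  "\<exists>P. \<forall>\<^sub>F k in sequentially. g (t + k * (2 * m * n)) * (((exp \<eta>)\<^sup>2) ^ k) ^ \<delta> (t mod n) = poly P (((exp \<eta>)\<^sup>2) ^ k)"
proof -
  let ?\<Lambda> = "(exp \<eta>)\<^sup>2" and ?d = "\<delta> (t mod n)"
  from integral_parameter obtain K c :: int where "c \<in> {0::int, 1} \<and> ?\<Lambda>\<^sup>2 - real_of_int K * ?\<Lambda> + c = 0" by (elim exE)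
  then have Kc: "c \<in> {0::int, 1}" "?\<Lambda>\<^sup>2 - K * ?\<Lambda> + c = 0" by simp_all
  obtain H where H: "(\<lambda>k. exp (dev t k) - poly H (w ^ k)) \<in> O(\<lambda>k. (w ^ k) ^ Suc ?d)"
    using expands_exp[OF w01 expansion[of "Suc ?d" t]] unfolding expands_def by blast
  have "filterlim (\<lambda>k. 2 * k) at_top (sequentially :: nat filter)"
    by (intro filterlim_at_top_mono[OF filterlim_ident]) (auto intro!: always_eventually)
  from landau_o.big.compose[OF H this]
  have H2: "(\<lambda>k. exp (dev t (2 * k)) - poly H (w ^ (2 * k))) \<in> O(\<lambda>k. (w ^ (2 * k)) ^ Suc ?d)" .
  have w2: "w ^ (2 * k) = 1 / (?\<Lambda> ^ k)\<^sup>2" for k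
  proof -
    have "w * ?\<Lambda> = 1" by (simp add: w_def exp_double[symmetric] flip: exp_add)
    then have "w = 1 / ?\<Lambda>" by (simp add: field_simps)
    then show ?thesis by (simp add: power_divide power_mult[symmetric] mult.commute)
  qed
  have y: "g (t + k * (2 * m * n)) = (?\<Lambda> ^ k) ^ ?d * exp (dev t (2 * k))" for k
    using g_form[of t "2 * k"] by (simp add: power_mult[symmetric] ac_simps)
  have "(\<lambda>k. (?\<Lambda> ^ k) ^ ?d * (exp (dev t (2 * k)) - poly H (w ^ (2 * k)))) \<in> O(\<lambda>k. (?\<Lambda> ^ k) ^ ?d * (w ^ (2 * k)) ^ Suc ?d)"
    by (rule landau_o.big.mult[OF landau_o.big_refl H2])
  then have "(\<lambda>k. g (t + k * (2 * m * n)) - (?\<Lambda> ^ k) ^ ?d * poly H (1 / (?\<Lambda> ^ k)\<^sup>2)) \<in> O(\<lambda>k. (?\<Lambda> ^ k) ^ ?d * (1 / (?\<Lambda> ^ k)\<^sup>2) ^ Suc ?d)"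
    by (simp only: y w2 right_diff_distrib)
  then show ?thesis
    by (intro integer_laurent_expansion[of ?\<Lambda> K c] Kc g_integer) (use \<eta> in \<open>simp_all\<close>)
qed

end

end

theorem laurent_polynomials:
  obtains \<Lambda> :: real and M where "\<Lambda> > 1" "M > 0"
    "\<And>t. \<exists>P. \<forall>\<^sub>F k in sequentially. g (t + k * (M * n)) * (\<Lambda> ^ k) ^ \<delta> (t mod n) = poly P (\<Lambda> ^ k)"
proof -
  obtain m W \<kappa> where mW: "m > 0" "\<kappa> \<noteq> 0"
    "\<And>v t. hom_sol v (t + m * n) = hom_sol v t + (\<Sum>j<n. W j * v j) * dl t"
    "\<And>y k. (\<Sum>j<n. W j * y (j + Suc k * n)) - (\<Sum>j<n. W j * y (j + k * n)) =
      \<kappa> * (\<Sum>s<n. forcing y (s + k * n) * dl s)" by (rule translation) blast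
  obtain \<eta> where \<eta>: "\<eta> > 0" "(\<lambda>k. \<kappa> * U k) \<longlonglongrightarrow> \<eta>"
    "\<And>t. (\<lambda>k. L (t + k * (m * n)) - k * \<eta> * dl t) \<in> O(\<lambda>_. 1)"
    by (rule linear_growth[OF mW]) blast
  define dev where "dev t k = L (t + k * (m * n)) - real k * \<eta> * dl t" for t k
  define w where "w = exp (- 2 * \<eta>)"
  have b: "dev t \<in> O(\<lambda>_. 1)" for t unfolding dev_def[abs_def] by (rule \<eta>(3))
  show thesis
  proof (rule that[of "(exp \<eta>)\<^sup>2" "2 * m"])
    fix t
    show "\<exists>P. \<forall>\<^sub>F k in sequentially. g (t + k * (2 * m * n)) * (((exp \<eta>)\<^sup>2) ^ k) ^ \<delta> (t mod n) = poly P (((exp \<eta>)\<^sup>2) ^ k)"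
      by (rule laurent_on_classes[OF mW \<eta>(1,2) b dev_def w_def])
  qed (use mW(1) \<eta>(1) in simp_all)
qed

lemma g_unbounded: "\<not> (\<forall>t. g t \<le> C)"
proof
  assume C: "\<forall>t. g t \<le> C"
  obtain m W \<kappa> where mW: "m > 0" "\<kappa> \<noteq> 0"
    "\<And>v t. hom_sol v (t + m * n) = hom_sol v t + (\<Sum>j<n. W j * v j) * dl t"
    "\<And>y k. (\<Sum>j<n. W j * y (j + Suc k * n)) - (\<Sum>j<n. W j * y (j + k * n)) =
      \<kappa> * (\<Sum>s<n. forcing y (s + k * n) * dl s)" by (rule translation) blast
  obtain \<eta> where \<eta>: "\<eta> > 0" "(\<lambda>k. \<kappa> * U k) \<longlonglongrightarrow> \<eta>"
    "\<And>t. (\<lambda>k. L (t + k * (m * n)) - k * \<eta> * dl t) \<in> O(\<lambda>_. 1)"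
    by (rule linear_growth[OF mW]) blast
  have "(\<lambda>k. L (e + k * (m * n))) \<in> O(\<lambda>_. 1)"
  proof (rule bigoI[of _ "ln C"], rule always_eventually, rule allI)
    fix k
    have "L (e + k * (m * n)) \<le> ln C" unfolding L_def using C g_pos by (intro ln_mono) auto
    then show "norm (L (e + k * (m * n))) \<le> ln C * norm (1::real)" using L_nonneg by simp
  qed
  then have "(\<lambda>k. L (e + k * (m * n)) - (L (e + k * (m * n)) - k * \<eta> * dl e)) \<in> O(\<lambda>_. 1)"
    using \<eta>(3)[of e] by (rule sum_in_bigo(2))
  then obtain B where "\<forall>\<^sub>F k in sequentially. norm (real k * \<eta>) \<le> B * norm (1::real)"
    by (elim landau_o.bigE) simp
  then obtain k0 where k0: "\<And>k. k \<ge> k0 \<Longrightarrow> real k * \<eta> \<le> B" using \<eta>(1) by (auto simp: eventually_sequentially)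
  obtain k :: nat where k: "B < real k * \<eta>" using reals_Archimedean3[OF \<eta>(1)] by blast
  have "real k * \<eta> \<le> real (k + k0) * \<eta>" using \<eta>(1) by (intro mult_right_mono) auto
  then show False using k0[of "k + k0"] k by simp
qed

end

section \<open>Ideals\<close>

definition is_ideal :: "'r::comm_ring_1 set \<Rightarrow> bool" where
  "is_ideal I \<longleftrightarrow> 0 \<in> I \<and> (\<forall>p\<in>I. \<forall>q\<in>I. p + q \<in> I) \<and> (\<forall>p\<in>I. \<forall>r. r * p \<in> I)"

definition is_prime_ideal :: "'r::comm_ring_1 set \<Rightarrow> bool" where
  "is_prime_ideal I \<longleftrightarrow> is_ideal I \<and> 1 \<notin> I \<and> (\<forall>p q. p * q \<in> I \<longrightarrow> p \<in> I \<or> q \<in> I)"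

lemma ideal_mult: "is_ideal I \<Longrightarrow> p \<in> I \<Longrightarrow> r * p \<in> I"
  and ideal_add: "is_ideal I \<Longrightarrow> p \<in> I \<Longrightarrow> q \<in> I \<Longrightarrow> p + q \<in> I"
  and ideal_0: "is_ideal I \<Longrightarrow> 0 \<in> I"
  by (auto simp: is_ideal_def)

lemma ideal_diff: "is_ideal I \<Longrightarrow> p \<in> I \<Longrightarrow> q \<in> I \<Longrightarrow> p - q \<in> I"
  using ideal_add[of I p "(-1) * q"] ideal_mult[of I q "-1"] by simp

lemma ideal_sum: "is_ideal I \<Longrightarrow> (\<And>i. i \<in> A \<Longrightarrow> f i \<in> I) \<Longrightarrow> sum f A \<in> I"
  by (induction A rule: infinite_finite_induct) (auto intro: ideal_0 ideal_add)

lemma prime_ideal_power: "is_prime_ideal I \<Longrightarrow> p ^ k \<in> I \<Longrightarrow> p \<in> I"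
  by (induction k) (auto simp: is_prime_ideal_def)

lemma ideal_adjoin:
  assumes "is_ideal I" shows "is_ideal {m + r * p |m r. m \<in> I}"
  unfolding is_ideal_def
proof (intro conjI ballI allI)
  show "0 \<in> {m + r * p |m r. m \<in> I}" using ideal_0[OF assms] by (intro CollectI exI[of _ 0]) auto
next
  fix x y assume "x \<in> {m + r * p |m r. m \<in> I}" "y \<in> {m + r * p |m r. m \<in> I}"
  then obtain m r m' r' where "x = m + r * p" "y = m' + r' * p" "m \<in> I" "m' \<in> I" by auto
  then show "x + y \<in> {m + r * p |m r. m \<in> I}"
    using ideal_add[OF assms] by (intro CollectI exI[of _ "m + m'"] exI[of _ "r + r'"]) (auto simp: algebra_simps)
next
  fix x s assume "x \<in> {m + r * p |m r. m \<in> I}"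
  then obtain m r where "x = m + r * p" "m \<in> I" by auto
  then show "s * x \<in> {m + r * p |m r. m \<in> I}"
    using ideal_mult[OF assms] by (intro CollectI exI[of _ "s * m"] exI[of _ "s * r"]) (auto simp: algebra_simps)
qed

text \<open>
  Krull: by Zorn's lemma there is an ideal that is maximal among those that contain \<open>I\<close> and
  avoid the multiplicative set \<open>S\<close>, and such an ideal is prime.
\<close>

lemma prime_ideal_avoiding:
  fixes I S :: "'r::comm_ring_1 set"
  assumes I: "is_ideal I" and S: "1 \<in> S" "\<And>s t. s \<in> S \<Longrightarrow> t \<in> S \<Longrightarrow> s * t \<in> S" and IS: "I \<inter> S = {}"
  obtains P where "is_prime_ideal P" "I \<subseteq> P" "P \<inter> S = {}"
proof -
  define \<A> where "\<A> = {J. is_ideal J \<and> I \<subseteq> J \<and> J \<inter> S = {}}"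
  have "\<exists>M\<in>\<A>. \<forall>X\<in>\<A>. M \<subseteq> X \<longrightarrow> X = M"
  proof (rule subset_Zorn_nonempty)
    show "\<A> \<noteq> {}" using I IS by (auto simp: \<A>_def)
    fix \<C> assume C: "\<C> \<noteq> {}" "subset.chain \<A> \<C>"
    then have CA: "\<And>J. J \<in> \<C> \<Longrightarrow> is_ideal J \<and> I \<subseteq> J \<and> J \<inter> S = {}"
      by (auto simp: subset.chain_def \<A>_def)
    have dir: "\<exists>J\<in>\<C>. p \<in> J \<and> q \<in> J" if "p \<in> \<Union>\<C>" "q \<in> \<Union>\<C>" for p q
      using that C(2) unfolding subset_chain_def by blast
    have "is_ideal (\<Union>\<C>)" unfolding is_ideal_def
    proof (intro conjI ballI allI)
      show "0 \<in> \<Union>\<C>" using C(1) CA ideal_0 by fast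
      fix p q assume "p \<in> \<Union>\<C>" "q \<in> \<Union>\<C>"
      then obtain J where "J \<in> \<C>" "p \<in> J" "q \<in> J" using dir by blast
      then show "p + q \<in> \<Union>\<C>" using CA ideal_add by blast
    next
      fix p r assume "p \<in> \<Union>\<C>" then show "r * p \<in> \<Union>\<C>" using CA ideal_mult by blast
    qed
    moreover have "I \<subseteq> \<Union>\<C>" "\<Union>\<C> \<inter> S = {}" using C(1) CA by blast+
    ultimately show "\<Union>\<C> \<in> \<A>" by (simp add: \<A>_def)
  qed
  then obtain M where M: "is_ideal M" "I \<subseteq> M" "M \<inter> S = {}"
    and max: "\<And>X. is_ideal X \<Longrightarrow> I \<subseteq> X \<Longrightarrow> X \<inter> S = {} \<Longrightarrow> M \<subseteq> X \<Longrightarrow> X = M"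
    by (auto simp: \<A>_def)
  have meet: "\<exists>m r. m \<in> M \<and> m + r * p \<in> S" if "p \<notin> M" for p
  proof (rule ccontr)
    assume a: "\<nexists>m r. m \<in> M \<and> m + r * p \<in> S"
    have sub: "M \<subseteq> {m + r * p |m r. m \<in> M}"
    proof
      fix x assume "x \<in> M" then show "x \<in> {m + r * p |m r. m \<in> M}"
        by (intro CollectI exI[of _ x] exI[of _ 0]) auto
    qed
    have "{m + r * p |m r. m \<in> M} = M"
      using a M sub by (intro max ideal_adjoin) auto
    moreover have "p \<in> {m + r * p |m r. m \<in> M}"
      using ideal_0[OF M(1)] by (intro CollectI exI[of _ 0] exI[of _ 1]) auto
    ultimately show False using that by simp
  qed
  have "p \<in> M \<or> q \<in> M" if pq: "p * q \<in> M" for p q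
  proof (rule ccontr)
    assume "\<not> (p \<in> M \<or> q \<in> M)"
    then obtain m r m' r' where mr: "m \<in> M" "m + r * p \<in> S" "m' \<in> M" "m' + r' * q \<in> S" using meet by metis
    have "(m + r * p) * (m' + r' * q) = (m' + r' * q) * m + (r * p) * m' + (r * r') * (p * q)"
      by (simp add: algebra_simps)
    also have "\<dots> \<in> M" by (intro ideal_add ideal_mult M mr pq)
    finally show False using S(2)[OF mr(2,4)] M(3) by blast
  qed
  moreover have "1 \<notin> M" using S(1) M(3) by blast
  ultimately show thesis using that[of M] M by (simp add: is_prime_ideal_def)
qed

section \<open>Polynomials in a set of variables\<close>

definition polys :: "nat set \<Rightarrow> polynomial set" where
  "polys K = {p. \<forall>m\<in>Poly_Mapping.keys p. Poly_Mapping.keys m \<subseteq> K}"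

abbreviation cst :: "complex \<Rightarrow> polynomial" where "cst c \<equiv> Poly_Mapping.single 0 c"
definition var :: "nat \<Rightarrow> polynomial" where
  "var i = Poly_Mapping.single (Poly_Mapping.single i 1) 1"

lemma polynomials_eq: "polynomials n = polys {1..n}"
  by (simp add: polynomials_def polys_def)

lemma polys_0 [simp]: "0 \<in> polys K" and polys_1 [simp]: "1 \<in> polys K" and polys_cst [simp]: "cst c \<in> polys K"
  by (auto simp: polys_def)

lemma polys_single: "Poly_Mapping.keys m \<subseteq> K \<Longrightarrow> Poly_Mapping.single m c \<in> polys K"
  by (auto simp: polys_def)

lemma polys_var: "i \<in> K \<Longrightarrow> var i \<in> polys K"
  unfolding var_def by (rule polys_single) auto

lemma polys_add: "p \<in> polys K \<Longrightarrow> q \<in> polys K \<Longrightarrow> p + q \<in> polys K"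
  using Poly_Mapping.keys_add[of p q] by (auto simp: polys_def)

lemma polys_uminus: "p \<in> polys K \<Longrightarrow> - p \<in> polys K"
  by (auto simp: polys_def)

lemma polys_diff: "p \<in> polys K \<Longrightarrow> q \<in> polys K \<Longrightarrow> p - q \<in> polys K"
  using polys_add[OF _ polys_uminus, of p K q] by simp

lemma polys_mult: "p \<in> polys K \<Longrightarrow> q \<in> polys K \<Longrightarrow> p * q \<in> polys K"
  unfolding polys_def
proof (intro CollectI ballI)
  fix m assume a: "p \<in> {p. \<forall>m\<in>Poly_Mapping.keys p. Poly_Mapping.keys m \<subseteq> K}"
    "q \<in> {p. \<forall>m\<in>Poly_Mapping.keys p. Poly_Mapping.keys m \<subseteq> K}" and "m \<in> Poly_Mapping.keys (p * q)"
  then obtain a b where "a \<in> Poly_Mapping.keys p" "b \<in> Poly_Mapping.keys q" "m = a + b"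
    using keys_mult[of p q] by auto
  then show "Poly_Mapping.keys m \<subseteq> K"
    using Poly_Mapping.keys_add[of a b] a by fastforce
qed

lemma polys_sum: "(\<And>i. i \<in> A \<Longrightarrow> f i \<in> polys K) \<Longrightarrow> sum f A \<in> polys K"
  by (induction A rule: infinite_finite_induct) (auto intro: polys_add)

lemma polys_power: "p \<in> polys K \<Longrightarrow> p ^ k \<in> polys K"
  by (induction k) (auto intro: polys_mult)

lemma eval_cst [simp]: "eval_poly (cst c) x = c"
  by (simp add: eval_poly_single eval_monom_def)

lemma eval_1 [simp]: "eval_poly 1 x = 1"
  using eval_cst[of 1 x] by simp

lemma eval_var [simp]: "eval_poly (var i) x = x i"
  by (simp add: var_def eval_poly_single eval_monom_def)

lemma eval_uminus [simp]: "eval_poly (- p) x = - eval_poly p x"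
  using eval_poly_add[of p "- p" x] by (simp add: eval_poly_0 eq_neg_iff_add_eq_0 add.commute)

lemma eval_diff [simp]: "eval_poly (p - q) x = eval_poly p x - eval_poly q x"
  using eval_poly_add[of p "- q" x] by simp

lemma eval_power [simp]: "eval_poly (p ^ k) x = eval_poly p x ^ k"
  by (induction k) (simp_all add: eval_poly_mult)

declare eval_poly_0 [simp] eval_poly_add [simp] eval_poly_mult [simp]

lemma eval_cong:
  assumes "p \<in> polys K" "\<And>i. i \<in> K \<Longrightarrow> x i = y i"
  shows "eval_poly p x = eval_poly p y"
  unfolding eval_poly_def eval_monom_def
proof (intro sum.cong refl arg_cong2[where f = "(*)"] prod.cong)
  fix m i assume "m \<in> Poly_Mapping.keys p" "i \<in> Poly_Mapping.keys m"
  then have "i \<in> K" using assms(1) by (auto simp: polys_def)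
  then show "x i ^ Poly_Mapping.lookup m i = y i ^ Poly_Mapping.lookup m i" using assms(2) by simp
qed

lemma polys_empty: "p \<in> polys {} \<Longrightarrow> \<exists>c. p = cst c"
proof -
  assume p: "p \<in> polys {}"
  have "Poly_Mapping.keys p \<subseteq> {0}" using p by (auto simp: polys_def)
  then have "p = cst (Poly_Mapping.lookup p 0)"
    by (intro poly_mapping_eqI) (auto simp: lookup_single when_def in_keys_iff)
  then show ?thesis by blast
qed

section \<open>One variable at a time\<close>

definition coeffs_in :: "nat set \<Rightarrow> polynomial poly \<Rightarrow> bool" where
  "coeffs_in K U \<longleftrightarrow> (\<forall>i. coeff U i \<in> polys K)"

lemma coeffs_in_add: "coeffs_in K U \<Longrightarrow> coeffs_in K V \<Longrightarrow> coeffs_in K (U + V)"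
  and coeffs_in_diff: "coeffs_in K U \<Longrightarrow> coeffs_in K V \<Longrightarrow> coeffs_in K (U - V)"
  and coeffs_in_smult: "c \<in> polys K \<Longrightarrow> coeffs_in K U \<Longrightarrow> coeffs_in K (smult c U)"
  and coeffs_in_monom: "c \<in> polys K \<Longrightarrow> coeffs_in K (monom c k)"
  and coeffs_in_0: "coeffs_in K 0"
  by (auto simp: coeffs_in_def polys_add polys_diff polys_mult)

lemma coeffs_in_mult: "coeffs_in K U \<Longrightarrow> coeffs_in K V \<Longrightarrow> coeffs_in K (U * V)"
  unfolding coeffs_in_def coeff_mult by (auto intro!: polys_sum polys_mult)

lemma coeffs_in_power: "coeffs_in K U \<Longrightarrow> coeffs_in K (U ^ k)"
  by (induction k) (auto simp: coeffs_in_def[of K 1] intro: coeffs_in_mult)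

lemma coeffs_in_sum: "(\<And>i. i \<in> A \<Longrightarrow> coeffs_in K (f i)) \<Longrightarrow> coeffs_in K (sum f A)"
  by (induction A rule: infinite_finite_induct) (auto intro: coeffs_in_add simp: coeffs_in_0)

lemma var_power: "var k ^ d = Poly_Mapping.single (Poly_Mapping.single k d) 1"
  by (induction d) (simp_all add: var_def mult_single flip: single_add)

lemma univariate:
  assumes p: "p \<in> polys (insert k K)"
  shows "\<exists>U. coeffs_in K U \<and> poly U (var k) = p"
proof -
  have "\<exists>U. coeffs_in K U \<and> poly U (var k) = Poly_Mapping.single m c" if "Poly_Mapping.keys m \<subseteq> insert k K" for m c
  proof -
    define m' where "m' = Poly_Mapping.update k 0 m"
    have m: "m = m' + Poly_Mapping.single k (Poly_Mapping.lookup m k)"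
      by (rule poly_mapping_eqI) (simp add: m'_def lookup_add lookup_single lookup_update when_def)
    have "Poly_Mapping.keys m' \<subseteq> K"
    proof
      fix i assume "i \<in> Poly_Mapping.keys m'"
      then have "i \<noteq> k" "i \<in> Poly_Mapping.keys m"
        by (auto simp: m'_def in_keys_iff lookup_update split: if_splits)
      then show "i \<in> K" using that by blast
    qed
    then have "Poly_Mapping.single m' c \<in> polys K" by (rule polys_single)
    moreover have "poly (monom (Poly_Mapping.single m' c) (Poly_Mapping.lookup m k)) (var k) = Poly_Mapping.single m c"
      by (subst (2) m) (simp add: poly_monom var_power mult_single)
    ultimately show ?thesis using coeffs_in_monom by blast
  qed
  then have "\<exists>U. coeffs_in K U \<and> poly U (var k) = Poly_Mapping.single m (Poly_Mapping.lookup p m)" if "m \<in> Poly_Mapping.keys p" for m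
    using p that by (auto simp: polys_def)
  then obtain U where U: "\<And>m. m \<in> Poly_Mapping.keys p \<Longrightarrow> coeffs_in K (U m) \<and> poly (U m) (var k) = Poly_Mapping.single m (Poly_Mapping.lookup p m)"
    by metis
  have "poly (\<Sum>m\<in>Poly_Mapping.keys p. U m) (var k) = p"
    using poly_eq_sum_single[of p] U by (simp add: poly_sum)
  then show ?thesis using U by (intro exI[of _ "\<Sum>m\<in>Poly_Mapping.keys p. U m"]) (auto intro: coeffs_in_sum)
qed

text \<open>
  Evaluation of the coefficients at a point turns a polynomial in one distinguished variable
  into a univariate complex polynomial.
\<close>

definition specialize :: "(nat \<Rightarrow> complex) \<Rightarrow> polynomial poly \<Rightarrow> complex poly" where
  "specialize y U = map_poly (\<lambda>c. eval_poly c y) U"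

lemma coeff_specialize [simp]: "coeff (specialize y U) i = eval_poly (coeff U i) y"
  by (simp add: specialize_def coeff_map_poly)

lemma poly_specialize:
  assumes "coeffs_in K U" "k \<notin> K"
  shows "poly (specialize y U) \<xi> = eval_poly (poly U (var k)) (y(k := \<xi>))"
  using assms(1)
proof (induction U)
  case 0 then show ?case by (simp add: specialize_def)
next
  case (pCons c U)
  have c: "c \<in> polys K" using pCons.prems by (metis coeff_pCons_0 coeffs_in_def)
  have U: "coeffs_in K U" using pCons.prems by (metis coeff_pCons_Suc coeffs_in_def)
  have "eval_poly c y = eval_poly c (y(k := \<xi>))"
    using c assms(2) by (intro eval_cong[of c K]) auto
  moreover have "poly (specialize y (pCons c U)) \<xi> = eval_poly c y + \<xi> * poly (specialize y U) \<xi>"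
    by (simp add: specialize_def map_poly_pCons)
  moreover have "eval_poly (poly (pCons c U) (var k)) z = eval_poly c z + z k * eval_poly (poly U (var k)) z" for z
    by simp
  ultimately show ?case using pCons.IH[OF U] by (metis fun_upd_same)
qed

lemma pseudo_division:
  assumes P: "coeffs_in K P" "degree P > 0" and F: "coeffs_in K F"
  shows "\<exists>e q r. coeffs_in K q \<and> coeffs_in K r \<and> smult (lead_coeff P ^ e) F = q * P + r \<and> degree r < degree P"
  using F
proof (induction "degree F" arbitrary: F rule: less_induct)
  case less
  show ?case
  proof (cases "degree F < degree P")
    case True
    then show ?thesis using less.prems by (intro exI[of _ 0] exI[of _ F]) (auto simp: coeffs_in_0)
  next
    case False
    let ?a = "lead_coeff P" and ?M = "monom (lead_coeff F) (degree F - degree P)"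
    define F' where "F' = smult ?a F - ?M * P"
    have lcF: "lead_coeff F \<in> polys K" and lcP: "?a \<in> polys K" using less.prems P by (auto simp: coeffs_in_def)
    have F': "coeffs_in K F'" unfolding F'_def
      by (intro coeffs_in_diff coeffs_in_smult coeffs_in_mult coeffs_in_monom less.prems P lcF lcP)
    have "coeff F' i = 0" if "i \<ge> degree F" for i
    proof (cases "i = degree F")
      case True
      then show ?thesis using False by (simp add: F'_def coeff_monom_mult; simp add: mult.commute)
    next
      case ne: False
      then have "coeff F i = 0" "coeff P (i - (degree F - degree P)) = 0"
        using that False by (auto intro!: coeff_eq_0)
      then show ?thesis using that by (simp add: F'_def coeff_monom_mult)
    qed
    then have "degree F' < degree F" using P(2) False by (intro degree_lessI) auto
    from less.hyps[OF this F'] obtain e q r where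
      eqr: "coeffs_in K q" "coeffs_in K r" "smult (?a ^ e) F' = q * P + r" "degree r < degree P" by blast
    have "smult (?a ^ Suc e) F = smult (?a ^ e) (F' + ?M * P)" by (simp add: F'_def mult.commute)
    also have "\<dots> = (q + smult (?a ^ e) ?M) * P + r" using eqr(3) by (simp add: smult_add_right algebra_simps)
    finally show ?thesis using eqr
      by (intro exI[of _ "Suc e"] exI[of _ "q + smult (?a ^ e) ?M"] exI[of _ r] conjI coeffs_in_add coeffs_in_smult coeffs_in_monom polys_power lcF lcP)
  qed
qed

lemma ideal_poly: "is_ideal I \<Longrightarrow> (\<And>i. coeff U i \<in> I) \<Longrightarrow> poly U x \<in> I"
  unfolding poly_altdef by (intro ideal_sum) (auto simp: mult.commute[of _ "x ^ _"] intro: ideal_mult)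

section \<open>The extension theorem\<close>

lemma finite_roots_specialize:
  assumes "coeff U i = u" "eval_poly u y \<noteq> 0"
  shows "finite {\<xi>. poly (specialize y U) \<xi> = 0}"
proof -
  have "coeff (specialize y U) i \<noteq> 0" using assms by simp
  then have "specialize y U \<noteq> 0" by (metis coeff_0)
  then show ?thesis by (rule poly_roots_finite)
qed

text \<open>
  A zero of \<open>I \<inter> polys K\<close> extends to a zero of \<open>I\<close> in one more variable, with \<open>v \<noteq> 0\<close>, unless a
  certain \<open>u\<close> vanishes. If all elements of \<open>I\<close> have their coefficients in \<open>I\<close>, every value of
  the new variable is a zero and \<open>u\<close> is a coefficient of \<open>v\<close>. Otherwise let \<open>P\<close> be an element of
  least degree that violates this. Pseudo-division by \<open>P\<close> shows that above a point where the
  leading coefficient \<open>a\<close> of \<open>P\<close> does not vanish, the roots of \<open>P\<close> are zeros of \<open>I\<close>. Not all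
  roots of \<open>P\<close> are roots of \<open>v\<close>, as otherwise \<open>P\<close> would divide \<open>v ^ degree P\<close>; so \<open>u\<close> is \<open>a\<close>
  times a coefficient of the remainder of that power.
\<close>

lemma extend_one:
  assumes I: "is_prime_ideal I" and k: "k \<notin> K" and v: "v \<in> polys (insert k K)" "v \<notin> I"
  shows "\<exists>u\<in>polys K. u \<notin> I \<and> (\<forall>y. (\<forall>p\<in>I \<inter> polys K. eval_poly p y = 0) \<longrightarrow> eval_poly u y \<noteq> 0 \<longrightarrow>
     (\<exists>\<xi>. (\<forall>p\<in>I \<inter> polys (insert k K). eval_poly p (y(k := \<xi>)) = 0) \<and> eval_poly v (y(k := \<xi>)) \<noteq> 0))"
proof -
  have id: "is_ideal I" and pr: "\<And>p q. p * q \<in> I \<Longrightarrow> p \<in> I \<or> q \<in> I" using I by (auto simp: is_prime_ideal_def)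
  obtain V where V: "coeffs_in K V" "poly V (var k) = v" using univariate[OF v(1)] by blast
  define N where "N = {P. coeffs_in K P \<and> poly P (var k) \<in> I \<and> (\<exists>i. coeff P i \<notin> I)}"
  note sp = poly_specialize[OF _ k]
  show ?thesis
  proof (cases "N = {}")
    case True
    obtain i where i: "coeff V i \<notin> I" using ideal_poly[OF id, of V "var k"] V v(2) by blast
    show ?thesis
    proof (intro bexI[of _ "coeff V i"] conjI allI impI)
      show "coeff V i \<in> polys K" using V by (simp add: coeffs_in_def)
      fix y assume y: "\<forall>p\<in>I \<inter> polys K. eval_poly p y = 0" "eval_poly (coeff V i) y \<noteq> 0"
      have "finite {\<xi>. poly (specialize y V) \<xi> = 0}" by (rule finite_roots_specialize[OF refl y(2)])
      then obtain \<xi> where \<xi>: "poly (specialize y V) \<xi> \<noteq> 0"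
        using infinite_UNIV_char_0[where 'a = complex] by (metis (mono_tags, lifting) UNIV_I finite_subset mem_Collect_eq subsetI)
      have "eval_poly p (y(k := \<xi>)) = 0" if p: "p \<in> I" "p \<in> polys (insert k K)" for p
      proof -
        obtain F where F: "coeffs_in K F" "poly F (var k) = p" using univariate[OF p(2)] by blast
        then have "coeff F i \<in> I" for i using True p(1) by (auto simp: N_def)
        then have "specialize y F = 0" using y(1) F(1) by (intro poly_eqI) (auto simp: coeffs_in_def)
        then show ?thesis using sp[OF F(1), of y \<xi>] F(2) by simp
      qed
      then show "\<exists>\<xi>. (\<forall>p\<in>I \<inter> polys (insert k K). eval_poly p (y(k := \<xi>)) = 0) \<and> eval_poly v (y(k := \<xi>)) \<noteq> 0"
        using \<xi> sp[OF V(1), of y \<xi>] V(2) by auto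
    qed (rule i)
  next
    case False
    define P where "P = arg_min degree (\<lambda>P. P \<in> N)"
    have PN: "P \<in> N" and Pmin: "\<And>F. F \<in> N \<Longrightarrow> degree P \<le> degree F"
      using False arg_min_nat_lemma[of "\<lambda>P. P \<in> N" _ degree] by (auto simp: P_def)
    let ?a = "lead_coeff P" and ?D = "degree P"
    have P: "coeffs_in K P" "poly P (var k) \<in> I" using PN by (auto simp: N_def)
    obtain i0 where i0: "coeff P i0 \<notin> I" using PN by (auto simp: N_def)
    have aK: "?a \<in> polys K" using P by (simp add: coeffs_in_def)
    have a: "?a \<notin> I"
    proof
      assume aI: "?a \<in> I"
      have i0D: "i0 < ?D" using i0 aI ideal_0[OF id] by (metis coeff_eq_0 linorder_neqE_nat)
      define P' where "P' = P - monom ?a ?D"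
      have "P' \<in> N" unfolding N_def
      proof (intro CollectI conjI exI[of _ i0])
        show "coeffs_in K P'" unfolding P'_def by (intro coeffs_in_diff coeffs_in_monom P aK)
        have "poly P' (var k) = poly P (var k) - var k ^ ?D * ?a" by (simp add: P'_def poly_monom mult.commute)
        then show "poly P' (var k) \<in> I" using ideal_diff[OF id P(2) ideal_mult[OF id aI]] by simp
        show "coeff P' i0 \<notin> I" using i0 i0D by (simp add: P'_def)
      qed
      moreover have "degree P' < ?D" using i0D
        by (intro degree_lessI) (auto simp: P'_def coeff_eq_0 le_less)
      ultimately show False using Pmin by fastforce
    qed
    have D: "?D > 0"
    proof (rule ccontr)
      assume "\<not> ?D > 0"
      then obtain c where "P = [:c:]" by (metis degree_eq_zeroE neq0_conv)
      then show False using P(2) a by simp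
    qed
    have small: "coeff r i \<in> I" if "coeffs_in K r" "degree r < ?D" "poly r (var k) \<in> I" for r i
      using that Pmin[of r] by (auto simp: N_def)
    obtain e q r where eqr: "coeffs_in K q" "coeffs_in K r" "smult (?a ^ e) (V ^ ?D) = q * P + r" "degree r < ?D"
      using pseudo_division[OF P(1) D coeffs_in_power[OF V(1)]] by blast
    have "\<exists>i. coeff r i \<notin> I"
    proof (rule ccontr)
      assume "\<nexists>i. coeff r i \<notin> I"
      then have "poly r (var k) \<in> I" using ideal_poly[OF id] by blast
      moreover have "?a ^ e * v ^ ?D = poly q (var k) * poly P (var k) + poly r (var k)"
        using arg_cong[OF eqr(3), of "\<lambda>U. poly U (var k)"] V(2) by (simp add: poly_power)
      ultimately have "?a ^ e * v ^ ?D \<in> I" using ideal_add[OF id ideal_mult[OF id P(2)]] by simp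
      then show False using pr prime_ideal_power[OF I] a v(2) by blast
    qed
    then obtain i1 where i1: "coeff r i1 \<notin> I" by blast
    show ?thesis
    proof (intro bexI[of _ "?a * coeff r i1"] conjI allI impI)
      show "?a * coeff r i1 \<in> polys K" using eqr(2) by (intro polys_mult aK) (simp add: coeffs_in_def)
      show "?a * coeff r i1 \<notin> I" using pr a i1 by blast
      fix y assume y: "\<forall>p\<in>I \<inter> polys K. eval_poly p y = 0" "eval_poly (?a * coeff r i1) y \<noteq> 0"
      have ay: "eval_poly ?a y \<noteq> 0" and ry: "eval_poly (coeff r i1) y \<noteq> 0" using y(2) by auto
      let ?Py = "specialize y P"
      have degP: "degree ?Py = ?D"
        using ay by (intro antisym degree_le le_degree) (auto simp: coeff_eq_0)
      have Py0: "?Py \<noteq> 0" using D degP by auto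
      have division: "eval_poly ?a y ^ e * poly (specialize y F) \<xi> = poly (specialize y q) \<xi> * poly ?Py \<xi> + poly (specialize y r) \<xi>"
        if "coeffs_in K F" "coeffs_in K q" "coeffs_in K r" "smult (?a ^ e) F = q * P + r" for F q r e \<xi>
      proof -
        have "eval_poly ?a (y(k := \<xi>)) = eval_poly ?a y" using aK k by (intro eval_cong[of _ K]) auto
        then show ?thesis
          using arg_cong[OF that(4), of "\<lambda>U. eval_poly (poly U (var k)) (y(k := \<xi>))"] that(1-3) P(1) by (simp add: sp)
      qed
      have "\<exists>\<xi>. poly ?Py \<xi> = 0 \<and> poly (specialize y V) \<xi> \<noteq> 0"
      proof (rule ccontr)
        assume "\<nexists>\<xi>. poly ?Py \<xi> = 0 \<and> poly (specialize y V) \<xi> \<noteq> 0"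
        then have dvd: "?Py dvd specialize y V ^ ?D"
          using nullstellensatz_univariate[of ?Py "specialize y V"] degP Py0 by auto
        have VD: "poly (specialize y (V ^ ?D)) \<xi> = poly (specialize y V ^ ?D) \<xi>" for \<xi>
          using V(1) by (simp add: sp coeffs_in_power poly_power)
        have "poly (smult (eval_poly ?a y ^ e) (specialize y V ^ ?D)) = poly (specialize y q * ?Py + specialize y r)"
        proof
          fix \<xi>
          show "poly (smult (eval_poly ?a y ^ e) (specialize y V ^ ?D)) \<xi> = poly (specialize y q * ?Py + specialize y r) \<xi>"
          using division[OF coeffs_in_power[OF V(1)] eqr(1-3), of \<xi>] VD[of \<xi>] by simp
        qed
        then have "smult (eval_poly ?a y ^ e) (specialize y V ^ ?D) = specialize y q * ?Py + specialize y r"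
          by (simp only: poly_eq_poly_eq_iff)
        then have "specialize y r = smult (eval_poly ?a y ^ e) (specialize y V ^ ?D) - specialize y q * ?Py" by simp
        then have "?Py dvd specialize y r" using dvd by (auto intro!: dvd_diff dvd_smult)
        moreover have "specialize y r \<noteq> 0" using ry by (metis coeff_0 coeff_specialize)
        ultimately have "?D \<le> degree (specialize y r)" using dvd_imp_degree_le degP by metis
        also have "\<dots> \<le> degree r" by (intro degree_le) (auto simp: coeff_eq_0)
        finally show False using eqr(4) by simp
      qed
      then obtain \<xi> where \<xi>: "poly ?Py \<xi> = 0" "poly (specialize y V) \<xi> \<noteq> 0" by blast
      have "eval_poly p (y(k := \<xi>)) = 0" if p: "p \<in> I" "p \<in> polys (insert k K)" for p
      proof -
        obtain F where F: "coeffs_in K F" "poly F (var k) = p" using univariate[OF p(2)] by blast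
        obtain e q r where qr: "coeffs_in K q" "coeffs_in K r" "smult (?a ^ e) F = q * P + r" "degree r < ?D"
          using pseudo_division[OF P(1) D F(1)] by blast
        have "poly r (var k) = ?a ^ e * p - poly q (var k) * poly P (var k)"
          using arg_cong[OF qr(3), of "\<lambda>U. poly U (var k)"] F(2) by simp
        also have "\<dots> \<in> I" by (intro ideal_diff[OF id] ideal_mult[OF id] p P)
        finally have "coeff r i \<in> I" for i using small[OF qr(2,4)] by blast
        then have "specialize y r = 0" using y(1) qr(2) by (intro poly_eqI) (auto simp: coeffs_in_def)
        then have "eval_poly ?a y ^ e * poly (specialize y F) \<xi> = 0"
          using division[OF F(1) qr(1-3), of \<xi>] \<xi>(1) by simp
        then show ?thesis using ay sp[OF F(1), of y \<xi>] F(2) by simp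
      qed
      then show "\<exists>\<xi>. (\<forall>p\<in>I \<inter> polys (insert k K). eval_poly p (y(k := \<xi>)) = 0) \<and> eval_poly v (y(k := \<xi>)) \<noteq> 0"
        using \<xi> sp[OF V(1), of y \<xi>] V(2) by auto
    qed
  qed
qed

lemma extend_many:
  assumes I: "is_prime_ideal I" and A: "finite A" "A \<inter> K = {}" and v: "v \<in> polys (K \<union> A)" "v \<notin> I"
  shows "\<exists>u\<in>polys K. u \<notin> I \<and> (\<forall>y. (\<forall>p\<in>I \<inter> polys K. eval_poly p y = 0) \<longrightarrow> eval_poly u y \<noteq> 0 \<longrightarrow>
     (\<exists>y'. (\<forall>i. i \<notin> A \<longrightarrow> y' i = y i) \<and> (\<forall>p\<in>I \<inter> polys (K \<union> A). eval_poly p y' = 0) \<and> eval_poly v y' \<noteq> 0))"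
  using A v
proof (induction A arbitrary: v rule: finite_induct)
  case empty
  then show ?case by (intro bexI[of _ v]) auto
next
  case (insert k A)
  have "k \<notin> K \<union> A" using insert by auto
  from extend_one[OF I this, of v] insert.prems obtain u1 where
    u1: "u1 \<in> polys (K \<union> A)" "u1 \<notin> I" and ext1: "\<And>y. (\<forall>p\<in>I \<inter> polys (K \<union> A). eval_poly p y = 0) \<Longrightarrow> eval_poly u1 y \<noteq> 0 \<Longrightarrow>
     (\<exists>\<xi>. (\<forall>p\<in>I \<inter> polys (insert k (K \<union> A)). eval_poly p (y(k := \<xi>)) = 0) \<and> eval_poly v (y(k := \<xi>)) \<noteq> 0)"
    by auto
  obtain u where u: "u \<in> polys K" "u \<notin> I" and ext: "\<And>y. (\<forall>p\<in>I \<inter> polys K. eval_poly p y = 0) \<Longrightarrow> eval_poly u y \<noteq> 0 \<Longrightarrow>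
     (\<exists>y'. (\<forall>i. i \<notin> A \<longrightarrow> y' i = y i) \<and> (\<forall>p\<in>I \<inter> polys (K \<union> A). eval_poly p y' = 0) \<and> eval_poly u1 y' \<noteq> 0)"
    using insert.IH[OF _ u1] insert.prems by auto
  show ?case
  proof (intro bexI[of _ u] conjI allI impI u)
    fix y assume "\<forall>p\<in>I \<inter> polys K. eval_poly p y = 0" "eval_poly u y \<noteq> 0"
    then obtain y' where y': "\<forall>i. i \<notin> A \<longrightarrow> y' i = y i" "\<forall>p\<in>I \<inter> polys (K \<union> A). eval_poly p y' = 0" "eval_poly u1 y' \<noteq> 0"
      using ext by blast
    then obtain \<xi> where "\<forall>p\<in>I \<inter> polys (insert k (K \<union> A)). eval_poly p (y'(k := \<xi>)) = 0" "eval_poly v (y'(k := \<xi>)) \<noteq> 0"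
      using ext1 by blast
    then show "\<exists>y'. (\<forall>i. i \<notin> insert k A \<longrightarrow> y' i = y i) \<and> (\<forall>p\<in>I \<inter> polys (K \<union> insert k A). eval_poly p y' = 0) \<and> eval_poly v y' \<noteq> 0"
      using y'(1) by (intro exI[of _ "y'(k := \<xi>)"]) auto
  qed
qed

section \<open>Zero loci of prime ideals\<close>

definition locus :: "nat \<Rightarrow> polynomial set \<Rightarrow> (nat \<Rightarrow> complex) set" where
  "locus n I = zero_locus n (I \<inter> polys {1..n})"

lemma locusD: "x \<in> locus n I \<Longrightarrow> p \<in> I \<Longrightarrow> p \<in> polys {1..n} \<Longrightarrow> eval_poly p x = 0"
  by (auto simp: locus_def zero_locus_def)

lemma closedin_locus: "closedin (zariski n) (locus n I)"
  unfolding closedin_zariski locus_def polynomials_eq by blast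

lemma extend_to_locus:
  assumes I: "is_prime_ideal I" and K: "K \<subseteq> {1..n}" and v: "v \<in> polys {1..n}" "v \<notin> I"
  shows "\<exists>u\<in>polys K. u \<notin> I \<and> (\<forall>y. (\<forall>p\<in>I \<inter> polys K. eval_poly p y = 0) \<longrightarrow> eval_poly u y \<noteq> 0 \<longrightarrow>
     (\<exists>x\<in>locus n I. (\<forall>i\<in>K. x i = y i) \<and> eval_poly v x \<noteq> 0))"
proof -
  have KU: "K \<union> ({1..n} - K) = {1..n}" using K by blast
  obtain u where u: "u \<in> polys K" "u \<notin> I" and ext: "\<And>y. (\<forall>p\<in>I \<inter> polys K. eval_poly p y = 0) \<Longrightarrow> eval_poly u y \<noteq> 0 \<Longrightarrow>
     (\<exists>y'. (\<forall>i. i \<notin> {1..n} - K \<longrightarrow> y' i = y i) \<and> (\<forall>p\<in>I \<inter> polys {1..n}. eval_poly p y' = 0) \<and> eval_poly v y' \<noteq> 0)"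
    using extend_many[OF I, of "{1..n} - K" K v] v unfolding KU by auto
  show ?thesis
  proof (intro bexI[of _ u] conjI allI impI u)
    fix y assume "\<forall>p\<in>I \<inter> polys K. eval_poly p y = 0" "eval_poly u y \<noteq> 0"
    then obtain y' where y': "\<forall>i. i \<notin> {1..n} - K \<longrightarrow> y' i = y i" "\<forall>p\<in>I \<inter> polys {1..n}. eval_poly p y' = 0" "eval_poly v y' \<noteq> 0"
      using ext by blast
    define x where "x = restrict y' {1..n}"
    have ev: "eval_poly p x = eval_poly p y'" if "p \<in> polys {1..n}" for p
      using that by (rule eval_cong) (simp add: x_def)
    have "x \<in> locus n I" using y'(2) ev by (auto simp: locus_def zero_locus_def affine_space_def x_def)
    moreover have "\<forall>i\<in>K. x i = y i" using y'(1) K by (auto simp: x_def)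
    ultimately show "\<exists>x\<in>locus n I. (\<forall>i\<in>K. x i = y i) \<and> eval_poly v x \<noteq> 0" using y'(3) ev[OF v(1)] by auto
  qed
qed

lemma constant_in_prime_ideal:
  assumes "is_prime_ideal I" "p \<in> I" "p \<in> polys {}" shows "p = 0"
proof (rule ccontr)
  assume "p \<noteq> 0"
  obtain c where c: "p = cst c" using polys_empty[OF assms(3)] by blast
  then have "c \<noteq> 0" using \<open>p \<noteq> 0\<close> by auto
  then have "cst (inverse c) * p = 1" by (simp add: c mult_single)
  then have "1 \<in> I" using assms(1,2) by (metis ideal_mult is_prime_ideal_def)
  then show False using assms(1) by (simp add: is_prime_ideal_def)
qed

text \<open>
  The extension theorem starting from no coordinates at all: there \<open>u\<close> is a nonzero constant.
\<close>

theorem nullstellensatz: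
  assumes I: "is_prime_ideal I" and v: "v \<in> polys {1..n}" "v \<notin> I"
  shows "\<exists>x\<in>locus n I. eval_poly v x \<noteq> 0"
proof -
  obtain u where u: "u \<in> polys {}" "u \<notin> I" and ext: "\<And>y. (\<forall>p\<in>I \<inter> polys {}. eval_poly p y = 0) \<Longrightarrow> eval_poly u y \<noteq> 0 \<Longrightarrow>
     (\<exists>x\<in>locus n I. (\<forall>i\<in>{}. x i = y i) \<and> eval_poly v x \<noteq> 0)"
    using extend_to_locus[OF I _ v, of "{}"] by auto
  have "u \<noteq> 0" using u(2) I by (auto simp: is_prime_ideal_def is_ideal_def)
  then have "eval_poly u undefined \<noteq> 0" using polys_empty[OF u(1)] by auto
  moreover have "\<forall>p\<in>I \<inter> polys {}. eval_poly p undefined = 0"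
    by (metis IntD1 IntD2 constant_in_prime_ideal[OF I] eval_poly_0)
  ultimately show ?thesis using ext by blast
qed

text \<open>
  Polynomials that separate the two closed parts from the locus are outside \<open>I\<close>, hence so is
  their product, which then is nonzero at a point that lies in neither part.
\<close>

lemma irreducible_locus:
  assumes I: "is_prime_ideal I"
  shows "irreducible_closedin (zariski n) (locus n I)"
  unfolding irreducible_closedin_def
proof (intro conjI allI impI closedin_locus)
  show "locus n I \<noteq> {}" using nullstellensatz[OF I, of 1 n] I by (auto simp: is_prime_ideal_def)
  fix A B assume AB: "closedin (zariski n) A" "closedin (zariski n) B" "locus n I = A \<union> B"
  then obtain S T where ST: "S \<subseteq> polys {1..n}" "A = zero_locus n S" "T \<subseteq> polys {1..n}" "B = zero_locus n T"
    unfolding closedin_zariski polynomials_eq by auto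
  show "locus n I = A \<or> locus n I = B"
  proof (rule ccontr)
    assume "\<not> (locus n I = A \<or> locus n I = B)"
    then obtain x y where x: "x \<in> locus n I" "x \<notin> A" and y: "y \<in> locus n I" "y \<notin> B" using AB(3) by blast
    then obtain s t where s: "s \<in> S" "eval_poly s x \<noteq> 0" and t: "t \<in> T" "eval_poly t y \<noteq> 0"
      unfolding ST by (auto simp: zero_locus_def locus_def)
    have st: "s \<in> polys {1..n}" "t \<in> polys {1..n}" using s t ST by auto
    have "s \<notin> I" "t \<notin> I" using locusD[OF x(1) _ st(1)] locusD[OF y(1) _ st(2)] s(2) t(2) by auto
    then have "s * t \<notin> I" using I by (auto simp: is_prime_ideal_def)
    then obtain z where z: "z \<in> locus n I" "eval_poly (s * t) z \<noteq> 0"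
      using nullstellensatz[OF I polys_mult[OF st]] by blast
    then have "z \<notin> A" "z \<notin> B" using s(1) t(1) unfolding ST by (auto simp: zero_locus_def)
    then show False using z(1) AB(3) by blast
  qed
qed

lemma closedin_point:
  assumes "x \<in> affine_space n" shows "closedin (zariski n) {x}"
proof -
  have "{x} = zero_locus n ((\<lambda>i. var i - cst (x i)) ` {1..n})"
  proof (intro equalityI subsetI)
    fix y assume "y \<in> zero_locus n ((\<lambda>i. var i - cst (x i)) ` {1..n})"
    then have y: "y \<in> affine_space n" "\<forall>p\<in>(\<lambda>i. var i - cst (x i)) ` {1..n}. eval_poly p y = 0"
      by (simp_all add: zero_locus_def)
    have "y i = x i" if "i \<in> {1..n}" for i
    proof -
      have "eval_poly (var i - cst (x i)) y = 0" using y(2) that by blast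
      then show ?thesis by simp
    qed
    then have "y = x" using y(1) assms unfolding affine_space_def by (intro PiE_ext[of y "{1..n}" "\<lambda>_. UNIV" x]) auto
    then show "y \<in> {x}" by simp
  qed (use assms in \<open>auto simp: zero_locus_def\<close>)
  moreover have "(\<lambda>i. var i - cst (x i)) ` {1..n} \<subseteq> polys {1..n}" by (auto intro!: polys_diff polys_var)
  ultimately show ?thesis unfolding closedin_zariski polynomials_eq by blast
qed

lemma irreducible_point:
  assumes "x \<in> affine_space n" shows "irreducible_closedin (zariski n) {x}"
  unfolding irreducible_closedin_def
proof (intro conjI allI impI closedin_point assms)
  fix A B assume "{x} = A \<union> B"
  then show "{x} = A \<or> {x} = B" by (metis Un_empty_left Un_upper1 subset_singletonD)
qed simp

text \<open>
  If the locus were the single point \<open>x\<close>, the linear polynomial \<open>X\<^sub>i - x i\<close> would be in \<open>J\<close>.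
\<close>

lemma point_in_locus:
  assumes J: "is_prime_ideal J" and i: "i \<in> {1..n}" "\<And>p. p \<in> J \<Longrightarrow> p \<in> polys {i} \<Longrightarrow> p = 0"
  shows "\<exists>x\<in>affine_space n. {x} \<subset> locus n J"
proof -
  obtain x where x: "x \<in> locus n J" using irreducible_locus[OF J, of n] by (auto simp: irreducible_closedin_def)
  have "{x} \<noteq> locus n J"
  proof
    assume e: "{x} = locus n J"
    let ?p = "var i - cst (x i)"
    have p: "?p \<in> polys {1..n}" "?p \<in> polys {i}" using i(1) by (auto intro!: polys_diff polys_var)
    have "?p \<in> J" using nullstellensatz[OF J p(1)] unfolding e[symmetric] by auto
    then have "?p = 0" using i(2) p(2) by blast
    then have "eval_poly ?p (x(i := x i + 1)) = 0" by simp
    then show False by simp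
  qed
  then show ?thesis using x by (intro bexI[of _ x]) (auto simp: locus_def zero_locus_def)
qed

section \<open>Bounds for the dimension of a closure\<close>

definition points_ideal :: "(nat \<Rightarrow> complex) set \<Rightarrow> polynomial set" where
  "points_ideal X = {p. \<forall>x\<in>X. eval_poly p x = 0}"

lemma is_ideal_points_ideal: "is_ideal (points_ideal X)"
  by (auto simp: is_ideal_def points_ideal_def)

lemma locus_subset_closure:
  assumes X: "X \<subseteq> affine_space n" and I: "points_ideal X \<subseteq> I"
  shows "locus n I \<subseteq> zariski n closure_of X"
proof
  fix x assume x: "x \<in> locus n I"
  show "x \<in> zariski n closure_of X"
    unfolding closure_of_def
  proof (intro CollectI conjI allI impI)
    show "x \<in> topspace (zariski n)" using x by (auto simp: topspace_zariski locus_def zero_locus_def)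
    fix T assume T: "x \<in> T \<and> openin (zariski n) T"
    then obtain S where S: "S \<subseteq> polys {1..n}" "T = affine_space n - zero_locus n S"
      unfolding openin_zariski polynomials_eq by blast
    then obtain s where s: "s \<in> S" "eval_poly s x \<noteq> 0" using T by (auto simp: zero_locus_def)
    then have "s \<notin> I" using locusD[OF x] S(1) by blast
    then obtain y where "y \<in> X" "eval_poly s y \<noteq> 0" using I by (auto simp: points_ideal_def)
    then show "\<exists>y\<in>X. y \<in> T" using s(1) X unfolding S(2) by (auto simp: zero_locus_def)
  qed
qed

lemma vanish_on_closure:
  assumes p: "p \<in> polys {1..n}" and X: "X \<subseteq> affine_space n" "\<And>x. x \<in> X \<Longrightarrow> eval_poly p x = 0"
    and x: "x \<in> zariski n closure_of X"
  shows "eval_poly p x = 0"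
proof -
  have "closedin (zariski n) (zero_locus n {p})" unfolding closedin_zariski polynomials_eq using p by blast
  moreover have "X \<subseteq> zero_locus n {p}" using X by (auto simp: zero_locus_def)
  ultimately have "zariski n closure_of X \<subseteq> zero_locus n {p}" by (rule closure_of_minimal[rotated])
  then show ?thesis using x by (auto simp: zero_locus_def)
qed

lemma irreducible_subtopology:
  assumes "closedin T X"
  shows "irreducible_closedin (subtopology T X) Z \<longleftrightarrow> irreducible_closedin T Z \<and> Z \<subseteq> X"
proof -
  have c: "closedin (subtopology T X) A \<longleftrightarrow> closedin T A \<and> A \<subseteq> X" for A
    by (rule closedin_closed_subtopology[OF assms])
  show ?thesis unfolding irreducible_closedin_def c by blast
qed

abbreviation dim_closure :: "nat \<Rightarrow> (nat \<Rightarrow> complex) set \<Rightarrow> enat" where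
  "dim_closure n X \<equiv> krull_dim (subtopology (zariski n) (zariski n closure_of X))"

lemma dim_closure_ge:
  assumes "\<And>i. i \<le> k \<Longrightarrow> irreducible_closedin (zariski n) (C i)" "\<And>i. i < k \<Longrightarrow> C i \<subset> C (Suc i)"
    "C k \<subseteq> zariski n closure_of X"
  shows "enat k \<le> dim_closure n X"
proof -
  have sub: "C i \<subseteq> C k" if "i \<le> k" for i
    using that by (induction rule: inc_induct) (use assms(2) in auto)
  have "irreducible_closedin (subtopology (zariski n) (zariski n closure_of X)) (C i)" if "i \<le> k" for i
    using assms(1)[OF that] sub[OF that] assms(3) irreducible_subtopology[OF closedin_closure_of, of "zariski n" X "C i"]
    by simp
  then show ?thesis unfolding krull_dim_def
    using assms(2) by (intro Sup_upper CollectI exI[of _ k] exI[of _ C] conjI refl) auto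
qed

text \<open>
  A polynomial in the variable \<open>i\<close> that vanishes on \<open>X\<close> has infinitely many roots. So a prime
  ideal over the vanishing ideal of \<open>X\<close> can be chosen without nonzero polynomials in the
  variable \<open>i\<close>, and its locus is not a point.
\<close>

lemma dim_closure_ge_1:
  assumes X: "X \<subseteq> affine_space n" and i: "i \<in> {1..n}" and inf: "infinite ((\<lambda>x. x i) ` X)"
  shows "1 \<le> dim_closure n X"
proof -
  have nz: "p = 0" if p: "p \<in> points_ideal X" "p \<in> polys {i}" for p
  proof (rule ccontr)
    assume "p \<noteq> 0"
    obtain U where U: "coeffs_in {} U" "poly U (var i) = p" using univariate[of p i "{}"] p(2) by auto
    then have "U \<noteq> 0" using \<open>p \<noteq> 0\<close> by auto
    then obtain j where "coeff U j \<noteq> 0" by (metis coeff_0 poly_eqI)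
    moreover obtain c where "coeff U j = cst c" using polys_empty U(1) by (auto simp: coeffs_in_def)
    ultimately have "finite {\<xi>. poly (specialize undefined U) \<xi> = 0}"
      by (intro finite_roots_specialize[of U j]) auto
    moreover have "poly (specialize undefined U) (x i) = 0" if "x \<in> X" for x
    proof -
      have "poly (specialize undefined U) (x i) = eval_poly p (undefined(i := x i))"
        using poly_specialize[OF U(1), of i undefined "x i"] U(2) by simp
      also have "\<dots> = eval_poly p x" using \<open>p \<in> polys {i}\<close> by (intro eval_cong[of p "{i}"]) auto
      finally show ?thesis using \<open>p \<in> points_ideal X\<close> that by (auto simp: points_ideal_def)
    qed
    ultimately have "finite ((\<lambda>x. x i) ` X)" by (elim finite_subset[rotated]) auto
    then show False using inf by simp
  qed
  obtain J where J: "is_prime_ideal J" "points_ideal X \<subseteq> J" "J \<inter> (polys {i} - {0}) = {}"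
  proof (rule prime_ideal_avoiding[OF is_ideal_points_ideal, of "polys {i} - {0}" X])
    show "points_ideal X \<inter> (polys {i} - {0}) = {}" using nz by auto
  qed (auto intro: polys_mult)
  have "p = 0" if "p \<in> J" "p \<in> polys {i}" for p using J(3) that by auto
  then obtain x where x: "x \<in> affine_space n" "{x} \<subset> locus n J" using point_in_locus[OF J(1) i] by blast
  have "enat 1 \<le> dim_closure n X"
    by (rule dim_closure_ge[of 1 n "\<lambda>k. if k = 0 then {x} else locus n J"])
       (use x irreducible_locus[OF J(1)] irreducible_point locus_subset_closure[OF X J(2)] in auto)
  then show ?thesis by (simp add: one_enat_def)
qed

text \<open>
  Choose a prime ideal \<open>I\<close> over the vanishing ideal of \<open>X\<close> without nonzero polynomials in the
  variables \<open>i\<close> and \<open>j\<close>. By the extension theorem the projection of its locus to the plane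
  contains the complement of a curve \<open>u = 0\<close>. So for a suitable \<open>c\<close> the slice at coordinate \<open>i\<close>
  equal to \<open>c\<close> takes all but finitely many values of coordinate \<open>j\<close>; a prime ideal \<open>J\<close> over its
  vanishing ideal lies strictly above \<open>I\<close>, and its locus contains more than one point.
\<close>

lemma dim_closure_ge_2:
  assumes X: "X \<subseteq> affine_space n" and ij: "i \<in> {1..n}" "j \<in> {1..n}" "i \<noteq> j"
    and indep: "\<And>p. p \<in> polys {i, j} \<Longrightarrow> (\<And>x. x \<in> X \<Longrightarrow> eval_poly p x = 0) \<Longrightarrow> p = 0"
  shows "2 \<le> dim_closure n X"
proof -
  obtain I where I: "is_prime_ideal I" "points_ideal X \<subseteq> I" "I \<inter> (polys {i, j} - {0}) = {}"
  proof (rule prime_ideal_avoiding[OF is_ideal_points_ideal, of "polys {i, j} - {0}" X])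
    show "points_ideal X \<inter> (polys {i, j} - {0}) = {}" using indep by (auto simp: points_ideal_def)
  qed (auto intro: polys_mult)
  have I0: "p = 0" if "p \<in> I" "p \<in> polys {i, j}" for p using I(3) that by blast
  have "1 \<notin> I" using I(1) by (simp add: is_prime_ideal_def)
  then obtain u where u: "u \<in> polys {i, j}" "u \<notin> I" and ext: "\<And>y. (\<forall>p\<in>I \<inter> polys {i, j}. eval_poly p y = 0) \<Longrightarrow> eval_poly u y \<noteq> 0 \<Longrightarrow>
     (\<exists>x\<in>locus n I. (\<forall>l\<in>{i, j}. x l = y l) \<and> eval_poly 1 x \<noteq> 0)"
    using extend_to_locus[OF I(1), of "{i, j}" n 1] ij by auto
  have u0: "u \<noteq> 0" using u(2) I(1) by (auto simp: is_prime_ideal_def is_ideal_def)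
  have slice: "\<exists>u'\<in>polys K. u' \<noteq> 0 \<and> (\<forall>y. eval_poly u' y \<noteq> 0 \<longrightarrow> finite {\<xi>. eval_poly p (y(k := \<xi>)) = 0})"
    if p: "p \<in> polys (insert k K)" "k \<notin> K" "p \<noteq> 0" for p k K
  proof -
    obtain U where U: "coeffs_in K U" "poly U (var k) = p" using univariate[OF p(1)] by blast
    then have "U \<noteq> 0" using p(3) by auto
    then obtain l where l: "coeff U l \<noteq> 0" by (metis coeff_0 poly_eqI)
    show ?thesis
    proof (intro bexI[of _ "coeff U l"] conjI allI impI l)
      show "coeff U l \<in> polys K" using U(1) by (simp add: coeffs_in_def)
      fix y assume "eval_poly (coeff U l) y \<noteq> 0"
      then have "finite {\<xi>. poly (specialize y U) \<xi> = 0}" by (rule finite_roots_specialize[OF refl])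
      then show "finite {\<xi>. eval_poly p (y(k := \<xi>)) = 0}" using poly_specialize[OF U(1) p(2), of y] U(2) by simp
    qed
  qed
  have cofinite: "\<exists>\<xi>. \<xi> \<notin> B" if "finite B" for B :: "complex set"
    using that infinite_UNIV_char_0[where 'a = complex] by (metis UNIV_eq_I)
  obtain u1 where u1: "u1 \<in> polys {i}" "u1 \<noteq> 0" "\<And>y. eval_poly u1 y \<noteq> 0 \<Longrightarrow> finite {\<xi>. eval_poly u (y(j := \<xi>)) = 0}"
    using slice[of u j "{i}"] u(1) u0 ij(3) by (auto simp: insert_commute)
  obtain u2 where u2: "u2 \<in> polys {}" "u2 \<noteq> 0" "\<And>y. eval_poly u2 y \<noteq> 0 \<Longrightarrow> finite {\<xi>. eval_poly u1 (y(i := \<xi>)) = 0}"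
    using slice[of u1 i "{}"] u1 by auto
  define y0 :: "nat \<Rightarrow> complex" where "y0 = (\<lambda>_. 0)"
  have "eval_poly u2 y0 \<noteq> 0" using polys_empty[OF u2(1)] u2(2) by auto
  then obtain c where c: "eval_poly u1 (y0(i := c)) \<noteq> 0" using u2(3) cofinite[of "{\<xi>. eval_poly u1 (y0(i := \<xi>)) = 0}"] by auto
  define bad where "bad = {\<xi>. eval_poly u (y0(i := c, j := \<xi>)) = 0}"
  have bad: "finite bad" unfolding bad_def using u1(3)[OF c] .
  define Y where "Y = {x \<in> locus n I. x i = c}"
  have fibre: "\<exists>x\<in>Y. x j = d" if "d \<notin> bad" for d
  proof -
    have "\<exists>x\<in>locus n I. (\<forall>l\<in>{i, j}. x l = (y0(i := c, j := d)) l) \<and> eval_poly 1 x \<noteq> 0"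
    proof (rule ext)
      show "\<forall>p\<in>I \<inter> polys {i, j}. eval_poly p (y0(i := c, j := d)) = 0" by (metis I0 IntD1 IntD2 eval_poly_0)
      show "eval_poly u (y0(i := c, j := d)) \<noteq> 0" using that unfolding bad_def by blast
    qed
    then show ?thesis using ij(3) by (auto simp: Y_def)
  qed
  have nz: "p = 0" if p: "p \<in> points_ideal Y" "p \<in> polys {j}" for p
  proof (rule ccontr)
    assume "p \<noteq> 0"
    then obtain u' where u': "u' \<in> polys {}" "u' \<noteq> 0" "\<And>y. eval_poly u' y \<noteq> 0 \<Longrightarrow> finite {\<xi>. eval_poly p (y(j := \<xi>)) = 0}"
      using slice[of p j "{}"] p(2) by auto
    have "eval_poly u' y0 \<noteq> 0" using polys_empty[OF u'(1)] u'(2) by auto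
    then have fin: "finite (bad \<union> {\<xi>. eval_poly p (y0(j := \<xi>)) = 0})" using u'(3) bad by blast
    then obtain d where d: "d \<notin> bad" "eval_poly p (y0(j := d)) \<noteq> 0" using cofinite[OF fin] by auto
    obtain x where x: "x \<in> Y" "x j = d" using fibre[OF d(1)] by blast
    have "eval_poly p (y0(j := d)) = eval_poly p x" using p(2) x(2) by (intro eval_cong[of p "{j}"]) auto
    then show False using d(2) p(1) x(1) by (simp add: points_ideal_def)
  qed
  obtain J where J: "is_prime_ideal J" "points_ideal Y \<subseteq> J" "J \<inter> (polys {j} - {0}) = {}"
  proof (rule prime_ideal_avoiding[OF is_ideal_points_ideal, of "polys {j} - {0}" Y])
    show "points_ideal Y \<inter> (polys {j} - {0}) = {}" using nz by auto
  qed (auto intro: polys_mult)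
  have "p = 0" if "p \<in> J" "p \<in> polys {j}" for p using J(3) that by auto
  then obtain x where x: "x \<in> affine_space n" "{x} \<subset> locus n J" using point_in_locus[OF J(1) ij(2)] by blast
  have "I \<inter> polys {1..n} \<subseteq> points_ideal Y" by (auto simp: points_ideal_def Y_def dest: locusD)
  then have sub: "locus n J \<subseteq> locus n I" using J(2) unfolding locus_def zero_locus_def by blast
  moreover have "locus n J \<noteq> locus n I"
  proof
    assume e: "locus n J = locus n I"
    let ?p = "var i - cst c"
    have p: "?p \<in> polys {1..n}" "?p \<in> polys {i, j}" using ij by (auto intro!: polys_diff polys_var)
    have "?p \<in> J" using J(2) by (auto simp: points_ideal_def Y_def)
    then have "\<And>x. x \<in> locus n I \<Longrightarrow> eval_poly ?p x = 0" using locusD[OF _ _ p(1)] e by blast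
    then have "?p \<in> I" using nullstellensatz[OF I(1) p(1)] by blast
    then have "?p = 0" using I0 p(2) by blast
    then have "eval_poly ?p (\<lambda>_. c + 1) = 0" by simp
    then show False by simp
  qed
  ultimately have JI: "locus n J \<subset> locus n I" by blast
  have "enat 2 \<le> dim_closure n X"
  proof (rule dim_closure_ge[of 2 n "\<lambda>k. if k = 0 then {x} else if k = 1 then locus n J else locus n I"])
    show "irreducible_closedin (zariski n) (if k = 0 then {x} else if k = 1 then locus n J else locus n I)" for k :: nat
      using x irreducible_locus[OF J(1)] irreducible_locus[OF I(1)] irreducible_point by auto
    show "(if k = 0 then {x} else if k = 1 then locus n J else locus n I)
      \<subset> (if Suc k = 0 then {x} else if Suc k = 1 then locus n J else locus n I)" if "k < 2" for k :: nat
      using that x JI by (auto simp: less_2_cases_iff)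
  qed (use locus_subset_closure[OF X I(2)] in auto)
  then show ?thesis by (simp add: numeral_eq_enat)
qed

text \<open>
  Finite sets are closed and discrete, so their irreducible closed subsets are points.
\<close>

lemma dim_closure_finite:
  assumes X: "X \<subseteq> affine_space n" "finite X" "X \<noteq> {}"
  shows "dim_closure n X = 0"
proof -
  have "closedin (zariski n) (\<Union>x\<in>X. {x})" using X by (intro closedin_Union) (auto intro: closedin_point)
  then have cl: "closedin (zariski n) X" by simp
  then have e: "zariski n closure_of X = X" by (simp add: closure_of_eq)
  have "k = 0" if C: "\<forall>i\<le>k. irreducible_closedin (subtopology (zariski n) X) (C i)" "\<forall>i<k. C i \<subset> C (Suc i)" for k C
  proof (rule ccontr)
    assume k: "k \<noteq> 0"
    have irr_le: "irreducible_closedin (zariski n) (C i) \<and> C i \<subseteq> X" if "i \<le> k" for i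
      using C(1) that irreducible_subtopology[OF cl, of "C i"] by simp
    have irr: "C 1 = A \<or> C 1 = B" if "closedin (zariski n) A" "closedin (zariski n) B" "C 1 = A \<union> B" for A B
      using irr_le[of 1] k that unfolding irreducible_closedin_def by (metis less_one not_less)
    have ss: "C 1 \<subseteq> X" using irr_le[of 1] k by simp
    have C0: "C 0 \<noteq> {}" "C 0 \<subset> C 1" using irr_le[of 0] C(2) k by (auto simp: irreducible_closedin_def)
    obtain x where x: "x \<in> C 0" using C0 by blast
    have fin: "closedin (zariski n) B" if "B \<subseteq> X" for B
    proof -
      have "closedin (zariski n) (\<Union>x\<in>B. {x})" using X that by (intro closedin_Union) (auto intro: closedin_point finite_subset)
      then show ?thesis by simp
    qed
    have xC: "x \<in> C 1" using x C0(2) by (rule psubsetD[rotated])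
    have "C 1 = {x} \<or> C 1 = C 1 - {x}"
    proof (rule irr)
      show "C 1 = {x} \<union> (C 1 - {x})" using xC by auto
      show "closedin (zariski n) {x}" by (rule fin) (use xC ss in auto)
      show "closedin (zariski n) (C 1 - {x})" by (rule fin) (use ss in auto)
    qed
    then show False
    proof
      assume "C 1 = {x}"
      then show False using C0 by (metis psubset_eq subset_singletonD)
    next
      assume "C 1 = C 1 - {x}"
      then show False using xC by (metis DiffD2 singletonI)
    qed
  qed
  then have S0: "{enat k |k. \<exists>C. (\<forall>i\<le>k. irreducible_closedin (subtopology (zariski n) X) (C i)) \<and> (\<forall>i<k. C i \<subset> C (Suc i))} \<subseteq> {0}"
    by (auto simp: zero_enat_def)
  then have "krull_dim (subtopology (zariski n) X) \<le> 0"
    unfolding krull_dim_def by (intro Sup_least) (drule subsetD[OF S0], simp)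
  then show ?thesis unfolding e by simp
qed

lemma substitute_polynomials:
  fixes G :: "complex poly poly"
  assumes "p \<in> polys K" "q \<in> polys K"
  shows "\<exists>r\<in>polys K. \<forall>x. eval_poly r x = poly (poly G [:eval_poly p x:]) (eval_poly q x)"
proof -
  have inner: "\<exists>r\<in>polys K. \<forall>x. eval_poly r x = poly g (eval_poly q x)" for g
  proof (induction g)
    case 0 show ?case by (intro bexI[of _ 0]) auto
  next
    case (pCons c g)
    then obtain r where "r \<in> polys K" "\<forall>x. eval_poly r x = poly g (eval_poly q x)" by blast
    then show ?case using assms by (intro bexI[of _ "cst c + q * r"]) (auto intro: polys_add polys_mult)
  qed
  show ?thesis
  proof (induction G)
    case 0 show ?case by (intro bexI[of _ 0]) auto
  next
    case (pCons g G)
    then obtain r where r: "r \<in> polys K" "\<forall>x. eval_poly r x = poly (poly G [:eval_poly p x:]) (eval_poly q x)" by blast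
    obtain s where s: "s \<in> polys K" "\<forall>x. eval_poly s x = poly g (eval_poly q x)" using inner by blast
    then show ?case using assms r by (intro bexI[of _ "s + p * r"]) (auto intro: polys_add polys_mult)
  qed
qed

lemma irreducible_cancel:
  assumes Z: "irreducible_closedin (zariski n) Z" and pq: "p \<in> polys {1..n}" "q \<in> polys {1..n}"
    and v: "\<And>x. x \<in> Z \<Longrightarrow> eval_poly p x * eval_poly q x = 0" and p: "x0 \<in> Z" "eval_poly p x0 \<noteq> 0"
  shows "\<forall>x\<in>Z. eval_poly q x = 0"
proof -
  have cl: "closedin (zariski n) (Z \<inter> zero_locus n {r})" if "r \<in> polys {1..n}" for r
    using Z that by (intro closedin_Int) (auto simp: irreducible_closedin_def closedin_zariski polynomials_eq)
  have sub: "Z \<subseteq> affine_space n"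
    using Z closedin_subset unfolding irreducible_closedin_def by (metis topspace_zariski)
  then have "Z = (Z \<inter> zero_locus n {p}) \<union> (Z \<inter> zero_locus n {q})"
    using v by (auto simp: zero_locus_def)
  then have "Z = Z \<inter> zero_locus n {p} \<or> Z = Z \<inter> zero_locus n {q}"
    using Z cl pq unfolding irreducible_closedin_def by metis
  moreover have "Z \<noteq> Z \<inter> zero_locus n {p}" using p by (auto simp: zero_locus_def)
  ultimately have "Z \<subseteq> zero_locus n {q}" by blast
  then show ?thesis by (auto simp: zero_locus_def)
qed

lemma poly_split_zero:
  fixes G :: "'r::idom poly"
  assumes "G \<noteq> 0" shows "\<exists>k H. G = [:0, 1:] ^ k * H \<and> coeff H 0 \<noteq> 0"
proof -
  obtain H where H: "G = [:- 0, 1:] ^ order 0 G * H" "\<not> [:- 0, 1:] dvd H" using order_decomp[OF assms] by blast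
  then have "poly H 0 \<noteq> 0" by (simp add: poly_eq_0_iff_dvd)
  then show ?thesis using H(1) by (intro exI[of _ "order 0 G"] exI[of _ H]) (simp add: poly_0_coeff_0)
qed

text \<open>
  Take \<open>p\<close> vanishing on \<open>C1\<close> but not on \<open>C2\<close> and \<open>q\<close> vanishing on \<open>C0\<close> but not on \<open>C1\<close>. In a
  relation that holds on \<open>C2\<close>, powers of \<open>p\<close> can be cancelled, as \<open>C2\<close> is irreducible;
  restricted to \<open>C1\<close> it becomes a relation for \<open>q\<close> alone, in which powers of \<open>q\<close> can be
  cancelled. Then it has a nonzero constant term, which contradicts \<open>q = 0\<close> on \<open>C0\<close>.
\<close>

lemma chain_independent:
  assumes C: "irreducible_closedin (zariski n) C0" "irreducible_closedin (zariski n) C1" "irreducible_closedin (zariski n) C2"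
    "C0 \<subset> C1" "C1 \<subset> C2"
  shows "\<exists>p\<in>polys {1..n}. \<exists>q\<in>polys {1..n}. \<forall>G. G \<noteq> 0 \<longrightarrow> (\<exists>x\<in>C2. poly (poly G [:eval_poly p x:]) (eval_poly q x) \<noteq> 0)"
proof -
  have sep: "\<exists>p\<in>polys {1..n}. (\<forall>x\<in>A. eval_poly p x = 0) \<and> (\<exists>x\<in>B. eval_poly p x \<noteq> 0)"
    if A: "irreducible_closedin (zariski n) A" "A \<subset> B" "irreducible_closedin (zariski n) B" for A B
  proof -
    obtain S where S: "S \<subseteq> polys {1..n}" "A = zero_locus n S"
      using A(1) unfolding irreducible_closedin_def closedin_zariski polynomials_eq by blast
    obtain x where x: "x \<in> B" "x \<notin> A" using A(2) by blast
    have "x \<in> affine_space n" using x A(3) closedin_subset unfolding irreducible_closedin_def by (metis subsetD topspace_zariski)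
    then obtain s where "s \<in> S" "eval_poly s x \<noteq> 0" using x S by (auto simp: zero_locus_def)
    then show ?thesis using S x by (intro bexI[of _ s]) (auto simp: zero_locus_def)
  qed
  obtain p xp where p: "p \<in> polys {1..n}" "\<forall>x\<in>C1. eval_poly p x = 0" "xp \<in> C2" "eval_poly p xp \<noteq> 0"
    using sep[OF C(2,5,3)] by blast
  obtain q xq where q: "q \<in> polys {1..n}" "\<forall>x\<in>C0. eval_poly q x = 0" "xq \<in> C1" "eval_poly q xq \<noteq> 0"
    using sep[OF C(1,4,2)] by blast
  have "\<exists>x\<in>C2. poly (poly G [:eval_poly p x:]) (eval_poly q x) \<noteq> 0" if "G \<noteq> 0" for G
  proof (rule ccontr)
    assume "\<not> ?thesis"
    then have G0: "poly (poly G [:eval_poly p x:]) (eval_poly q x) = 0" if "x \<in> C2" for x using that by blast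
    obtain k H where H: "G = [:0, 1:] ^ k * H" "coeff H 0 \<noteq> 0" using poly_split_zero[OF \<open>G \<noteq> 0\<close>] by blast
    obtain r where r: "r \<in> polys {1..n}" "\<And>x. eval_poly r x = poly (poly H [:eval_poly p x:]) (eval_poly q x)"
      using substitute_polynomials[OF p(1) q(1), of H] by blast
    have "\<forall>x\<in>C2. eval_poly r x = 0"
    proof (rule irreducible_cancel[OF C(3) polys_power[OF p(1), of k] r(1) _ p(3)])
      show "eval_poly (p ^ k) x * eval_poly r x = 0" if "x \<in> C2" for x
        using G0[OF that] by (simp add: H(1) r(2) poly_power)
    qed (use p in simp)
    then have "poly (poly H [:eval_poly p x:]) (eval_poly q x) = 0" if "x \<in> C1" for x using that r(2) C(5) by auto
    then have h0: "poly (coeff H 0) (eval_poly q x) = 0" if "x \<in> C1" for x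
      using that p(2) by (auto simp: poly_0_coeff_0)
    obtain l h where h: "coeff H 0 = [:0, 1:] ^ l * h" "coeff h 0 \<noteq> 0" using poly_split_zero[OF H(2)] by blast
    obtain s where s: "s \<in> polys {1..n}" "\<And>x. eval_poly s x = poly h (eval_poly q x)"
      using substitute_polynomials[OF p(1) q(1), of "[:h:]"] by auto
    have "\<forall>x\<in>C1. eval_poly s x = 0"
    proof (rule irreducible_cancel[OF C(2) polys_power[OF q(1), of l] s(1) _ q(3)])
      show "eval_poly (q ^ l) x * eval_poly s x = 0" if "x \<in> C1" for x
        using h0[OF that] by (simp add: h(1) s(2) poly_power)
    qed (use q in simp)
    moreover obtain x0 where "x0 \<in> C0" using C(1) by (auto simp: irreducible_closedin_def)
    ultimately have "poly h 0 = 0" using s(2)[of x0] q(2) C(4) by auto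
    then show False using h(2) by (simp add: poly_0_coeff_0)
  qed
  then show ?thesis using p(1) q(1) by blast
qed

text \<open>
  A polynomial relation that holds on \<open>X\<close> holds on the closure, in contrast to
  \<open>chain_independent\<close>.
\<close>

lemma dim_closure_le_1:
  assumes X: "X \<subseteq> affine_space n"
    and dep: "\<And>p q. p \<in> polys {1..n} \<Longrightarrow> q \<in> polys {1..n} \<Longrightarrow>
      \<exists>G. G \<noteq> 0 \<and> (\<forall>x\<in>X. poly (poly G [:eval_poly p x:]) (eval_poly q x) = 0)"
  shows "dim_closure n X \<le> 1"
  unfolding krull_dim_def
proof (rule Sup_least, clarify)
  fix k C assume C: "\<forall>i\<le>k. irreducible_closedin (subtopology (zariski n) (zariski n closure_of X)) (C i)" "\<forall>i<k. C i \<subset> C (Suc i)"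
  have irr: "irreducible_closedin (zariski n) (C i)" "C i \<subseteq> zariski n closure_of X" if "i \<le> k" for i
    using C(1) that irreducible_subtopology[OF closedin_closure_of, of "zariski n" X "C i"] by simp_all
  show "enat k \<le> 1"
  proof (rule ccontr)
    assume "\<not> enat k \<le> 1"
    then have k: "k \<ge> 2" by (simp add: one_enat_def)
    have "C 0 \<subset> C 1" "C 1 \<subset> C 2"
      using C(2)[rule_format, of 0] C(2)[rule_format, of 1] k by (simp_all add: numeral_2_eq_2)
    then obtain p q where pq: "p \<in> polys {1..n}" "q \<in> polys {1..n}"
      "\<And>G. G \<noteq> 0 \<Longrightarrow> \<exists>x\<in>C 2. poly (poly G [:eval_poly p x:]) (eval_poly q x) \<noteq> 0"
      using chain_independent[of n "C 0" "C 1" "C 2"] irr(1)[of 0] irr(1)[of 1] irr(1)[of 2] k by auto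
    obtain G where G: "G \<noteq> 0" "\<forall>x\<in>X. poly (poly G [:eval_poly p x:]) (eval_poly q x) = 0" using dep[OF pq(1,2)] by blast
    obtain r where r: "r \<in> polys {1..n}" "\<And>x. eval_poly r x = poly (poly G [:eval_poly p x:]) (eval_poly q x)"
      using substitute_polynomials[OF pq(1,2), of G] by blast
    have "eval_poly r x = 0" if "x \<in> C 2" for x
      using vanish_on_closure[OF r(1) X, of x] G(2) r(2) irr(2)[OF k] that by auto
    then show False using pq(3)[OF G(1)] r(2) by auto
  qed
qed

section \<open>Algebraic dependence of Laurent polynomials\<close>

text \<open>
  A homogeneous system with more unknowns than equations, by Gaussian elimination.
\<close>

lemma nontrivial_solution:
  fixes M :: "nat \<Rightarrow> 's \<Rightarrow> complex"
  assumes "finite S" "r < card S"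
  shows "\<exists>c. (\<exists>s\<in>S. c s \<noteq> 0) \<and> (\<forall>e<r. (\<Sum>s\<in>S. c s * M e s) = 0)"
  using assms
proof (induction r arbitrary: S M)
  case 0
  then obtain s where "s \<in> S" by fastforce
  then show ?case by (intro exI[of _ "\<lambda>_. 1"]) auto
next
  case (Suc r)
  show ?case
  proof (cases "\<forall>s\<in>S. M r s = 0")
    case True
    obtain c where c: "\<exists>s\<in>S. c s \<noteq> 0" "\<forall>e<r. (\<Sum>s\<in>S. c s * M e s) = 0"
      using Suc.IH[of S M] Suc.prems by auto
    have "(\<Sum>s\<in>S. c s * M r s) = 0" using True by (intro sum.neutral) auto
    then show ?thesis using c by (intro exI[of _ c]) (auto simp: less_Suc_eq)
  next
    case False
    then obtain s0 where s0: "s0 \<in> S" "M r s0 \<noteq> 0" by blast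
    define S' where "S' = S - {s0}"
    have S': "finite S'" "r < card S'" "S = insert s0 S'" "s0 \<notin> S'" using Suc.prems s0 by (auto simp: S'_def)
    obtain c where c: "\<exists>s\<in>S'. c s \<noteq> 0" "\<forall>e<r. (\<Sum>s\<in>S'. c s * (M e s - M e s0 * M r s / M r s0)) = 0"
      using Suc.IH[OF S'(1,2), of "\<lambda>e s. M e s - M e s0 * M r s / M r s0"] by auto
    define c0 where "c0 = - (\<Sum>s\<in>S'. c s * M r s) / M r s0"
    define c' where "c' = c(s0 := c0)"
    have sum: "(\<Sum>s\<in>S. c' s * M e s) = c0 * M e s0 + (\<Sum>s\<in>S'. c s * M e s)" for e
    proof -
      have "(\<Sum>s\<in>S'. c' s * M e s) = (\<Sum>s\<in>S'. c s * M e s)"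
        using S'(4) by (intro sum.cong) (auto simp: c'_def)
      then show ?thesis using S' by (simp add: c'_def)
    qed
    have "(\<Sum>s\<in>S. c' s * M e s) = 0" if "e < Suc r" for e
    proof (cases "e = r")
      case True
      then show ?thesis using s0(2) by (simp add: sum c0_def)
    next
      case False
      then have "(\<Sum>s\<in>S'. c s * (M e s - M e s0 * M r s / M r s0)) = 0" using c(2) that by simp
      moreover have "(\<Sum>s\<in>S'. c s * (M e s - M e s0 * M r s / M r s0)) =
          (\<Sum>s\<in>S'. c s * M e s) - (\<Sum>s\<in>S'. (c s * M r s) * (M e s0 / M r s0))"
        by (simp add: sum_subtractf right_diff_distrib ac_simps)
      moreover have "(\<Sum>s\<in>S'. (c s * M r s) * (M e s0 / M r s0)) = (\<Sum>s\<in>S'. c s * M r s) * (M e s0 / M r s0)"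
        by (simp only: sum_distrib_right)
      ultimately show ?thesis by (simp add: sum c0_def)
    qed
    moreover have "\<exists>s\<in>S. c' s \<noteq> 0" using c(1) S'(3,4) by (auto simp: c'_def)
    ultimately show ?thesis by blast
  qed
qed

text \<open>
  Counting dimensions. Cleared of denominators, the \<open>(N + 1)\<^sup>2\<close> products \<open>u ^ i * v ^ j\<close> with
  \<open>i, j \<le> N\<close> become polynomials in \<open>z\<close> of degree linear in \<open>N\<close>, so for large \<open>N\<close> they are
  linearly dependent.
\<close>

lemma laurent_dependence:
  fixes A B :: "complex poly"
  shows "\<exists>G::complex poly poly. G \<noteq> 0 \<and> (\<forall>z u v. z \<noteq> 0 \<longrightarrow> u * z ^ D = poly A z \<longrightarrow> v * z ^ D = poly B z \<longrightarrow>
    poly (poly G [:u:]) v = 0)"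
proof -
  define N where "N = degree A + degree B + 2 * D + 1"
  define r where "r = N * (degree A + degree B + 2 * D) + 1"
  define S where "S = {..N} \<times> {..N}"
  define T where "T = (\<lambda>(i, j). A ^ i * B ^ j * monom 1 (D * (2 * N - i - j)))"
  have S: "finite S" "card S = Suc N * Suc N" by (auto simp: S_def)
  have "N * (degree A + degree B + 2 * D) \<le> N * N" unfolding N_def by (intro mult_le_mono2) simp
  moreover have "Suc N * Suc N = N * N + 2 * N + 1" by (simp add: algebra_simps)
  ultimately have "r < card S" unfolding S(2) r_def using N_def by linarith
  from nontrivial_solution[OF S(1) this, of "\<lambda>e s. coeff (T s) e"]
  obtain c where c: "\<exists>s\<in>S. c s \<noteq> 0" "\<forall>e<r. (\<Sum>s\<in>S. c s * coeff (T s) e) = 0" by blast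
  have degT: "degree (T s) < r" if "s \<in> S" for s
  proof -
    obtain i j where s: "s = (i, j)" "i \<le> N" "j \<le> N" using \<open>s \<in> S\<close> by (auto simp: S_def)
    have "degree (T s) \<le> degree (A ^ i * B ^ j) + degree (monom (1::complex) (D * (2 * N - i - j)))"
      unfolding T_def s(1) prod.case by (rule degree_mult_le)
    also have "degree (A ^ i * B ^ j) \<le> degree (A ^ i) + degree (B ^ j)" by (rule degree_mult_le)
    also have "degree (A ^ i) \<le> degree A * i" by (rule degree_power_le)
    also have "degree (B ^ j) \<le> degree B * j" by (rule degree_power_le)
    also have "degree (monom (1::complex) (D * (2 * N - i - j))) \<le> D * (2 * N)"
      by (rule order_trans[OF degree_monom_le]) simp
    also have "degree A * i + degree B * j + D * (2 * N) \<le> degree A * N + degree B * N + D * (2 * N)"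
      using s by (intro add_mono mult_le_mono2) auto
    also have "\<dots> < r" by (simp add: r_def algebra_simps)
    finally show ?thesis by simp
  qed
  have zero: "(\<Sum>s\<in>S. smult (c s) (T s)) = 0"
  proof (rule poly_eqI)
    fix e
    show "coeff (\<Sum>s\<in>S. smult (c s) (T s)) e = coeff 0 e"
    proof (cases "e < r")
      case True then show ?thesis using c(2) by (simp add: coeff_sum)
    next
      case False
      then have "coeff (T s) e = 0" if "s \<in> S" for s using degT[OF that] by (intro coeff_eq_0) simp
      then show ?thesis by (simp add: coeff_sum)
    qed
  qed
  define G where "G = (\<Sum>i\<le>N. monom (\<Sum>j\<le>N. monom (c (i, j)) j) i)"
  have "G \<noteq> 0"
  proof
    assume "G = 0"
    obtain i j where ij: "c (i, j) \<noteq> 0" "i \<le> N" "j \<le> N" using c(1) by (auto simp: S_def)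
    have "coeff G i = (\<Sum>j\<le>N. monom (c (i, j)) j)"
      unfolding G_def coeff_sum coeff_monom using ij(2) by (simp add: sum.delta)
    then have "coeff (coeff G i) j = c (i, j)" using ij(3) by (simp add: coeff_sum sum.delta)
    then show False using \<open>G = 0\<close> ij(1) by simp
  qed
  moreover have "poly (poly G [:u:]) v = 0"
    if z: "z \<noteq> 0" and u: "u * z ^ D = poly A z" and v: "v * z ^ D = poly B z" for z u v
  proof -
    have "poly (poly G [:u:]) v = (\<Sum>i\<le>N. \<Sum>j\<le>N. c (i, j) * (u ^ i * v ^ j))"
      unfolding G_def poly_sum poly_monom poly_mult poly_power
      by (simp add: sum_distrib_right sum_distrib_left ac_simps)
    also have "\<dots> = (\<Sum>(i, j)\<in>S. c (i, j) * (u ^ i * v ^ j))" unfolding S_def by (simp add: sum.cartesian_product)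
    finally have "z ^ (D * (2 * N)) * poly (poly G [:u:]) v = (\<Sum>(i, j)\<in>S. c (i, j) * (z ^ (D * (2 * N)) * (u ^ i * v ^ j)))"
      by (simp add: sum_distrib_left case_prod_unfold ac_simps)
    also have "\<dots> = (\<Sum>s\<in>S. poly (smult (c s) (T s)) z)"
    proof (rule sum.cong[OF refl])
      fix s assume "s \<in> S"
      then obtain i j where s: "s = (i, j)" "i \<le> N" "j \<le> N" by (auto simp: S_def)
      have "D * (2 * N) = D * i + D * j + D * (2 * N - i - j)"
        using s by (metis (no_types, lifting) add_mult_distrib2 add_mono le_add_diff_inverse diff_diff_left mult_2)
      then have "z ^ (D * (2 * N)) * (u ^ i * v ^ j) = (u * z ^ D) ^ i * (v * z ^ D) ^ j * z ^ (D * (2 * N - i - j))"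
        by (simp add: power_add power_mult power_mult_distrib ac_simps)
      then show "(case s of (i, j) \<Rightarrow> c (i, j) * (z ^ (D * (2 * N)) * (u ^ i * v ^ j))) = poly (smult (c s) (T s)) z"
        unfolding u v by (simp add: s T_def poly_power poly_monom)
    qed
    also have "\<dots> = poly (\<Sum>s\<in>S. smult (c s) (T s)) z" by (simp only: poly_sum)
    also have "\<dots> = 0" unfolding zero by simp
    finally show ?thesis using z by simp
  qed
  ultimately show ?thesis by blast
qed

text \<open>
  The sequence is eventually a Laurent polynomial in \<open>\<Lambda> ^ k\<close>.
\<close>

definition laurent :: "complex \<Rightarrow> (nat \<Rightarrow> complex) \<Rightarrow> bool" where
  "laurent \<Lambda> u \<longleftrightarrow> (\<exists>A D. \<forall>\<^sub>F k in sequentially. u k * (\<Lambda> ^ k) ^ D = poly A (\<Lambda> ^ k))"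

lemma laurent_const: "laurent \<Lambda> (\<lambda>_. c)"
  unfolding laurent_def by (intro exI[of _ "[:c:]"] exI[of _ 0]) simp

lemma laurent_add:
  assumes "laurent \<Lambda> u" "laurent \<Lambda> v" shows "laurent \<Lambda> (\<lambda>k. u k + v k)"
proof -
  obtain A D B E where "\<forall>\<^sub>F k in sequentially. u k * (\<Lambda> ^ k) ^ D = poly A (\<Lambda> ^ k)"
    "\<forall>\<^sub>F k in sequentially. v k * (\<Lambda> ^ k) ^ E = poly B (\<Lambda> ^ k)" using assms by (auto simp: laurent_def)
  then have "\<forall>\<^sub>F k in sequentially. (u k + v k) * (\<Lambda> ^ k) ^ (D + E) = poly (A * monom 1 E + B * monom 1 D) (\<Lambda> ^ k)"
  proof eventually_elim
    case (elim k)
    have "(u k + v k) * (\<Lambda> ^ k) ^ (D + E) = (u k * (\<Lambda> ^ k) ^ D) * (\<Lambda> ^ k) ^ E + (v k * (\<Lambda> ^ k) ^ E) * (\<Lambda> ^ k) ^ D"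
      by (simp add: power_add algebra_simps)
    then show ?case unfolding elim by (simp add: poly_monom)
  qed
  then show ?thesis unfolding laurent_def by blast
qed

lemma laurent_mult:
  assumes "laurent \<Lambda> u" "laurent \<Lambda> v" shows "laurent \<Lambda> (\<lambda>k. u k * v k)"
proof -
  obtain A D B E where "\<forall>\<^sub>F k in sequentially. u k * (\<Lambda> ^ k) ^ D = poly A (\<Lambda> ^ k)"
    "\<forall>\<^sub>F k in sequentially. v k * (\<Lambda> ^ k) ^ E = poly B (\<Lambda> ^ k)" using assms by (auto simp: laurent_def)
  then have "\<forall>\<^sub>F k in sequentially. (u k * v k) * (\<Lambda> ^ k) ^ (D + E) = poly (A * B) (\<Lambda> ^ k)"
  proof eventually_elim
    case (elim k)
    have "(u k * v k) * (\<Lambda> ^ k) ^ (D + E) = (u k * (\<Lambda> ^ k) ^ D) * (v k * (\<Lambda> ^ k) ^ E)"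
      by (simp add: power_add algebra_simps)
    then show ?case unfolding elim by simp
  qed
  then show ?thesis unfolding laurent_def by blast
qed

lemma laurent_sum: "(\<And>i. i \<in> I \<Longrightarrow> laurent \<Lambda> (u i)) \<Longrightarrow> laurent \<Lambda> (\<lambda>k. \<Sum>i\<in>I. u i k)"
  by (induction I rule: infinite_finite_induct) (auto intro: laurent_add laurent_const)

lemma laurent_prod: "(\<And>i. i \<in> I \<Longrightarrow> laurent \<Lambda> (u i)) \<Longrightarrow> laurent \<Lambda> (\<lambda>k. \<Prod>i\<in>I. u i k)"
  by (induction I rule: infinite_finite_induct) (auto intro: laurent_mult laurent_const)

lemma laurent_power: "laurent \<Lambda> u \<Longrightarrow> laurent \<Lambda> (\<lambda>k. u k ^ j)"
  by (induction j) (auto intro: laurent_mult laurent_const)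

lemma laurent_eval:
  assumes "\<And>i. i \<in> K \<Longrightarrow> laurent \<Lambda> (\<lambda>k. x k i)" "p \<in> polys K"
  shows "laurent \<Lambda> (\<lambda>k. eval_poly p (x k))"
  unfolding eval_poly_def eval_monom_def
proof (intro laurent_sum laurent_mult laurent_const laurent_prod laurent_power assms(1))
  fix m i assume "m \<in> Poly_Mapping.keys p" "i \<in> Poly_Mapping.keys m"
  then show "i \<in> K" using assms(2) by (auto simp: polys_def)
qed

lemma laurent_relation:
  assumes \<Lambda>: "\<Lambda> \<noteq> 0" and uv: "laurent \<Lambda> u" "laurent \<Lambda> v"
  shows "\<exists>G::complex poly poly. G \<noteq> 0 \<and> (\<forall>\<^sub>F k in sequentially. poly (poly G [:u k:]) (v k) = 0)"
proof -
  obtain A D B E where ev: "\<forall>\<^sub>F k in sequentially. u k * (\<Lambda> ^ k) ^ D = poly A (\<Lambda> ^ k)"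
    "\<forall>\<^sub>F k in sequentially. v k * (\<Lambda> ^ k) ^ E = poly B (\<Lambda> ^ k)" using uv by (auto simp: laurent_def)
  obtain G :: "complex poly poly" where G: "G \<noteq> 0" "\<And>z u v. z \<noteq> 0 \<Longrightarrow> u * z ^ (D + E) = poly (A * monom 1 E) z \<Longrightarrow>
      v * z ^ (D + E) = poly (B * monom 1 D) z \<Longrightarrow> poly (poly G [:u:]) v = 0"
    using laurent_dependence[of "D + E" "A * monom 1 E" "B * monom 1 D"] by blast
  have "\<forall>\<^sub>F k in sequentially. poly (poly G [:u k:]) (v k) = 0"
    using ev
  proof eventually_elim
    case (elim k)
    show ?case
    proof (rule G(2)[of "\<Lambda> ^ k"])
      have "u k * (\<Lambda> ^ k) ^ (D + E) = (u k * (\<Lambda> ^ k) ^ D) * (\<Lambda> ^ k) ^ E" by (simp add: power_add)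
      then show "u k * (\<Lambda> ^ k) ^ (D + E) = poly (A * monom 1 E) (\<Lambda> ^ k)" unfolding elim by (simp add: poly_monom)
      have "v k * (\<Lambda> ^ k) ^ (D + E) = (v k * (\<Lambda> ^ k) ^ E) * (\<Lambda> ^ k) ^ D" by (simp add: power_add ac_simps)
      then show "v k * (\<Lambda> ^ k) ^ (D + E) = poly (B * monom 1 D) (\<Lambda> ^ k)" unfolding elim by (simp add: poly_monom)
    qed (use \<Lambda> in simp)
  qed
  then show ?thesis using G(1) by blast
qed

text \<open>
  On each residue class of the index the values are Laurent polynomials in \<open>\<Lambda> ^ k\<close>, hence
  dependent. The finitely many exceptional points and the finitely many classes are accommodated
  by multiplying relations.
\<close>

lemma laurent_points_dependent:
  assumes \<Lambda>: "\<Lambda> \<noteq> 0" and M: "M > 0" and P: "\<And>s i. i \<in> K \<Longrightarrow> laurent \<Lambda> (\<lambda>k. P (s + k * M) i)"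
    and pq: "p \<in> polys K" "q \<in> polys K"
  shows "\<exists>G. G \<noteq> 0 \<and> (\<forall>x\<in>range P. poly (poly G [:eval_poly p x:]) (eval_poly q x) = 0)"
proof -
  have "\<exists>G::complex poly poly. G \<noteq> 0 \<and> (\<forall>k. poly (poly G [:eval_poly p (P (s + k * M)):]) (eval_poly q (P (s + k * M))) = 0)" for s
  proof -
    let ?u = "\<lambda>k. eval_poly p (P (s + k * M))" and ?v = "\<lambda>k. eval_poly q (P (s + k * M))"
    have "laurent \<Lambda> ?u" "laurent \<Lambda> ?v" using pq by (auto intro!: laurent_eval[of K] P)
    then obtain G :: "complex poly poly" where G: "G \<noteq> 0" "\<forall>\<^sub>F k in sequentially. poly (poly G [:?u k:]) (?v k) = 0"
      using laurent_relation[OF \<Lambda>] by blast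
    then obtain k0 where k0: "\<And>k. k \<ge> k0 \<Longrightarrow> poly (poly G [:?u k:]) (?v k) = 0" by (auto simp: eventually_sequentially)
    define F where "F = G * (\<Prod>k<k0. [:[:- ?u k:], 1:])"
    have "F \<noteq> 0" using G(1) by (simp add: F_def)
    moreover have "poly (poly F [:?u k:]) (?v k) = 0" for k
    proof (cases "k \<ge> k0")
      case True then show ?thesis using k0 by (simp add: F_def)
    next
      case False
      then have "(\<Prod>l<k0. poly (poly [:[:- ?u l:], 1:] [:?u k:]) (?v k)) = 0"
        by (intro prod_zero bexI[of _ k]) auto
      then show ?thesis by (simp add: F_def poly_prod)
    qed
    ultimately show ?thesis by blast
  qed
  then obtain G where G: "\<And>s. G s \<noteq> (0 :: complex poly poly)"
    "\<And>s k. poly (poly (G s) [:eval_poly p (P (s + k * M)):]) (eval_poly q (P (s + k * M))) = 0" by metis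
  have "(\<Prod>s<M. G s) \<noteq> 0" using G(1) by simp
  moreover have "poly (poly (\<Prod>s<M. G s) [:eval_poly p (P t):]) (eval_poly q (P t)) = 0" for t
  proof -
    have "poly (poly (G (t mod M)) [:eval_poly p (P t):]) (eval_poly q (P t)) = 0"
      using G(2)[of "t mod M" "t div M"] by simp
    then have "(\<Prod>s<M. poly (poly (G s) [:eval_poly p (P t):]) (eval_poly q (P t))) = 0"
      using M by (intro prod_zero bexI[of _ "t mod M"]) auto
    then show ?thesis by (simp add: poly_prod)
  qed
  ultimately show ?thesis by blast
qed

section \<open>Dynkin and affine diagrams\<close>

definition edge_count :: "'v set multiset \<Rightarrow> 'v \<Rightarrow> 'v \<Rightarrow> nat" where
  "edge_count E u v = (if u = v then 0 else count E {u, v})"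

definition weighted_sum :: "'v multigraph \<Rightarrow> ('v \<Rightarrow> 'c::comm_semiring_1) \<Rightarrow> 'v \<Rightarrow> 'c" where
  "weighted_sum G d u = (\<Sum>v\<in>fst G. of_nat (edge_count (snd G) u v) * d v)"

definition dynkin_diagrams :: "nat multigraph set" where
  "dynkin_diagrams = dynkin_A ` {1..} \<union> dynkin_D ` {4..} \<union> dynkin_E ` {6, 7, 8}"

definition affine_diagrams :: "nat multigraph set" where
  "affine_diagrams = affine_A ` {1..} \<union> affine_D ` {4..} \<union> affine_E ` {6, 7, 8}"

lemma edge_count_empty [simp]: "edge_count {#} u v = 0"
  by (simp add: edge_count_def)

lemma edge_count_plus [simp]: "edge_count (E + F) u v = edge_count E u v + edge_count F u v"
  by (simp add: edge_count_def)

lemma edge_count_add_mset [simp]: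
  "edge_count (add_mset {p, q} E) u v = of_bool (u \<noteq> v \<and> (u = p \<and> v = q \<or> u = q \<and> v = p)) + edge_count E u v"
  by (auto simp: edge_count_def doubleton_eq_iff)

lemma edge_count_sym: "edge_count E u v = edge_count E v u"
  by (simp add: edge_count_def insert_commute)

lemma path_edges_Suc: "path_edges (Suc m) = (if m \<ge> 1 then add_mset {m, m + 1} (path_edges m) else {#})"
proof (cases "m \<ge> 1")
  case True
  then have "{1..<Suc m} = insert m {1..<m}" by auto
  then show ?thesis using True by (simp add: path_edges_def)
qed (simp add: path_edges_def)

lemma edge_count_path [simp]:
  "edge_count (path_edges m) i j = of_bool (j = i + 1 \<and> 1 \<le> i \<and> i < m \<or> i = j + 1 \<and> 1 \<le> j \<and> j < m)"
proof (induction m)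
  case 0 show ?case by (simp add: path_edges_def)
next
  case (Suc m)
  show ?case
  proof (cases "m \<ge> 1")
    case True
    then show ?thesis unfolding path_edges_Suc if_P[OF True] edge_count_add_mset Suc by (simp add: of_bool_def) arith
  qed (simp add: path_edges_Suc)
qed

lemma weighted_sum_plus [simp]:
  "weighted_sum (V, E + F) d u = weighted_sum (V, E) d u + weighted_sum (V, F) d u"
  by (simp add: weighted_sum_def distrib_right sum.distrib)

lemma weighted_sum_empty [simp]: "weighted_sum (V, {#}) d u = 0"
  by (simp add: weighted_sum_def)

lemma weighted_sum_add_mset:
  assumes "finite V" "p \<in> V" "q \<in> V" "p \<noteq> q"
  shows "weighted_sum (V, add_mset {p, q} E) d u =
    (if u = p then d q else 0) + (if u = q then d p else 0) + weighted_sum (V, E) d u"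
proof -
  have "(\<Sum>v\<in>V. of_nat (of_bool (u \<noteq> v \<and> (u = p \<and> v = q \<or> u = q \<and> v = p))) * d v) =
      (\<Sum>v\<in>V. (if v = q then (if u = p then d v else 0) else 0) + (if v = p then (if u = q then d v else 0) else 0))"
    using assms(4) by (intro sum.cong) auto
  also have "\<dots> = (if u = p then d q else 0) + (if u = q then d p else 0)"
    using assms by (simp add: sum.distrib sum.delta)
  finally show ?thesis by (simp add: weighted_sum_def distrib_right sum.distrib)
qed

lemma weighted_sum_path:
  assumes "finite V" "{1..m} \<subseteq> V"
  shows "weighted_sum (V, path_edges m) d i =
    (if 1 \<le> i \<and> i < m then d (i + 1) else 0) + (if 2 \<le> i \<and> i \<le> m then d (i - 1) else 0)"
proof -
  have "(\<Sum>j\<in>V. of_nat (edge_count (path_edges m) i j) * d j) =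
      (\<Sum>j\<in>V. (if j = i + 1 then (if 1 \<le> i \<and> i < m then d j else 0) else 0) +
        (if j = i - 1 then (if 2 \<le> i \<and> i \<le> m then d j else 0) else 0))"
    by (intro sum.cong refl) auto
  also have "\<dots> = (if 1 \<le> i \<and> i < m then d (i + 1) else 0) + (if 2 \<le> i \<and> i \<le> m then d (i - 1) else 0)"
    (is "_ = ?r")
  proof -
    have "1 \<le> i \<and> i < m \<Longrightarrow> i + 1 \<in> V" "2 \<le> i \<and> i \<le> m \<Longrightarrow> i - 1 \<in> V"
      by (rule subsetD[OF assms(2)], unfold atLeastAtMost_iff, linarith)+
    then show ?thesis unfolding sum.distrib sum.delta[OF assms(1)] by simp
  qed
  finally show ?thesis by (simp add: weighted_sum_def)
qed

lemma atLeastAtMost_numerals: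
  "i \<in> {1..6::nat} \<longleftrightarrow> i = 1 \<or> i = 2 \<or> i = 3 \<or> i = 4 \<or> i = 5 \<or> i = 6"
  "i \<in> {1..7::nat} \<longleftrightarrow> i = 1 \<or> i = 2 \<or> i = 3 \<or> i = 4 \<or> i = 5 \<or> i = 6 \<or> i = 7"
  "i \<in> {1..8::nat} \<longleftrightarrow> i = 1 \<or> i = 2 \<or> i = 3 \<or> i = 4 \<or> i = 5 \<or> i = 6 \<or> i = 7 \<or> i = 8"
  "i \<in> {0..n} \<longleftrightarrow> i = 0 \<or> i \<in> {1..n}"
  by auto

lemma dynkin_E_weighted_sum:
  assumes "6 \<le> n"
  shows "weighted_sum (dynkin_E n) d i =
    (if 1 \<le> i \<and> i < n - 1 then d (i + 1) else 0) + (if 2 \<le> i \<and> i \<le> n - 1 then d (i - 1) else 0) +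
    ((if i = 3 then d n else 0) + (if i = n then d 3 else 0))"
  using assms by (simp add: dynkin_E_def weighted_sum_path weighted_sum_add_mset ac_simps)

lemma affine_E_weighted_sum:
  assumes "n \<in> {6, 7, 8}"
  defines "q \<equiv> if n = 6 then 6 else if n = 7 then 1 else 7"
  shows "weighted_sum (affine_E n) d i =
    (if 1 \<le> i \<and> i < n - 1 then d (i + 1) else 0) + (if 2 \<le> i \<and> i \<le> n - 1 then d (i - 1) else 0) +
    ((if i = 3 then d n else 0) + (if i = n then d 3 else 0) + ((if i = 0 then d q else 0) + (if i = q then d 0 else 0)))"
  using assms(1) unfolding q_def by (elim insertE) (simp_all add: affine_E_def weighted_sum_path weighted_sum_add_mset ac_simps)

text \<open>
  The weights are the coefficients of the sum of all positive roots, expressed by simple roots;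
  they satisfy \<open>2 d - A d = 2\<close> at every vertex.
\<close>

lemma dynkin_subharmonic:
  assumes "H \<in> dynkin_diagrams"
  shows "\<exists>d :: nat \<Rightarrow> real. \<forall>i\<in>fst H. d i > 0 \<and> weighted_sum H d i < 2 * d i"
proof -
  consider (A) n where "H = dynkin_A n" "n \<ge> 1" | (D) n where "H = dynkin_D n" "n \<ge> 4"
    | (E) "H = dynkin_E 6 \<or> H = dynkin_E 7 \<or> H = dynkin_E 8"
    using assms by (auto simp: dynkin_diagrams_def)
  then show ?thesis
  proof cases
    case (A n)
    define d where "d i = real i * (real n + 1 - real i)" for i
    have "d i > 0 \<and> weighted_sum H d i < 2 * d i" if "i \<in> {1..n}" for i
    proof
      show "d i > 0" using that by (simp add: d_def)
      have "weighted_sum H d i = (if i < n then d (i + 1) else 0) + (if 2 \<le> i then d (i - 1) else 0)"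
        using that A by (simp add: dynkin_A_def weighted_sum_path)
      also have "(if i < n then d (i + 1) else 0) = (real i + 1) * (real n - real i)"
        using that by (auto simp: d_def)
      also have "(if 2 \<le> i then d (i - 1) else 0) = (real i - 1) * (real n + 2 - real i)"
        using that by (auto simp: d_def of_nat_diff)
      finally have "weighted_sum H d i = 2 * (real i * (real n + 1 - real i)) - 2" by (simp only: algebra_simps)
      then show "weighted_sum H d i < 2 * d i" by (simp add: d_def)
    qed
    then show ?thesis using A by (intro exI[of _ d]) (simp add: dynkin_A_def)
  next
    case (D n)
    define d where "d i = (if i \<le> n - 2 then real i * (2 * real n - 1 - real i) else real n * (real n - 1) / 2)" for i
    have "d i > 0 \<and> weighted_sum H d i < 2 * d i" if i: "i \<in> {1..n}" for i
    proof
      show "d i > 0" using that D by (auto simp: d_def)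
      have w: "weighted_sum H d i = (if i < n - 1 then d (i + 1) else 0) + (if 2 \<le> i \<and> i \<le> n - 1 then d (i - 1) else 0)
          + ((if i = n - 2 then d n else 0) + (if i = n then d (n - 2) else 0))"
        using that D by (simp add: dynkin_D_def weighted_sum_path weighted_sum_add_mset)
      have q: "real (n - Suc 0) = real n - 1" "real (n - 2) = real n - 2" "real (n - 3) = real n - 3" using D by auto
      consider "i \<le> n - 3" | "i = n - 2" | "i = n - 1" | "i = n" using i D by fastforce
      then show "weighted_sum H d i < 2 * d i"
      proof cases
        case 1
        have "weighted_sum H d i = d (i + 1) + (if 2 \<le> i then d (i - 1) else 0)"
          unfolding w using 1 D i by auto
        also have "d (i + 1) = (real i + 1) * (2 * real n - 2 - real i)"
          using 1 D by (auto simp: d_def algebra_simps)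
        also have "(if 2 \<le> i then d (i - 1) else 0) = (real i - 1) * (2 * real n - real i)"
          using 1 D i by (cases "2 \<le> i") (auto simp: d_def of_nat_diff)
        finally have "weighted_sum H d i = 2 * (real i * (2 * real n - 1 - real i)) - 2" by (simp only: algebra_simps)
        moreover have "i \<le> n - 2" using 1 by simp
        then have "d i = real i * (2 * real n - 1 - real i)" by (simp add: d_def)
        ultimately show ?thesis by simp
      next
        case 2
        have "weighted_sum H d i = real n * (real n - 1) + (real n - 3) * (real n + 2)"
          unfolding w using 2 D by (auto simp: d_def of_nat_diff q)
        moreover have "d i = (real n - 2) * (real n + 1)" using 2 D by (simp add: d_def q)
        ultimately show ?thesis by (simp add: algebra_simps)
      next
        case 3
        have "n - 1 - 1 = n - 2" using D by simp
        then have "weighted_sum H d i = (real n - 2) * (real n + 1)"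
          unfolding w using 3 D by (auto simp: d_def q)
        moreover have "d i = real n * (real n - 1) / 2" using 3 D by (simp add: d_def)
        ultimately show ?thesis by (simp add: algebra_simps)
      next
        case 4
        then have "weighted_sum H d i = (real n - 2) * (real n + 1)"
          unfolding w using D by (auto simp: d_def q)
        moreover have "d i = real n * (real n - 1) / 2" using 4 D by (auto simp add: d_def)
        ultimately show ?thesis by (simp add: algebra_simps)
      qed
    qed
    then show ?thesis using D by (intro exI[of _ d]) (simp add: dynkin_D_def)
  next
    case E
    let ?d6 = "(\<lambda>i. [0, 16, 30, 42, 30, 16, 22] ! i) :: nat \<Rightarrow> real"
    let ?d7 = "(\<lambda>i. [0, 34, 66, 96, 75, 52, 27, 49] ! i) :: nat \<Rightarrow> real"
    let ?d8 = "(\<lambda>i. [0, 92, 182, 270, 220, 168, 114, 58, 136] ! i) :: nat \<Rightarrow> real"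
    from E show ?thesis
    proof (elim disjE)
      assume H: "H = dynkin_E 6"
      have "?d6 i > 0 \<and> weighted_sum (dynkin_E 6) ?d6 i < 2 * ?d6 i" if "i \<in> {1..6}" for i
        using that unfolding atLeastAtMost_numerals by (elim disjE) (simp_all add: dynkin_E_weighted_sum)
      then show ?thesis unfolding H by (intro exI[of _ ?d6]) (simp add: dynkin_E_def)
    next
      assume H: "H = dynkin_E 7"
      have "?d7 i > 0 \<and> weighted_sum (dynkin_E 7) ?d7 i < 2 * ?d7 i" if "i \<in> {1..7}" for i
        using that unfolding atLeastAtMost_numerals by (elim disjE) (simp_all add: dynkin_E_weighted_sum)
      then show ?thesis unfolding H by (intro exI[of _ ?d7]) (simp add: dynkin_E_def)
    next
      assume H: "H = dynkin_E 8"
      have "?d8 i > 0 \<and> weighted_sum (dynkin_E 8) ?d8 i < 2 * ?d8 i" if "i \<in> {1..8}" for i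
        using that unfolding atLeastAtMost_numerals by (elim disjE) (simp_all add: dynkin_E_weighted_sum)
      then show ?thesis unfolding H by (intro exI[of _ ?d8]) (simp add: dynkin_E_def)
    qed
  qed
qed

text \<open>
  The weight is the primitive imaginary root.
\<close>

lemma affine_harmonic:
  assumes "H \<in> affine_diagrams"
  shows "\<exists>d :: nat \<Rightarrow> nat. (\<forall>i\<in>fst H. d i > 0 \<and> weighted_sum H d i = 2 * d i) \<and> (\<exists>i\<in>fst H. d i = 1)"
proof -
  consider (A) n where "H = affine_A n" "n \<ge> 1" | (D) n where "H = affine_D n" "n \<ge> 4"
    | (E) "H = affine_E 6 \<or> H = affine_E 7 \<or> H = affine_E 8"
    using assms by (auto simp: affine_diagrams_def)
  then show ?thesis
  proof cases
    case (A n)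
    then show ?thesis
      by (intro exI[of _ "\<lambda>_. 1"]) (auto simp: affine_A_def weighted_sum_path weighted_sum_add_mset)
  next
    case (D n)
    define d :: "nat \<Rightarrow> nat" where "d i = (if i = 0 \<or> i = 1 \<or> i \<ge> n - 1 then 1 else 2)" for i
    have "weighted_sum H d i = 2 * d i" if "i \<le> n" for i
    proof -
      have w: "weighted_sum H d i = (if 1 \<le> i \<and> i < n - 1 then d (i + 1) else 0) + (if 2 \<le> i \<and> i \<le> n - 1 then d (i - 1) else 0)
          + ((if i = n - 2 then d n else 0) + (if i = n then d (n - 2) else 0) + ((if i = 0 then d 2 else 0) + (if i = 2 then d 0 else 0)))"
        using D by (simp add: affine_D_def weighted_sum_path weighted_sum_add_mset)
      have small: "d 0 = 1" "d 1 = 1" "d 2 = 2" "d (n - 1) = 1" "d n = 1" "d (n - 2) = 2" using D by (auto simp: d_def)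
      have mid: "d (j + 1) = (if j = n - 2 then 1 else 2)" "d (j - 1) = (if j = 2 then 1 else 2)" "d j = 2"
        if "2 \<le> j" "j \<le> n - 2" for j using that D by (auto simp: d_def)
      consider "i = 0" | "i = 1" | "i = n - 1" | "i = n" | "2 \<le> i" "i \<le> n - 2" using \<open>i \<le> n\<close> D by linarith
      then show ?thesis
      proof cases
        case 5
        then have "weighted_sum H d i = d (i + 1) + d (i - 1) + ((if i = n - 2 then d n else 0) + (if i = 2 then d 0 else 0))"
          unfolding w using D by auto
        then show ?thesis unfolding mid[OF 5] small by simp
      next
        case 3
        have "n - 1 - 1 = n - 2" "2 \<le> n - 1" "n - 1 \<noteq> n - 2" "n - 1 \<noteq> 2" "n - 1 \<noteq> n" using D by auto
        then show ?thesis unfolding w using 3 D small by simp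
      qed (unfold w, use D small in \<open>auto simp: numeral_2_eq_2\<close>)
    qed
    moreover have "d i > 0" for i by (simp add: d_def)
    moreover have "d 0 = 1" by (simp add: d_def)
    ultimately show ?thesis using D by (intro exI[of _ d]) (auto simp: affine_D_def)
  next
    case E
    let ?d6 = "(\<lambda>i. [1, 1, 2, 3, 2, 1, 2] ! i) :: nat \<Rightarrow> nat"
    let ?d7 = "(\<lambda>i. [1, 2, 3, 4, 3, 2, 1, 2] ! i) :: nat \<Rightarrow> nat"
    let ?d8 = "(\<lambda>i. [1, 2, 4, 6, 5, 4, 3, 2, 3] ! i) :: nat \<Rightarrow> nat"
    from E show ?thesis
    proof (elim disjE)
      assume H: "H = affine_E 6"
      have "?d6 i > 0 \<and> weighted_sum (affine_E 6) ?d6 i = 2 * ?d6 i" if "i \<in> {0..6}" for i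
        using that unfolding atLeastAtMost_numerals by (elim disjE) (simp_all add: affine_E_weighted_sum)
      then have "\<forall>i\<in>fst H. ?d6 i > 0 \<and> weighted_sum H ?d6 i = 2 * ?d6 i" unfolding H by (simp add: affine_E_def)
      moreover have "\<exists>i\<in>fst H. ?d6 i = 1" unfolding H by (intro bexI[of _ 0]) (simp_all add: affine_E_def)
      ultimately show ?thesis by blast
    next
      assume H: "H = affine_E 7"
      have "?d7 i > 0 \<and> weighted_sum (affine_E 7) ?d7 i = 2 * ?d7 i" if "i \<in> {0..7}" for i
        using that unfolding atLeastAtMost_numerals by (elim disjE) (simp_all add: affine_E_weighted_sum)
      then have "\<forall>i\<in>fst H. ?d7 i > 0 \<and> weighted_sum H ?d7 i = 2 * ?d7 i" unfolding H by (simp add: affine_E_def)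
      moreover have "\<exists>i\<in>fst H. ?d7 i = 1" unfolding H by (intro bexI[of _ 6]) (simp_all add: affine_E_def)
      ultimately show ?thesis by blast
    next
      assume H: "H = affine_E 8"
      have "?d8 i > 0 \<and> weighted_sum (affine_E 8) ?d8 i = 2 * ?d8 i" if "i \<in> {0..8}" for i
        using that unfolding atLeastAtMost_numerals by (elim disjE) (simp_all add: affine_E_weighted_sum)
      then have "\<forall>i\<in>fst H. ?d8 i > 0 \<and> weighted_sum H ?d8 i = 2 * ?d8 i" unfolding H by (simp add: affine_E_def)
      moreover have "\<exists>i\<in>fst H. ?d8 i = 1" unfolding H by (intro bexI[of _ 0]) (simp_all add: affine_E_def)
      ultimately show ?thesis by blast
    qed
  qed
qed

section \<open>Growing paths and stars\<close>

lemma simple_path: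
  assumes "(u, v) \<in> r\<^sup>*"
  shows "\<exists>f k. f 0 = u \<and> f k = v \<and> inj_on f {..k} \<and> (\<forall>i<k. (f i, f (Suc i)) \<in> r)"
  using assms
proof (induction rule: rtrancl_induct)
  case base
  show ?case by (intro exI[of _ "\<lambda>_. u"] exI[of _ 0]) simp
next
  case (step y z)
  then obtain f k where f: "f 0 = u" "f k = y" "inj_on f {..k}" "\<forall>i<k. (f i, f (Suc i)) \<in> r" by blast
  show ?case
  proof (cases "z \<in> f ` {..k}")
    case True
    then obtain i where i: "i \<le> k" "f i = z" by auto
    have "inj_on f {..i}" using f(3) by (rule inj_on_subset) (use i in auto)
    then show ?thesis using f i by (intro exI[of _ f] exI[of _ i]) auto
  next
    case False
    let ?f = "f(Suc k := z)"
    have "inj_on ?f {..k}" using f(3) by (auto simp: inj_on_def)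
    moreover have "?f ` {..k} = f ` {..k}" by auto
    ultimately have "inj_on ?f {..Suc k}" using False by (simp add: atMost_Suc)
    moreover have "(?f i, ?f (Suc i)) \<in> r" if "i < Suc k" for i
      using that f step(2) by (cases "i = k") auto
    moreover have "?f 0 = u" "?f (Suc k) = z" using f by auto
    ultimately show ?thesis by blast
  qed
qed

text \<open>
  A star has three arms, of lengths \<open>l 0\<close>, \<open>l 1\<close> and \<open>l 2\<close>. The vertex \<open>(a, j)\<close> is at distance
  \<open>j\<close> from the centre on arm \<open>a\<close>, and the centre is \<open>(0, 0)\<close> only.
\<close>

definition star_vertices :: "(nat \<Rightarrow> nat) \<Rightarrow> (nat \<times> nat) set" where
  "star_vertices l = {(a, j). a < 3 \<and> j \<le> l a \<and> (j = 0 \<longrightarrow> a = 0)}"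

definition star_adjacent :: "nat \<times> nat \<Rightarrow> nat \<times> nat \<Rightarrow> bool" where
  "star_adjacent x y \<longleftrightarrow> (fst x = fst y \<and> (snd y = snd x + 1 \<or> snd x = snd y + 1)) \<or>
     (snd x = 0 \<and> snd y = 1) \<or> (snd x = 1 \<and> snd y = 0)"

text \<open>
  Vertices of a star, with the centre as position \<open>0\<close> of each arm.
\<close>

definition arm :: "nat \<Rightarrow> nat \<Rightarrow> nat \<times> nat" where
  "arm a j = (if j = 0 then (0, 0) else (a, j))"

lemma arm_in_star: "a < 3 \<Longrightarrow> j \<le> l a \<Longrightarrow> arm a j \<in> star_vertices l"
  by (simp add: arm_def star_vertices_def)

lemma star_vertices_arm: "x \<in> star_vertices l \<Longrightarrow> \<exists>a j. a < 3 \<and> j \<le> l a \<and> x = arm a j"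
  by (cases x, rule exI[of _ "fst x"], rule exI[of _ "snd x"]) (auto simp: star_vertices_def arm_def)

lemma arm_eq_iff: "arm a j = arm b k \<longleftrightarrow> j = k \<and> (j = 0 \<or> a = b)"
  by (auto simp: arm_def)

lemma star_adjacent_arm:
  "star_adjacent (arm a j) (arm b k) \<longleftrightarrow>
    (a = b \<or> j = 0 \<or> k = 0) \<and> (k = j + 1 \<or> j = k + 1)"
  by (auto simp: star_adjacent_def arm_def)

text \<open>
  The number of edges between two vertices is given by \<open>m\<close>.
\<close>

locale connected_multigraph =
  fixes V :: "'v set" and m :: "'v \<Rightarrow> 'v \<Rightarrow> nat"
  assumes finite_V: "finite V" and nonempty_V: "V \<noteq> {}"
    and m_sym: "m u v = m v u" and m_irrefl: "m v v = 0"
    and conn: "u \<in> V \<Longrightarrow> v \<in> V \<Longrightarrow> (u, v) \<in> {(x, y). x \<in> V \<and> y \<in> V \<and> m x y > 0}\<^sup>*"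
begin

text \<open>
  The image need not be an induced subgraph: \<open>H\<close> may have fewer edges.
\<close>

definition embeds :: "'w multigraph \<Rightarrow> bool" where
  "embeds H \<longleftrightarrow> (\<exists>\<phi>. inj_on \<phi> (fst H) \<and> \<phi> ` fst H \<subseteq> V \<and>
     (\<forall>i\<in>fst H. \<forall>j\<in>fst H. edge_count (snd H) i j \<le> m (\<phi> i) (\<phi> j)))"

definition isomorphic_to :: "'w multigraph \<Rightarrow> bool" where
  "isomorphic_to H \<longleftrightarrow> (\<exists>\<phi>. bij_betw \<phi> (fst H) V \<and>
     (\<forall>i\<in>fst H. \<forall>j\<in>fst H. edge_count (snd H) i j = m (\<phi> i) (\<phi> j)))"

definition edges_in :: "'v set \<Rightarrow> ('v \<times> 'v) set" where
  "edges_in C = {(x, y). x \<in> C \<and> y \<in> C \<and> m x y > 0}"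

definition path_on :: "(nat \<Rightarrow> 'v) \<Rightarrow> nat \<Rightarrow> 'v set \<Rightarrow> bool" where
  "path_on f k C \<longleftrightarrow> inj_on f {..k} \<and> f ` {..k} = C \<and>
     (\<forall>i\<le>k. \<forall>j\<le>k. m (f i) (f j) = of_bool (j = i + 1 \<or> i = j + 1))"

definition star_on :: "(nat \<times> nat \<Rightarrow> 'v) \<Rightarrow> (nat \<Rightarrow> nat) \<Rightarrow> 'v set \<Rightarrow> bool" where
  "star_on \<beta> l C \<longleftrightarrow> (\<forall>a<3. l a \<ge> 1) \<and> inj_on \<beta> (star_vertices l) \<and> \<beta> ` star_vertices l = C \<and>
     (\<forall>x\<in>star_vertices l. \<forall>y\<in>star_vertices l. m (\<beta> x) (\<beta> y) = of_bool (star_adjacent x y))"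

lemma embeds_affine_A:
  assumes k: "k \<ge> 1" and inj: "inj_on f {..k}" and V: "f ` {..k} \<subseteq> V"
    and path: "\<And>i. i < k \<Longrightarrow> m (f i) (f (Suc i)) \<ge> 1"
    and closing: "m (f 0) (f k) \<ge> (if k = 1 then 2 else 1)"
  shows "embeds (affine_A k)"
proof -
  have "edge_count (snd (affine_A k)) i j \<le> m (f i) (f j)" if ij: "i \<le> k" "j \<le> k" "i \<le> j" for i j
  proof -
    consider "j = i + 1" "1 \<le> i" | "i = 0" "j = 1" "k \<noteq> 1" | "i = 0" "j = k" "k \<noteq> 1" | "i = 0" "j = 1" "k = 1"
      | "j \<noteq> i + 1" "i \<noteq> 0 \<or> j \<noteq> k" using ij by fastforce
    then show ?thesis
    proof cases
      case 1 then show ?thesis using path[of i] ij k by (simp add: affine_A_def)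
    next
      case 2 then show ?thesis using path[of 0] ij k by (simp add: affine_A_def)
    next
      case 3 then show ?thesis using closing ij k by (simp add: affine_A_def)
    next
      case 4 then show ?thesis using closing ij k by (simp add: affine_A_def)
    next
      case 5 then show ?thesis using ij k by (auto simp add: affine_A_def)
    qed
  qed
  then have "edge_count (snd (affine_A k)) i j \<le> m (f i) (f j)" if "i \<le> k" "j \<le> k" for i j
    using that by (metis m_sym edge_count_sym nle_le)
  moreover have "fst (affine_A k) = {..k}" by (auto simp: affine_A_def)
  ultimately show ?thesis unfolding embeds_def using inj V by (intro exI[of _ f]) auto
qed

text \<open>
  A new vertex with two edges into a connected set closes a double edge or a cycle.
\<close>

lemma embeds_cycle_or_unique_neighbour:
  assumes C: "C \<subseteq> V" "\<And>u v. u \<in> C \<Longrightarrow> v \<in> C \<Longrightarrow> (u, v) \<in> (edges_in C)\<^sup>*"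
    and w: "w \<in> V" "w \<notin> C" and u: "u \<in> C" "m u w > 0"
  shows "(\<exists>n\<ge>1. embeds (affine_A n)) \<or> (\<forall>v\<in>C. m v w = of_bool (v = u))"
proof (rule disjCI)
  assume "\<not> (\<forall>v\<in>C. m v w = of_bool (v = u))"
  then obtain v where v: "v \<in> C" "m v w \<noteq> of_bool (v = u)" by blast
  show "\<exists>n\<ge>1. embeds (affine_A n)"
  proof (cases "v = u")
    case True
    have "m u w \<ge> 2" using v True u by simp
    moreover have "inj_on ((\<lambda>_. u)(1 := w)) {..1::nat}" using u w by (auto simp: inj_on_def)
    ultimately have "embeds (affine_A 1)"
      by (intro embeds_affine_A[of _ "(\<lambda>_. u)(1 := w)"]) (use u w C in auto)
    then show ?thesis by blast
  next
    case False
    then have vw: "m v w \<ge> 1" using v by simp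
    obtain f k where f: "f 0 = u" "f k = v" "inj_on f {..k}" "\<forall>i<k. (f i, f (Suc i)) \<in> edges_in C"
      using simple_path[OF C(2)[OF u(1) v(1)]] by blast
    have k: "k \<ge> 1" using f(1,2) False by (cases k) auto
    have fC: "f i \<in> C" if "i \<le> k" for i
    proof (cases "i = k")
      case False
      then have "(f i, f (Suc i)) \<in> edges_in C" using f(4) that by simp
      then show ?thesis by (simp add: edges_in_def)
    qed (use f v in simp)
    let ?f = "f(Suc k := w)"
    have inj: "inj_on ?f {..k}" using f(3) by (auto simp: inj_on_def)
    have im: "?f ` {..k} = f ` {..k}" by auto
    have "w \<notin> f ` {..k}" using fC w by auto
    then have "inj_on ?f {..Suc k}" using inj im by (simp add: atMost_Suc)
    moreover have "?f ` {..Suc k} \<subseteq> V" using fC C(1) w by (auto simp: le_Suc_eq)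
    moreover have "m (?f i) (?f (Suc i)) \<ge> 1" if "i < Suc k" for i
    proof (cases "i = k")
      case True then show ?thesis using f(2) vw by simp
    next
      case False
      then have "(f i, f (Suc i)) \<in> edges_in C" using f(4) that by simp
      then show ?thesis using that False by (simp add: edges_in_def Suc_le_eq)
    qed
    moreover have "m (?f 0) (?f (Suc k)) \<ge> 1" using f(1) u by simp
    ultimately have "embeds (affine_A (Suc k))" using k by (intro embeds_affine_A[of _ ?f]) auto
    then show ?thesis by (intro exI[of _ "Suc k"]) simp
  qed
qed

text \<open>
  A vertex attached to an end gives a longer path; attached to an inner vertex it becomes the
  third arm of a star.
\<close>

lemma extend_path:
  assumes f: "path_on f k C" and w: "w \<notin> C" and i: "i \<le> k" and nb: "\<forall>v\<in>C. m v w = of_bool (v = f i)"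
  shows "(\<exists>f k. path_on f k (insert w C)) \<or> (\<exists>\<beta> l. star_on \<beta> l (insert w C))"
proof -
  have inj: "inj_on f {..k}" and C: "f ` {..k} = C"
    and m: "\<And>i j. i \<le> k \<Longrightarrow> j \<le> k \<Longrightarrow> m (f i) (f j) = of_bool (j = i + 1 \<or> i = j + 1)"
    using f by (auto simp: path_on_def)
  have mw: "m (f j) w = of_bool (j = i)" "m w (f j) = of_bool (j = i)" if "j \<le> k" for j
  proof -
    have "f j \<in> C" "f j = f i \<longleftrightarrow> j = i" using C that i inj by (auto simp: inj_on_def)
    then show "m (f j) w = of_bool (j = i)" using nb by simp
    then show "m w (f j) = of_bool (j = i)" using m_sym by metis
  qed
  have fw: "f j \<noteq> w" "w \<noteq> f j" if "j \<le> k" for j using w C that by auto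
  consider "i = k" | "i = 0" | "0 < i" "i < k" using i by linarith
  then show ?thesis
  proof cases
    case 1
    let ?f = "f(Suc k := w)"
    have "path_on ?f (Suc k) (insert w C)"
      unfolding path_on_def
    proof (intro conjI allI impI)
      have "inj_on ?f {..k}" using inj by (auto simp: inj_on_def)
      moreover have "?f ` {..k} = f ` {..k}" by auto
      ultimately show "inj_on ?f {..Suc k}" using C w by (simp add: atMost_Suc)
      show "?f ` {..Suc k} = insert w C" unfolding C[symmetric] by (auto simp: atMost_Suc)
      fix a b assume "a \<le> Suc k" "b \<le> Suc k"
      then consider "a \<le> k" "b \<le> k" | "a \<le> k" "b = Suc k" | "a = Suc k" "b \<le> k" | "a = Suc k" "b = Suc k"
        by linarith
      then show "m (?f a) (?f b) = of_bool (b = a + 1 \<or> a = b + 1)"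
        by cases (use m mw m_irrefl 1 in \<open>auto\<close>)
    qed
    then show ?thesis by blast
  next
    case 2
    let ?f = "\<lambda>j. if j = 0 then w else f (j - 1)"
    have "path_on ?f (Suc k) (insert w C)"
      unfolding path_on_def
    proof (intro conjI allI impI)
      show "inj_on ?f {..Suc k}"
      proof (rule inj_onI)
        fix a b assume ab: "a \<in> {..Suc k}" "b \<in> {..Suc k}" "?f a = ?f b"
        show "a = b"
        proof (cases "a = 0 \<or> b = 0")
          case True then show ?thesis using ab fw[of "a - 1"] fw[of "b - 1"] by (auto split: if_splits)
        next
          case False
          then have "a - 1 = b - 1" using ab inj by (auto simp: inj_on_def)
          then show ?thesis using False by linarith
        qed
      qed
      have "?f ` {..Suc k} = insert w ((\<lambda>j. ?f (Suc j)) ` {..k})"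
        unfolding atMost_Suc_eq_insert_0 image_insert image_image by simp
      then show "?f ` {..Suc k} = insert w C" using C by simp
      fix a b assume ab: "a \<le> Suc k" "b \<le> Suc k"
      show "m (?f a) (?f b) = of_bool (b = a + 1 \<or> a = b + 1)"
      proof (cases a; cases b)
        fix a' b' assume "a = Suc a'" "b = Suc b'"
        then show ?thesis using ab m[of a' b'] by simp
      qed (use ab m_irrefl mw 2 in auto)
    qed
    then show ?thesis by blast
  next
    case 3
    define l where "l = (\<lambda>a::nat. if a = 0 then i else if a = 1 then k - i else 1)"
    define \<beta> where "\<beta> = (\<lambda>(a::nat, j). if a = 0 then f (i - j) else if a = 1 then f (i + j) else w)"
    have sv: "x \<in> star_vertices l \<longleftrightarrow> (\<exists>j\<le>i. x = (0, j)) \<or> (\<exists>j. 1 \<le> j \<and> i + j \<le> k \<and> x = (1, j)) \<or> x = (2, 1)" for x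
      using 3 by (cases x) (auto simp: star_vertices_def l_def less_Suc_eq numeral_3_eq_3)
    have "star_on \<beta> l (insert w C)"
      unfolding star_on_def
    proof (intro conjI allI impI ballI)
      show "l a \<ge> 1" for a using 3 by (auto simp: l_def)
      have eq: "f a = f b \<longleftrightarrow> a = b" if "a \<le> k" "b \<le> k" for a b
        using that inj by (auto simp: inj_on_def)
      show "inj_on \<beta> (star_vertices l)"
        by (rule inj_onI) (use 3 fw eq in \<open>auto simp: sv \<beta>_def\<close>)
      show "\<beta> ` star_vertices l = insert w C"
      proof (intro equalityI subsetI)
        fix v assume "v \<in> \<beta> ` star_vertices l"
        then show "v \<in> insert w C" using 3 unfolding C[symmetric] by (auto simp: sv \<beta>_def)
      next
        fix v assume "v \<in> insert w C"
        then consider "v = w" | j where "j \<le> k" "v = f j" using C by auto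
        then show "v \<in> \<beta> ` star_vertices l"
        proof cases
          case 1 then show ?thesis by (intro image_eqI[of _ _ "(2, 1)"]) (auto simp: sv \<beta>_def)
        next
          case (2 j)
          show ?thesis
          proof (cases "j \<le> i")
            case True then show ?thesis using 2 by (intro image_eqI[of _ _ "(0, i - j)"]) (auto simp: sv \<beta>_def)
          next
            case False then show ?thesis using 2 by (intro image_eqI[of _ _ "(1, j - i)"]) (auto simp: sv \<beta>_def)
          qed
        qed
      qed
      fix x y assume "x \<in> star_vertices l" "y \<in> star_vertices l"
      then show "m (\<beta> x) (\<beta> y) = of_bool (star_adjacent x y)"
        unfolding sv using 3
        by (elim disjE exE conjE; simp add: \<beta>_def star_adjacent_def m mw m_irrefl) (auto simp: of_bool_def)
    qed
    then show ?thesis by blast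
  qed
qed

text \<open>
  A vertex attached to the end of an arm lengthens the arm. Attached at position \<open>j\<close> before the
  end of arm \<open>a\<close>, it makes this position the second fork of an affine diagram of type \<open>D\<close>; for
  \<open>j = 0\<close> both forks coincide.
\<close>

lemma extend_star:
  assumes st: "star_on \<beta> l C" and CV: "C \<subseteq> V" and w: "w \<in> V" "w \<notin> C" and x: "x \<in> star_vertices l"
    and nb: "\<forall>v\<in>C. m v w = of_bool (v = \<beta> x)"
  shows "(\<exists>\<beta> l. star_on \<beta> l (insert w C)) \<or> (\<exists>n\<ge>4. embeds (affine_D n))"
proof -
  have l: "\<And>a. a < 3 \<Longrightarrow> l a \<ge> 1" and inj: "inj_on \<beta> (star_vertices l)" and C: "\<beta> ` star_vertices l = C"
    and m: "\<And>x y. x \<in> star_vertices l \<Longrightarrow> y \<in> star_vertices l \<Longrightarrow> m (\<beta> x) (\<beta> y) = of_bool (star_adjacent x y)"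
    using st by (auto simp: star_on_def)
  have mw: "m (\<beta> y) w = of_bool (y = x)" "m w (\<beta> y) = of_bool (y = x)" if "y \<in> star_vertices l" for y
  proof -
    have "\<beta> y \<in> C" "\<beta> y = \<beta> x \<longleftrightarrow> y = x" using C that x inj by (auto simp: inj_on_def)
    then show "m (\<beta> y) w = of_bool (y = x)" using nb by simp
    then show "m w (\<beta> y) = of_bool (y = x)" using m_sym by metis
  qed
  obtain a j where a: "a < 3" "j \<le> l a" "x = arm a j" using star_vertices_arm[OF x] by blast
  show ?thesis
  proof (cases "j = l a")
    case True
    have x': "x = (a, l a)" using a True l[OF a(1)] by (simp add: arm_def)
    let ?l = "l(a := Suc (l a))" and ?\<beta> = "\<beta>((a, Suc (l a)) := w)"
    have sv: "star_vertices ?l = insert (a, Suc (l a)) (star_vertices l)"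
      using a(1) by (auto simp: star_vertices_def split: if_splits)
    have new: "(a, Suc (l a)) \<notin> star_vertices l" by (simp add: star_vertices_def)
    have \<beta>': "?\<beta> y = \<beta> y" if "y \<in> star_vertices l" for y using that new by auto
    have im: "?\<beta> ` star_vertices l = C" unfolding C[symmetric] using \<beta>' by (rule image_cong[OF refl])
    have "star_on ?\<beta> ?l (insert w C)"
      unfolding star_on_def
    proof (intro conjI allI impI ballI)
      show "?l b \<ge> 1" if "b < 3" for b using l that by simp
      have "inj_on ?\<beta> (star_vertices l)" using inj \<beta>' by (simp add: inj_on_def)
      then show "inj_on ?\<beta> (star_vertices ?l)" unfolding sv inj_on_insert using im w new by auto
      show "?\<beta> ` star_vertices ?l = insert w C" unfolding sv image_insert im by simp
      have adj: "star_adjacent y (a, Suc (l a)) \<longleftrightarrow> y = x" "star_adjacent (a, Suc (l a)) y \<longleftrightarrow> y = x"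
        if "y \<in> star_vertices l" for y
        using that l[OF a(1)] unfolding x' by (cases y; auto simp: star_adjacent_def star_vertices_def)+
      fix y z assume "y \<in> star_vertices ?l" "z \<in> star_vertices ?l"
      then consider "y \<in> star_vertices l" "z \<in> star_vertices l" | "y \<in> star_vertices l" "z = (a, Suc (l a))"
        | "y = (a, Suc (l a))" "z \<in> star_vertices l" | "y = (a, Suc (l a))" "z = (a, Suc (l a))" unfolding sv by blast
      then show "m (?\<beta> y) (?\<beta> z) = of_bool (star_adjacent y z)"
      proof cases
        case 1 then show ?thesis using m \<beta>' by simp
      next
        case 2 then show ?thesis using mw(1) \<beta>' adj by simp
      next
        case 3 then show ?thesis using mw(2) \<beta>' adj by simp
      next
        case 4 then show ?thesis using m_irrefl l[OF a(1)] by (simp add: star_adjacent_def)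
      qed
    qed
    then show ?thesis by blast
  next
    case False
    then have j: "j < l a" using a by simp
    obtain b c where bc: "b < 3" "c < 3" "b \<noteq> a" "c \<noteq> a" "b \<noteq> c"
    proof -
      consider "a = 0" | "a = 1" | "a = 2" using a(1) by linarith
      then show thesis by cases (use that[of 1 2] that[of 0 2] that[of 0 1] in auto)
    qed
    \<comment> \<open>The centre gets number \<open>2\<close>, the other two arms start with \<open>0\<close> and \<open>1\<close>, and
      the second fork at position \<open>j\<close> gets number \<open>j + 2\<close>; the new vertex is the last one.\<close>
    define pos where "pos i = (if i = 0 then arm c 1 else if i = 1 then arm b 1 else arm a (i - 2))" for i
    define \<phi> where "\<phi> i = (if i = j + 4 then w else \<beta> (pos i))" for i
    have pos: "pos i \<in> star_vertices l" if "i \<le> j + 3" for i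
      unfolding pos_def using that j a bc l by (auto intro!: arm_in_star)
    have pos_inj: "i = k" if "pos i = pos k" for i k
      using that bc unfolding pos_def by (auto simp: arm_eq_iff split: if_splits)
    have "inj_on \<phi> {0..j + 4}"
    proof (rule inj_onI)
      fix i k assume ik: "i \<in> {0..j + 4}" "k \<in> {0..j + 4}" "\<phi> i = \<phi> k"
      have \<beta>w: "\<beta> (pos i) \<noteq> w" if "i \<le> j + 3" for i using pos[OF that] C w by auto
      show "i = k"
      proof (cases "i = j + 4 \<or> k = j + 4")
        case True then show ?thesis using ik \<beta>w[of i] \<beta>w[of k] by (auto simp: \<phi>_def split: if_splits)
      next
        case False
        then have "\<beta> (pos i) = \<beta> (pos k)" "i \<le> j + 3" "k \<le> j + 3" using ik by (auto simp: \<phi>_def)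
        then have "pos i = pos k" using inj pos by (auto simp: inj_on_def)
        then show ?thesis by (rule pos_inj)
      qed
    qed
    moreover have "\<phi> ` {0..j + 4} \<subseteq> V"
    proof
      fix v assume "v \<in> \<phi> ` {0..j + 4}"
      then obtain i where i: "i \<le> j + 4" "v = \<phi> i" by auto
      show "v \<in> V"
      proof (cases "i = j + 4")
        case True then show ?thesis using i w by (simp add: \<phi>_def)
      next
        case False
        then have "pos i \<in> star_vertices l" using i pos by simp
        then show ?thesis using i False C CV by (auto simp: \<phi>_def)
      qed
    qed
    moreover have "edge_count (snd (affine_D (j + 4))) i k \<le> m (\<phi> i) (\<phi> k)" if ik: "i \<le> j + 4" "k \<le> j + 4" "i \<le> k" for i k
    proof -
      have edge_count: "edge_count (snd (affine_D (j + 4))) i k = of_bool (k = i + 1 \<and> 1 \<le> i \<and> i < j + 3 \<or> i = j + 2 \<and> k = j + 4 \<or> i = 0 \<and> k = 2)"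
        using ik by (auto simp: affine_D_def)
      consider "k = i + 1" "1 \<le> i" "i < j + 3" | "i = j + 2" "k = j + 4" | "i = 0" "k = 2"
        | "\<not> (k = i + 1 \<and> 1 \<le> i \<and> i < j + 3 \<or> i = j + 2 \<and> k = j + 4 \<or> i = 0 \<and> k = 2)" by blast
      then show ?thesis
      proof cases
        case 1
        then have "m (\<phi> i) (\<phi> k) = of_bool (star_adjacent (pos i) (pos k))" using m pos by (simp add: \<phi>_def)
        moreover have "star_adjacent (pos i) (pos k)" using 1 by (auto simp: pos_def star_adjacent_arm)
        ultimately show ?thesis unfolding edge_count by simp
      next
        case 2
        have "pos i = x" using 2 a by (simp add: pos_def)
        then have "m (\<phi> i) (\<phi> k) = 1" using mw x 2 by (simp add: \<phi>_def)
        then show ?thesis unfolding edge_count by simp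
      next
        case 3
        then have "m (\<phi> i) (\<phi> k) = of_bool (star_adjacent (pos i) (pos k))" using m pos by (simp add: \<phi>_def)
        moreover have "star_adjacent (pos i) (pos k)" using 3 by (auto simp: pos_def star_adjacent_arm)
        ultimately show ?thesis unfolding edge_count by simp
      next
        case 4 then show ?thesis unfolding edge_count by (simp only: of_bool_eq le0)
      qed
    qed
    then have "edge_count (snd (affine_D (j + 4))) i k \<le> m (\<phi> i) (\<phi> k)" if "i \<le> j + 4" "k \<le> j + 4" for i k
      using that by (metis m_sym edge_count_sym nle_le)
    ultimately have "embeds (affine_D (j + 4))"
      unfolding embeds_def by (intro exI[of _ \<phi>]) (simp add: affine_D_def)
    then show ?thesis by (intro disjI2 exI[of _ "j + 4"]) simp
  qed
qed

text \<open>
  A connected set of vertices is grown one vertex at a time, starting from a single vertex.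
\<close>

lemma path_or_star:
  assumes no: "\<And>n. n \<ge> 1 \<Longrightarrow> \<not> embeds (affine_A n)" "\<And>n. n \<ge> 4 \<Longrightarrow> \<not> embeds (affine_D n)"
  shows "(\<exists>f k. path_on f k V) \<or> (\<exists>\<beta> l. star_on \<beta> l V)"
proof -
  define good where "good C \<longleftrightarrow> C \<noteq> {} \<and> C \<subseteq> V \<and> (\<forall>u\<in>C. \<forall>v\<in>C. (u, v) \<in> (edges_in C)\<^sup>*) \<and>
    ((\<exists>f k. path_on f k C) \<or> (\<exists>\<beta> l. star_on \<beta> l C))" for C
  have grow: "\<exists>w\<in>V - C. good (insert w C)" if C: "good C" "C \<noteq> V" for C
  proof -
    obtain u0 v0 where u0: "u0 \<in> C" and v0: "v0 \<in> V - C" using C by (auto simp: good_def)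
    have "(u0, v0) \<in> (edges_in V)\<^sup>*" using conn[of u0 v0] u0 v0 C
      by (auto simp: good_def edges_in_def)
    then have "\<exists>u w. u \<in> C \<and> w \<in> V - C \<and> m u w > 0"
      using u0
    proof (induction rule: converse_rtrancl_induct)
      case base then show ?case using v0 by simp
    next
      case (step y z)
      then show ?case by (cases "z \<in> C") (auto simp: edges_in_def)
    qed
    then obtain u w where uw: "u \<in> C" "w \<in> V" "w \<notin> C" "m u w > 0" by blast
    have CV: "C \<subseteq> V" and con: "\<And>u v. u \<in> C \<Longrightarrow> v \<in> C \<Longrightarrow> (u, v) \<in> (edges_in C)\<^sup>*" using C by (auto simp: good_def)
    have nb: "\<forall>v\<in>C. m v w = of_bool (v = u)"
      using embeds_cycle_or_unique_neighbour[OF CV con uw(2,3,1,4)] no(1) by blast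
    have "(\<exists>f k. path_on f k (insert w C)) \<or> (\<exists>\<beta> l. star_on \<beta> l (insert w C))"
    proof -
      consider f k where "path_on f k C" | \<beta> l where "star_on \<beta> l C" using C by (auto simp: good_def)
      then show ?thesis
      proof cases
        case (1 f k)
        then obtain i where "i \<le> k" "u = f i" using uw(1) by (auto simp: path_on_def)
        then show ?thesis using extend_path[OF 1 uw(3)] nb by blast
      next
        case (2 \<beta> l)
        then obtain x where "x \<in> star_vertices l" "u = \<beta> x" using uw(1) by (auto simp: star_on_def)
        then show ?thesis using extend_star[OF 2 CV uw(2,3)] nb no(2) by blast
      qed
    qed
    moreover have "(x, y) \<in> (edges_in (insert w C))\<^sup>*" if "x \<in> insert w C" "y \<in> insert w C" for x y
    proof -
      have "edges_in C \<subseteq> edges_in (insert w C)" by (auto simp: edges_in_def)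
      then have sub: "(edges_in C)\<^sup>* \<subseteq> (edges_in (insert w C))\<^sup>*" by (rule rtrancl_mono)
      have uw': "(u, w) \<in> edges_in (insert w C)" "(w, u) \<in> edges_in (insert w C)"
        using uw m_sym[of u w] by (auto simp: edges_in_def)
      have "(x, u) \<in> (edges_in (insert w C))\<^sup>*" if "x \<in> insert w C" for x
        using that con[of x u] uw(1) sub uw'(2) by blast
      moreover have "(u, x) \<in> (edges_in (insert w C))\<^sup>*" if "x \<in> insert w C" for x
        using that con[of u x] uw(1) sub uw'(1) by blast
      ultimately show ?thesis using that by (meson rtrancl_trans)
    qed
    ultimately have "good (insert w C)" using CV uw by (auto simp: good_def)
    then show ?thesis using uw by blast
  qed
  have "good V" if "good C" for C
    using that
  proof (induction "card (V - C)" arbitrary: C rule: less_induct)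
    case less
    show ?case
    proof (cases "C = V")
      case False
      then obtain w where w: "w \<in> V - C" "good (insert w C)" using grow less.prems by blast
      have "V - insert w C \<subset> V - C" using w by blast
      then have "card (V - insert w C) < card (V - C)" using finite_V by (intro psubset_card_mono) auto
      then show ?thesis using less.hyps w by blast
    qed (use less in simp)
  qed
  obtain v where v: "v \<in> V" using nonempty_V by blast
  have "path_on (\<lambda>_. v) 0 {v}" by (simp add: path_on_def m_irrefl)
  then have "good {v}" unfolding good_def using v by (intro conjI disjI1 exI[of _ "\<lambda>_. v"] exI[of _ 0]) auto
  then have "good V" by (rule \<open>\<And>C. good C \<Longrightarrow> good V\<close>)
  then show ?thesis by (simp add: good_def)
qed

end

section \<open>Classification of connected multigraphs\<close>

lemma edge_count_path_two_edges:
  assumes "a < b" "c < d" "(a, b) \<noteq> (c, d)" "\<not> (b = a + 1 \<and> 1 \<le> a \<and> a < k)" "\<not> (d = c + 1 \<and> 1 \<le> c \<and> c < k)"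
    and "i \<le> j"
  shows "edge_count (path_edges k + {#{a, b}, {c, d}#}) i j =
    of_bool (j = i + 1 \<and> 1 \<le> i \<and> i < k \<or> i = a \<and> j = b \<or> i = c \<and> j = d)"
proof -
  have "edge_count (path_edges k) i j = of_bool (j = i + 1 \<and> 1 \<le> i \<and> i < k)" using assms(6) by simp
  moreover have "edge_count {#{a, b}#} i j = of_bool (i = a \<and> j = b)" "edge_count {#{c, d}#} i j = of_bool (i = c \<and> j = d)"
    using assms(1,2,6) by auto
  moreover have "edge_count (path_edges k + {#{a, b}, {c, d}#}) i j = edge_count (path_edges k) i j + (edge_count {#{a, b}#} i j + edge_count {#{c, d}#} i j)"
    by simp
  ultimately have "edge_count (path_edges k + {#{a, b}, {c, d}#}) i j =
      of_bool (j = i + 1 \<and> 1 \<le> i \<and> i < k) + (of_bool (i = a \<and> j = b) + of_bool (i = c \<and> j = d))"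
    by (simp only:)
  also have "\<dots> = of_bool (j = i + 1 \<and> 1 \<le> i \<and> i < k \<or> i = a \<and> j = b \<or> i = c \<and> j = d)"
    using assms(3-5) by (cases "i = a \<and> j = b"; cases "i = c \<and> j = d") auto
  finally show ?thesis .
qed

lemma edge_count_path_one_edge:
  assumes "a < b" "\<not> (b = a + 1 \<and> 1 \<le> a \<and> a < k)"
  shows "edge_count (path_edges k + {#{a, b}#}) i j =
    of_bool (j = i + 1 \<and> 1 \<le> i \<and> i < k \<or> i = j + 1 \<and> 1 \<le> j \<and> j < k \<or> i = a \<and> j = b \<or> j = a \<and> i = b)"
  using assms by (cases "i = a \<and> j = b"; cases "j = a \<and> i = b") auto

lemma edge_count_affine_E:
  assumes "i \<le> j"
  shows "edge_count (snd (affine_E 6)) i j = of_bool (j = i + 1 \<and> 1 \<le> i \<and> i < 5 \<or> i = 3 \<and> j = 6 \<or> i = 0 \<and> j = 6)"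
    "edge_count (snd (affine_E 7)) i j = of_bool (j = i + 1 \<and> 1 \<le> i \<and> i < 6 \<or> i = 3 \<and> j = 7 \<or> i = 0 \<and> j = 1)"
    "edge_count (snd (affine_E 8)) i j = of_bool (j = i + 1 \<and> 1 \<le> i \<and> i < 7 \<or> i = 3 \<and> j = 8 \<or> i = 0 \<and> j = 7)"
proof -
  have "snd (affine_E 6) = path_edges 5 + {#{3, 6}, {0, 6}#}" "snd (affine_E 7) = path_edges 6 + {#{3, 7}, {0, 1}#}"
    "snd (affine_E 8) = path_edges 7 + {#{3, 8}, {0, 7}#}" by (simp_all add: affine_E_def)
  note eqs = this
  show "edge_count (snd (affine_E 6)) i j = of_bool (j = i + 1 \<and> 1 \<le> i \<and> i < 5 \<or> i = 3 \<and> j = 6 \<or> i = 0 \<and> j = 6)"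
    unfolding eqs by (rule edge_count_path_two_edges) (use assms in simp_all)
  show "edge_count (snd (affine_E 7)) i j = of_bool (j = i + 1 \<and> 1 \<le> i \<and> i < 6 \<or> i = 3 \<and> j = 7 \<or> i = 0 \<and> j = 1)"
    unfolding eqs by (rule edge_count_path_two_edges) (use assms in simp_all)
  show "edge_count (snd (affine_E 8)) i j = of_bool (j = i + 1 \<and> 1 \<le> i \<and> i < 7 \<or> i = 3 \<and> j = 8 \<or> i = 0 \<and> j = 7)"
    unfolding eqs by (rule edge_count_path_two_edges) (use assms in simp_all)
qed

lemma sort_arms:
  fixes l :: "nat \<Rightarrow> nat"
  obtains p q r where "{p, q, r} = {0, 1, 2 :: nat}" "p \<noteq> q" "p \<noteq> r" "q \<noteq> r" "l q \<le> l p" "l r \<le> l q"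
proof -
  have "\<exists>p q r. {p, q, r} = {0, 1, 2 :: nat} \<and> p \<noteq> q \<and> p \<noteq> r \<and> q \<noteq> r \<and> l q \<le> l p \<and> l r \<le> l q"
  proof -
    consider "l 1 \<le> l 0" "l 2 \<le> l 1" | "l 2 \<le> l 0" "l 1 \<le> l 2" | "l 0 \<le> l 1" "l 2 \<le> l 0"
      | "l 2 \<le> l 1" "l 0 \<le> l 2" | "l 0 \<le> l 2" "l 1 \<le> l 0" | "l 1 \<le> l 2" "l 0 \<le> l 1" by linarith
    then show ?thesis
    proof cases
      case 1 show ?thesis by (rule exI[of _ 0], rule exI[of _ 1], rule exI[of _ 2]) (use 1 in auto)
    next
      case 2 show ?thesis by (rule exI[of _ 0], rule exI[of _ 2], rule exI[of _ 1]) (use 2 in auto)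
    next
      case 3 show ?thesis by (rule exI[of _ 1], rule exI[of _ 0], rule exI[of _ 2]) (use 3 in auto)
    next
      case 4 show ?thesis by (rule exI[of _ 1], rule exI[of _ 2], rule exI[of _ 0]) (use 4 in auto)
    next
      case 5 show ?thesis by (rule exI[of _ 2], rule exI[of _ 0], rule exI[of _ 1]) (use 5 in auto)
    next
      case 6 show ?thesis by (rule exI[of _ 2], rule exI[of _ 1], rule exI[of _ 0]) (use 6 in auto)
    qed
  qed
  then show ?thesis using that by blast
qed

context connected_multigraph
begin

lemma embeds_star:
  assumes st: "star_on \<beta> l V" and H: "fst H = {0..n}" and xs: "distinct xs" "length xs = Suc n" "set xs \<subseteq> star_vertices l"
    and adj: "\<And>i j. i \<le> j \<Longrightarrow> j \<le> n \<Longrightarrow> edge_count (snd H) i j \<noteq> 0 \<Longrightarrow> edge_count (snd H) i j = 1 \<and> star_adjacent (xs ! i) (xs ! j)"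
  shows "embeds H"
proof -
  have inj: "inj_on \<beta> (star_vertices l)" and V: "\<beta> ` star_vertices l = V"
    and m: "\<And>x y. x \<in> star_vertices l \<Longrightarrow> y \<in> star_vertices l \<Longrightarrow> m (\<beta> x) (\<beta> y) = of_bool (star_adjacent x y)"
    using st by (auto simp: star_on_def)
  have mem: "xs ! i \<in> star_vertices l" if "i \<le> n" for i using xs that nth_mem[of i xs] by auto
  have "inj_on (\<lambda>i. \<beta> (xs ! i)) {0..n}"
  proof (rule inj_onI)
    fix i j assume ij: "i \<in> {0..n}" "j \<in> {0..n}" "\<beta> (xs ! i) = \<beta> (xs ! j)"
    then have "xs ! i = xs ! j" using inj mem by (auto simp: inj_on_def)
    then show "i = j" using ij xs by (simp add: nth_eq_iff_index_eq)
  qed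
  moreover have "(\<lambda>i. \<beta> (xs ! i)) ` {0..n} \<subseteq> V" using mem V by auto
  moreover have le: "edge_count (snd H) i j \<le> m (\<beta> (xs ! i)) (\<beta> (xs ! j))" if "i \<le> j" "j \<le> n" for i j
  proof (cases "edge_count (snd H) i j = 0")
    case False
    then show ?thesis using adj[OF that False] m[OF mem mem, of i j] that by simp
  qed simp
  moreover have "edge_count (snd H) i j \<le> m (\<beta> (xs ! i)) (\<beta> (xs ! j))" if "i \<le> n" "j \<le> n" for i j
    using that le by (metis m_sym edge_count_sym nle_le)
  ultimately show ?thesis unfolding embeds_def H by (intro exI[of _ "\<lambda>i. \<beta> (xs ! i)"]) auto
qed

lemma isomorphic_star:
  assumes st: "star_on \<beta> l V" and H: "fst H = {1..n}" and pos: "inj_on pos {1..n}" "pos ` {1..n} = star_vertices l"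
    and adj: "\<And>i j. i \<in> {1..n} \<Longrightarrow> j \<in> {1..n} \<Longrightarrow> edge_count (snd H) i j = of_bool (star_adjacent (pos i) (pos j))"
  shows "isomorphic_to H"
proof -
  have inj: "inj_on \<beta> (star_vertices l)" and V: "\<beta> ` star_vertices l = V"
    and m: "\<And>x y. x \<in> star_vertices l \<Longrightarrow> y \<in> star_vertices l \<Longrightarrow> m (\<beta> x) (\<beta> y) = of_bool (star_adjacent x y)"
    using st by (auto simp: star_on_def)
  have "bij_betw (\<beta> \<circ> pos) {1..n} V"
    using pos inj V by (intro bij_betw_trans[of pos _ "star_vertices l"]) (auto simp: bij_betw_def)
  moreover have "edge_count (snd H) i j = m ((\<beta> \<circ> pos) i) ((\<beta> \<circ> pos) j)" if ij: "i \<in> {1..n}" "j \<in> {1..n}" for i j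
  proof -
    have "pos i \<in> star_vertices l" "pos j \<in> star_vertices l" using ij pos(2) by auto
    then show ?thesis using adj[OF ij] m by simp
  qed
  ultimately show ?thesis unfolding isomorphic_to_def H by (intro exI[of _ "\<beta> \<circ> pos"]) blast
qed

text \<open>
  A path is of type \<open>A\<close>. For a star with arm lengths \<open>l p \<ge> l q \<ge> l r\<close>, the affine diagrams of
  type \<open>E\<close> are the stars with lengths \<open>(2, 2, 2)\<close>, \<open>(3, 3, 1)\<close> and \<open>(5, 2, 1)\<close>. A star that
  contains none of them has \<open>l r = 1\<close> and either \<open>l q = 1\<close>, which is type \<open>D\<close>, or \<open>l q = 2\<close> and
  \<open>l p \<le> 4\<close>, which is type \<open>E\<close>.
\<close>

theorem dynkin_or_affine:
  "(\<exists>H\<in>dynkin_diagrams. isomorphic_to H) \<or> (\<exists>H\<in>affine_diagrams. embeds H)"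
proof (rule disjCI)
  assume "\<not> (\<exists>H\<in>affine_diagrams. embeds H)"
  then have no: "\<And>n. n \<ge> 1 \<Longrightarrow> \<not> embeds (affine_A n)" "\<And>n. n \<ge> 4 \<Longrightarrow> \<not> embeds (affine_D n)"
    "\<not> embeds (affine_E 6)" "\<not> embeds (affine_E 7)" "\<not> embeds (affine_E 8)"
    by (auto simp: affine_diagrams_def)
  consider f k where "path_on f k V" | \<beta> l where "star_on \<beta> l V" using path_or_star no by blast
  then show "\<exists>H\<in>dynkin_diagrams. isomorphic_to H"
  proof cases
    case (1 f k)
    have "bij_betw (\<lambda>i. i - 1) {1..Suc k} {..k}"
      by (rule bij_betwI[where g = Suc]) auto
    moreover have "bij_betw f {..k} V" using 1 by (auto simp: path_on_def bij_betw_def)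
    ultimately have bij: "bij_betw (f \<circ> (\<lambda>i. i - 1)) {1..Suc k} V" by (rule bij_betw_trans)
    have eq: "edge_count (snd (dynkin_A (Suc k))) i j = m ((f \<circ> (\<lambda>i. i - 1)) i) ((f \<circ> (\<lambda>i. i - 1)) j)"
      if "i \<in> {1..Suc k}" "j \<in> {1..Suc k}" for i j
    proof -
      obtain i' j' where ij: "i = Suc i'" "j = Suc j'" "i' \<le> k" "j' \<le> k"
        using \<open>i \<in> {1..Suc k}\<close> \<open>j \<in> {1..Suc k}\<close> by (cases i; cases j) auto
      then have "m (f i') (f j') = of_bool (j' = i' + 1 \<or> i' = j' + 1)" using 1 by (simp add: path_on_def)
      then show ?thesis using ij by (auto simp: dynkin_A_def)
    qed
    have "isomorphic_to (dynkin_A (Suc k))" unfolding isomorphic_to_def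
      by (rule exI[of _ "f \<circ> (\<lambda>i. i - 1)"]) (use bij eq in \<open>auto simp: dynkin_A_def\<close>)
    moreover have "dynkin_A (Suc k) \<in> dynkin_diagrams" by (simp add: dynkin_diagrams_def)
    ultimately show ?thesis by blast
  next
    case (2 \<beta> l)
    obtain p q r where pqr: "{p, q, r} = {0, 1, 2 :: nat}" "p \<noteq> q" "p \<noteq> r" "q \<noteq> r" "l q \<le> l p" "l r \<le> l q"
      by (rule sort_arms)
    have mem: "p \<in> {0,1,2}" "q \<in> {0,1,2}" "r \<in> {0,1,2}" unfolding pqr(1)[symmetric] by auto
    then have lt: "p < 3" "q < 3" "r < 3" by auto
    have each: "a = p \<or> a = q \<or> a = r" if "a < 3" for a
    proof -
      have "a \<in> {0, 1, 2}" using that by auto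
      then show ?thesis unfolding pqr(1)[symmetric] by blast
    qed
    have pos: "l p \<ge> 1" "l q \<ge> 1" "l r \<ge> 1" using 2 lt by (auto simp: star_on_def)
    have arms: "arm a j \<in> star_vertices l" if "a < 3" "j \<le> l a" for a j using arm_in_star that by blast
    have "\<not> l r \<ge> 2"
    proof
      assume r: "l r \<ge> 2"
      let ?xs = "[arm r 2, arm p 2, arm p 1, arm p 0, arm q 1, arm q 2, arm r 1]"
      have "embeds (affine_E 6)"
      proof (rule embeds_star[OF 2, of _ 6 ?xs])
        fix i j :: nat assume ij: "i \<le> j" "j \<le> 6" "edge_count (snd (affine_E 6)) i j \<noteq> 0"
        then have "edge_count (snd (affine_E 6)) i j = 1" "j = i + 1 \<and> 1 \<le> i \<and> i < 5 \<or> i = 3 \<and> j = 6 \<or> i = 0 \<and> j = 6"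
          unfolding edge_count_affine_E[OF ij(1)] by (simp_all only: of_bool_eq_0_iff of_bool_eq_1_iff not_not)
        moreover have "1 \<le> i \<and> i < 5 \<Longrightarrow> i = 1 \<or> i = 2 \<or> i = 3 \<or> i = 4" by linarith
        ultimately show "edge_count (snd (affine_E 6)) i j = 1 \<and> star_adjacent (?xs ! i) (?xs ! j)"
          by (elim disjE conjE impCE) (auto simp: star_adjacent_arm)
      qed (use r pqr(2-6) lt in \<open>auto simp: affine_E_def arm_eq_iff intro!: arms\<close>)
      then show False using no by blast
    qed
    then have r: "l r = 1" using pos(3) by simp
    have "\<not> l q \<ge> 3"
    proof
      assume q: "l q \<ge> 3"
      let ?xs = "[arm p 3, arm p 2, arm p 1, arm p 0, arm q 1, arm q 2, arm q 3, arm r 1]"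
      have "embeds (affine_E 7)"
      proof (rule embeds_star[OF 2, of _ 7 ?xs])
        fix i j :: nat assume ij: "i \<le> j" "j \<le> 7" "edge_count (snd (affine_E 7)) i j \<noteq> 0"
        then have "edge_count (snd (affine_E 7)) i j = 1" "j = i + 1 \<and> 1 \<le> i \<and> i < 6 \<or> i = 3 \<and> j = 7 \<or> i = 0 \<and> j = 1"
          unfolding edge_count_affine_E[OF ij(1)] by (simp_all only: of_bool_eq_0_iff of_bool_eq_1_iff not_not)
        moreover have "1 \<le> i \<and> i < 6 \<Longrightarrow> i = 1 \<or> i = 2 \<or> i = 3 \<or> i = 4 \<or> i = 5" by linarith
        ultimately show "edge_count (snd (affine_E 7)) i j = 1 \<and> star_adjacent (?xs ! i) (?xs ! j)"
          by (elim disjE conjE impCE) (auto simp: star_adjacent_arm)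
      qed (use q r pqr(2-6) lt in \<open>auto simp: affine_E_def arm_eq_iff intro!: arms\<close>)
      then show False using no by blast
    qed
    then consider "l q = 1" | "l q = 2" using pos(2) by linarith
    then show ?thesis
    proof cases
      case q: 1
      define L where "L = l p"
      define n where "n = L + 3"
      define \<phi> where "\<phi> i = (if i \<le> L + 1 then arm p (L + 1 - i) else if i = L + 2 then arm q 1 else arm r 1)" for i
      define R where "R i x \<longleftrightarrow> (\<exists>t\<le>L. x = arm p t \<and> t + i = L + 1) \<or> (x = arm q 1 \<and> i = L + 2) \<or> (x = arm r 1 \<and> i = L + 3)" for i x
      have L: "L \<ge> 1" "l p = L" using pos by (auto simp: L_def)
      have R\<phi>: "R i (\<phi> i)" if "i \<in> {1..n}" for i
      proof -
        consider "1 \<le> i" "i \<le> L + 1" | "i = L + 2" | "i = L + 3" using \<open>i \<in> {1..n}\<close> unfolding n_def atLeastAtMost_iff by linarith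
        then show ?thesis
        proof cases
          case 1 then show ?thesis unfolding R_def \<phi>_def by (intro disjI1 exI[of _ "L + 1 - i"]) auto
        qed (simp_all add: R_def \<phi>_def)
      qed
      have R_unique: "i = j" if "R i x" "R j x" for i j x
        using that pqr(2-4) unfolding R_def by (elim disjE exE conjE) (simp_all add: arm_eq_iff)
      have R_mem: "x \<in> star_vertices l" if "R i x" for i x
        using that q r L lt unfolding R_def by (elim disjE exE conjE) (simp_all add: arms)
      have "isomorphic_to (dynkin_D n)"
      proof (rule isomorphic_star[OF 2, of _ n \<phi>])
        show "inj_on \<phi> {1..n}" using R\<phi> R_unique by (metis inj_onI)
        have "\<exists>i\<in>{1..n}. R i x" if "x \<in> star_vertices l" for x
        proof -
          obtain a j where x: "a < 3" "j \<le> l a" "x = arm a j" using star_vertices_arm[OF \<open>x \<in> star_vertices l\<close>] by blast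
          then consider "x = arm p j" "j \<le> L" | "x = arm q 1" | "x = arm r 1" using each[OF x(1)] L q r by (auto simp: arm_def le_Suc_eq)
          then show "\<exists>i\<in>{1..n}. R i x"
          proof cases
            case 1 then show ?thesis by (intro bexI[of _ "L + 1 - j"]) (auto simp: R_def n_def)
          next
            case 2 then show ?thesis by (intro bexI[of _ "L + 2"]) (auto simp: R_def n_def)
          next
            case 3 then show ?thesis by (intro bexI[of _ "L + 3"]) (auto simp: R_def n_def)
          qed
        qed
        then have R_ex: "\<And>x. x \<in> star_vertices l \<Longrightarrow> \<exists>i\<in>{1..n}. R i x" .
        have R_eq: "R i x \<Longrightarrow> i \<in> {1..n} \<Longrightarrow> x = \<phi> i" for i x
        proof -
          assume "R i x" "i \<in> {1..n}"
          moreover have "R i (\<phi> i)" by (rule R\<phi>) fact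
          ultimately show "x = \<phi> i" using pqr(2-4) unfolding R_def by (elim disjE exE conjE) (simp_all add: arm_eq_iff)
        qed
        show "\<phi> ` {1..n} = star_vertices l"
        proof (intro equalityI subsetI)
          fix x assume "x \<in> \<phi> ` {1..n}"
          then show "x \<in> star_vertices l" using R\<phi> R_mem by blast
        next
          fix x assume "x \<in> star_vertices l"
          then obtain i where "i \<in> {1..n}" "R i x" using R_ex by blast
          then show "x \<in> \<phi> ` {1..n}" using R_eq by blast
        qed
        fix i j assume ij: "i \<in> {1..n}" "j \<in> {1..n}"
        have edge_count: "edge_count (snd (dynkin_D n)) i j = of_bool (j = i + 1 \<and> i < L + 2 \<or> i = j + 1 \<and> j < L + 2 \<or> i = L + 1 \<and> j = L + 3 \<or> j = L + 1 \<and> i = L + 3)"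
          using ij by (auto simp: dynkin_D_def n_def)
        show "edge_count (snd (dynkin_D n)) i j = of_bool (star_adjacent (\<phi> i) (\<phi> j))"
          unfolding edge_count of_bool_eq_iff
          using R\<phi>[OF ij(1)] R\<phi>[OF ij(2)] pqr(2-4) unfolding R_def
          by (elim disjE exE conjE) (simp add: star_adjacent_arm; auto)+
      qed (simp add: dynkin_D_def)
      have "n \<ge> 4" using L by (simp add: n_def)
      then show ?thesis using \<open>isomorphic_to (dynkin_D n)\<close> by (auto simp: dynkin_diagrams_def)
    next
      case q: 2
      have "\<not> l p \<ge> 5"
      proof
        assume p: "l p \<ge> 5"
        let ?xs = "[arm p 5, arm q 2, arm q 1, arm p 0, arm p 1, arm p 2, arm p 3, arm p 4, arm r 1]"
        have "embeds (affine_E 8)"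
        proof (rule embeds_star[OF 2, of _ 8 ?xs])
        fix i j :: nat assume ij: "i \<le> j" "j \<le> 8" "edge_count (snd (affine_E 8)) i j \<noteq> 0"
        then have "edge_count (snd (affine_E 8)) i j = 1" "j = i + 1 \<and> 1 \<le> i \<and> i < 7 \<or> i = 3 \<and> j = 8 \<or> i = 0 \<and> j = 7"
          unfolding edge_count_affine_E[OF ij(1)] by (simp_all only: of_bool_eq_0_iff of_bool_eq_1_iff not_not)
        moreover have "1 \<le> i \<and> i < 7 \<Longrightarrow> i = 1 \<or> i = 2 \<or> i = 3 \<or> i = 4 \<or> i = 5 \<or> i = 6" by linarith
        ultimately show "edge_count (snd (affine_E 8)) i j = 1 \<and> star_adjacent (?xs ! i) (?xs ! j)"
          by (elim disjE conjE impCE) (auto simp: star_adjacent_arm)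
        qed (use p q r pqr(2-6) lt in \<open>auto simp: affine_E_def arm_eq_iff intro!: arms\<close>)
        then show False using no by blast
      qed
      then have p: "l p \<in> {2, 3, 4}" using pqr(5) q by auto
      define L where "L = l p"
      define n where "n = L + 4"
      define \<phi> where "\<phi> i = (if i \<le> 3 then arm q (3 - i) else if i = L + 4 then arm r 1 else arm p (i - 3))" for i
      define R where "R i x \<longleftrightarrow> (x = arm q 0 \<and> i = 3) \<or> (x = arm q 1 \<and> i = 2) \<or> (x = arm q 2 \<and> i = 1) \<or> (\<exists>t. 1 \<le> t \<and> t \<le> L \<and> x = arm p t \<and> i = t + 3) \<or> (x = arm r 1 \<and> i = L + 4)" for i x
      have L: "L \<ge> 2" "l p = L" using p by (auto simp: L_def)
      have R\<phi>: "R i (\<phi> i)" if "i \<in> {1..n}" for i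
      proof -
        consider "i = 1 \<or> i = 2 \<or> i = 3" | "4 \<le> i" "i \<le> L + 3" | "i = L + 4" using \<open>i \<in> {1..n}\<close> unfolding n_def atLeastAtMost_iff by linarith
        then show ?thesis
        proof cases
          case 1 then show ?thesis unfolding R_def \<phi>_def by (elim disjE) simp_all
        next
          case 2 then show ?thesis unfolding R_def \<phi>_def by (intro disjI2[OF disjI2[OF disjI2[OF disjI1]]] exI[of _ "i - 3"]) auto
        qed (simp_all add: R_def \<phi>_def)
      qed
      have R_unique: "i = j" if "R i x" "R j x" for i j x
        using that pqr(2-4) unfolding R_def by (elim disjE exE conjE) (simp_all add: arm_eq_iff)
      have R_mem: "x \<in> star_vertices l" if "R i x" for i x
        using that q r L lt unfolding R_def by (elim disjE exE conjE) (simp_all add: arms)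
      have "isomorphic_to (dynkin_E n)"
      proof (rule isomorphic_star[OF 2, of _ n \<phi>])
        show "inj_on \<phi> {1..n}" using R\<phi> R_unique by (metis inj_onI)
        have "\<exists>i\<in>{1..n}. R i x" if "x \<in> star_vertices l" for x
        proof -
          obtain a j where x: "a < 3" "j \<le> l a" "x = arm a j" using star_vertices_arm[OF \<open>x \<in> star_vertices l\<close>] by blast
          then consider "x = arm q j" "j \<le> 2" | "x = arm p j" "1 \<le> j" "j \<le> L" | "x = arm r 1"
          proof -
            have z: "arm b 0 = arm q 0" for b by (simp add: arm_def)
            consider "j = 0" | "a = q" | "a = p" "1 \<le> j" | "a = r" "1 \<le> j" using each[OF x(1)] by linarith
            then show thesis
            proof cases
              case 1 then show thesis using that(1) x(3) z by simp
            next
              case 2 then show thesis using that(1) x q by simp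
            next
              case 3 then show thesis using that(2) x L by simp
            next
              case 4
              then have "j = 1" using x r by simp
              then show thesis using that(3) x 4 by simp
            qed
          qed
          then show "\<exists>i\<in>{1..n}. R i x"
          proof cases
            case 1
            then have "j = 0 \<or> j = 1 \<or> j = 2" by linarith
            then show ?thesis using 1 by (intro bexI[of _ "3 - j"]) (auto simp: R_def n_def)
          next
            case 2 then show ?thesis by (intro bexI[of _ "j + 3"]) (auto simp: R_def n_def)
          next
            case 3 then show ?thesis by (intro bexI[of _ "L + 4"]) (auto simp: R_def n_def)
          qed
        qed
        then have R_ex: "\<And>x. x \<in> star_vertices l \<Longrightarrow> \<exists>i\<in>{1..n}. R i x" .
        have R_eq: "R i x \<Longrightarrow> i \<in> {1..n} \<Longrightarrow> x = \<phi> i" for i x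
        proof -
          assume "R i x" "i \<in> {1..n}"
          moreover have "R i (\<phi> i)" by (rule R\<phi>) fact
          ultimately show "x = \<phi> i" using pqr(2-4) unfolding R_def by (elim disjE exE conjE) (simp_all add: arm_eq_iff)
        qed
        show "\<phi> ` {1..n} = star_vertices l"
        proof (intro equalityI subsetI)
          fix x assume "x \<in> \<phi> ` {1..n}"
          then show "x \<in> star_vertices l" using R\<phi> R_mem by blast
        next
          fix x assume "x \<in> star_vertices l"
          then obtain i where "i \<in> {1..n}" "R i x" using R_ex by blast
          then show "x \<in> \<phi> ` {1..n}" using R_eq by blast
        qed
        fix i j assume ij: "i \<in> {1..n}" "j \<in> {1..n}"
        have edge_count: "edge_count (snd (dynkin_E n)) i j = of_bool (j = i + 1 \<and> i < L + 3 \<or> i = j + 1 \<and> j < L + 3 \<or> i = 3 \<and> j = L + 4 \<or> j = 3 \<and> i = L + 4)"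
        proof -
          have n1: "n - 1 = L + 3" "n = L + 4" by (simp_all add: n_def)
          have "edge_count (path_edges (L + 3) + {#{3, L + 4}#}) i j =
              of_bool (j = i + 1 \<and> 1 \<le> i \<and> i < L + 3 \<or> i = j + 1 \<and> 1 \<le> j \<and> j < L + 3 \<or> i = 3 \<and> j = L + 4 \<or> j = 3 \<and> i = L + 4)"
            using L(1) by (intro edge_count_path_one_edge) linarith+
          moreover have "1 \<le> i" "1 \<le> j" using ij by auto
          ultimately show ?thesis unfolding dynkin_E_def snd_conv n1(1) unfolding n1(2) by (simp only: simp_thms)
        qed
        show "edge_count (snd (dynkin_E n)) i j = of_bool (star_adjacent (\<phi> i) (\<phi> j))"
          unfolding edge_count of_bool_eq_iff
          using R\<phi>[OF ij(1)] R\<phi>[OF ij(2)] pqr(2-4) unfolding R_def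
          by (elim disjE exE conjE) (simp add: star_adjacent_arm; auto)+
      qed (simp add: dynkin_E_def)
      have "n \<in> {6, 7, 8}" using p by (auto simp: n_def L_def)
      then show ?thesis using \<open>isomorphic_to (dynkin_E n)\<close> by (auto simp: dynkin_diagrams_def)
    qed
  qed
qed

text \<open>
  Extend the harmonic weight by zero. An edge that is missing in the diagram makes the
  inequality strict at its end points; a vertex outside the diagram with a neighbour inside has
  weight zero but a positive neighbour sum.
\<close>

lemma affine_or_superharmonic:
  assumes H: "H \<in> affine_diagrams" "embeds H"
  shows "isomorphic_to H \<or> (\<exists>d :: 'v \<Rightarrow> nat. (\<forall>u\<in>V. (\<Sum>v\<in>V. m u v * d v) \<ge> 2 * d u) \<and> (\<exists>u\<in>V. (\<Sum>v\<in>V. m u v * d v) > 2 * d u))"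
proof -
  obtain \<phi> where \<phi>: "inj_on \<phi> (fst H)" "\<phi> ` fst H \<subseteq> V"
    "\<And>i j. i \<in> fst H \<Longrightarrow> j \<in> fst H \<Longrightarrow> edge_count (snd H) i j \<le> m (\<phi> i) (\<phi> j)"
    using H(2) by (auto simp: embeds_def)
  obtain \<delta> :: "nat \<Rightarrow> nat" where \<delta>: "\<And>i. i \<in> fst H \<Longrightarrow> \<delta> i > 0"
    "\<And>i. i \<in> fst H \<Longrightarrow> weighted_sum H \<delta> i = 2 * \<delta> i" "\<exists>i\<in>fst H. \<delta> i = 1"
    using affine_harmonic[OF H(1)] by blast
  define C where "C = \<phi> ` fst H"
  define d where "d v = (if v \<in> C then \<delta> (the_inv_into (fst H) \<phi> v) else 0)" for v
  have C: "C \<subseteq> V" "C \<noteq> {}" using \<phi>(2) \<delta>(3) by (auto simp: C_def)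
  have d\<phi>: "d (\<phi> i) = \<delta> i" if "i \<in> fst H" for i
    using that \<phi>(1) by (auto simp: d_def C_def the_inv_into_f_f)
  have S: "(\<Sum>v\<in>V. m u v * d v) = (\<Sum>i\<in>fst H. m u (\<phi> i) * \<delta> i)" for u
  proof -
    have "(\<Sum>v\<in>V. m u v * d v) = (\<Sum>v\<in>C. m u v * d v)"
      using C(1) finite_V by (intro sum.mono_neutral_right) (auto simp: d_def)
    also have "\<dots> = (\<Sum>i\<in>fst H. m u (\<phi> i) * \<delta> i)"
      unfolding C_def by (subst sum.reindex[OF \<phi>(1)]) (auto intro!: sum.cong simp: d\<phi>)
    finally show ?thesis .
  qed
  have finH: "finite (fst H)" using finite_subset[OF \<phi>(2) finite_V] \<phi>(1) by (rule finite_imageD)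
  have ge: "2 * d u \<le> (\<Sum>v\<in>V. m u v * d v)" for u
  proof (cases "u \<in> C")
    case True
    then obtain i where i: "i \<in> fst H" "u = \<phi> i" by (auto simp: C_def)
    have "2 * d u = (\<Sum>j\<in>fst H. edge_count (snd H) i j * \<delta> j)"
      using \<delta>(2)[OF i(1)] i d\<phi> by (simp add: weighted_sum_def)
    also have "\<dots> \<le> (\<Sum>j\<in>fst H. m u (\<phi> j) * \<delta> j)"
      using \<phi>(3) i by (intro sum_mono mult_le_mono1) auto
    finally show ?thesis unfolding S .
  qed (simp add: d_def)
  show ?thesis
  proof (cases "C = V \<and> (\<forall>i\<in>fst H. \<forall>j\<in>fst H. edge_count (snd H) i j = m (\<phi> i) (\<phi> j))")
    case True
    then have "isomorphic_to H" unfolding isomorphic_to_def using \<phi>(1) by (intro exI[of _ \<phi>]) (auto simp: bij_betw_def C_def)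
    then show ?thesis ..
  next
    case False
    have "\<exists>u\<in>V. (\<Sum>v\<in>V. m u v * d v) > 2 * d u"
    proof (cases "C = V")
      case True
      then obtain i j where ij: "i \<in> fst H" "j \<in> fst H" "edge_count (snd H) i j < m (\<phi> i) (\<phi> j)"
        using False \<phi>(3) by (metis order_le_less)
      have "2 * d (\<phi> i) = (\<Sum>j\<in>fst H. edge_count (snd H) i j * \<delta> j)"
        using \<delta>(2)[OF ij(1)] d\<phi>[OF ij(1)] by (simp add: weighted_sum_def)
      also have "\<dots> < (\<Sum>j\<in>fst H. m (\<phi> i) (\<phi> j) * \<delta> j)"
        using \<phi>(3) ij \<delta>(1) finH by (intro sum_strict_mono_ex1) (auto intro!: mult_le_mono1 bexI[of _ j])
      finally show ?thesis using ij \<phi>(2) unfolding S by blast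
    next
      case False
      then obtain u0 v0 where uv: "u0 \<in> C" "v0 \<in> V - C" using C by auto
      have "(u0, v0) \<in> {(x, y). x \<in> V \<and> y \<in> V \<and> m x y > 0}\<^sup>*" using conn[of u0 v0] uv C by auto
      then have "\<exists>u w. u \<in> C \<and> w \<in> V - C \<and> m u w > 0"
        using uv(1)
      proof (induction rule: converse_rtrancl_induct)
        case base then show ?case using uv by simp
      next
        case (step y z)
        then show ?case by (cases "z \<in> C") auto
      qed
      then obtain i w where iw: "i \<in> fst H" "w \<in> V" "w \<notin> C" "m (\<phi> i) w > 0" by (auto simp: C_def)
      have "0 < m w (\<phi> i) * \<delta> i" using iw \<delta>(1) m_sym[of w] by simp
      also have "\<dots> \<le> (\<Sum>j\<in>fst H. m w (\<phi> j) * \<delta> j)" by (rule member_le_sum) (use iw finH in auto)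
      finally have "2 * d w < (\<Sum>v\<in>V. m w v * d v)" unfolding S using iw(3) by (simp add: d_def)
      then show ?thesis using iw by blast
    qed
    then show ?thesis using ge by blast
  qed
qed

end

section \<open>Isomorphisms of multigraphs\<close>

lemma edge_count_image:
  assumes "inj_on b V" "\<And>e. e \<in># E \<Longrightarrow> e \<subseteq> V" "u \<in> V" "v \<in> V"
  shows "edge_count (image_mset (image b) E) (b u) (b v) = edge_count E u v"
proof -
  have "b ` e = {b u, b v} \<longleftrightarrow> e = {u, v}" if "e \<in># E" for e
    using inj_on_image_eq_iff[OF assms(1), of e "{u, v}"] assms(2)[OF that] assms(3,4) by simp
  then have "{e. e \<in># E \<and> {b u, b v} = b ` e} = {e. e \<in># E \<and> e = {u, v}}" by blast
  then have "count (image_mset (image b) E) {b u, b v} = (\<Sum>e\<in>{e. e \<in># E \<and> e = {u, v}}. count E e)"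
    by (simp only: count_image_mset')
  also have "\<dots> = count E {u, v}"
  proof (cases "{u, v} \<in># E")
    case True
    then have "{e. e \<in># E \<and> e = {u, v}} = {{u, v}}" by auto
    then show ?thesis by simp
  next
    case False
    then have "{e. e \<in># E \<and> e = {u, v}} = {}" by auto
    then show ?thesis using False by (simp add: not_in_iff)
  qed
  finally show ?thesis using assms by (auto simp: edge_count_def inj_on_eq_iff)
qed

text \<open>
  The condition that edges are sets of two vertices is what allows a multigraph to be recovered
  from its numbers of edges between distinct vertices.
\<close>

definition loopless :: "'v multigraph \<Rightarrow> bool" where
  "loopless G \<longleftrightarrow> (\<forall>e\<in>#snd G. \<exists>u\<in>fst G. \<exists>v\<in>fst G. u \<noteq> v \<and> e = {u, v})"

lemma path_edges_loopless: "e \<in># path_edges m \<Longrightarrow> {1..m} \<subseteq> V \<Longrightarrow> \<exists>u\<in>V. \<exists>v\<in>V. u \<noteq> v \<and> e = {u, v}"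
proof -
  assume "e \<in># path_edges m" "{1..m} \<subseteq> V"
  then obtain i where i: "e = {i, i + 1}" "1 \<le> i" "i < m" by (auto simp: path_edges_def)
  then have "i \<in> {1..m}" "i + 1 \<in> {1..m}" by auto
  then have "i \<in> V" "i + 1 \<in> V" using \<open>{1..m} \<subseteq> V\<close> by blast+
  then show "\<exists>u\<in>V. \<exists>v\<in>V. u \<noteq> v \<and> e = {u, v}" using i by (intro bexI[of _ i] bexI[of _ "i + 1"]) auto
qed

lemma diagrams_loopless: "H \<in> dynkin_diagrams \<union> affine_diagrams \<Longrightarrow> loopless H"
proof -
  have E: "loopless (V, path_edges k + M)"
    if "{1..k} \<subseteq> V" "\<forall>e\<in>#M. \<exists>u\<in>V. \<exists>v\<in>V. u \<noteq> v \<and> e = {u, v}" for V k M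
    using that path_edges_loopless[of _ k V] by (auto simp: loopless_def)
  have one: "\<exists>u\<in>V. \<exists>v\<in>V. u \<noteq> v \<and> {p, q} = {u, v}" if "p \<in> V" "q \<in> V" "p \<noteq> q" for p q :: nat and V
    using that by blast
  have A: "loopless (dynkin_A n)" for n using E[of n "{1..n}" "{#}"] by (simp add: dynkin_A_def)
  have D: "loopless (dynkin_D n)" if "n \<ge> 4" for n
    unfolding dynkin_D_def by (rule E) (use that in \<open>auto intro!: one\<close>)
  have DE: "loopless (dynkin_E n)" if "n \<ge> 6" for n
    unfolding dynkin_E_def by (rule E) (use that in \<open>auto intro!: one\<close>)
  have AA: "loopless (affine_A n)" if "n \<ge> 1" for n
    unfolding affine_A_def by (rule E) (use that in \<open>auto intro!: one\<close>)
  have AD: "loopless (affine_D n)" if "n \<ge> 4" for n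
    unfolding affine_D_def by (rule E) (use that in \<open>auto intro!: one\<close>)
  have AE: "loopless (affine_E n)" if "n \<in> {6, 7, 8}" for n
    unfolding affine_E_def by (rule E) (use that in \<open>auto intro!: one\<close>)
  show "loopless H" if "H \<in> dynkin_diagrams \<union> affine_diagrams"
    using that A D DE AA AD AE by (auto simp: dynkin_diagrams_def affine_diagrams_def)
qed

lemma multigraph_isoI:
  assumes "loopless G" "loopless H" and \<phi>: "bij_betw \<phi> (fst H) (fst G)"
    and m: "\<And>i j. i \<in> fst H \<Longrightarrow> j \<in> fst H \<Longrightarrow> edge_count (snd H) i j = edge_count (snd G) (\<phi> i) (\<phi> j)"
  shows "G \<simeq> H"
proof -
  define b where "b = the_inv_into (fst H) \<phi>"
  have b: "bij_betw b (fst G) (fst H)" unfolding b_def by (rule bij_betw_the_inv_into[OF \<phi>])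
  have b\<phi>: "b (\<phi> i) = i" if "i \<in> fst H" for i
    using \<phi> that by (auto simp: b_def bij_betw_def the_inv_into_f_f)
  have \<phi>G: "\<phi> i \<in> fst G" if "i \<in> fst H" for i using \<phi> that by (auto simp: bij_betw_def)
  have sub: "\<And>e. e \<in># snd G \<Longrightarrow> e \<subseteq> fst G" using assms(1) by (auto simp: loopless_def)
  have inj: "inj_on b (fst G)" using b by (simp add: bij_betw_def)
  let ?E = "image_mset (image b) (snd G)"
  have "count ?E x = count (snd H) x" for x
  proof (cases "\<exists>i\<in>fst H. \<exists>j\<in>fst H. i \<noteq> j \<and> x = {i, j}")
    case True
    then obtain i j where ij: "i \<in> fst H" "j \<in> fst H" "i \<noteq> j" "x = {i, j}" by blast
    have "edge_count ?E i j = edge_count (snd H) i j"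
      using edge_count_image[OF inj sub \<phi>G[OF ij(1)] \<phi>G[OF ij(2)]] m[OF ij(1,2)] by (simp add: b\<phi> ij)
    then show ?thesis using ij by (simp add: edge_count_def)
  next
    case False
    then have "x \<notin># snd H" using assms(2) unfolding loopless_def by blast
    moreover have "x \<notin># ?E"
    proof
      assume "x \<in># ?E"
      then obtain e where e: "e \<in># snd G" "x = b ` e" by auto
      then obtain u v where uv: "u \<in> fst G" "v \<in> fst G" "u \<noteq> v" "e = {u, v}" using assms(1) by (auto simp: loopless_def)
      then have "b u \<in> fst H" "b v \<in> fst H" "b u \<noteq> b v" "x = {b u, b v}" using b e by (auto simp: bij_betw_def inj_on_eq_iff)
      then show False using False by blast
    qed
    ultimately show ?thesis by (simp only: not_in_iff)
  qed
  then have "?E = snd H" by (rule multiset_eqI)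
  then show ?thesis unfolding multigraph_iso_def using b by blast
qed

lemma isomorphic_weighted_sum:
  assumes "G \<simeq> H" "loopless G"
  obtains b where "bij_betw b (fst G) (fst H)"
    "\<And>d :: _ \<Rightarrow> 'c::comm_semiring_1. \<And>u. u \<in> fst G \<Longrightarrow> weighted_sum G (\<lambda>v. d (b v)) u = weighted_sum H d (b u)"
proof -
  obtain b where b: "bij_betw b (fst G) (fst H)" "image_mset (image b) (snd G) = snd H"
    using assms(1) by (auto simp: multigraph_iso_def)
  have inj: "inj_on b (fst G)" using b by (simp add: bij_betw_def)
  have sub: "\<And>e. e \<in># snd G \<Longrightarrow> e \<subseteq> fst G" using assms(2) by (auto simp: loopless_def)
  have "weighted_sum G (\<lambda>v. d (b v)) u = weighted_sum H d (b u)" if "u \<in> fst G" for d :: "_ \<Rightarrow> 'c" and u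
  proof -
    have "weighted_sum G (\<lambda>v. d (b v)) u = (\<Sum>v\<in>fst G. of_nat (edge_count (snd H) (b u) (b v)) * d (b v))"
      unfolding weighted_sum_def b(2)[symmetric] using edge_count_image[OF inj sub that] by (intro sum.cong) auto
    also have "\<dots> = weighted_sum H d (b u)"
      unfolding weighted_sum_def by (rule sum.reindex_bij_betw[OF b(1)])
    finally show ?thesis .
  qed
  then show ?thesis using b that by blast
qed

lemma count_image_mset_set:
  "finite A \<Longrightarrow> count (image_mset f (mset_set A)) y = card {x \<in> A. f x = y}"
proof (induction A rule: finite_induct)
  case (insert x A)
  have "{z \<in> insert x A. f z = y} = (if f x = y then insert x {z \<in> A. f z = y} else {z \<in> A. f z = y})" by auto
  then show ?case using insert by auto
qed simp

section \<open>Polynomial relations between positive numbers\<close>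

lemma ex_maximum_on:
  fixes T :: "'m \<Rightarrow> real"
  assumes "finite K" "K \<noteq> {}"
  shows "\<exists>m\<in>K. \<forall>k\<in>K. T k \<le> T m"
proof -
  have "Max (T ` K) \<in> T ` K" using assms by (intro Max_in) auto
  then obtain m where "m \<in> K" "T m = Max (T ` K)" by auto
  then show ?thesis using assms by (intro bexI[of _ m]) auto
qed

text \<open>
  The term of largest absolute value is cancelled by the others, so it is at most \<open>card K\<close> times
  the second largest. The constant is uniform in \<open>x\<close> and \<open>y\<close>; only the pair of terms depends on
  them.
\<close>

lemma vanishing_sum_comparable_terms:
  fixes c :: "'m \<Rightarrow> complex" and p q :: "'m \<Rightarrow> nat"
  assumes K: "finite K" "K \<noteq> {}" and c: "\<And>m. m \<in> K \<Longrightarrow> c m \<noteq> 0"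
  shows "\<exists>C. \<forall>x>0. \<forall>y>0. (\<Sum>m\<in>K. c m * (of_real x ^ p m * of_real y ^ q m)) = 0 \<longrightarrow>
    (\<exists>m\<in>K. \<exists>m'\<in>K. m \<noteq> m' \<and> \<bar>(real (p m) - real (p m')) * ln x + (real (q m) - real (q m')) * ln y\<bar> \<le> C)"
proof (intro exI allI impI)
  fix x y :: real
  assume x: "x > 0" and y: "y > 0" and sum: "(\<Sum>m\<in>K. c m * (of_real x ^ p m * of_real y ^ q m)) = 0"
  define S where "S = (\<Sum>m\<in>K. \<bar>ln (norm (c m))\<bar>)"
  define T where "T m = norm (c m) * (x ^ p m * y ^ q m)" for m
  have T: "T m = norm (c m * (of_real x ^ p m * of_real y ^ q m))" for m
    using x y by (simp add: T_def norm_mult norm_power)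
  have Tpos: "T m > 0" if "m \<in> K" for m using c[OF that] x y by (simp add: T_def)
  have lnT: "ln (T m) = ln (norm (c m)) + (p m * ln x + q m * ln y)" if "m \<in> K" for m
    using c[OF that] x y by (simp add: T_def ln_mult ln_realpow)
  obtain m where m: "m \<in> K" "\<And>k. k \<in> K \<Longrightarrow> T k \<le> T m"
    using ex_maximum_on[OF K, of T] by blast
  have "(\<Sum>k\<in>K. c k * (of_real x ^ p k * of_real y ^ q k)) =
      c m * (of_real x ^ p m * of_real y ^ q m) + (\<Sum>k\<in>K - {m}. c k * (of_real x ^ p k * of_real y ^ q k))"
    by (rule sum.remove[OF K(1) m(1)])
  then have "c m * (of_real x ^ p m * of_real y ^ q m) = - (\<Sum>k\<in>K - {m}. c k * (of_real x ^ p k * of_real y ^ q k))"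
    using sum by (simp add: eq_neg_iff_add_eq_0)
  then have "T m = norm (\<Sum>k\<in>K - {m}. c k * (of_real x ^ p k * of_real y ^ q k))" unfolding T by simp
  then have Tm: "T m \<le> (\<Sum>k\<in>K - {m}. T k)" using norm_sum[of "\<lambda>k. c k * (of_real x ^ p k * of_real y ^ q k)" "K - {m}"] by (simp add: T)
  have "K - {m} \<noteq> {}" using Tm Tpos[OF m(1)] by (metis sum.empty not_less)
  then obtain m' where m': "m' \<in> K - {m}" "\<And>k. k \<in> K - {m} \<Longrightarrow> T k \<le> T m'"
    using ex_maximum_on[of "K - {m}" T] K by blast
  have "(\<Sum>k\<in>K - {m}. T k) \<le> (\<Sum>k\<in>K - {m}. T m')" by (rule sum_mono) (rule m'(2))
  also have "\<dots> = card (K - {m}) * T m'" by simp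
  also have "\<dots> \<le> card K * T m'" using Tpos[of m'] m' K by (intro mult_right_mono) (auto intro!: card_mono)
  finally have up: "T m \<le> card K * T m'" using Tm by linarith
  have cK: "real (card K) > 0" using K by (simp add: card_gt_0_iff)
  have "ln (T m) \<le> ln (card K * T m')" using up Tpos[OF m(1)] by simp
  also have "\<dots> = ln (card K) + ln (T m')" using Tpos[of m'] m' cK by (simp add: ln_mult)
  finally have u: "ln (T m) \<le> ln (card K) + ln (T m')" .
  have l: "ln (T m') \<le> ln (T m)" using m(2)[of m'] m' Tpos[of m'] by (simp add: ln_le_cancel_iff)
  have S: "\<bar>ln (norm (c k))\<bar> \<le> S" if "k \<in> K" for k
    unfolding S_def using K(1) that by (intro member_le_sum) auto
  have "(real (p m) - real (p m')) * ln x + (real (q m) - real (q m')) * ln y =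
      (ln (T m) - ln (T m')) - ln (norm (c m)) + ln (norm (c m'))"
    using lnT[OF m(1)] lnT[of m'] m' by (simp add: algebra_simps)
  moreover have "m' \<in> K" "m \<noteq> m'" using m' by auto
  moreover have "card K \<ge> 1" using K by (simp add: Suc_le_eq card_gt_0_iff)
  then have "ln (card K) \<ge> 0" by simp
  ultimately have "\<bar>(real (p m) - real (p m')) * ln x + (real (q m) - real (q m')) * ln y\<bar> \<le> ln (card K) + 2 * S"
    using S[OF m(1)] S[of m'] u l by linarith
  then show "\<exists>m\<in>K. \<exists>m'\<in>K. m \<noteq> m' \<and> \<bar>(real (p m) - real (p m')) * ln x + (real (q m) - real (q m')) * ln y\<bar> \<le>
      ln (card K) + 2 * (\<Sum>m\<in>K. \<bar>ln (norm (c m))\<bar>)"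
    unfolding S_def[symmetric] using m(1) \<open>m' \<in> K\<close> \<open>m \<noteq> m'\<close> by blast
qed

text \<open>
  The coefficients \<open>(r, s)\<close> are differences of exponents of distinct monomials, hence not both
  zero.
\<close>

lemma polynomial_relation_comparable:
  assumes p: "p \<in> polys {i, j}" "p \<noteq> 0" and ij: "i \<noteq> j"
  shows "\<exists>R C. finite R \<and> (0, 0) \<notin> R \<and> (\<forall>x. \<forall>u>0. \<forall>v>0. x i = of_real u \<longrightarrow> x j = of_real v \<longrightarrow> eval_poly p x = 0 \<longrightarrow>
    (\<exists>(r, s)\<in>R. \<bar>real_of_int r * ln u + real_of_int s * ln v\<bar> \<le> C))"
proof -
  let ?K = "Poly_Mapping.keys p" and ?c = "Poly_Mapping.lookup p"
  let ?p = "\<lambda>m. Poly_Mapping.lookup m i" and ?q = "\<lambda>m. Poly_Mapping.lookup m j"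
  have "?K \<noteq> {}" using p(2) by simp
  define rel where "rel C x y \<longleftrightarrow> (\<exists>m\<in>?K. \<exists>m'\<in>?K. m \<noteq> m' \<and>
      \<bar>(real (?p m) - real (?p m')) * ln x + (real (?q m) - real (?q m')) * ln y\<bar> \<le> C)" for C x y
  have "\<exists>C. \<forall>x>0. \<forall>y>0. (\<Sum>m\<in>?K. ?c m * (of_real x ^ ?p m * of_real y ^ ?q m)) = 0 \<longrightarrow> rel C x y"
    unfolding rel_def by (rule vanishing_sum_comparable_terms[OF finite_keys \<open>?K \<noteq> {}\<close>]) (simp add: in_keys_iff)
  then obtain C where C: "\<And>x y. x > 0 \<Longrightarrow> y > 0 \<Longrightarrow> (\<Sum>m\<in>?K. ?c m * (of_real x ^ ?p m * of_real y ^ ?q m)) = 0 \<Longrightarrow> rel C x y"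
    by blast
  define f where "f = (\<lambda>(m, m'). (int (?p m) - int (?p m'), int (?q m) - int (?q m')))"
  define R where "R = f ` {(m, m'). m \<in> ?K \<and> m' \<in> ?K \<and> m \<noteq> m'}"
  have "finite {(m, m'). m \<in> ?K \<and> m' \<in> ?K \<and> m \<noteq> m'}" by (rule finite_subset[of _ "?K \<times> ?K"]) auto
  then have "finite R" by (simp add: R_def)
  moreover have "(0, 0) \<notin> R"
  proof
    assume "(0, 0) \<in> R"
    then obtain m m' where m: "m \<in> ?K" "m' \<in> ?K" "m \<noteq> m'" "?p m = ?p m'" "?q m = ?q m'" by (auto simp: R_def f_def)
    have "Poly_Mapping.lookup m k = Poly_Mapping.lookup m' k" for k
    proof (cases "k \<in> {i, j}")
      case False
      then have "k \<notin> Poly_Mapping.keys m" "k \<notin> Poly_Mapping.keys m'" using m p by (auto simp: polys_def)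
      then show ?thesis by (simp add: in_keys_iff)
    qed (use m in auto)
    then have "m = m'" by (rule poly_mapping_eqI)
    then show False using m(3) by simp
  qed
  moreover have "\<exists>(r, s)\<in>R. \<bar>real_of_int r * ln u + real_of_int s * ln v\<bar> \<le> C"
    if u: "u > 0" "v > 0" "x i = of_real u" "x j = of_real v" "eval_poly p x = 0" for x u v
  proof -
    have "eval_monom m x = of_real u ^ ?p m * of_real v ^ ?q m" if "m \<in> ?K" for m
    proof -
      have "Poly_Mapping.keys m \<subseteq> {i, j}" using that p by (auto simp: polys_def)
      then have "eval_monom m x = (\<Prod>k\<in>{i, j}. x k ^ Poly_Mapping.lookup m k)" by (intro eval_monom_superset) auto
      then show ?thesis using ij u by simp
    qed
    then have "(\<Sum>m\<in>?K. ?c m * (of_real u ^ ?p m * of_real v ^ ?q m)) = 0"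
      using u(5) by (simp add: eval_poly_def)
    from C[OF u(1,2) this] obtain m m' where m: "m \<in> ?K" "m' \<in> ?K" "m \<noteq> m'"
      "\<bar>(real (?p m) - real (?p m')) * ln u + (real (?q m) - real (?q m')) * ln v\<bar> \<le> C" unfolding rel_def by blast
    have "f (m, m') \<in> R" using m by (auto simp: R_def)
    then show ?thesis using m(4) by (intro bexI[of _ "f (m, m')"]) (simp_all add: f_def)
  qed
  ultimately show ?thesis by blast
qed


section \<open>Friezes of quivers\<close>

lemma poly_map_poly_of_real: "poly (map_poly of_real P) (of_real x) = (of_real (poly P x) :: complex)"
  by (induction P) (simp_all add: map_poly_pCons)

lemma of_rat_complex: "of_rat r = complex_of_real (of_rat r)"
  by (cases r) (simp add: of_rat_rat)

locale labelled_quiver =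
  fixes Q :: "('a, 'b) pre_digraph" and lab :: "'a \<Rightarrow> nat"
  assumes acyclic: "acyclic_quiver Q" and connected: "Digraph_Component.connected Q"
    and labelling: "admissible_labelling Q lab"
begin

definition N :: nat where "N = card (verts Q)"
definition vtx :: "nat \<Rightarrow> 'a" where "vtx i = the_inv_into (verts Q) lab (Suc i)"
definition edges :: "nat \<Rightarrow> nat \<Rightarrow> nat" where "edges i j = edge_count (snd (underlying_graph Q)) (vtx i) (vtx j)"
definition seq :: "nat \<Rightarrow> real" where "seq t = of_rat (frieze Q lab (t div N) (Suc (t mod N)))"

lemma fin_Q: "fin_digraph Q"
  using acyclic by (simp add: acyclic_quiver_def)

lemma finite_verts: "finite (verts Q)" and finite_arcs: "finite (arcs Q)"
  and ends_in_verts: "e \<in> arcs Q \<Longrightarrow> tail Q e \<in> verts Q" "e \<in> arcs Q \<Longrightarrow> head Q e \<in> verts Q"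
proof -
  interpret fin_digraph Q by (rule fin_Q)
  show "finite (verts Q)" "finite (arcs Q)" by simp_all
  show "e \<in> arcs Q \<Longrightarrow> tail Q e \<in> verts Q" "e \<in> arcs Q \<Longrightarrow> head Q e \<in> verts Q" by simp_all
qed

lemma verts_nonempty: "verts Q \<noteq> {}"
  using connected by (simp add: Digraph_Component.connected_def strongly_connected_def)

lemma N_pos: "N > 0"
  using finite_verts verts_nonempty by (simp add: N_def card_gt_0_iff)

lemma lab_bij: "bij_betw lab (verts Q) {1..N}" and lab_less: "e \<in> arcs Q \<Longrightarrow> lab (head Q e) < lab (tail Q e)"
  using labelling by (auto simp: admissible_labelling_def N_def)

lemma vtx_bij: "bij_betw vtx {..<N} (verts Q)"
proof -
  have "bij_betw Suc {..<N} {1..N}" by (rule bij_betwI[where g = "\<lambda>i. i - 1"]) auto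
  moreover have "bij_betw (the_inv_into (verts Q) lab) {1..N} (verts Q)" by (rule bij_betw_the_inv_into[OF lab_bij])
  ultimately have "bij_betw (the_inv_into (verts Q) lab \<circ> Suc) {..<N} (verts Q)" by (rule bij_betw_trans)
  then show ?thesis by (rule bij_betw_cong[THEN iffD1, rotated]) (simp add: vtx_def)
qed

lemma lab_vtx: "i < N \<Longrightarrow> lab (vtx i) = Suc i"
  unfolding vtx_def by (rule f_the_inv_into_f_bij_betw[OF lab_bij]) auto

lemma vtx_lab: "v \<in> verts Q \<Longrightarrow> vtx (lab v - 1) = v"
proof -
  assume v: "v \<in> verts Q"
  then have "lab v \<in> {1..N}" using lab_bij by (auto simp: bij_betw_def)
  then show ?thesis using the_inv_into_f_f[of lab "verts Q" v] lab_bij v by (simp add: vtx_def bij_betw_def)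
qed

lemma vtx_in: "i < N \<Longrightarrow> vtx i \<in> verts Q"
  using vtx_bij by (auto simp: bij_betw_def)

lemma vtx_eq_iff: "v \<in> verts Q \<Longrightarrow> i < N \<Longrightarrow> v = vtx i \<longleftrightarrow> lab v = Suc i"
  using lab_vtx vtx_lab by fastforce

text \<open>
  By admissibility all arrows between two vertices point to the smaller label.
\<close>

lemma edges_eq_card:
  assumes "i < j" "j < N"
  shows "edges i j = card {e \<in> arcs Q. lab (head Q e) = Suc i \<and> lab (tail Q e) = Suc j}"
proof -
  have ne: "vtx i \<noteq> vtx j" using assms lab_vtx[of i] lab_vtx[of j] by auto
  have "{tail Q e, head Q e} = {vtx i, vtx j} \<longleftrightarrow> lab (head Q e) = Suc i \<and> lab (tail Q e) = Suc j" if e: "e \<in> arcs Q" for e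
  proof -
    have "{tail Q e, head Q e} = {vtx i, vtx j} \<longleftrightarrow>
        lab (tail Q e) = Suc i \<and> lab (head Q e) = Suc j \<or> lab (tail Q e) = Suc j \<and> lab (head Q e) = Suc i"
      unfolding doubleton_eq_iff using vtx_eq_iff ends_in_verts[OF e] assms by simp
    then show ?thesis using lab_less[OF e] assms(1) by auto
  qed
  then have "{e \<in> arcs Q. {tail Q e, head Q e} = {vtx i, vtx j}} = {e \<in> arcs Q. lab (head Q e) = Suc i \<and> lab (tail Q e) = Suc j}"
    by blast
  then show ?thesis
    using ne by (simp add: edges_def edge_count_def underlying_graph_def count_image_mset_set[OF finite_arcs])
qed

lemma edges_sym: "edges i j = edges j i"
  by (simp add: edges_def edge_count_sym)

lemma seq_at: "i < N \<Longrightarrow> seq (i + k * N) = of_rat (frieze Q lab k (Suc i))"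
  by (simp add: seq_def)

text \<open>
  The arrows that end at a vertex come from larger labels, at the same step of the window, and
  those that start there lead to smaller labels, at the next step. Grouping both products by the
  other end point turns arrows into exponents.
\<close>

lemma seq_rec: "seq (t + N) * seq t = 1 + (\<Prod>s\<in>{t<..<t+N}. seq s ^ edges (t mod N) (s mod N))"
proof -
  define i k where "i = t mod N" and "k = t div N"
  have i: "i < N" and t: "t = i + k * N" using N_pos by (auto simp: i_def k_def)
  let ?F = "\<lambda>k j. of_rat (frieze Q lab k j) :: real"
  let ?A = "{e \<in> arcs Q. lab (head Q e) = Suc i}" and ?B = "{e \<in> arcs Q. lab (tail Q e) = Suc i}"
  have pos: "?F k (Suc i) \<noteq> 0" using frieze_pos[of Q lab k "Suc i"] by simp
  have "?F (Suc k) (Suc i) * ?F k (Suc i) = 1 + (\<Prod>e\<in>?A. ?F k (lab (tail Q e))) * (\<Prod>e\<in>?B. ?F (Suc k) (lab (head Q e)))"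
    unfolding frieze_recurrence[OF labelling, of k "Suc i"] using pos
    by (simp add: of_rat_divide of_rat_add of_rat_mult of_rat_prod)
  also have "(\<Prod>e\<in>?A. ?F k (lab (tail Q e))) = (\<Prod>j\<in>{i<..<N}. seq (j + k * N) ^ edges i j)"
  proof -
    have "(\<Prod>e\<in>?A. ?F k (lab (tail Q e))) =
        (\<Prod>j\<in>{i<..<N}. \<Prod>e\<in>{e \<in> ?A. lab (tail Q e) - 1 = j}. ?F k (lab (tail Q e)))"
    proof (rule prod.group[symmetric])
      show "(\<lambda>e. lab (tail Q e) - 1) ` ?A \<subseteq> {i<..<N}"
      proof (rule image_subsetI)
        fix e assume "e \<in> {e \<in> arcs Q. lab (head Q e) = Suc i}"
        then have e: "e \<in> arcs Q" "lab (head Q e) = Suc i" by auto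
        have "lab (tail Q e) \<in> {1..N}" using lab_bij ends_in_verts(1)[OF e(1)] by (auto simp: bij_betw_def)
        then show "lab (tail Q e) - 1 \<in> {i<..<N}" using lab_less[OF e(1)] e(2) by auto
      qed
    qed (use finite_arcs in auto)
    also have "\<dots> = (\<Prod>j\<in>{i<..<N}. seq (j + k * N) ^ edges i j)"
    proof (rule prod.cong[OF refl])
      fix j assume j: "j \<in> {i<..<N}"
      have "{e \<in> ?A. lab (tail Q e) - 1 = j} = {e \<in> arcs Q. lab (head Q e) = Suc i \<and> lab (tail Q e) = Suc j}"
        using j by auto
      then show "(\<Prod>e\<in>{e \<in> ?A. lab (tail Q e) - 1 = j}. ?F k (lab (tail Q e))) = seq (j + k * N) ^ edges i j"
        using j by (simp add: edges_eq_card seq_at)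
    qed
    finally show ?thesis .
  qed
  also have "(\<Prod>e\<in>?B. ?F (Suc k) (lab (head Q e))) = (\<Prod>j\<in>{..<i}. seq (j + Suc k * N) ^ edges i j)"
  proof -
    have "(\<Prod>e\<in>?B. ?F (Suc k) (lab (head Q e))) =
        (\<Prod>j\<in>{..<i}. \<Prod>e\<in>{e \<in> ?B. lab (head Q e) - 1 = j}. ?F (Suc k) (lab (head Q e)))"
    proof (rule prod.group[symmetric])
      show "(\<lambda>e. lab (head Q e) - 1) ` ?B \<subseteq> {..<i}"
      proof (rule image_subsetI)
        fix e assume "e \<in> {e \<in> arcs Q. lab (tail Q e) = Suc i}"
        then have e: "e \<in> arcs Q" "lab (tail Q e) = Suc i" by auto
        have "lab (head Q e) \<in> {1..N}" using lab_bij ends_in_verts(2)[OF e(1)] by (auto simp: bij_betw_def)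
        then show "lab (head Q e) - 1 \<in> {..<i}" using lab_less[OF e(1)] e(2) by auto
      qed
    qed (use finite_arcs in auto)
    also have "\<dots> = (\<Prod>j\<in>{..<i}. seq (j + Suc k * N) ^ edges i j)"
    proof (rule prod.cong[OF refl])
      fix j assume j: "j \<in> {..<i}"
      have "lab (head Q e) \<ge> 1" if "e \<in> arcs Q" for e
        using lab_bij ends_in_verts(2)[OF that] by (force simp: bij_betw_def)
      then have "{e \<in> ?B. lab (head Q e) - 1 = j} = {e \<in> arcs Q. lab (head Q e) = Suc j \<and> lab (tail Q e) = Suc i}"
        by fastforce
      then show "(\<Prod>e\<in>{e \<in> ?B. lab (head Q e) - 1 = j}. ?F (Suc k) (lab (head Q e))) = seq (j + Suc k * N) ^ edges i j"
        using j i seq_at[of j "Suc k"] by (simp add: edges_eq_card edges_sym[of i j])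
    qed
    finally show ?thesis .
  qed
  also have "(\<Prod>j\<in>{i<..<N}. seq (j + k * N) ^ edges i j) * (\<Prod>j\<in>{..<i}. seq (j + Suc k * N) ^ edges i j) =
      (\<Prod>s\<in>{t<..<t+N}. seq s ^ edges i (s mod N))"
  proof -
    have split: "{t<..<t+N} = (\<lambda>j. j + k * N) ` {i<..<N} \<union> (\<lambda>j. j + Suc k * N) ` {..<i}" (is "_ = ?X \<union> ?Y")
    proof (intro equalityI subsetI)
      fix s assume s: "s \<in> {t<..<t+N}"
      show "s \<in> ?X \<union> ?Y"
      proof (cases "s < Suc k * N")
        case True
        then show ?thesis using s t by (intro UnI1 image_eqI[of _ _ "s - k * N"]) auto
      next
        case False
        then show ?thesis using s t by (intro UnI2 image_eqI[of _ _ "s - Suc k * N"]) auto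
      qed
    qed (use t i in auto)
    have "?X \<inter> ?Y = {}" by auto
    then have "(\<Prod>s\<in>{t<..<t+N}. seq s ^ edges i (s mod N)) =
        (\<Prod>s\<in>?X. seq s ^ edges i (s mod N)) * (\<Prod>s\<in>?Y. seq s ^ edges i (s mod N))"
      unfolding split by (intro prod.union_disjoint) auto
    also have "(\<Prod>s\<in>?X. seq s ^ edges i (s mod N)) = (\<Prod>j\<in>{i<..<N}. seq (j + k * N) ^ edges i j)"
      by (subst prod.reindex) (auto intro: inj_onI)
    also have "(\<Prod>s\<in>?Y. seq s ^ edges i (s mod N)) = (\<Prod>j\<in>{..<i}. seq (j + Suc k * N) ^ edges i j)"
    proof (subst prod.reindex)
      have "(j + Suc k * N) mod N = j" if "j < i" for j using mod_mult_self1[of j "Suc k" N] that i by simp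
      then show "prod ((\<lambda>s. seq s ^ edges i (s mod N)) \<circ> (\<lambda>j. j + Suc k * N)) {..<i} = (\<Prod>j<i. seq (j + Suc k * N) ^ edges i j)"
        by (intro prod.cong) auto
    qed (auto intro: inj_onI)
    finally show ?thesis by simp
  qed
  finally have "?F (Suc k) (Suc i) * ?F k (Suc i) = 1 + (\<Prod>s\<in>{t<..<t+N}. seq s ^ edges i (s mod N))" .
  moreover have "t + N = i + Suc k * N" using t by simp
  ultimately show ?thesis unfolding i_def[symmetric] using seq_at[OF i] t by metis
qed

sublocale frieze_seq N edges seq
proof
  show "0 < N" by (rule N_pos)
  show "edges i j = edges j i" for i j by (rule edges_sym)
  show "edges i i = 0" for i by (simp add: edges_def edge_count_def)
  show "seq t = 1" if "t < N" for t using seq_at[OF that, of 0] by simp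
  show "0 < seq t" for t using frieze_pos by (simp add: seq_def)
  show "seq (t + N) * seq t = 1 + (\<Prod>s\<in>{t<..<t + N}. seq s ^ edges (t mod N) (s mod N))" for t by (rule seq_rec)
qed

sublocale graph: connected_multigraph "verts Q" "edge_count (snd (underlying_graph Q))"
proof
  show "finite (verts Q)" "verts Q \<noteq> {}" by (rule finite_verts, rule verts_nonempty)
  show "edge_count (snd (underlying_graph Q)) u v = edge_count (snd (underlying_graph Q)) v u" for u v by (rule edge_count_sym)
  show "edge_count (snd (underlying_graph Q)) v v = 0" for v by (simp add: edge_count_def)
  fix u v assume uv: "u \<in> verts Q" "v \<in> verts Q"
  let ?S = "{(x, y). x \<in> verts Q \<and> y \<in> verts Q \<and> 0 < edge_count (snd (underlying_graph Q)) x y}"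
  have "reachable (with_proj (mk_symmetric Q)) u v"
    using connected uv by (simp add: Digraph_Component.connected_def strongly_connected_def)
  then have "(u, v) \<in> (arcs_ends (with_proj (mk_symmetric Q)))\<^sup>*" unfolding reachable_def by (rule rtrancl_on_rtranclI)
  moreover have "arcs_ends (with_proj (mk_symmetric Q)) \<subseteq> ?S"
  proof -
    have "{(tail Q e, head Q e), (head Q e, tail Q e)} \<subseteq> ?S" if e: "e \<in> arcs Q" for e
    proof -
      have "card {x \<in> arcs Q. {tail Q x, head Q x} = {tail Q e, head Q e}} > 0"
        using e finite_arcs by (auto simp: card_gt_0_iff)
      moreover have "tail Q e \<noteq> head Q e" using lab_less[OF e] by auto
      ultimately have "0 < edge_count (snd (underlying_graph Q)) (tail Q e) (head Q e)"
        by (simp add: edge_count_def underlying_graph_def count_image_mset_set[OF finite_arcs])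
      then show ?thesis using ends_in_verts[OF e] edge_count_sym[of _ "tail Q e"] by auto
    qed
    then have "(\<Union>e\<in>arcs Q. {(tail Q e, head Q e), (head Q e, tail Q e)}) \<subseteq> ?S" by (rule UN_least)
    moreover have "arcs_ends (with_proj (mk_symmetric Q)) = (\<Union>e\<in>arcs Q. {(tail Q e, head Q e), (head Q e, tail Q e)})"
      by (simp add: parcs_mk_symmetric)
    ultimately show ?thesis by (simp only:)
  qed
  ultimately show "(u, v) \<in> ?S\<^sup>*" by (rule subsetD[OF rtrancl_mono, rotated])
qed

lemma adjacency_connected:
  assumes "i < N" "j < N"
  shows "(i, j) \<in> adjacency\<^sup>*"
proof -
  let ?S = "{(x, y). x \<in> verts Q \<and> y \<in> verts Q \<and> 0 < edge_count (snd (underlying_graph Q)) x y}"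
  have "(vtx i, vtx j) \<in> ?S\<^sup>*" using graph.conn vtx_in assms by blast
  then have "(lab (vtx i) - 1, lab (vtx j) - 1) \<in> adjacency\<^sup>*"
  proof (induction rule: rtrancl_induct)
    case (step x y)
    then have xy: "x \<in> verts Q" "y \<in> verts Q" "0 < edge_count (snd (underlying_graph Q)) x y" by auto
    then have "lab x \<in> {1..N}" "lab y \<in> {1..N}" using lab_bij by (auto simp: bij_betw_def)
    then have "lab x - 1 < N" "lab y - 1 < N" by auto
    then have "(lab x - 1, lab y - 1) \<in> adjacency"
      unfolding adjacency_def edges_def using xy vtx_lab by simp
    then show ?case using step.IH by (rule rtrancl_into_rtrancl[rotated])
  qed simp
  then show ?thesis using assms by (simp add: lab_vtx)
qed

lemma sum_edges:
  fixes d :: "'a \<Rightarrow> 'c::comm_semiring_1"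
  shows "(\<Sum>j<N. of_nat (edges i j) * d (vtx j)) = weighted_sum (underlying_graph Q) d (vtx i)"
  unfolding weighted_sum_def edges_def
  using sum.reindex_bij_betw[OF vtx_bij, of "\<lambda>v. of_nat (edge_count (snd (underlying_graph Q)) (vtx i) v) * d v"]
  by (simp add: underlying_graph_def)

lemma loopless_Q: "loopless (underlying_graph Q)"
proof -
  have "\<exists>u\<in>verts Q. \<exists>v\<in>verts Q. u \<noteq> v \<and> {tail Q e, head Q e} = {u, v}" if e: "e \<in> arcs Q" for e
    using ends_in_verts[OF e] lab_less[OF e] by (intro bexI[of _ "tail Q e"] bexI[of _ "head Q e"]) auto
  then show ?thesis by (auto simp: loopless_def underlying_graph_def finite_arcs)
qed

lemma rep_finite_iff: "rep_finite Q \<longleftrightarrow> (\<exists>H\<in>dynkin_diagrams. underlying_graph Q \<simeq> H)"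
  by (auto simp: rep_finite_def dynkin_diagrams_def)

lemma tame_iff: "tame Q \<longleftrightarrow> (\<exists>H\<in>affine_diagrams. underlying_graph Q \<simeq> H)"
  by (auto simp: tame_def affine_diagrams_def)

lemma isomorphic_to_imp_iso:
  assumes "graph.isomorphic_to H" "H \<in> dynkin_diagrams \<union> affine_diagrams"
  shows "underlying_graph Q \<simeq> H"
proof -
  obtain \<phi> where "bij_betw \<phi> (fst H) (verts Q)"
    "\<forall>i\<in>fst H. \<forall>j\<in>fst H. edge_count (snd H) i j = edge_count (snd (underlying_graph Q)) (\<phi> i) (\<phi> j)"
    using assms(1) by (auto simp: graph.isomorphic_to_def)
  then show ?thesis
    by (intro multigraph_isoI[OF loopless_Q diagrams_loopless[OF assms(2)], of \<phi>]) (auto simp: underlying_graph_def)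
qed

lemma wild_superharmonic:
  assumes "wild Q"
  shows "\<exists>d :: 'a \<Rightarrow> nat. (\<forall>u\<in>verts Q. weighted_sum (underlying_graph Q) d u \<ge> 2 * d u) \<and>
    (\<exists>u\<in>verts Q. weighted_sum (underlying_graph Q) d u > 2 * d u)"
proof -
  have "\<not> (\<exists>H\<in>dynkin_diagrams. graph.isomorphic_to H)"
    using assms isomorphic_to_imp_iso by (auto simp: wild_def rep_finite_iff)
  then obtain H where H: "H \<in> affine_diagrams" "graph.embeds H" using graph.dynkin_or_affine by blast
  moreover have "\<not> graph.isomorphic_to H"
    using assms isomorphic_to_imp_iso[of H] H(1) by (auto simp: wild_def tame_iff)
  ultimately show ?thesis
    using graph.affine_or_superharmonic[OF H] by (simp add: weighted_sum_def underlying_graph_def)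
qed

lemma frieze_point_eq:
  assumes "i < N"
  shows "frieze_point Q lab k (Suc i) = of_real (seq (i + k * N))"
  using assms by (simp add: frieze_point_def N_def[symmetric] seq_at of_rat_complex)

lemma points_affine: "range (frieze_point Q lab) \<subseteq> affine_space N"
  by (auto simp: frieze_point_def affine_space_def N_def)

lemma frieze_dim_eq: "frieze_dim Q lab = dim_closure N (range (frieze_point Q lab))"
  by (simp add: frieze_dim_def frieze_variety_def N_def)

lemma bounded_imp_dim_0:
  assumes "\<And>t. seq t \<le> C"
  shows "frieze_dim Q lab = 0"
  unfolding frieze_dim_eq
proof (rule dim_closure_finite[OF points_affine])
  have vals: "seq t \<in> real_of_int ` {0..\<lfloor>C\<rfloor>}" for t
  proof -
    obtain z where z: "seq t = of_int z" using g_integer[of t] by (auto elim: Ints_cases)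
    then have "z \<in> {0..\<lfloor>C\<rfloor>}" using assms[of t] g_pos[of t] by (simp add: le_floor_iff)
    then show ?thesis using z by blast
  qed
  have "range (frieze_point Q lab) \<subseteq> ({1..N} \<rightarrow>\<^sub>E of_real ` real_of_int ` {0..\<lfloor>C\<rfloor>})"
  proof (rule image_subsetI)
    fix k
    show "frieze_point Q lab k \<in> ({1..N} \<rightarrow>\<^sub>E of_real ` real_of_int ` {0..\<lfloor>C\<rfloor>})"
    proof (rule PiE_I)
      fix i assume "i \<in> {1..N}"
      then obtain i' where i': "i = Suc i'" "i' < N" by (cases i) auto
      then have "frieze_point Q lab k i = of_real (seq (i' + k * N))" using frieze_point_eq by simp
      then show "frieze_point Q lab k i \<in> of_real ` real_of_int ` {0..\<lfloor>C\<rfloor>}" using vals by simp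
    qed (auto simp: frieze_point_def N_def)
  qed
  then show "finite (range (frieze_point Q lab))" by (rule finite_subset) (intro finite_PiE finite_imageI, auto)
qed simp

theorem rep_finite_dim:
  assumes "rep_finite Q"
  shows "frieze_dim Q lab = 0"
proof -
  obtain H where H: "H \<in> dynkin_diagrams" "underlying_graph Q \<simeq> H" using assms rep_finite_iff by blast
  obtain d :: "nat \<Rightarrow> real" where d: "\<And>i. i \<in> fst H \<Longrightarrow> d i > 0 \<and> weighted_sum H d i < 2 * d i"
    using dynkin_subharmonic[OF H(1)] by blast
  obtain b where b: "bij_betw b (verts Q) (fst H)"
    "\<And>d :: nat \<Rightarrow> real. \<And>u. u \<in> verts Q \<Longrightarrow> weighted_sum (underlying_graph Q) (\<lambda>v. d (b v)) u = weighted_sum H d (b u)"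
    using isomorphic_weighted_sum[OF H(2) loopless_Q, where 'c = real] by (auto simp: underlying_graph_def)
  have bv: "b (vtx i) \<in> fst H" if "i < N" for i using b(1) vtx_in[OF that] by (auto simp: bij_betw_def)
  have "\<exists>C. \<forall>t. seq t \<le> C"
  proof (rule positive_definite_bounded[of "\<lambda>i. d (b (vtx i))"])
    fix i assume i: "i < N"
    show "0 < d (b (vtx i))" using d bv[OF i] by blast
    have "(\<Sum>j<N. \<alpha> i j * d (b (vtx j))) = (\<Sum>j<N. of_nat (edges i j) * d (b (vtx j)))"
      using i by (intro sum.cong) (auto simp: \<alpha>_small)
    also have "\<dots> = weighted_sum H d (b (vtx i))" using sum_edges[of i "\<lambda>v. d (b v)"] b(2)[OF vtx_in[OF i]] by simp
    finally show "(\<Sum>j<N. \<alpha> i j * d (b (vtx j))) < 2 * d (b (vtx i))" using d bv[OF i] by simp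
  qed
  then show ?thesis using bounded_imp_dim_0 by blast
qed

lemma unbounded_imp_dim_ge_1:
  assumes "\<And>C. \<not> (\<forall>t. seq t \<le> C)"
  shows "1 \<le> frieze_dim Q lab"
proof -
  have "\<exists>i<N. infinite ((\<lambda>x. x (Suc i)) ` range (frieze_point Q lab))"
  proof (rule ccontr)
    assume "\<not> ?thesis"
    then have fin: "finite ((\<lambda>x. x (Suc i)) ` range (frieze_point Q lab))" if "i < N" for i using that by blast
    let ?A = "\<Union>i<N. (\<lambda>x. norm (x (Suc i))) ` range (frieze_point Q lab)"
    have "finite ((\<lambda>x. norm (x (Suc i))) ` range (frieze_point Q lab))" if "i < N" for i
      using finite_imageI[OF fin[OF that], of norm] by (simp add: image_image)
    then have A: "finite ?A" by blast
    have "seq t \<le> Max ?A" for t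
    proof (rule Max_ge[OF A])
      have "t mod N < N" "t = t mod N + (t div N) * N" using N_pos by auto
      then have "seq t = norm (frieze_point Q lab (t div N) (Suc (t mod N)))"
        using frieze_point_eq[of "t mod N" "t div N"] g_pos[of t] by simp
      then show "seq t \<in> ?A" using \<open>t mod N < N\<close> by (intro UN_I[of "t mod N"] image_eqI[of _ _ "frieze_point Q lab (t div N)"]) auto
    qed
    then show False using assms by blast
  qed
  then obtain i where i: "i < N" "infinite ((\<lambda>x. x (Suc i)) ` range (frieze_point Q lab))" by blast
  show ?thesis unfolding frieze_dim_eq by (rule dim_closure_ge_1[OF points_affine _ i(2)]) (use i in auto)
qed

theorem tame_dim:
  assumes "tame Q"
  shows "frieze_dim Q lab = 1"
proof -
  obtain H where H: "H \<in> affine_diagrams" "underlying_graph Q \<simeq> H" using assms tame_iff by blast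
  obtain d :: "nat \<Rightarrow> nat" where d: "\<And>i. i \<in> fst H \<Longrightarrow> d i > 0 \<and> weighted_sum H d i = 2 * d i" "\<exists>i\<in>fst H. d i = 1"
    using affine_harmonic[OF H(1)] by blast
  obtain b where b: "bij_betw b (verts Q) (fst H)"
    "\<And>d :: nat \<Rightarrow> nat. \<And>u. u \<in> verts Q \<Longrightarrow> weighted_sum (underlying_graph Q) (\<lambda>v. d (b v)) u = weighted_sum H d (b u)"
    using isomorphic_weighted_sum[OF H(2) loopless_Q, where 'c = nat] by (auto simp: underlying_graph_def)
  have bv: "b (vtx i) \<in> fst H" if "i < N" for i using b(1) vtx_in[OF that] by (auto simp: bij_betw_def)
  obtain e where e: "e < N" "d (b (vtx e)) = 1"
  proof -
    obtain i where i: "i \<in> fst H" "d i = 1" using d(2) by blast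
    have "i \<in> b ` vtx ` {..<N}" using i b(1) vtx_bij by (simp add: bij_betw_def)
    then show ?thesis using that i by auto
  qed
  interpret affine_frieze N edges seq "\<lambda>i. d (b (vtx i))" e
  proof
    fix i j assume ij: "i < N" "j < N"
    then show "(i, j) \<in> adjacency\<^sup>*" by (rule adjacency_connected)
  next
    fix i assume i: "i < N"
    show "0 < d (b (vtx i))" using d(1) bv[OF i] by blast
    show "(\<Sum>j<N. edges i j * d (b (vtx j))) = 2 * d (b (vtx i))"
      using sum_edges[of i "\<lambda>v. d (b v)"] b(2)[OF vtx_in[OF i]] d(1)[OF bv[OF i]] by simp
  qed (use e in auto)
  obtain \<Lambda> :: real and M where \<Lambda>: "\<Lambda> > 1" "M > 0"
    "\<And>t. \<exists>P. \<forall>\<^sub>F k in sequentially. seq (t + k * (M * N)) * (\<Lambda> ^ k) ^ d (b (vtx (t mod N))) = poly P (\<Lambda> ^ k)"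
    using laurent_polynomials by blast
  have laur: "laurent (of_real \<Lambda>) (\<lambda>k. frieze_point Q lab (s + k * M) i)" if i: "i \<in> {1..N}" for s i
  proof -
    obtain i' where i': "i = Suc i'" "i' < N" using i by (cases i) auto
    obtain P where P: "\<forall>\<^sub>F k in sequentially. seq (i' + s * N + k * (M * N)) * (\<Lambda> ^ k) ^ d (b (vtx ((i' + s * N) mod N))) = poly P (\<Lambda> ^ k)"
      using \<Lambda>(3) by blast
    have "\<forall>\<^sub>F k in sequentially. frieze_point Q lab (s + k * M) i * (of_real \<Lambda> ^ k) ^ d (b (vtx ((i' + s * N) mod N))) =
        poly (map_poly of_real P) (of_real \<Lambda> ^ k)"
      using P
    proof eventually_elim
      case (elim k)
      have "frieze_point Q lab (s + k * M) i = of_real (seq (i' + s * N + k * (M * N)))"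
        unfolding i'(1) frieze_point_eq[OF i'(2)] by (simp add: algebra_simps)
      then have "frieze_point Q lab (s + k * M) i * (of_real \<Lambda> ^ k) ^ d (b (vtx ((i' + s * N) mod N))) =
          of_real (seq (i' + s * N + k * (M * N)) * (\<Lambda> ^ k) ^ d (b (vtx ((i' + s * N) mod N))))" by simp
      also have "\<dots> = of_real (poly P (\<Lambda> ^ k))" by (simp only: elim)
      also have "\<dots> = poly (map_poly of_real P) (of_real \<Lambda> ^ k)" by (simp add: poly_map_poly_of_real flip: of_real_power)
      finally show ?case .
    qed
    then show ?thesis unfolding laurent_def by blast
  qed
  have "frieze_dim Q lab \<le> 1"
    unfolding frieze_dim_eq
  proof (rule dim_closure_le_1[OF points_affine])
    fix p q assume "p \<in> polys {1..N}" "q \<in> polys {1..N}"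
    then show "\<exists>G. G \<noteq> 0 \<and> (\<forall>x\<in>range (frieze_point Q lab). poly (poly G [:eval_poly p x:]) (eval_poly q x) = 0)"
      using \<Lambda> laur by (intro laurent_points_dependent[of "of_real \<Lambda>" M "{1..N}"]) auto
  qed
  moreover have "1 \<le> frieze_dim Q lab" by (rule unbounded_imp_dim_ge_1) (rule g_unbounded)
  ultimately show ?thesis by (rule antisym)
qed

text \<open>
  If the dimension were at most one, any two coordinates would be algebraically dependent on the
  points; \<open>polynomial_relation_comparable\<close> turns this into the bounded linear relations between
  logarithms that are impossible in view of the growth.
\<close>

theorem wild_dim:
  assumes "wild Q"
  shows "2 \<le> frieze_dim Q lab"
proof (rule ccontr)
  assume small: "\<not> 2 \<le> frieze_dim Q lab"
  obtain d :: "'a \<Rightarrow> nat" and u0 where d: "\<And>u. u \<in> verts Q \<Longrightarrow> weighted_sum (underlying_graph Q) d u \<ge> 2 * d u"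
    "u0 \<in> verts Q" "weighted_sum (underlying_graph Q) d u0 > 2 * d u0"
    using wild_superharmonic[OF assms] by blast
  obtain i0 where i0: "i0 < N" "u0 = vtx i0" using d(2) vtx_bij by (auto simp: bij_betw_def)
  have sum: "(\<Sum>j<N. \<alpha> i j * real (d (vtx j))) = real (weighted_sum (underlying_graph Q) d (vtx i))" if "i < N" for i
  proof -
    have "(\<Sum>j<N. \<alpha> i j * real (d (vtx j))) = real (\<Sum>j<N. edges i j * d (vtx j))"
      using that by (simp add: \<alpha>_small)
    also have "(\<Sum>j<N. edges i j * d (vtx j)) = weighted_sum (underlying_graph Q) d (vtx i)"
      using sum_edges[of i d] by simp
    finally show ?thesis .
  qed
  have "\<exists>C>0. \<forall>K. (\<Sum>k<K. size_at k) \<le> C * size_at K"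
  proof (rule superharmonic_growth[of "\<lambda>i. real (d (vtx i))" i0])
    show "(i, j) \<in> adjacency\<^sup>*" if "i < N" "j < N" for i j using that by (rule adjacency_connected)
    show "2 * real (d (vtx i)) \<le> (\<Sum>j<N. \<alpha> i j * real (d (vtx j)))" if "i < N" for i
      unfolding sum[OF that] using d(1)[OF vtx_in[OF that]] by linarith
    show "2 * real (d (vtx i0)) < (\<Sum>j<N. \<alpha> i0 j * real (d (vtx j)))"
      unfolding sum[OF i0(1)] using d(3)[unfolded i0(2)] by linarith
  qed (use i0 in auto)
  then obtain C0 where C0: "C0 > 0" "\<And>K. (\<Sum>k<K. size_at k) \<le> C0 * size_at K" by blast
  define related where "related i j R c \<longleftrightarrow> finite R \<and> (0, 0) \<notin> R \<and>
    (\<forall>k. \<exists>(p, q)\<in>R. \<bar>real_of_int p * L (i + k * N) + real_of_int q * L (j + k * N)\<bar> \<le> c)"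
    for i j R and c :: real
  have "\<exists>R c. related i j R c" if ij: "i < N" "j < N" for i j
  proof (cases "i = j")
    case True
    then show ?thesis unfolding related_def by (intro exI[of _ "{(1, -1)}"] exI[of _ 0]) simp
  next
    case False
    have "\<exists>p. p \<in> polys {Suc i, Suc j} \<and> (\<forall>x\<in>range (frieze_point Q lab). eval_poly p x = 0) \<and> p \<noteq> 0"
    proof (rule ccontr)
      assume "\<not> ?thesis"
      then have "2 \<le> frieze_dim Q lab"
        unfolding frieze_dim_eq using ij False by (intro dim_closure_ge_2[OF points_affine, of "Suc i" "Suc j"]) auto
      then show False using small by simp
    qed
    then obtain p where p: "p \<in> polys {Suc i, Suc j}" "p \<noteq> 0" "\<And>k. eval_poly p (frieze_point Q lab k) = 0" by blast
    obtain R C where R: "finite R" "(0, 0) \<notin> R"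
      "\<And>x u v. u > 0 \<Longrightarrow> v > 0 \<Longrightarrow> x (Suc i) = of_real u \<Longrightarrow> x (Suc j) = of_real v \<Longrightarrow> eval_poly p x = 0 \<Longrightarrow>
        \<exists>(r, s)\<in>R. \<bar>real_of_int r * ln u + real_of_int s * ln v\<bar> \<le> C"
      using polynomial_relation_comparable[OF p(1,2)] False by blast
    have "\<exists>(r, s)\<in>R. \<bar>real_of_int r * L (i + k * N) + real_of_int s * L (j + k * N)\<bar> \<le> C" for k
      unfolding L_def by (rule R(3)[of _ _ "frieze_point Q lab k"]) (use ij p(3) g_pos in \<open>auto simp: frieze_point_eq\<close>)
    then show ?thesis unfolding related_def using R(1,2) by blast
  qed
  then obtain R c where "\<And>i j. i < N \<Longrightarrow> j < N \<Longrightarrow> related i j (R i j) (c i j)" by metis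
  then show False
    using bounded_relations_contradiction[OF C0, of R c] unfolding related_def by blast
qed

end

theorem theorem1p1:
  fixes Q :: "('a, 'b) pre_digraph" and lab :: "'a \<Rightarrow> nat"
  assumes "acyclic_quiver Q"
    and "Digraph_Component.connected Q"
    and "admissible_labelling Q lab"
  shows "(rep_finite Q \<longrightarrow> frieze_dim Q lab = 0) \<and>
         (tame Q \<longrightarrow> frieze_dim Q lab = 1) \<and>
         (wild Q \<longrightarrow> frieze_dim Q lab \<ge> 2)"
proof -
  interpret labelled_quiver Q lab by unfold_locales (rule assms)+
  show ?thesis using rep_finite_dim tame_dim wild_dim by blast
qed

end
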